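(* Let $H$ be a quasitriangular Hopf algebra over $\Bbbk$ with $R$-matrix $R=\sum_is_i\otimes t_i$ and $A$ a left $H$-comodule algebra with coaction $a\mapsto a_{[-1]}\otimes a_{[0]}$. Then $$\mathcal{E}_{H\text{-}\mathsf{mod}}(A\text{-}\mathsf{mod})\;\cong\;{}^{\widehat{H}}_A\mathsf{DH}(H)$$ as braided left $(H\text{-}\mathsf{mod})$-module categories, where: (a) The left $(H\text{-}\mathsf{mod})$-module category structure on ${}^{\widehat{H}}_A\mathsf{DH}(H)$ sends $((Y,\cdot),(M,\ast,\varphi))$ to $(Y\otimes M,\widetilde{\ast},\widetilde{\varphi})$, where $a\,\widetilde{\ast}\,(y\otimes m)=(a_{[-1]}\cdot y)\otimes(a_{[0]}\ast m)$ for $a\in A$, $y\in Y$, $m\in M$, and, for $\varphi(m)=m_{-1}\otimes m_0$, $$\widetilde{\varphi}(y\otimes m)=\sum_{i,j}(t_jm_{-1}s_i)\otimes(s_jt_i\cdot y)\otimes m_0.$$ (b) The braiding on ${}^{\widehat{H}}_A\mathsf{DH}(H)$ is given by $e^{\mathsf{DH}}_{X,(M,\ast,\varphi)}(x\otimes m)=(m_{-1}\cdot x)\otimes m_0$ for $X\in H\text{-}\mathsf{mod}$, $(M,\ast,\varphi)\in{}^{\widehat{H}}_A\mathsf{DH}(H)$, $x\in X$, $m\in M$.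
   Context: $\Bbbk$ is an algebraically closed field, $\otimes=\otimes_\Bbbk$, sumless Sweedler notation. $R$ is invertible with $(\Delta\otimes \mathrm{Id})R=R_{13}R_{23}$, $(\mathrm{Id}\otimes\Delta)R=R_{13}R_{12}$, $R\Delta(h)=\Delta^{\mathrm{op}}(h)R$; $H\text{-}\mathsf{mod}$ (left modules) is braided by $c_{X,Y}(x\otimes y)=\sum_i(t_i\cdot y)\otimes(s_i\cdot x)$. $A\text{-}\mathsf{mod}$ is a left $H\text{-}\mathsf{mod}$-module category via $X\triangleright M=X\otimes M$ with $a\cdot(x\otimes m)=(a_{[-1]}\cdot x)\otimes(a_{[0]}\cdot m)$ (trivial associativity, suppressed). For a braided monoidal category $(\mathcal{C},c)$, a braiding on a left $\mathcal{C}$-module category $\mathcal{M}$ (associators suppressed) is a natural isomorphism $e_{X,M}:X\triangleright M\to X\triangleright M$ with (BM1) $e_{X\otimes Y,M}=(\mathrm{Id}_X\triangleright e_{Y,M})(c_{Y,X}\triangleright \mathrm{Id}_M)(\mathrm{Id}_Y\triangleright e_{X,M})(c_{Y,X}^{-1}\triangleright \mathrm{Id}_M)$, (BM2) $e_{X,Y\triangleright M}=(c_{Y,X}\triangleright \mathrm{Id}_M)(\mathrm{Id}_Y\triangleright e_{X,M})(c_{X,Y}\triangleright \mathrm{Id}_M)$. A braided $\mathcal{C}$-module functor is a $\mathcal{C}$-module functor $(F,s)$, $s_{X,M}:F(X\triangleright M)\cong X\triangleright'F(M)$, with $e'_{X,F(M)}s_{X,M}=s_{X,M}F(e_{X,M})$;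 an isomorphism of braided module categories is given by two such functors, one in each direction, yielding an isomorphism of the underlying categories. Reflective center $\mathcal{E}_{\mathcal{C}}(\mathcal{M})$: objects $(M,e^M)$, $M\in\mathcal{M}$, $e^M=\{e^M_Y:Y\triangleright M\to Y\triangleright M\}_{Y}$ a natural isomorphism such that $e_{X,M}:=e^M_X$ satisfies (BM1); morphisms $f:M\to N$ with $(\mathrm{Id}_Y\triangleright f)e^M_Y=e^N_Y(\mathrm{Id}_Y\triangleright f)$ for all $Y$. Its braided module structure is $Y\triangleright(M,e^M)=(Y\triangleright M,e^{Y\triangleright M})$ with $e^{Y\triangleright M}_X=(c_{Y,X}\triangleright \mathrm{Id}_M)(\mathrm{Id}_Y\triangleright e^M_X)(c_{X,Y}\triangleright \mathrm{Id}_M)$, and braiding $e_{X,(M,e^M)}=e^M_X$. $\widehat{H}$ is $H$ as a vector space, with $\widehat{\Delta}(h)=\sum_{i,j}t_jh_{(1)}t_i\otimes h_{(2)}s_iS^{-1}(s_j)$, $\widehat{\varepsilon}=\varepsilon$ and left $H$-action $\ell\rightharpoonup h=\ell_{(2)}hS^{-1}(\ell_{(1)})$; it is a left $H$-module coalgebra. Objects of ${}^{\widehat{H}}_A\mathsf{DH}(H)$ are triples $(M,\ast,\varphi)$ with $(M,\ast)$ a left $A$-module and $(M,\varphi)$ a left $\widehat{H}$-comodule, $\varphi(m)=m_{-1}\otimes m_0$, such that $(a\ast m)_{-1}\otimes(a\ast m)_0=(a_{[-1]}\rightharpoonup m_{-1})\otimes(a_{[0]}\ast m_0)$; morphisms are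 maps that are both $A$-linear and $\widehat{H}$-colinear. *)

theory Defs
  imports "HOL-Algebra.Algebraic_Closure" "HOL-Library.FuncSet"
begin

(* frees the identifier X for objects *)
no_notation var (\<open>X\<index>\<close>)

section \<open>Categories, module categories and reflective centers\<close>

record ('o, 'm) cat =
  Obj :: "'o set"
  Arr :: "'m set"
  Dom :: "'m \<Rightarrow> 'o"
  Cod :: "'m \<Rightarrow> 'o"
  Idn :: "'o \<Rightarrow> 'm"
  Comp :: "'m \<Rightarrow> 'm \<Rightarrow> 'm" (infixr \<open>\<cdot>\<index>\<close> 70)

definition Homs :: "('o, 'm, 'z) cat_scheme \<Rightarrow> 'o \<Rightarrow> 'o \<Rightarrow> 'm set" where
  "Homs C X Y = {f \<in> Arr C. Dom C f = X \<and> Cod C f = Y}"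

definition inverse_arrows :: "('o, 'm, 'z) cat_scheme \<Rightarrow> 'm \<Rightarrow> 'm \<Rightarrow> bool" where
  "inverse_arrows C f g \<longleftrightarrow>
     f \<in> Arr C \<and> g \<in> Homs C (Cod C f) (Dom C f) \<and>
     g \<cdot>\<^bsub>C\<^esub> f = Idn C (Dom C f) \<and> f \<cdot>\<^bsub>C\<^esub> g = Idn C (Cod C f)"

definition Isos :: "('o, 'm, 'z) cat_scheme \<Rightarrow> 'o \<Rightarrow> 'o \<Rightarrow> 'm set" where
  "Isos C X Y = {f \<in> Homs C X Y. \<exists>g. inverse_arrows C f g}"

definition inv_arr :: "('o, 'm, 'z) cat_scheme \<Rightarrow> 'm \<Rightarrow> 'm" where
  "inv_arr C f = (THE g. inverse_arrows C f g)"

locale category =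
  fixes C :: "('o, 'm, 'z) cat_scheme"
  assumes Dom_Obj: "f \<in> Arr C \<Longrightarrow> Dom C f \<in> Obj C"
    and Cod_Obj: "f \<in> Arr C \<Longrightarrow> Cod C f \<in> Obj C"
    and Idn_Homs: "X \<in> Obj C \<Longrightarrow> Idn C X \<in> Homs C X X"
    and Comp_Homs: "\<lbrakk>f \<in> Homs C X Y; g \<in> Homs C Y Z\<rbrakk> \<Longrightarrow> g \<cdot>\<^bsub>C\<^esub> f \<in> Homs C X Z"
    and Comp_Idn: "f \<in> Homs C X Y \<Longrightarrow> f \<cdot>\<^bsub>C\<^esub> Idn C X = f"
    and Idn_Comp: "f \<in> Homs C X Y \<Longrightarrow> Idn C Y \<cdot>\<^bsub>C\<^esub> f = f"
    and Comp_assoc: "\<lbrakk>f \<in> Homs C W X; g \<in> Homs C X Y; h \<in> Homs C Y Z\<rbrakk> \<Longrightarrow>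
          (h \<cdot>\<^bsub>C\<^esub> g) \<cdot>\<^bsub>C\<^esub> f = h \<cdot>\<^bsub>C\<^esub> (g \<cdot>\<^bsub>C\<^esub> f)"

record ('o, 'm) monoidal_cat = "('o, 'm) cat" +
  tensor_obj :: "'o \<Rightarrow> 'o \<Rightarrow> 'o" (infixr \<open>\<boxtimes>\<index>\<close> 75)
  tensor_arr :: "'m \<Rightarrow> 'm \<Rightarrow> 'm" (infixr \<open>\<boxtimes>\<^sub>a\<index>\<close> 75)
  unit_obj :: 'o
  associator :: "'o \<Rightarrow> 'o \<Rightarrow> 'o \<Rightarrow> 'm"
  left_unitor :: "'o \<Rightarrow> 'm"
  right_unitor :: "'o \<Rightarrow> 'm"

record ('o, 'm) braided_cat = "('o, 'm) monoidal_cat" +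
  braiding :: "'o \<Rightarrow> 'o \<Rightarrow> 'm"

locale monoidal_category = category C
  for C :: "('o, 'm, 'z) monoidal_cat_scheme" +
  assumes tensor_obj: "\<lbrakk>X \<in> Obj C; Y \<in> Obj C\<rbrakk> \<Longrightarrow> X \<boxtimes>\<^bsub>C\<^esub> Y \<in> Obj C"
    and tensor_arr: "\<lbrakk>f \<in> Homs C X X'; g \<in> Homs C Y Y'\<rbrakk> \<Longrightarrow>
          f \<boxtimes>\<^sub>a\<^bsub>C\<^esub> g \<in> Homs C (X \<boxtimes>\<^bsub>C\<^esub> Y) (X' \<boxtimes>\<^bsub>C\<^esub> Y')"
    and tensor_Idn: "\<lbrakk>X \<in> Obj C; Y \<in> Obj C\<rbrakk> \<Longrightarrow>
          Idn C X \<boxtimes>\<^sub>a\<^bsub>C\<^esub> Idn C Y = Idn C (X \<boxtimes>\<^bsub>C\<^esub> Y)"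
    and tensor_Comp: "\<lbrakk>f \<in> Homs C X X'; f' \<in> Homs C X' X''; g \<in> Homs C Y Y'; g' \<in> Homs C Y' Y''\<rbrakk> \<Longrightarrow>
          (f' \<cdot>\<^bsub>C\<^esub> f) \<boxtimes>\<^sub>a\<^bsub>C\<^esub> (g' \<cdot>\<^bsub>C\<^esub> g) = (f' \<boxtimes>\<^sub>a\<^bsub>C\<^esub> g') \<cdot>\<^bsub>C\<^esub> (f \<boxtimes>\<^sub>a\<^bsub>C\<^esub> g)"
    and unit_obj: "unit_obj C \<in> Obj C"
    and associator_iso: "\<lbrakk>X \<in> Obj C; Y \<in> Obj C; Z \<in> Obj C\<rbrakk> \<Longrightarrow>
          associator C X Y Z \<in> Isos C ((X \<boxtimes>\<^bsub>C\<^esub> Y) \<boxtimes>\<^bsub>C\<^esub> Z) (X \<boxtimes>\<^bsub>C\<^esub> (Y \<boxtimes>\<^bsub>C\<^esub> Z))"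
    and associator_nat: "\<lbrakk>f \<in> Homs C X X'; g \<in> Homs C Y Y'; h \<in> Homs C Z Z'\<rbrakk> \<Longrightarrow>
          associator C X' Y' Z' \<cdot>\<^bsub>C\<^esub> ((f \<boxtimes>\<^sub>a\<^bsub>C\<^esub> g) \<boxtimes>\<^sub>a\<^bsub>C\<^esub> h)
          = (f \<boxtimes>\<^sub>a\<^bsub>C\<^esub> (g \<boxtimes>\<^sub>a\<^bsub>C\<^esub> h)) \<cdot>\<^bsub>C\<^esub> associator C X Y Z"
    and left_unitor_iso: "X \<in> Obj C \<Longrightarrow> left_unitor C X \<in> Isos C (unit_obj C \<boxtimes>\<^bsub>C\<^esub> X) X"
    and left_unitor_nat: "f \<in> Homs C X Y \<Longrightarrow>
          left_unitor C Y \<cdot>\<^bsub>C\<^esub> (Idn C (unit_obj C) \<boxtimes>\<^sub>a\<^bsub>C\<^esub> f) = f \<cdot>\<^bsub>C\<^esub> left_unitor C X"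
    and right_unitor_iso: "X \<in> Obj C \<Longrightarrow> right_unitor C X \<in> Isos C (X \<boxtimes>\<^bsub>C\<^esub> unit_obj C) X"
    and right_unitor_nat: "f \<in> Homs C X Y \<Longrightarrow>
          right_unitor C Y \<cdot>\<^bsub>C\<^esub> (f \<boxtimes>\<^sub>a\<^bsub>C\<^esub> Idn C (unit_obj C)) = f \<cdot>\<^bsub>C\<^esub> right_unitor C X"
    and pentagon: "\<lbrakk>W \<in> Obj C; X \<in> Obj C; Y \<in> Obj C; Z \<in> Obj C\<rbrakk> \<Longrightarrow>
          (Idn C W \<boxtimes>\<^sub>a\<^bsub>C\<^esub> associator C X Y Z) \<cdot>\<^bsub>C\<^esub> associator C W (X \<boxtimes>\<^bsub>C\<^esub> Y) Z
            \<cdot>\<^bsub>C\<^esub> (associator C W X Y \<boxtimes>\<^sub>a\<^bsub>C\<^esub> Idn C Z)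
          = associator C W X (Y \<boxtimes>\<^bsub>C\<^esub> Z) \<cdot>\<^bsub>C\<^esub> associator C (W \<boxtimes>\<^bsub>C\<^esub> X) Y Z"
    and triangle: "\<lbrakk>X \<in> Obj C; Y \<in> Obj C\<rbrakk> \<Longrightarrow>
          (Idn C X \<boxtimes>\<^sub>a\<^bsub>C\<^esub> left_unitor C Y) \<cdot>\<^bsub>C\<^esub> associator C X (unit_obj C) Y
          = right_unitor C X \<boxtimes>\<^sub>a\<^bsub>C\<^esub> Idn C Y"

locale braided_category = monoidal_category C
  for C :: "('o, 'm, 'z) braided_cat_scheme" +
  assumes braiding_iso: "\<lbrakk>X \<in> Obj C; Y \<in> Obj C\<rbrakk> \<Longrightarrow>
          braiding C X Y \<in> Isos C (X \<boxtimes>\<^bsub>C\<^esub> Y) (Y \<boxtimes>\<^bsub>C\<^esub> X)"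
    and braiding_nat: "\<lbrakk>f \<in> Homs C X X'; g \<in> Homs C Y Y'\<rbrakk> \<Longrightarrow>
          braiding C X' Y' \<cdot>\<^bsub>C\<^esub> (f \<boxtimes>\<^sub>a\<^bsub>C\<^esub> g) = (g \<boxtimes>\<^sub>a\<^bsub>C\<^esub> f) \<cdot>\<^bsub>C\<^esub> braiding C X Y"
    and hexagon1: "\<lbrakk>X \<in> Obj C; Y \<in> Obj C; Z \<in> Obj C\<rbrakk> \<Longrightarrow>
          associator C Y Z X \<cdot>\<^bsub>C\<^esub> braiding C X (Y \<boxtimes>\<^bsub>C\<^esub> Z) \<cdot>\<^bsub>C\<^esub> associator C X Y Z
          = (Idn C Y \<boxtimes>\<^sub>a\<^bsub>C\<^esub> braiding C X Z) \<cdot>\<^bsub>C\<^esub> associator C Y X Z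
            \<cdot>\<^bsub>C\<^esub> (braiding C X Y \<boxtimes>\<^sub>a\<^bsub>C\<^esub> Idn C Z)"
    and hexagon2: "\<lbrakk>X \<in> Obj C; Y \<in> Obj C; Z \<in> Obj C\<rbrakk> \<Longrightarrow>
          inv_arr C (associator C Z X Y) \<cdot>\<^bsub>C\<^esub> braiding C (X \<boxtimes>\<^bsub>C\<^esub> Y) Z \<cdot>\<^bsub>C\<^esub> inv_arr C (associator C X Y Z)
          = (braiding C X Z \<boxtimes>\<^sub>a\<^bsub>C\<^esub> Idn C Y) \<cdot>\<^bsub>C\<^esub> inv_arr C (associator C X Z Y)
            \<cdot>\<^bsub>C\<^esub> (Idn C X \<boxtimes>\<^sub>a\<^bsub>C\<^esub> braiding C Y Z)"

text \<open>Left module categories; \<^typ>\<open>'c\<close> and \<^typ>\<open>'d\<close> are the types of objects and arrows of the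
  monoidal category that acts. The associativity constraint \<open>act_assoc X Y P\<close> goes from
  \<open>(X \<otimes> Y) \<triangleright> P\<close> to \<open>X \<triangleright> (Y \<triangleright> P)\<close>, the unit constraint from \<open>1 \<triangleright> P\<close> to \<open>P\<close>.\<close>

record ('o, 'm, 'c, 'd) module_cat = "('o, 'm) cat" +
  act_obj :: "'c \<Rightarrow> 'o \<Rightarrow> 'o" (infixr \<open>\<triangleright>\<index>\<close> 75)
  act_arr :: "'d \<Rightarrow> 'm \<Rightarrow> 'm" (infixr \<open>\<triangleright>\<^sub>a\<index>\<close> 75)
  act_assoc :: "'c \<Rightarrow> 'c \<Rightarrow> 'o \<Rightarrow> 'm"
  act_unit :: "'o \<Rightarrow> 'm"

record ('o, 'm, 'c, 'd) braided_module_cat = "('o, 'm, 'c, 'd) module_cat" +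
  mod_braiding :: "'c \<Rightarrow> 'o \<Rightarrow> 'm"

locale module_category = C: monoidal_category C + category M
  for C :: "('c, 'd, 'y) monoidal_cat_scheme" and M :: "('o, 'm, 'c, 'd, 'z) module_cat_scheme" +
  assumes act_obj: "\<lbrakk>X \<in> Obj C; P \<in> Obj M\<rbrakk> \<Longrightarrow> X \<triangleright>\<^bsub>M\<^esub> P \<in> Obj M"
    and act_arr: "\<lbrakk>g \<in> Homs C X X'; f \<in> Homs M P P'\<rbrakk> \<Longrightarrow>
          g \<triangleright>\<^sub>a\<^bsub>M\<^esub> f \<in> Homs M (X \<triangleright>\<^bsub>M\<^esub> P) (X' \<triangleright>\<^bsub>M\<^esub> P')"
    and act_Idn: "\<lbrakk>X \<in> Obj C; P \<in> Obj M\<rbrakk> \<Longrightarrow> Idn C X \<triangleright>\<^sub>a\<^bsub>M\<^esub> Idn M P = Idn M (X \<triangleright>\<^bsub>M\<^esub> P)"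
    and act_Comp: "\<lbrakk>g \<in> Homs C X X'; g' \<in> Homs C X' X''; f \<in> Homs M P P'; f' \<in> Homs M P' P''\<rbrakk> \<Longrightarrow>
          (g' \<cdot>\<^bsub>C\<^esub> g) \<triangleright>\<^sub>a\<^bsub>M\<^esub> (f' \<cdot>\<^bsub>M\<^esub> f) = (g' \<triangleright>\<^sub>a\<^bsub>M\<^esub> f') \<cdot>\<^bsub>M\<^esub> (g \<triangleright>\<^sub>a\<^bsub>M\<^esub> f)"
    and act_assoc_iso: "\<lbrakk>X \<in> Obj C; Y \<in> Obj C; P \<in> Obj M\<rbrakk> \<Longrightarrow>
          act_assoc M X Y P \<in> Isos M ((X \<boxtimes>\<^bsub>C\<^esub> Y) \<triangleright>\<^bsub>M\<^esub> P) (X \<triangleright>\<^bsub>M\<^esub> (Y \<triangleright>\<^bsub>M\<^esub> P))"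
    and act_assoc_nat: "\<lbrakk>g \<in> Homs C X X'; h \<in> Homs C Y Y'; f \<in> Homs M P P'\<rbrakk> \<Longrightarrow>
          act_assoc M X' Y' P' \<cdot>\<^bsub>M\<^esub> ((g \<boxtimes>\<^sub>a\<^bsub>C\<^esub> h) \<triangleright>\<^sub>a\<^bsub>M\<^esub> f)
          = (g \<triangleright>\<^sub>a\<^bsub>M\<^esub> (h \<triangleright>\<^sub>a\<^bsub>M\<^esub> f)) \<cdot>\<^bsub>M\<^esub> act_assoc M X Y P"
    and act_unit_iso: "P \<in> Obj M \<Longrightarrow> act_unit M P \<in> Isos M (unit_obj C \<triangleright>\<^bsub>M\<^esub> P) P"
    and act_unit_nat: "f \<in> Homs M P P' \<Longrightarrow>
          act_unit M P' \<cdot>\<^bsub>M\<^esub> (Idn C (unit_obj C) \<triangleright>\<^sub>a\<^bsub>M\<^esub> f) = f \<cdot>\<^bsub>M\<^esub> act_unit M P"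
    and act_pentagon: "\<lbrakk>X \<in> Obj C; Y \<in> Obj C; Z \<in> Obj C; P \<in> Obj M\<rbrakk> \<Longrightarrow>
          (Idn C X \<triangleright>\<^sub>a\<^bsub>M\<^esub> act_assoc M Y Z P) \<cdot>\<^bsub>M\<^esub> act_assoc M X (Y \<boxtimes>\<^bsub>C\<^esub> Z) P
            \<cdot>\<^bsub>M\<^esub> (associator C X Y Z \<triangleright>\<^sub>a\<^bsub>M\<^esub> Idn M P)
          = act_assoc M X Y (Z \<triangleright>\<^bsub>M\<^esub> P) \<cdot>\<^bsub>M\<^esub> act_assoc M (X \<boxtimes>\<^bsub>C\<^esub> Y) Z P"
    and act_triangle: "\<lbrakk>X \<in> Obj C; P \<in> Obj M\<rbrakk> \<Longrightarrow>
          (Idn C X \<triangleright>\<^sub>a\<^bsub>M\<^esub> act_unit M P) \<cdot>\<^bsub>M\<^esub> act_assoc M X (unit_obj C) P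
          = right_unitor C X \<triangleright>\<^sub>a\<^bsub>M\<^esub> Idn M P"

text \<open>The two braid axioms, with the associativity constraints written out. In both, \<open>e\<close> is the family
  \<open>X \<mapsto> e\<^bsub>X,P\<^esub>\<close> for a fixed object \<open>P\<close>; \<open>BM2_rhs C M Y P e X\<close> is the composite
  \<open>(c\<^bsub>Y,X\<^esub> \<triangleright> Id\<^bsub>P\<^esub>) (Id\<^bsub>Y\<^esub> \<triangleright> e\<^bsub>X,P\<^esub>) (c\<^bsub>X,Y\<^esub> \<triangleright> Id\<^bsub>P\<^esub>)\<close> on \<open>X \<triangleright> (Y \<triangleright> P)\<close>.\<close>

definition BM1 ::
  "('c, 'd, 'y) braided_cat_scheme \<Rightarrow> ('o, 'm, 'c, 'd, 'z) module_cat_scheme \<Rightarrow> 'o \<Rightarrow> ('c \<Rightarrow> 'm) \<Rightarrow> bool"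
  where
  "BM1 C M P e \<longleftrightarrow> (\<forall>X\<in>Obj C. \<forall>Y\<in>Obj C.
     e (X \<boxtimes>\<^bsub>C\<^esub> Y)
     = inv_arr M (act_assoc M X Y P) \<cdot>\<^bsub>M\<^esub> (Idn C X \<triangleright>\<^sub>a\<^bsub>M\<^esub> e Y) \<cdot>\<^bsub>M\<^esub> act_assoc M X Y P
       \<cdot>\<^bsub>M\<^esub> (braiding C Y X \<triangleright>\<^sub>a\<^bsub>M\<^esub> Idn M P)
       \<cdot>\<^bsub>M\<^esub> inv_arr M (act_assoc M Y X P) \<cdot>\<^bsub>M\<^esub> (Idn C Y \<triangleright>\<^sub>a\<^bsub>M\<^esub> e X) \<cdot>\<^bsub>M\<^esub> act_assoc M Y X P
       \<cdot>\<^bsub>M\<^esub> (inv_arr C (braiding C Y X) \<triangleright>\<^sub>a\<^bsub>M\<^esub> Idn M P))"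

definition BM2_rhs ::
  "('c, 'd, 'y) braided_cat_scheme \<Rightarrow> ('o, 'm, 'c, 'd, 'z) module_cat_scheme \<Rightarrow> 'c \<Rightarrow> 'o \<Rightarrow> ('c \<Rightarrow> 'm) \<Rightarrow> 'c \<Rightarrow> 'm"
  where
  "BM2_rhs C M Y P e X =
     act_assoc M X Y P \<cdot>\<^bsub>M\<^esub> (braiding C Y X \<triangleright>\<^sub>a\<^bsub>M\<^esub> Idn M P)
     \<cdot>\<^bsub>M\<^esub> inv_arr M (act_assoc M Y X P) \<cdot>\<^bsub>M\<^esub> (Idn C Y \<triangleright>\<^sub>a\<^bsub>M\<^esub> e X) \<cdot>\<^bsub>M\<^esub> act_assoc M Y X P
     \<cdot>\<^bsub>M\<^esub> (braiding C X Y \<triangleright>\<^sub>a\<^bsub>M\<^esub> Idn M P) \<cdot>\<^bsub>M\<^esub> inv_arr M (act_assoc M X Y P)"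

locale braided_module_category = C: braided_category C + module_category C M
  for C :: "('c, 'd, 'y) braided_cat_scheme" and M :: "('o, 'm, 'c, 'd, 'z) braided_module_cat_scheme" +
  assumes mod_braiding_iso: "\<lbrakk>X \<in> Obj C; P \<in> Obj M\<rbrakk> \<Longrightarrow>
          mod_braiding M X P \<in> Isos M (X \<triangleright>\<^bsub>M\<^esub> P) (X \<triangleright>\<^bsub>M\<^esub> P)"
    and mod_braiding_nat: "\<lbrakk>g \<in> Homs C X X'; f \<in> Homs M P P'\<rbrakk> \<Longrightarrow>
          mod_braiding M X' P' \<cdot>\<^bsub>M\<^esub> (g \<triangleright>\<^sub>a\<^bsub>M\<^esub> f) = (g \<triangleright>\<^sub>a\<^bsub>M\<^esub> f) \<cdot>\<^bsub>M\<^esub> mod_braiding M X P"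
    and mod_braiding_BM1: "P \<in> Obj M \<Longrightarrow> BM1 C M P (\<lambda>X. mod_braiding M X P)"
    and mod_braiding_BM2: "\<lbrakk>X \<in> Obj C; Y \<in> Obj C; P \<in> Obj M\<rbrakk> \<Longrightarrow>
          mod_braiding M X (Y \<triangleright>\<^bsub>M\<^esub> P) = BM2_rhs C M Y P (\<lambda>Z. mod_braiding M Z P) X"

locale module_functor = M: module_category C M + N: module_category C N
  for C :: "('c, 'd, 'x) monoidal_cat_scheme" and M :: "('o, 'm, 'c, 'd, 'y) module_cat_scheme"
    and N :: "('p, 'n, 'c, 'd, 'z) module_cat_scheme" +
  fixes FO :: "'o \<Rightarrow> 'p" and FA :: "'m \<Rightarrow> 'n" and s :: "'c \<Rightarrow> 'o \<Rightarrow> 'n"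
  assumes FO_Obj: "P \<in> Obj M \<Longrightarrow> FO P \<in> Obj N"
    and FA_Homs: "f \<in> Homs M P Q \<Longrightarrow> FA f \<in> Homs N (FO P) (FO Q)"
    and FA_Idn: "P \<in> Obj M \<Longrightarrow> FA (Idn M P) = Idn N (FO P)"
    and FA_Comp: "\<lbrakk>f \<in> Homs M P P'; f' \<in> Homs M P' P''\<rbrakk> \<Longrightarrow> FA (f' \<cdot>\<^bsub>M\<^esub> f) = FA f' \<cdot>\<^bsub>N\<^esub> FA f"
    and s_iso: "\<lbrakk>X \<in> Obj C; P \<in> Obj M\<rbrakk> \<Longrightarrow> s X P \<in> Isos N (FO (X \<triangleright>\<^bsub>M\<^esub> P)) (X \<triangleright>\<^bsub>N\<^esub> FO P)"
    and s_nat: "\<lbrakk>g \<in> Homs C X X'; f \<in> Homs M P P'\<rbrakk> \<Longrightarrow>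
          s X' P' \<cdot>\<^bsub>N\<^esub> FA (g \<triangleright>\<^sub>a\<^bsub>M\<^esub> f) = (g \<triangleright>\<^sub>a\<^bsub>N\<^esub> FA f) \<cdot>\<^bsub>N\<^esub> s X P"
    and s_assoc: "\<lbrakk>X \<in> Obj C; Y \<in> Obj C; P \<in> Obj M\<rbrakk> \<Longrightarrow>
          (Idn C X \<triangleright>\<^sub>a\<^bsub>N\<^esub> s Y P) \<cdot>\<^bsub>N\<^esub> s X (Y \<triangleright>\<^bsub>M\<^esub> P) \<cdot>\<^bsub>N\<^esub> FA (act_assoc M X Y P)
          = act_assoc N X Y (FO P) \<cdot>\<^bsub>N\<^esub> s (X \<boxtimes>\<^bsub>C\<^esub> Y) P"
    and s_unit: "P \<in> Obj M \<Longrightarrow>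
          act_unit N (FO P) \<cdot>\<^bsub>N\<^esub> s (unit_obj C) P = FA (act_unit M P)"

locale braided_module_functor =
  M: braided_module_category C M + N: braided_module_category C N + module_functor C M N FO FA s
  for C :: "('c, 'd, 'x) braided_cat_scheme" and M :: "('o, 'm, 'c, 'd, 'y) braided_module_cat_scheme"
    and N :: "('p, 'n, 'c, 'd, 'z) braided_module_cat_scheme"
    and FO :: "'o \<Rightarrow> 'p" and FA :: "'m \<Rightarrow> 'n" and s :: "'c \<Rightarrow> 'o \<Rightarrow> 'n" +
  assumes s_braid: "\<lbrakk>X \<in> Obj C; P \<in> Obj M\<rbrakk> \<Longrightarrow>
          mod_braiding N X (FO P) \<cdot>\<^bsub>N\<^esub> s X P = s X P \<cdot>\<^bsub>N\<^esub> FA (mod_braiding M X P)"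

definition braided_module_isomorphic ::
  "('c, 'd, 'x) braided_cat_scheme \<Rightarrow> ('o, 'm, 'c, 'd, 'y) braided_module_cat_scheme \<Rightarrow>
   ('p, 'n, 'c, 'd, 'z) braided_module_cat_scheme \<Rightarrow> bool" where
  "braided_module_isomorphic C M N \<longleftrightarrow>
     (\<exists>FO FA s GO GA t.
        braided_module_functor C M N FO FA s \<and> braided_module_functor C N M GO GA t \<and>
        (\<forall>P\<in>Obj M. GO (FO P) = P) \<and> (\<forall>f\<in>Arr M. GA (FA f) = f) \<and>
        (\<forall>Q\<in>Obj N. FO (GO Q) = Q) \<and> (\<forall>g\<in>Arr N. FA (GA g) = g))"

datatype ('o, 'f) arrow = Arrow (src: 'o) (fn: 'f) (tgt: 'o)

definition center_obj ::
  "('c, 'd, 'y) braided_cat_scheme \<Rightarrow> ('o, 'm, 'c, 'd, 'z) module_cat_scheme \<Rightarrow> ('o \<times> ('c \<Rightarrow> 'm)) set"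
  where
  "center_obj C M = {(P, e). P \<in> Obj M \<and> e \<in> extensional (Obj C) \<and>
     (\<forall>Y\<in>Obj C. e Y \<in> Isos M (Y \<triangleright>\<^bsub>M\<^esub> P) (Y \<triangleright>\<^bsub>M\<^esub> P)) \<and>
     (\<forall>Y\<in>Obj C. \<forall>Z\<in>Obj C. \<forall>g\<in>Homs C Y Z.
        e Z \<cdot>\<^bsub>M\<^esub> (g \<triangleright>\<^sub>a\<^bsub>M\<^esub> Idn M P) = (g \<triangleright>\<^sub>a\<^bsub>M\<^esub> Idn M P) \<cdot>\<^bsub>M\<^esub> e Y) \<and>
     BM1 C M P e}"

definition center_arr ::
  "('c, 'd, 'y) braided_cat_scheme \<Rightarrow> ('o, 'm, 'c, 'd, 'z) module_cat_scheme \<Rightarrow>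
   ('o \<times> ('c \<Rightarrow> 'm), 'm) arrow set" where
  "center_arr C M = {Arrow (P, e) f (Q, e') | P e f Q e'.
     (P, e) \<in> center_obj C M \<and> (Q, e') \<in> center_obj C M \<and> f \<in> Homs M P Q \<and>
     (\<forall>Y\<in>Obj C. (Idn C Y \<triangleright>\<^sub>a\<^bsub>M\<^esub> f) \<cdot>\<^bsub>M\<^esub> e Y = e' Y \<cdot>\<^bsub>M\<^esub> (Idn C Y \<triangleright>\<^sub>a\<^bsub>M\<^esub> f))}"

definition center_act ::
  "('c, 'd, 'y) braided_cat_scheme \<Rightarrow> ('o, 'm, 'c, 'd, 'z) module_cat_scheme \<Rightarrow>
   'c \<Rightarrow> 'o \<times> ('c \<Rightarrow> 'm) \<Rightarrow> 'o \<times> ('c \<Rightarrow> 'm)" where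
  "center_act C M Y P = (Y \<triangleright>\<^bsub>M\<^esub> fst P, restrict (BM2_rhs C M Y (fst P) (snd P)) (Obj C))"

definition reflective_center ::
  "('c, 'd, 'y) braided_cat_scheme \<Rightarrow> ('o, 'm, 'c, 'd, 'z) module_cat_scheme \<Rightarrow>
   ('o \<times> ('c \<Rightarrow> 'm), ('o \<times> ('c \<Rightarrow> 'm), 'm) arrow, 'c, 'd) braided_module_cat" where
  "reflective_center C M =
    \<lparr>Obj = center_obj C M,
     Arr = center_arr C M,
     Dom = src,
     Cod = tgt,
     Idn = (\<lambda>P. Arrow P (Idn M (fst P)) P),
     Comp = (\<lambda>g f. Arrow (src f) (fn g \<cdot>\<^bsub>M\<^esub> fn f) (tgt g)),
     act_obj = center_act C M,
     act_arr = (\<lambda>g f. Arrow (center_act C M (Dom C g) (src f)) (g \<triangleright>\<^sub>a\<^bsub>M\<^esub> fn f) (center_act C M (Cod C g) (tgt f))),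
     act_assoc = (\<lambda>X Y P. Arrow (center_act C M (X \<boxtimes>\<^bsub>C\<^esub> Y) P) (act_assoc M X Y (fst P))
                            (center_act C M X (center_act C M Y P))),
     act_unit = (\<lambda>P. Arrow (center_act C M (unit_obj C) P) (act_unit M (fst P)) P),
     mod_braiding = (\<lambda>X P. Arrow (center_act C M X P) (snd P X) (center_act C M X P))\<rparr>"


section \<open>Tensor products of vector spaces\<close>

text \<open>All vector spaces below have their carrier inside one type, which is closed under the formation
  of tensor products: elements of \<open>X \<otimes> Y\<close> are the \<open>Tens\<close> values whose list \<open>[(x\<^sub>1, y\<^sub>1), \<dots>]\<close>,
  standing for \<open>x\<^sub>1 \<otimes> y\<^sub>1 + \<dots>\<close>, is the chosen representative of its class modulo the tensor
  relations. \<open>Scal\<close> accommodates the ground field, and \<open>Atom\<close> arbitrary given vector spaces.\<close>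

datatype ('k, 'a) univ =
    Atom 'a
  | Scal (unScal: 'k)
  | Tens (summands: "(('k, 'a) univ \<times> ('k, 'a) univ) list")

inductive tensor_rel ::
  "('k, 'r) ring_scheme \<Rightarrow> ('k, 'u, 'x) module_scheme \<Rightarrow> ('k, 'v, 'y) module_scheme \<Rightarrow>
   ('u \<times> 'v) list \<Rightarrow> ('u \<times> 'v) list \<Rightarrow> bool"
  for K X Y where
  refl: "set p \<subseteq> carrier X \<times> carrier Y \<Longrightarrow> tensor_rel K X Y p p"
| sym: "tensor_rel K X Y p q \<Longrightarrow> tensor_rel K X Y q p"
| trans: "\<lbrakk>tensor_rel K X Y p q; tensor_rel K X Y q r\<rbrakk> \<Longrightarrow> tensor_rel K X Y p r"
| append: "\<lbrakk>tensor_rel K X Y p p'; tensor_rel K X Y q q'\<rbrakk> \<Longrightarrow> tensor_rel K X Y (p @ q) (p' @ q')"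
| commute: "\<lbrakk>set p \<subseteq> carrier X \<times> carrier Y; set q \<subseteq> carrier X \<times> carrier Y\<rbrakk> \<Longrightarrow>
    tensor_rel K X Y (p @ q) (q @ p)"
| add_left: "\<lbrakk>x \<in> carrier X; x' \<in> carrier X; y \<in> carrier Y\<rbrakk> \<Longrightarrow>
    tensor_rel K X Y [(x \<oplus>\<^bsub>X\<^esub> x', y)] [(x, y), (x', y)]"
| add_right: "\<lbrakk>x \<in> carrier X; y \<in> carrier Y; y' \<in> carrier Y\<rbrakk> \<Longrightarrow>
    tensor_rel K X Y [(x, y \<oplus>\<^bsub>Y\<^esub> y')] [(x, y), (x, y')]"
| balanced: "\<lbrakk>c \<in> carrier K; x \<in> carrier X; y \<in> carrier Y\<rbrakk> \<Longrightarrow>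
    tensor_rel K X Y [(c \<odot>\<^bsub>X\<^esub> x, y)] [(x, c \<odot>\<^bsub>Y\<^esub> y)]"
| zero: "y \<in> carrier Y \<Longrightarrow> tensor_rel K X Y [(\<zero>\<^bsub>X\<^esub>, y)] []"

definition tsum ::
  "('k, 'r) ring_scheme \<Rightarrow> ('k, ('k, 'a) univ, 'x) module_scheme \<Rightarrow> ('k, ('k, 'a) univ, 'y) module_scheme \<Rightarrow>
   (('k, 'a) univ \<times> ('k, 'a) univ) list \<Rightarrow> ('k, 'a) univ" where
  "tsum K X Y p = Tens (SOME q. tensor_rel K X Y p q)"

definition tens ::
  "('k, 'r) ring_scheme \<Rightarrow> ('k, ('k, 'a) univ, 'x) module_scheme \<Rightarrow> ('k, ('k, 'a) univ, 'y) module_scheme \<Rightarrow>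
   ('k, 'a) univ \<Rightarrow> ('k, 'a) univ \<Rightarrow> ('k, 'a) univ" where
  "tens K X Y x y = tsum K X Y [(x, y)]"

text \<open>The multiplication and unit are those of the tensor product algebra; they are meaningful only if
  \<open>X\<close> and \<open>Y\<close> are algebras.\<close>

definition tensor ::
  "('k, 'r) ring_scheme \<Rightarrow> ('k, ('k, 'a) univ, 'x) module_scheme \<Rightarrow> ('k, ('k, 'a) univ, 'y) module_scheme \<Rightarrow>
   ('k, ('k, 'a) univ) module" where
  "tensor K X Y =
    \<lparr>carrier = tsum K X Y ` {p. set p \<subseteq> carrier X \<times> carrier Y},
     monoid.mult = (\<lambda>u v. tsum K X Y
       (map (\<lambda>((x, y), (x', y')). (x \<otimes>\<^bsub>X\<^esub> x', y \<otimes>\<^bsub>Y\<^esub> y')) (List.product (summands u) (summands v)))),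
     one = tens K X Y \<one>\<^bsub>X\<^esub> \<one>\<^bsub>Y\<^esub>,
     zero = tsum K X Y [],
     add = (\<lambda>u v. tsum K X Y (summands u @ summands v)),
     smult = (\<lambda>c u. tsum K X Y (map (\<lambda>(x, y). (c \<odot>\<^bsub>X\<^esub> x, y)) (summands u)))\<rparr>"

text \<open>Sweedler notation: for \<open>u = \<Sum>\<^sub>i x\<^sub>i \<otimes> y\<^sub>i\<close>, \<open>sweedler W u f\<close> is \<open>\<Sum>\<^sub>i f x\<^sub>i y\<^sub>i\<close> in \<open>W\<close>,
  the value at \<open>u\<close> of the linear map on the tensor product induced by the bilinear map \<open>f\<close>.\<close>

definition sweedler ::
  "('w, 'z) ring_scheme \<Rightarrow> ('k, 'a) univ \<Rightarrow> (('k, 'a) univ \<Rightarrow> ('k, 'a) univ \<Rightarrow> 'w) \<Rightarrow> 'w" where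
  "sweedler W u f = foldr (\<lambda>(x, y) w. f x y \<oplus>\<^bsub>W\<^esub> w) (summands u) \<zero>\<^bsub>W\<^esub>"

definition linear_maps ::
  "('k, 'r) ring_scheme \<Rightarrow> ('k, 'u, 'x) module_scheme \<Rightarrow> ('k, 'v, 'y) module_scheme \<Rightarrow> ('u \<Rightarrow> 'v) set" where
  "linear_maps K V W = {f. f \<in> carrier V \<rightarrow> carrier W \<and>
     (\<forall>x\<in>carrier V. \<forall>y\<in>carrier V. f (x \<oplus>\<^bsub>V\<^esub> y) = f x \<oplus>\<^bsub>W\<^esub> f y) \<and>
     (\<forall>c\<in>carrier K. \<forall>x\<in>carrier V. f (c \<odot>\<^bsub>V\<^esub> x) = c \<odot>\<^bsub>W\<^esub> f x)}"

definition tensor_map ::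
  "('k, 'r) ring_scheme \<Rightarrow> ('k, ('k, 'a) univ, 'x) module_scheme \<Rightarrow> ('k, ('k, 'a) univ, 'y) module_scheme \<Rightarrow>
   ('k, ('k, 'a) univ, 'x1) module_scheme \<Rightarrow> ('k, ('k, 'a) univ, 'y1) module_scheme \<Rightarrow>
   (('k, 'a) univ \<Rightarrow> ('k, 'a) univ) \<Rightarrow> (('k, 'a) univ \<Rightarrow> ('k, 'a) univ) \<Rightarrow> ('k, 'a) univ \<Rightarrow> ('k, 'a) univ" where
  "tensor_map K X Y X' Y' f g =
     (\<lambda>u\<in>carrier (tensor K X Y). sweedler (tensor K X' Y') u (\<lambda>x y. tens K X' Y' (f x) (g y)))"

definition tensor_assoc ::
  "('k, 'r) ring_scheme \<Rightarrow> ('k, ('k, 'a) univ, 'x) module_scheme \<Rightarrow> ('k, ('k, 'a) univ, 'y) module_scheme \<Rightarrow>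
   ('k, ('k, 'a) univ, 'z) module_scheme \<Rightarrow> ('k, 'a) univ \<Rightarrow> ('k, 'a) univ" where
  "tensor_assoc K X Y Z =
     (\<lambda>w\<in>carrier (tensor K (tensor K X Y) Z).
        sweedler (tensor K X (tensor K Y Z)) w (\<lambda>u z.
        sweedler (tensor K X (tensor K Y Z)) u (\<lambda>x y.
          tens K X (tensor K Y Z) x (tens K Y Z y z))))"


section \<open>Quasitriangular Hopf algebras, comodule algebras and modules\<close>

record ('k, 'a) coalg = "('k, ('k, 'a) univ) module" +
  comult :: "('k, 'a) univ \<Rightarrow> ('k, 'a) univ"
  counit :: "('k, 'a) univ \<Rightarrow> 'k"

record ('k, 'a) hopf = "('k, 'a) coalg" +
  antipode :: "('k, 'a) univ \<Rightarrow> ('k, 'a) univ"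

record ('k, 'a) qt_hopf = "('k, 'a) hopf" +
  Rmat :: "('k, 'a) univ"

record ('k, 'a) comod_alg = "('k, ('k, 'a) univ) module" +
  coact :: "('k, 'a) univ \<Rightarrow> ('k, 'a) univ"

record ('k, 'u) lmod = "('k, 'u) module" +
  act :: "'u \<Rightarrow> 'u \<Rightarrow> 'u"

definition assoc_algebra :: "('k, 'r) ring_scheme \<Rightarrow> ('k, 'u, 'x) module_scheme \<Rightarrow> bool" where
  "assoc_algebra K A \<longleftrightarrow> module K A \<and> ring A \<and>
     (\<forall>c\<in>carrier K. \<forall>x\<in>carrier A. \<forall>y\<in>carrier A.
        (c \<odot>\<^bsub>A\<^esub> x) \<otimes>\<^bsub>A\<^esub> y = c \<odot>\<^bsub>A\<^esub> (x \<otimes>\<^bsub>A\<^esub> y) \<and> x \<otimes>\<^bsub>A\<^esub> (c \<odot>\<^bsub>A\<^esub> y) = c \<odot>\<^bsub>A\<^esub> (x \<otimes>\<^bsub>A\<^esub> y))"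

definition left_comodule ::
  "('k, 'r) ring_scheme \<Rightarrow> ('k, 'a, 'x) coalg_scheme \<Rightarrow> ('k, ('k, 'a) univ, 'y) module_scheme \<Rightarrow>
   (('k, 'a) univ \<Rightarrow> ('k, 'a) univ) \<Rightarrow> bool" where
  "left_comodule K C M \<phi> \<longleftrightarrow> module K M \<and> \<phi> \<in> linear_maps K M (tensor K C M) \<and>
     (\<forall>m\<in>carrier M.
        sweedler (tensor K (tensor K C C) M) (\<phi> m) (\<lambda>c n. tens K (tensor K C C) M (comult C c) n)
        = sweedler (tensor K (tensor K C C) M) (\<phi> m) (\<lambda>c n.
          sweedler (tensor K (tensor K C C) M) (\<phi> n) (\<lambda>d n'.
            tens K (tensor K C C) M (tens K C C c d) n'))) \<and>
     (\<forall>m\<in>carrier M. sweedler M (\<phi> m) (\<lambda>c n. counit C c \<odot>\<^bsub>M\<^esub> n) = m)"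

definition coalgebra :: "('k, 'r) ring_scheme \<Rightarrow> ('k, 'a, 'x) coalg_scheme \<Rightarrow> bool" where
  "coalgebra K C \<longleftrightarrow> left_comodule K C C (comult C) \<and>
     counit C \<in> carrier C \<rightarrow> carrier K \<and>
     (\<forall>x\<in>carrier C. \<forall>y\<in>carrier C. counit C (x \<oplus>\<^bsub>C\<^esub> y) = counit C x \<oplus>\<^bsub>K\<^esub> counit C y) \<and>
     (\<forall>c\<in>carrier K. \<forall>x\<in>carrier C. counit C (c \<odot>\<^bsub>C\<^esub> x) = c \<otimes>\<^bsub>K\<^esub> counit C x) \<and>
     (\<forall>x\<in>carrier C. sweedler C (comult C x) (\<lambda>a b. counit C b \<odot>\<^bsub>C\<^esub> a) = x)"

definition hopf_algebra :: "('k, 'r) ring_scheme \<Rightarrow> ('k, 'a, 'x) hopf_scheme \<Rightarrow> bool" where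
  "hopf_algebra K H \<longleftrightarrow> assoc_algebra K H \<and> coalgebra K H \<and>
     comult H \<in> ring_hom H (tensor K H H) \<and> counit H \<in> ring_hom H K \<and>
     antipode H \<in> linear_maps K H H \<and>
     (\<forall>h\<in>carrier H.
        sweedler H (comult H h) (\<lambda>a b. antipode H a \<otimes>\<^bsub>H\<^esub> b) = counit H h \<odot>\<^bsub>H\<^esub> \<one>\<^bsub>H\<^esub> \<and>
        sweedler H (comult H h) (\<lambda>a b. a \<otimes>\<^bsub>H\<^esub> antipode H b) = counit H h \<odot>\<^bsub>H\<^esub> \<one>\<^bsub>H\<^esub>)"

definition quasitriangular_hopf_algebra ::
  "('k, 'r) ring_scheme \<Rightarrow> ('k, 'a, 'x) qt_hopf_scheme \<Rightarrow> bool" where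
  "quasitriangular_hopf_algebra K H \<longleftrightarrow> hopf_algebra K H \<and>
     (let HH = tensor K H H; HHH = tensor K HH H; R = Rmat H;
          R12 = tens K HH H R \<one>\<^bsub>H\<^esub>;
          R13 = sweedler HHH R (\<lambda>s t. tens K HH H (tens K H H s \<one>\<^bsub>H\<^esub>) t);
          R23 = sweedler HHH R (\<lambda>s t. tens K HH H (tens K H H \<one>\<^bsub>H\<^esub> s) t)
      in R \<in> Units HH \<and>
         sweedler HHH R (\<lambda>s t. tens K HH H (comult H s) t) = R13 \<otimes>\<^bsub>HHH\<^esub> R23 \<and>
         sweedler HHH R (\<lambda>s t. sweedler HHH (comult H t) (\<lambda>t1 t2. tens K HH H (tens K H H s t1) t2))
           = R13 \<otimes>\<^bsub>HHH\<^esub> R12 \<and>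
         (\<forall>h\<in>carrier H. R \<otimes>\<^bsub>HH\<^esub> comult H h
            = sweedler HH (comult H h) (\<lambda>a b. tens K H H b a) \<otimes>\<^bsub>HH\<^esub> R))"

definition left_comodule_algebra ::
  "('k, 'r) ring_scheme \<Rightarrow> ('k, 'a, 'x) coalg_scheme \<Rightarrow> ('k, 'a, 'y) comod_alg_scheme \<Rightarrow> bool" where
  "left_comodule_algebra K H A \<longleftrightarrow> assoc_algebra K A \<and> left_comodule K H A (coact A) \<and>
     coact A \<in> ring_hom A (tensor K H A)"

definition left_module ::
  "('k, 'r) ring_scheme \<Rightarrow> ('k, 'u, 'x) module_scheme \<Rightarrow> ('k, 'u, 'y) lmod_scheme \<Rightarrow> bool" where
  "left_module K A M \<longleftrightarrow> module K M \<and>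
     (\<forall>a\<in>carrier A. act M a \<in> linear_maps K M M) \<and>
     (\<forall>m\<in>carrier M. (\<lambda>a. act M a m) \<in> linear_maps K A M) \<and>
     (\<forall>m\<in>carrier M. act M \<one>\<^bsub>A\<^esub> m = m) \<and>
     (\<forall>a\<in>carrier A. \<forall>b\<in>carrier A. \<forall>m\<in>carrier M. act M (a \<otimes>\<^bsub>A\<^esub> b) m = act M a (act M b m))"

definition left_module_maps ::
  "('k, 'r) ring_scheme \<Rightarrow> ('k, 'u, 'x) module_scheme \<Rightarrow> ('k, 'u, 'y) lmod_scheme \<Rightarrow> ('k, 'u, 'z) lmod_scheme \<Rightarrow>
   ('u \<Rightarrow> 'u) set" where
  "left_module_maps K A M N = {f \<in> linear_maps K M N.
     \<forall>a\<in>carrier A. \<forall>m\<in>carrier M. f (act M a m) = act N a (f m)}"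

text \<open>\<open>Y \<otimes> M\<close> with the action of \<open>a\<close> through \<open>\<delta> a = a\<^bsub>[-1]\<^esub> \<otimes> a\<^bsub>[0]\<^esub>\<close>.\<close>

definition tensor_lmod ::
  "('k, 'r) ring_scheme \<Rightarrow> (('k, 'a) univ \<Rightarrow> ('k, 'a) univ) \<Rightarrow>
   ('k, ('k, 'a) univ) lmod \<Rightarrow> ('k, ('k, 'a) univ) lmod \<Rightarrow> ('k, ('k, 'a) univ) lmod" where
  "tensor_lmod K \<delta> Y M =
     module.extend (tensor K Y M)
       \<lparr>act = (\<lambda>a u. sweedler (tensor K Y M) (\<delta> a) (\<lambda>h b.
                sweedler (tensor K Y M) u (\<lambda>y m. tens K Y M (act Y h y) (act M b m))))\<rparr>"

definition trivial_lmod ::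
  "('k, 'r) ring_scheme \<Rightarrow> ('k, 'a, 'x) coalg_scheme \<Rightarrow> ('k, ('k, 'a) univ) lmod" where
  "trivial_lmod K H =
     \<lparr>carrier = Scal ` carrier K,
      monoid.mult = (\<lambda>u v. Scal (unScal u \<otimes>\<^bsub>K\<^esub> unScal v)),
      one = Scal \<one>\<^bsub>K\<^esub>,
      zero = Scal \<zero>\<^bsub>K\<^esub>,
      add = (\<lambda>u v. Scal (unScal u \<oplus>\<^bsub>K\<^esub> unScal v)),
      smult = (\<lambda>c u. Scal (c \<otimes>\<^bsub>K\<^esub> unScal u)),
      act = (\<lambda>h u. Scal (counit H h \<otimes>\<^bsub>K\<^esub> unScal u))\<rparr>"


section \<open>The categories of the statement\<close>

text \<open>Underlying functions of arrows are extensional on the carrier of the source, so that two arrows are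
  equal iff they have the same source and target and agree as maps.\<close>

definition lmod_cat ::
  "('k, 'r) ring_scheme \<Rightarrow> ('k, ('k, 'a) univ, 'x) module_scheme \<Rightarrow>
   (('k, ('k, 'a) univ) lmod, (('k, ('k, 'a) univ) lmod, ('k, 'a) univ \<Rightarrow> ('k, 'a) univ) arrow) cat" where
  "lmod_cat K A =
    \<lparr>Obj = {M. left_module K A M},
     Arr = {Arrow M f N | M f N. left_module K A M \<and> left_module K A N \<and>
              f \<in> left_module_maps K A M N \<and> f \<in> extensional (carrier M)},
     Dom = src,
     Cod = tgt,
     Idn = (\<lambda>M. Arrow M (\<lambda>m\<in>carrier M. m) M),
     Comp = (\<lambda>g f. Arrow (src f) (compose (carrier (src f)) (fn g) (fn f)) (tgt g))\<rparr>"

definition H_mod ::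
  "('k, 'r) ring_scheme \<Rightarrow> ('k, 'a, 'x) qt_hopf_scheme \<Rightarrow>
   (('k, ('k, 'a) univ) lmod, (('k, ('k, 'a) univ) lmod, ('k, 'a) univ \<Rightarrow> ('k, 'a) univ) arrow) braided_cat" where
  "H_mod K H = (let T = tensor_lmod K (comult H); I = trivial_lmod K H in
     cat.extend (lmod_cat K H)
      \<lparr>tensor_obj = T,
       tensor_arr = (\<lambda>f g. Arrow (T (src f) (src g))
         (tensor_map K (src f) (src g) (tgt f) (tgt g) (fn f) (fn g)) (T (tgt f) (tgt g))),
       unit_obj = I,
       associator = (\<lambda>X Y Z. Arrow (T (T X Y) Z) (tensor_assoc K X Y Z) (T X (T Y Z))),
       left_unitor = (\<lambda>X. Arrow (T I X)
         (\<lambda>u\<in>carrier (T I X). sweedler X u (\<lambda>c x. unScal c \<odot>\<^bsub>X\<^esub> x)) X),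
       right_unitor = (\<lambda>X. Arrow (T X I)
         (\<lambda>u\<in>carrier (T X I). sweedler X u (\<lambda>x c. unScal c \<odot>\<^bsub>X\<^esub> x)) X),
       braiding = (\<lambda>X Y. Arrow (T X Y)
         (\<lambda>u\<in>carrier (T X Y). sweedler (T Y X) u (\<lambda>x y.
            sweedler (T Y X) (Rmat H) (\<lambda>s t. tens K Y X (act Y t y) (act X s x)))) (T Y X))\<rparr>)"

definition A_mod ::
  "('k, 'r) ring_scheme \<Rightarrow> ('k, 'a, 'x) qt_hopf_scheme \<Rightarrow> ('k, 'a, 'y) comod_alg_scheme \<Rightarrow>
   (('k, ('k, 'a) univ) lmod, (('k, ('k, 'a) univ) lmod, ('k, 'a) univ \<Rightarrow> ('k, 'a) univ) arrow,
    ('k, ('k, 'a) univ) lmod, (('k, ('k, 'a) univ) lmod, ('k, 'a) univ \<Rightarrow> ('k, 'a) univ) arrow) module_cat" where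
  "A_mod K H A = (let T = tensor_lmod K (comult H); V = tensor_lmod K (coact A); I = trivial_lmod K H in
     cat.extend (lmod_cat K A)
      \<lparr>act_obj = V,
       act_arr = (\<lambda>g f. Arrow (V (src g) (src f))
         (tensor_map K (src g) (src f) (tgt g) (tgt f) (fn g) (fn f)) (V (tgt g) (tgt f))),
       act_assoc = (\<lambda>X Y M. Arrow (V (T X Y) M) (tensor_assoc K X Y M) (V X (V Y M))),
       act_unit = (\<lambda>M. Arrow (V I M)
         (\<lambda>u\<in>carrier (V I M). sweedler M u (\<lambda>c m. unScal c \<odot>\<^bsub>M\<^esub> m)) M)\<rparr>)"

abbreviation antipode_inv :: "('k, 'a, 'x) hopf_scheme \<Rightarrow> ('k, 'a) univ \<Rightarrow> ('k, 'a) univ" where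
  "antipode_inv H \<equiv> inv_into (carrier H) (antipode H)"

definition H_hat :: "('k, 'r) ring_scheme \<Rightarrow> ('k, 'a, 'x) qt_hopf_scheme \<Rightarrow> ('k, 'a) coalg" where
  "H_hat K H = module.extend (module.truncate H)
     \<lparr>comult = (\<lambda>h.
        sweedler (tensor K H H) (Rmat H) (\<lambda>s\<^sub>i t\<^sub>i.
        sweedler (tensor K H H) (Rmat H) (\<lambda>s\<^sub>j t\<^sub>j.
        sweedler (tensor K H H) (comult H h) (\<lambda>h1 h2.
          tens K H H (t\<^sub>j \<otimes>\<^bsub>H\<^esub> h1 \<otimes>\<^bsub>H\<^esub> t\<^sub>i) (h2 \<otimes>\<^bsub>H\<^esub> s\<^sub>i \<otimes>\<^bsub>H\<^esub> antipode_inv H s\<^sub>j))))),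
      counit = counit H\<rparr>"

definition H_hat_act ::
  "('k, 'a, 'x) qt_hopf_scheme \<Rightarrow> ('k, 'a) univ \<Rightarrow> ('k, 'a) univ \<Rightarrow> ('k, 'a) univ" where
  "H_hat_act H l h = sweedler H (comult H l) (\<lambda>l1 l2. l2 \<otimes>\<^bsub>H\<^esub> h \<otimes>\<^bsub>H\<^esub> antipode_inv H l1)"

text \<open>Doi-Hopf modules: pairs of an \<open>A\<close>-module and an extensional \<open>H_hat\<close>-coaction on it.\<close>

definition DH_obj ::
  "('k, 'r) ring_scheme \<Rightarrow> ('k, 'a, 'x) qt_hopf_scheme \<Rightarrow> ('k, 'a, 'y) comod_alg_scheme \<Rightarrow>
   (('k, ('k, 'a) univ) lmod \<times> (('k, 'a) univ \<Rightarrow> ('k, 'a) univ)) set" where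
  "DH_obj K H A = {(M, \<phi>). left_module K A M \<and> \<phi> \<in> extensional (carrier M) \<and>
     left_comodule K (H_hat K H) M \<phi> \<and>
     (\<forall>a\<in>carrier A. \<forall>m\<in>carrier M.
        \<phi> (act M a m) =
          sweedler (tensor K (H_hat K H) M) (coact A a) (\<lambda>l b.
          sweedler (tensor K (H_hat K H) M) (\<phi> m) (\<lambda>h n.
            tens K (H_hat K H) M (H_hat_act H l h) (act M b n))))}"

definition DH_arr ::
  "('k, 'r) ring_scheme \<Rightarrow> ('k, 'a, 'x) qt_hopf_scheme \<Rightarrow> ('k, 'a, 'y) comod_alg_scheme \<Rightarrow>
   (('k, ('k, 'a) univ) lmod \<times> (('k, 'a) univ \<Rightarrow> ('k, 'a) univ), ('k, 'a) univ \<Rightarrow> ('k, 'a) univ) arrow set" where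
  "DH_arr K H A = {Arrow (M, \<phi>) f (N, \<psi>) | M \<phi> f N \<psi>.
     (M, \<phi>) \<in> DH_obj K H A \<and> (N, \<psi>) \<in> DH_obj K H A \<and>
     f \<in> left_module_maps K A M N \<and> f \<in> extensional (carrier M) \<and>
     (\<forall>m\<in>carrier M. \<psi> (f m) =
        sweedler (tensor K (H_hat K H) N) (\<phi> m) (\<lambda>h n. tens K (H_hat K H) N h (f n)))}"

definition DH_act ::
  "('k, 'r) ring_scheme \<Rightarrow> ('k, 'a, 'x) qt_hopf_scheme \<Rightarrow> ('k, 'a, 'y) comod_alg_scheme \<Rightarrow>
   ('k, ('k, 'a) univ) lmod \<Rightarrow>
   ('k, ('k, 'a) univ) lmod \<times> (('k, 'a) univ \<Rightarrow> ('k, 'a) univ) \<Rightarrow>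
   ('k, ('k, 'a) univ) lmod \<times> (('k, 'a) univ \<Rightarrow> ('k, 'a) univ)" where
  "DH_act K H A Y P = (let M = fst P; \<phi> = snd P; YM = tensor_lmod K (coact A) Y M; W = tensor K (H_hat K H) YM in
     (YM, \<lambda>u\<in>carrier YM.
        sweedler W u (\<lambda>y m.
        sweedler W (Rmat H) (\<lambda>s\<^sub>i t\<^sub>i.
        sweedler W (Rmat H) (\<lambda>s\<^sub>j t\<^sub>j.
        sweedler W (\<phi> m) (\<lambda>h n.
          tens K (H_hat K H) YM (t\<^sub>j \<otimes>\<^bsub>H\<^esub> h \<otimes>\<^bsub>H\<^esub> s\<^sub>i) (tens K Y M (act Y (s\<^sub>j \<otimes>\<^bsub>H\<^esub> t\<^sub>i) y) n)))))))"

definition DH_cat ::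
  "('k, 'r) ring_scheme \<Rightarrow> ('k, 'a, 'x) qt_hopf_scheme \<Rightarrow> ('k, 'a, 'y) comod_alg_scheme \<Rightarrow>
   (('k, ('k, 'a) univ) lmod \<times> (('k, 'a) univ \<Rightarrow> ('k, 'a) univ),
    (('k, ('k, 'a) univ) lmod \<times> (('k, 'a) univ \<Rightarrow> ('k, 'a) univ), ('k, 'a) univ \<Rightarrow> ('k, 'a) univ) arrow,
    ('k, ('k, 'a) univ) lmod, (('k, ('k, 'a) univ) lmod, ('k, 'a) univ \<Rightarrow> ('k, 'a) univ) arrow)
   braided_module_cat" where
  "DH_cat K H A = (let V = DH_act K H A; T = tensor_lmod K (comult H); I = trivial_lmod K H in
    \<lparr>Obj = DH_obj K H A,
     Arr = DH_arr K H A,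
     Dom = src,
     Cod = tgt,
     Idn = (\<lambda>P. Arrow P (\<lambda>m\<in>carrier (fst P). m) P),
     Comp = (\<lambda>g f. Arrow (src f) (compose (carrier (fst (src f))) (fn g) (fn f)) (tgt g)),
     act_obj = V,
     act_arr = (\<lambda>g f. Arrow (V (src g) (src f))
       (tensor_map K (src g) (fst (src f)) (tgt g) (fst (tgt f)) (fn g) (fn f)) (V (tgt g) (tgt f))),
     act_assoc = (\<lambda>X Y P. Arrow (V (T X Y) P) (tensor_assoc K X Y (fst P)) (V X (V Y P))),
     act_unit = (\<lambda>P. Arrow (V I P)
       (\<lambda>u\<in>carrier (fst (V I P)). sweedler (fst P) u (\<lambda>c m. unScal c \<odot>\<^bsub>fst P\<^esub> m)) P),
     mod_braiding = (\<lambda>X P. Arrow (V X P)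
       (\<lambda>u\<in>carrier (fst (V X P)). sweedler (fst (V X P)) u (\<lambda>x m.
          sweedler (fst (V X P)) (snd P m) (\<lambda>h n. tens K X (fst P) (act X h x) n))) (V X P))\<rparr>)"

end

theory Submission
  imports Defs
begin

text \<open>An object of the reflective center is an \<open>A\<close>-module M with a natural family
  of operators e_Y on Y \<otimes> M. Every element y of an \<open>H\<close>-module Y is the image of
  1 under the module map h \<mapsto> h y from the regular module, so naturality determines the whole
  family by the linear map \<phi>(m) = e_H(1 \<otimes> m) from M to H \<otimes> M: necessarily e_Y(y
  \<otimes> m) = m_{-1} y \<otimes> m_0 (\<open>center_e_tens\<close>). Conversely any linear \<phi>
  defines a natural family by this formula (\<open>earr\<close>). It remains to see what the
  conditions on the family say about \<phi>.

  Evaluated at 1 in regular modules, linearity over \<open>A\<close> becomes an exchange rule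
  between \<phi> and the coaction of \<open>A\<close>, and BM1 becomes a reflection equation that
  compares \<Delta>(m_{-1}) with the iterated coaction by means of \<open>R\<close>. Invertibility
  gives the counit axiom: at the unit object the operator is injective, and BM1 makes it idempotent
  (\<open>center_counit\<close>). These three conditions are collected in
  \<open>refl_coaction\<close>. They contain no antipode; cancelling \<open>R\<close> and the
  antipode identities turns them into comodule axioms over \<open>H_hat\<close> and the Doi-Hopf
  compatibility, and back (\<open>DH_obj_iff\<close>). That the operators of such a \<phi> are
  invertible is shown by an explicit inverse built from the inverse antipode, the inverse of
  \<open>R\<close> and the Drinfeld element (\<open>earr_inverse\<close>).

  Morphisms match because commuting with all e_Y is the same as colinearity: one direction is the
  formula for e_Y, the other is evaluation at 1 in the regular module
  (\<open>colin_earr_nat\<close>, \<open>earr_nat_colin\<close>). The actions match because the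
  coaction on Y \<otimes> M is the one that BM2 prescribes (\<open>earr_BM2\<close>), and the
  braidings match by the definition of e.

  From the R-matrix come the counit contractions of \<open>R\<close>, (S \<otimes> Id)R = R^{-1}, (S
  \<otimes> S)R = R, the Yang-Baxter equation, and the invertible Drinfeld element u with u h =
  S(S(h)) u. The last makes the antipode bijective (\<open>S_bij\<close>), which the definition of
  \<open>H_hat\<close> presupposes. Yang-Baxter is what makes the reflection equation pass from M to
  Y \<otimes> M (\<open>phit_braid\<close>).

  Both sides must also be shown to be braided module categories. The Doi-Hopf category has a
  faithful structure-preserving functor to the \<open>A\<close>-modules that reflects isomorphisms,
  so its axioms follow once the structure maps are colinear (\<open>phit_refl_coaction\<close>,
  \<open>colin_lassoc\<close>, \<open>colin_lunit\<close>, \<open>colin_earr\<close>,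
  \<open>DH_reflecting\<close>). The reflective center then receives its axioms through the
  bijections on objects and arrows (\<open>DH_center_transport\<close>,
  \<open>structure_transport.isomorphic\<close>).

  All computations are in Sweedler notation. A tensor stores one chosen list of summands, and a sum
  over it is independent of that choice when the summand is multilinear; a rewriting step is
  therefore the application of a linear map induced by a multilinear expression.\<close>

section \<open>Multilinear maps and tensor products\<close>

definition bilin ::
  "('k, 'r) ring_scheme \<Rightarrow> ('k, 'u, 'x) module_scheme \<Rightarrow> ('k, 'v, 'y) module_scheme \<Rightarrow>
   ('k, 'w, 'z) module_scheme \<Rightarrow> ('u \<Rightarrow> 'v \<Rightarrow> 'w) \<Rightarrow> bool" where
  "bilin K X Y W f \<longleftrightarrow> (\<forall>x\<in>carrier X. (\<lambda>y. f x y) \<in> linear_maps K Y W) \<and>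
     (\<forall>y\<in>carrier Y. (\<lambda>x. f x y) \<in> linear_maps K X W)"

definition trilin ::
  "('k, 'r) ring_scheme \<Rightarrow> ('k, 'u, 'x) module_scheme \<Rightarrow> ('k, 'v, 'y) module_scheme \<Rightarrow>
   ('k, 't, 'y1) module_scheme \<Rightarrow> ('k, 'w, 'z) module_scheme \<Rightarrow> ('u \<Rightarrow> 'v \<Rightarrow> 't \<Rightarrow> 'w) \<Rightarrow> bool" where
  "trilin K X Y Z W f \<longleftrightarrow> (\<forall>x\<in>carrier X. bilin K Y Z W (f x)) \<and>
     (\<forall>y\<in>carrier Y. \<forall>z\<in>carrier Z. (\<lambda>x. f x y z) \<in> linear_maps K X W)"

locale base_ring = cring K for K :: "('k, 'r) ring_scheme"
begin

lemma linI:
  assumes "\<And>x. x \<in> carrier V \<Longrightarrow> f x \<in> carrier W"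
    and "\<And>x y. x \<in> carrier V \<Longrightarrow> y \<in> carrier V \<Longrightarrow> f (x \<oplus>\<^bsub>V\<^esub> y) = f x \<oplus>\<^bsub>W\<^esub> f y"
    and "\<And>c x. c \<in> carrier K \<Longrightarrow> x \<in> carrier V \<Longrightarrow> f (c \<odot>\<^bsub>V\<^esub> x) = c \<odot>\<^bsub>W\<^esub> f x"
  shows "f \<in> linear_maps K V W"
  using assms by (auto simp: linear_maps_def)

lemma
  assumes "f \<in> linear_maps K V W"
  shows lin_closed: "x \<in> carrier V \<Longrightarrow> f x \<in> carrier W"
    and lin_add: "x \<in> carrier V \<Longrightarrow> y \<in> carrier V \<Longrightarrow> f (x \<oplus>\<^bsub>V\<^esub> y) = f x \<oplus>\<^bsub>W\<^esub> f y"
    and lin_smult: "c \<in> carrier K \<Longrightarrow> x \<in> carrier V \<Longrightarrow> f (c \<odot>\<^bsub>V\<^esub> x) = c \<odot>\<^bsub>W\<^esub> f x"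
  using assms by (auto simp: linear_maps_def)

lemma bilinI:
  assumes "\<And>x. x \<in> carrier X \<Longrightarrow> (\<lambda>y. f x y) \<in> linear_maps K Y W"
    and "\<And>y. y \<in> carrier Y \<Longrightarrow> (\<lambda>x. f x y) \<in> linear_maps K X W"
  shows "bilin K X Y W f"
  using assms by (auto simp: bilin_def)

lemma trilinI:
  assumes "\<And>y z. y \<in> carrier Y \<Longrightarrow> z \<in> carrier Z \<Longrightarrow> (\<lambda>x. f x y z) \<in> linear_maps K X W"
    and "\<And>x z. x \<in> carrier X \<Longrightarrow> z \<in> carrier Z \<Longrightarrow> (\<lambda>y. f x y z) \<in> linear_maps K Y W"
    and "\<And>x y. x \<in> carrier X \<Longrightarrow> y \<in> carrier Y \<Longrightarrow> (\<lambda>z. f x y z) \<in> linear_maps K Z W"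
  shows "trilin K X Y Z W f"
  using assms by (auto simp: trilin_def bilin_def)

lemma lin_comp:
  "F \<in> linear_maps K V' W \<Longrightarrow> g \<in> linear_maps K V V' \<Longrightarrow> (\<lambda>x. F (g x)) \<in> linear_maps K V W"
  by (auto simp: linear_maps_def Pi_iff)

lemma lin_id: "(\<lambda>x. x) \<in> linear_maps K V V"
  by (auto simp: linear_maps_def)

lemma
  assumes "bilin K X Y W f"
  shows bilin_lin1: "g \<in> linear_maps K V X \<Longrightarrow> y \<in> carrier Y \<Longrightarrow> (\<lambda>x. f (g x) y) \<in> linear_maps K V W"
    and bilin_lin2: "x \<in> carrier X \<Longrightarrow> h \<in> linear_maps K V Y \<Longrightarrow> (\<lambda>y. f x (h y)) \<in> linear_maps K V W"
    and bilin_closed: "x \<in> carrier X \<Longrightarrow> y \<in> carrier Y \<Longrightarrow> f x y \<in> carrier W"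
  using assms by (auto simp: bilin_def intro: lin_comp lin_closed)

lemma
  assumes "trilin K X Y Z W f"
  shows trilin_lin1: "g \<in> linear_maps K V X \<Longrightarrow> y \<in> carrier Y \<Longrightarrow> z \<in> carrier Z \<Longrightarrow>
      (\<lambda>x. f (g x) y z) \<in> linear_maps K V W"
    and trilin_lin2: "x \<in> carrier X \<Longrightarrow> h \<in> linear_maps K V Y \<Longrightarrow> z \<in> carrier Z \<Longrightarrow>
      (\<lambda>y. f x (h y) z) \<in> linear_maps K V W"
    and trilin_lin3: "x \<in> carrier X \<Longrightarrow> y \<in> carrier Y \<Longrightarrow> k \<in> linear_maps K V Z \<Longrightarrow>
      (\<lambda>z. f x y (k z)) \<in> linear_maps K V W"
    and trilin_closed: "x \<in> carrier X \<Longrightarrow> y \<in> carrier Y \<Longrightarrow> z \<in> carrier Z \<Longrightarrow> f x y z \<in> carrier W"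
proof -
  have *: "x \<in> carrier X \<Longrightarrow> bilin K Y Z W (f x)" for x
    using assms by (simp add: trilin_def)
  show "(\<lambda>x. f (g x) y z) \<in> linear_maps K V W"
    if "g \<in> linear_maps K V X" "y \<in> carrier Y" "z \<in> carrier Z"
    by (rule lin_comp[where F="\<lambda>x. f x y z", OF _ that(1)]) (use assms that in \<open>simp add: trilin_def\<close>)
  show "x \<in> carrier X \<Longrightarrow> h \<in> linear_maps K V Y \<Longrightarrow> z \<in> carrier Z \<Longrightarrow>
      (\<lambda>y. f x (h y) z) \<in> linear_maps K V W"
    by (rule bilin_lin1[OF *])
  show "x \<in> carrier X \<Longrightarrow> y \<in> carrier Y \<Longrightarrow> k \<in> linear_maps K V Z \<Longrightarrow>
      (\<lambda>z. f x y (k z)) \<in> linear_maps K V W"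
    by (rule bilin_lin2[OF *])
  show "x \<in> carrier X \<Longrightarrow> y \<in> carrier Y \<Longrightarrow> z \<in> carrier Z \<Longrightarrow> f x y z \<in> carrier W"
    by (rule bilin_closed[OF *])
qed

lemma module_ops [simp]:
  assumes "module K X"
  shows "\<zero>\<^bsub>X\<^esub> \<in> carrier X"
    and "x \<in> carrier X \<Longrightarrow> y \<in> carrier X \<Longrightarrow> x \<oplus>\<^bsub>X\<^esub> y \<in> carrier X"
    and "c \<in> carrier K \<Longrightarrow> x \<in> carrier X \<Longrightarrow> c \<odot>\<^bsub>X\<^esub> x \<in> carrier X"
    and "x \<in> carrier X \<Longrightarrow> \<zero>\<^bsub>X\<^esub> \<oplus>\<^bsub>X\<^esub> x = x"
    and "x \<in> carrier X \<Longrightarrow> x \<oplus>\<^bsub>X\<^esub> \<zero>\<^bsub>X\<^esub> = x"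
    and "c \<in> carrier K \<Longrightarrow> c \<odot>\<^bsub>X\<^esub> \<zero>\<^bsub>X\<^esub> = \<zero>\<^bsub>X\<^esub>"
    and "x \<in> carrier X \<Longrightarrow> \<zero>\<^bsub>K\<^esub> \<odot>\<^bsub>X\<^esub> x = \<zero>\<^bsub>X\<^esub>"
    and "x \<in> carrier X \<Longrightarrow> \<one>\<^bsub>K\<^esub> \<odot>\<^bsub>X\<^esub> x = x"
proof -
  interpret module K X by fact
  show "\<zero>\<^bsub>X\<^esub> \<in> carrier X"
    and "x \<in> carrier X \<Longrightarrow> y \<in> carrier X \<Longrightarrow> x \<oplus>\<^bsub>X\<^esub> y \<in> carrier X"
    and "c \<in> carrier K \<Longrightarrow> x \<in> carrier X \<Longrightarrow> c \<odot>\<^bsub>X\<^esub> x \<in> carrier X"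
    and "x \<in> carrier X \<Longrightarrow> \<zero>\<^bsub>X\<^esub> \<oplus>\<^bsub>X\<^esub> x = x"
    and "x \<in> carrier X \<Longrightarrow> x \<oplus>\<^bsub>X\<^esub> \<zero>\<^bsub>X\<^esub> = x"
    and "c \<in> carrier K \<Longrightarrow> c \<odot>\<^bsub>X\<^esub> \<zero>\<^bsub>X\<^esub> = \<zero>\<^bsub>X\<^esub>"
    and "x \<in> carrier X \<Longrightarrow> \<zero>\<^bsub>K\<^esub> \<odot>\<^bsub>X\<^esub> x = \<zero>\<^bsub>X\<^esub>"
    and "x \<in> carrier X \<Longrightarrow> \<one>\<^bsub>K\<^esub> \<odot>\<^bsub>X\<^esub> x = x"
    by auto
qed

text \<open>Membership in \<open>linear_maps\<close> depends only on the values on the carrier,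
  since the module operations do not leave it. This is how functions cut down by
  \<open>restrict\<close>, as arrows require, are exchanged for plain lambda terms.\<close>

lemma lin_cong:
  "(\<And>x. x \<in> carrier V \<Longrightarrow> f x = g x) \<Longrightarrow> module K V \<Longrightarrow> f \<in> linear_maps K V W \<longleftrightarrow> g \<in> linear_maps K V W"
  by (simp add: linear_maps_def Pi_iff module_ops cong: ball_cong)

lemma lin_zero:
  assumes "f \<in> linear_maps K V W" "module K V" "module K W"
  shows "f \<zero>\<^bsub>V\<^esub> = \<zero>\<^bsub>W\<^esub>"
proof -
  interpret V: module K V by fact
  interpret W: module K W by fact
  have "f (\<zero>\<^bsub>K\<^esub> \<odot>\<^bsub>V\<^esub> \<zero>\<^bsub>V\<^esub>) = \<zero>\<^bsub>K\<^esub> \<odot>\<^bsub>W\<^esub> f \<zero>\<^bsub>V\<^esub>"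
    using assms(1) by (intro lin_smult) auto
  thus ?thesis using lin_closed[OF assms(1)] by simp
qed

lemma lin_const_zero: "module K W \<Longrightarrow> (\<lambda>x. \<zero>\<^bsub>W\<^esub>) \<in> linear_maps K V W"
  by (auto simp: linear_maps_def)

lemma lin_sum:
  assumes f: "f \<in> linear_maps K V W" and g: "g \<in> linear_maps K V W" and W: "module K W"
  shows "(\<lambda>x. f x \<oplus>\<^bsub>W\<^esub> g x) \<in> linear_maps K V W"
proof -
  interpret W: module K W by fact
  show ?thesis
    by (rule linI) (auto simp: lin_closed[OF f] lin_closed[OF g] lin_add[OF f] lin_add[OF g]
        lin_smult[OF f] lin_smult[OF g] W.a_ac W.smult_r_distr)
qed

lemma lin_smult_const:
  assumes f: "f \<in> linear_maps K V W" and c: "c \<in> carrier K" and W: "module K W"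
  shows "(\<lambda>x. c \<odot>\<^bsub>W\<^esub> f x) \<in> linear_maps K V W"
proof -
  interpret W: module K W by fact
  show ?thesis
    by (rule linI) (auto simp: lin_closed[OF f] lin_add[OF f] c
        lin_smult[OF f] W.smult_r_distr W.smult_assoc1[symmetric] m_comm)
qed

text \<open>\<open>sweedler\<close> sums over the representative stored in a tensor. Comparing
  representatives needs the same sum over an arbitrary list.\<close>

definition list_sum :: "('w, 'z) ring_scheme \<Rightarrow> ('u \<Rightarrow> 'v \<Rightarrow> 'w) \<Rightarrow> ('u \<times> 'v) list \<Rightarrow> 'w" where
  "list_sum W f p = foldr (\<lambda>(x, y) w. f x y \<oplus>\<^bsub>W\<^esub> w) p \<zero>\<^bsub>W\<^esub>"

lemma list_sum_simps [simp]:
  "list_sum W f [] = \<zero>\<^bsub>W\<^esub>" "list_sum W f ((x, y) # p) = f x y \<oplus>\<^bsub>W\<^esub> list_sum W f p"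
  by (auto simp: list_sum_def)

lemma list_sum_closed:
  assumes "module K W" "\<And>x y. (x, y) \<in> set p \<Longrightarrow> f x y \<in> carrier W"
  shows "list_sum W f p \<in> carrier W"
  using assms(2) by (induction p) (auto simp: module_ops[OF assms(1)])

lemma list_sum_append:
  assumes "module K W" "\<And>x y. (x, y) \<in> set p \<union> set q \<Longrightarrow> f x y \<in> carrier W"
  shows "list_sum W f (p @ q) = list_sum W f p \<oplus>\<^bsub>W\<^esub> list_sum W f q"
proof -
  interpret W: module K W by fact
  show ?thesis using assms(2)
    by (induction p) (auto simp: W.a_ac list_sum_closed[OF assms(1)])
qed

lemma list_sum_cong:
  assumes "\<And>x y. (x, y) \<in> set p \<Longrightarrow> f x y = g x y"
  shows "list_sum W f p = list_sum W g p"
  using assms by (induction p) auto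

lemma list_sum_lin:
  assumes "h \<in> linear_maps K V W" "module K V" "module K W"
    "\<And>x y. (x, y) \<in> set p \<Longrightarrow> f x y \<in> carrier V"
  shows "h (list_sum V f p) = list_sum W (\<lambda>x y. h (f x y)) p"
  using assms(4)
  by (induction p) (auto simp: lin_zero[OF assms(1-3)] lin_add[OF assms(1)] list_sum_closed[OF assms(2)])

lemma list_sum_add:
  assumes "module K W" "\<And>x y. (x, y) \<in> set p \<Longrightarrow> f x y \<in> carrier W \<and> g x y \<in> carrier W"
  shows "list_sum W (\<lambda>x y. f x y \<oplus>\<^bsub>W\<^esub> g x y) p = list_sum W f p \<oplus>\<^bsub>W\<^esub> list_sum W g p"
proof -
  interpret W: module K W by fact
  show ?thesis using assms(2)
    by (induction p) (auto simp: W.a_ac list_sum_closed[OF assms(1)])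
qed

lemma list_sum_zero: "module K W \<Longrightarrow> list_sum W (\<lambda>x y. \<zero>\<^bsub>W\<^esub>) p = \<zero>\<^bsub>W\<^esub>"
  by (induction p) (auto)

lemma list_sum_swap:
  assumes W: "module K W"
    and f: "\<And>a b c d. (a, b) \<in> set p \<Longrightarrow> (c, d) \<in> set q \<Longrightarrow> f a b c d \<in> carrier W"
  shows "list_sum W (\<lambda>a b. list_sum W (\<lambda>c d. f a b c d) q) p =
         list_sum W (\<lambda>c d. list_sum W (\<lambda>a b. f a b c d) p) q"
  using f
proof (induction p)
  case Nil
  then show ?case by (simp add: list_sum_zero[OF W])
next
  case (Cons ab p)
  obtain a b where [simp]: "ab = (a, b)" by (cases ab)
  show ?case using Cons.prems
    by (simp, subst Cons.IH, simp, subst list_sum_add[OF W]) (auto intro: list_sum_closed[OF W])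
qed

text \<open>A bilinear map respects each generating relation, so the sum is an invariant of the
  class. Carrier membership of both lists is part of the induction because the case
  \<open>append\<close> needs it.\<close>

lemma list_sum_tensor_rel:
  assumes "tensor_rel K X Y p q" "module K X" "module K Y" "module K W" "bilin K X Y W f"
  shows "set p \<subseteq> carrier X \<times> carrier Y \<and> set q \<subseteq> carrier X \<times> carrier Y \<and> list_sum W f p = list_sum W f q"
  using assms(1)
proof (induction)
  interpret X: module K X by fact
  interpret Y: module K Y by fact
  interpret W: module K W by fact
  note f = bilin_closed[OF assms(5)]
  have a: "list_sum W f (p @ q) = list_sum W f p \<oplus>\<^bsub>W\<^esub> list_sum W f q"
    if "set p \<subseteq> carrier X \<times> carrier Y" "set q \<subseteq> carrier X \<times> carrier Y" for p q
    using that by (intro list_sum_append[OF assms(4)]) (auto intro!: f)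
  have c: "list_sum W f p \<in> carrier W" if "set p \<subseteq> carrier X \<times> carrier Y" for p
    using that by (intro list_sum_closed[OF assms(4)]) (auto intro!: f)
  note l1 = bilin_lin1[OF assms(5) lin_id]
  note l2 = bilin_lin2[OF assms(5) _ lin_id]
  {
    case (append p p' q q') then show ?case by (auto simp: a)
  next
    case (commute p q) then show ?case by (auto simp: a c W.a_comm)
  next
    case (add_left x x' y) then show ?case by (auto simp: lin_add[OF l1] f)
  next
    case (add_right x y y') then show ?case by (auto simp: lin_add[OF l2] f)
  next
    case (balanced c x y) then show ?case by (auto simp: lin_smult[OF l1] lin_smult[OF l2] f)
  next
    case (zero y) then show ?case using lin_zero[OF l1 assms(2,4)] by auto
  }
qed auto

lemma sweedler_list_sum: "sweedler W u f = list_sum W f (summands u)"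
  by (simp add: sweedler_def list_sum_def)

lemma tensor_rel_carrier:
  assumes "tensor_rel K X Y p q" "module K X" "module K Y"
  shows "set p \<subseteq> carrier X \<times> carrier Y" "set q \<subseteq> carrier X \<times> carrier Y"
proof -
  \<comment> \<open>The zero map is a bilinear map that always exists; it serves to read the carrier
    part off \<open>list_sum_tensor_rel\<close>.\<close>
  have "bilin K X Y X (\<lambda>x y. \<zero>\<^bsub>X\<^esub>)"
    using assms by (intro bilinI lin_const_zero)
  from list_sum_tensor_rel[OF assms assms(2) this]
  show "set p \<subseteq> carrier X \<times> carrier Y" "set q \<subseteq> carrier X \<times> carrier Y" by auto
qed

text \<open>Related lists are related to the same lists, so \<open>SOME\<close> picks the same
  representative for both: equality of tensors is literal equality of values.\<close>

lemma tsum_cong: "tensor_rel K X Y p q \<Longrightarrow> tsum K X Y p = tsum K X Y q"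
proof -
  assume *: "tensor_rel K X Y p q"
  have "tensor_rel K X Y p r \<longleftrightarrow> tensor_rel K X Y q r" for r
    using tensor_rel.trans[OF *] tensor_rel.trans[OF tensor_rel.sym[OF *]] by blast
  thus "tsum K X Y p = tsum K X Y q" by (simp add: tsum_def)
qed

lemma summands_tsum:
  "set p \<subseteq> carrier X \<times> carrier Y \<Longrightarrow> tensor_rel K X Y p (summands (tsum K X Y p))"
  unfolding tsum_def by (simp, rule someI[where x=p], rule tensor_rel.refl)

lemma tensor_carrier: "carrier (tensor K X Y) = tsum K X Y ` {p. set p \<subseteq> carrier X \<times> carrier Y}"
  by (simp add: tensor_def)

lemma tsum_closed: "set p \<subseteq> carrier X \<times> carrier Y \<Longrightarrow> tsum K X Y p \<in> carrier (tensor K X Y)"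
  by (auto simp: tensor_carrier)

lemma tens_closed [simp]: "x \<in> carrier X \<Longrightarrow> y \<in> carrier Y \<Longrightarrow> tens K X Y x y \<in> carrier (tensor K X Y)"
  by (auto simp: tens_def intro: tsum_closed)

lemma tsum_summands:
  assumes "u \<in> carrier (tensor K X Y)"
  shows "tsum K X Y (summands u) = u"
proof -
  obtain p where p: "set p \<subseteq> carrier X \<times> carrier Y" and u: "u = tsum K X Y p"
    using assms by (auto simp: tensor_carrier)
  show ?thesis unfolding u by (rule tsum_cong[OF summands_tsum[OF p], symmetric])
qed

lemma summands_carrier:
  assumes "u \<in> carrier (tensor K X Y)" "module K X" "module K Y"
  shows "set (summands u) \<subseteq> carrier X \<times> carrier Y"
proof -
  obtain p where p: "set p \<subseteq> carrier X \<times> carrier Y" and u: "u = tsum K X Y p"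
    using assms(1) by (auto simp: tensor_carrier)
  show ?thesis unfolding u by (rule tensor_rel_carrier(2)[OF summands_tsum[OF p] assms(2,3)])
qed

lemma tensor_add_tsum:
  assumes "set p \<subseteq> carrier X \<times> carrier Y" "set q \<subseteq> carrier X \<times> carrier Y"
  shows "tsum K X Y p \<oplus>\<^bsub>tensor K X Y\<^esub> tsum K X Y q = tsum K X Y (p @ q)"
proof -
  have "tensor_rel K X Y (p @ q) (summands (tsum K X Y p) @ summands (tsum K X Y q))"
    by (rule tensor_rel.append[OF summands_tsum[OF assms(1)] summands_tsum[OF assms(2)]])
  from tsum_cong[OF this] show ?thesis by (simp add: tensor_def)
qed

text \<open>Scaling the left entries descends to the quotient. In the case \<open>balanced\<close>
  two scalars meet on the left entry, and commutativity of \<open>K\<close> exchanges them.\<close>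

lemma tensor_rel_smult:
  assumes "tensor_rel K X Y p q" "module K X" "module K Y" "c \<in> carrier K"
  shows "tensor_rel K X Y (map (\<lambda>(x, y). (c \<odot>\<^bsub>X\<^esub> x, y)) p) (map (\<lambda>(x, y). (c \<odot>\<^bsub>X\<^esub> x, y)) q)"
  using assms(1)
proof induction
  interpret X: module K X by fact
  interpret Y: module K Y by fact
  note c = assms(4)
  {
    case (refl p) then show ?case by (intro tensor_rel.refl) (use c in auto)
  next
    case (sym p q) show ?case by (rule tensor_rel.sym[OF sym.IH])
  next
    case (trans p q r) show ?case by (rule tensor_rel.trans[OF trans.IH])
  next
    case (append p p' q q') show ?case unfolding map_append by (rule tensor_rel.append[OF append.IH])
  next
    case (commute p q) then show ?case unfolding map_append by (intro tensor_rel.commute) (use c in auto)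
  next
    case (add_left x x' y) then show ?case using c by (simp add: X.smult_r_distr tensor_rel.add_left)
  next
    case (add_right x y y') then show ?case using c by (simp add: tensor_rel.add_right)
  next
    case (balanced d x y)
    have "tensor_rel K X Y [(d \<odot>\<^bsub>X\<^esub> (c \<odot>\<^bsub>X\<^esub> x), y)] [(c \<odot>\<^bsub>X\<^esub> x, d \<odot>\<^bsub>Y\<^esub> y)]"
      using c balanced by (intro tensor_rel.balanced) auto
    then show ?case using c balanced by (simp add: X.smult_assoc1[symmetric] m_comm)
  next
    case (zero y) then show ?case using c by (simp add: tensor_rel.zero)
  }
qed

lemma tensor_smult_tsum:
  assumes "set p \<subseteq> carrier X \<times> carrier Y" "module K X" "module K Y" "c \<in> carrier K"
  shows "c \<odot>\<^bsub>tensor K X Y\<^esub> tsum K X Y p = tsum K X Y (map (\<lambda>(x, y). (c \<odot>\<^bsub>X\<^esub> x, y)) p)"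
  using tsum_cong[OF tensor_rel_smult[OF summands_tsum[OF assms(1)] assms(2-4)]]
  by (simp add: tensor_def)

lemma tensor_zero: "\<zero>\<^bsub>tensor K X Y\<^esub> = tsum K X Y []"
  by (simp add: tensor_def)

lemma list_sum_tens:
  assumes "set p \<subseteq> carrier X \<times> carrier Y"
  shows "list_sum (tensor K X Y) (\<lambda>x y. tens K X Y x y) p = tsum K X Y p"
  using assms
proof (induction p)
  case Nil then show ?case by (simp add: tensor_zero)
next
  case (Cons xy p)
  then show ?case
    by (cases xy) (auto simp: tens_def tensor_add_tsum)
qed

lemma tens_rules:
  assumes "module K X" "module K Y"
  shows "x \<in> carrier X \<Longrightarrow> x' \<in> carrier X \<Longrightarrow> y \<in> carrier Y \<Longrightarrow>
      tens K X Y (x \<oplus>\<^bsub>X\<^esub> x') y = tens K X Y x y \<oplus>\<^bsub>tensor K X Y\<^esub> tens K X Y x' y"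
    and "x \<in> carrier X \<Longrightarrow> y \<in> carrier Y \<Longrightarrow> y' \<in> carrier Y \<Longrightarrow>
      tens K X Y x (y \<oplus>\<^bsub>Y\<^esub> y') = tens K X Y x y \<oplus>\<^bsub>tensor K X Y\<^esub> tens K X Y x y'"
    and "c \<in> carrier K \<Longrightarrow> x \<in> carrier X \<Longrightarrow> y \<in> carrier Y \<Longrightarrow>
      tens K X Y (c \<odot>\<^bsub>X\<^esub> x) y = c \<odot>\<^bsub>tensor K X Y\<^esub> tens K X Y x y"
    and "c \<in> carrier K \<Longrightarrow> x \<in> carrier X \<Longrightarrow> y \<in> carrier Y \<Longrightarrow>
      tens K X Y x (c \<odot>\<^bsub>Y\<^esub> y) = c \<odot>\<^bsub>tensor K X Y\<^esub> tens K X Y x y"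
    and "y \<in> carrier Y \<Longrightarrow> tens K X Y \<zero>\<^bsub>X\<^esub> y = \<zero>\<^bsub>tensor K X Y\<^esub>"
proof -
  show "c \<in> carrier K \<Longrightarrow> x \<in> carrier X \<Longrightarrow> y \<in> carrier Y \<Longrightarrow>
      tens K X Y (c \<odot>\<^bsub>X\<^esub> x) y = c \<odot>\<^bsub>tensor K X Y\<^esub> tens K X Y x y"
    using assms by (simp add: tens_def tensor_smult_tsum)
  thus "c \<in> carrier K \<Longrightarrow> x \<in> carrier X \<Longrightarrow> y \<in> carrier Y \<Longrightarrow>
      tens K X Y x (c \<odot>\<^bsub>Y\<^esub> y) = c \<odot>\<^bsub>tensor K X Y\<^esub> tens K X Y x y"
    using tsum_cong[OF tensor_rel.balanced[of c K x X y Y]] by (simp add: tens_def)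
qed (simp_all add: tens_def tensor_add_tsum tensor_zero tsum_cong[OF tensor_rel.add_left]
    tsum_cong[OF tensor_rel.add_right] tsum_cong[OF tensor_rel.zero])

lemma tensor_induct [consumes 1, case_names zero add]:
  assumes "u \<in> carrier (tensor K X Y)"
    and "P \<zero>\<^bsub>tensor K X Y\<^esub>"
    and "\<And>x y v. x \<in> carrier X \<Longrightarrow> y \<in> carrier Y \<Longrightarrow> v \<in> carrier (tensor K X Y) \<Longrightarrow> P v \<Longrightarrow>
        P (tens K X Y x y \<oplus>\<^bsub>tensor K X Y\<^esub> v)"
  shows "P u"
proof -
  obtain p where p: "set p \<subseteq> carrier X \<times> carrier Y" and u: "u = tsum K X Y p"
    using assms(1) by (auto simp: tensor_carrier)
  have "P (tsum K X Y p)" using p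
  proof (induction p)
    case Nil then show ?case using assms(2) by (simp add: tensor_zero)
  next
    case (Cons xy p)
    then obtain x y where [simp]: "xy = (x, y)" by (cases xy)
    show ?case using Cons assms(3)[of x y "tsum K X Y p"]
      by (auto simp: tens_def tensor_add_tsum tsum_closed)
  qed
  thus ?thesis using u by simp
qed

lemma tensor_module [simp]:
  assumes "module K X" "module K Y"
  shows "module K (tensor K X Y)"
proof -
  interpret X: module K X by fact
  interpret Y: module K Y by fact
  let ?T = "tensor K X Y"
  have elim: "\<exists>p. set p \<subseteq> carrier X \<times> carrier Y \<and> u = tsum K X Y p" if "u \<in> carrier ?T" for u
    using that by (auto simp: tensor_carrier)
  have smult_add: "c \<odot>\<^bsub>?T\<^esub> (u \<oplus>\<^bsub>?T\<^esub> v) = c \<odot>\<^bsub>?T\<^esub> u \<oplus>\<^bsub>?T\<^esub> c \<odot>\<^bsub>?T\<^esub> v"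
    if "c \<in> carrier K" "u \<in> carrier ?T" "v \<in> carrier ?T" for c u v
    using elim[OF that(2)] elim[OF that(3)] that(1) assms
    by (auto simp: tensor_add_tsum tensor_smult_tsum) (subst tensor_add_tsum, auto)
  have smult_closed: "c \<odot>\<^bsub>?T\<^esub> u \<in> carrier ?T" if "c \<in> carrier K" "u \<in> carrier ?T" for c u
    using elim[OF that(2)] that(1) assms by (fastforce simp: tensor_smult_tsum intro!: tsum_closed)
  have add_closed: "u \<oplus>\<^bsub>?T\<^esub> v \<in> carrier ?T" if "u \<in> carrier ?T" "v \<in> carrier ?T" for u v
    using elim[OF that(1)] elim[OF that(2)] by (fastforce simp: tensor_add_tsum intro!: tsum_closed)
  have zero_closed: "\<zero>\<^bsub>?T\<^esub> \<in> carrier ?T"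
    by (auto simp: tensor_zero intro: tsum_closed)
  have assoc: "(u \<oplus>\<^bsub>?T\<^esub> v) \<oplus>\<^bsub>?T\<^esub> w = u \<oplus>\<^bsub>?T\<^esub> (v \<oplus>\<^bsub>?T\<^esub> w)"
    if "u \<in> carrier ?T" "v \<in> carrier ?T" "w \<in> carrier ?T" for u v w
    using elim[OF that(1)] elim[OF that(2)] elim[OF that(3)] by (auto simp: tensor_add_tsum)
  have comm: "u \<oplus>\<^bsub>?T\<^esub> v = v \<oplus>\<^bsub>?T\<^esub> u" if "u \<in> carrier ?T" "v \<in> carrier ?T" for u v
    using elim[OF that(1)] elim[OF that(2)]
    by (auto simp: tensor_add_tsum intro!: tsum_cong[OF tensor_rel.commute])
  have l_zero: "\<zero>\<^bsub>?T\<^esub> \<oplus>\<^bsub>?T\<^esub> u = u" if "u \<in> carrier ?T" for u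
    using elim[OF that] by (auto simp: tensor_zero tensor_add_tsum)
  have interchange: "(a \<oplus>\<^bsub>?T\<^esub> b) \<oplus>\<^bsub>?T\<^esub> (c \<oplus>\<^bsub>?T\<^esub> d) = (a \<oplus>\<^bsub>?T\<^esub> c) \<oplus>\<^bsub>?T\<^esub> (b \<oplus>\<^bsub>?T\<^esub> d)"
    if "a \<in> carrier ?T" "b \<in> carrier ?T" "c \<in> carrier ?T" "d \<in> carrier ?T" for a b c d
    using that by (metis assoc comm add_closed)
  have smult_zero: "c \<odot>\<^bsub>?T\<^esub> \<zero>\<^bsub>?T\<^esub> = \<zero>\<^bsub>?T\<^esub>" if "c \<in> carrier K" for c
    using that assms by (auto simp: tensor_zero tensor_smult_tsum)
  have l_distr: "(c \<oplus>\<^bsub>K\<^esub> d) \<odot>\<^bsub>?T\<^esub> u = c \<odot>\<^bsub>?T\<^esub> u \<oplus>\<^bsub>?T\<^esub> d \<odot>\<^bsub>?T\<^esub> u"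
    if "u \<in> carrier ?T" "c \<in> carrier K" "d \<in> carrier K" for c d u
    using that(1)
  proof (induction rule: tensor_induct)
    case zero then show ?case using that by (simp add: smult_zero l_zero zero_closed)
  next
    case (add x y v)
    then show ?case using that assms
      by (simp add: smult_add tens_rules(3)[symmetric] X.smult_l_distr tens_rules(1)
          interchange smult_closed)
  qed
  have assoc1: "(c \<otimes>\<^bsub>K\<^esub> d) \<odot>\<^bsub>?T\<^esub> u = c \<odot>\<^bsub>?T\<^esub> (d \<odot>\<^bsub>?T\<^esub> u)"
    if "u \<in> carrier ?T" "c \<in> carrier K" "d \<in> carrier K" for c d u
    using that(1)
  proof (induction rule: tensor_induct)
    case zero then show ?case using that by (simp add: smult_zero)
  next
    case (add x y v)
    then show ?case using that assms
      by (simp add: smult_add tens_rules(3)[symmetric] X.smult_assoc1 smult_closed)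
  qed
  have one: "\<one>\<^bsub>K\<^esub> \<odot>\<^bsub>?T\<^esub> u = u" if "u \<in> carrier ?T" for u
    using that
  proof (induction rule: tensor_induct)
    case zero then show ?case by (simp add: smult_zero)
  next
    case (add x y v)
    then show ?case using assms
      by (simp add: smult_add tens_rules(3)[symmetric])
  qed
  \<comment> \<open>Negation is not a field of the record. Scaling by minus one provides additive
    inverses, by distributivity over scalars and 0 u = 0.\<close>
  have inv: "\<exists>v\<in>carrier ?T. v \<oplus>\<^bsub>?T\<^esub> u = \<zero>\<^bsub>?T\<^esub>" if "u \<in> carrier ?T" for u
  proof
    show "(\<ominus>\<^bsub>K\<^esub> \<one>\<^bsub>K\<^esub>) \<odot>\<^bsub>?T\<^esub> u \<in> carrier ?T" using that by (simp add: smult_closed)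
    have z: "\<zero>\<^bsub>K\<^esub> \<odot>\<^bsub>?T\<^esub> u = \<zero>\<^bsub>?T\<^esub>" using that
    proof (induction rule: tensor_induct)
      case zero then show ?case by (simp add: smult_zero)
    next
      case (add x y v)
      then show ?case using assms
        by (simp add: smult_add tens_rules(3)[symmetric] tens_rules(5) l_zero zero_closed)
    qed
    show "(\<ominus>\<^bsub>K\<^esub> \<one>\<^bsub>K\<^esub>) \<odot>\<^bsub>?T\<^esub> u \<oplus>\<^bsub>?T\<^esub> u = \<zero>\<^bsub>?T\<^esub>"
      using l_distr[OF that, of "\<ominus>\<^bsub>K\<^esub> \<one>\<^bsub>K\<^esub>" "\<one>\<^bsub>K\<^esub>"] one[OF that] z by (simp add: l_neg)
  qed
  show ?thesis
    by (intro moduleI abelian_groupI is_cring smult_closed add_closed zero_closed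
        assoc comm l_zero inv smult_add l_distr assoc1 one)
qed

lemma tens_bilin:
  assumes "module K X" "module K Y"
  shows "bilin K X Y (tensor K X Y) (tens K X Y)"
  by (intro bilinI linI) (auto simp: tens_rules assms)

lemmas tens_lin1 = bilin_lin1[OF tens_bilin]
lemmas tens_lin2 = bilin_lin2[OF tens_bilin]

end

context base_ring
begin

lemma sweedler_closed:
  assumes "u \<in> carrier (tensor K X Y)" "module K X" "module K Y" "module K W"
    and "\<And>x y. x \<in> carrier X \<Longrightarrow> y \<in> carrier Y \<Longrightarrow> f x y \<in> carrier W"
  shows "sweedler W u f \<in> carrier W"
  unfolding sweedler_list_sum using summands_carrier[OF assms(1-3)]
  by (intro list_sum_closed[OF assms(4)]) (auto intro: assms(5))

lemma sweedler_cong: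
  assumes "u \<in> carrier (tensor K X Y)" "module K X" "module K Y"
    and "\<And>x y. x \<in> carrier X \<Longrightarrow> y \<in> carrier Y \<Longrightarrow> f x y = g x y"
  shows "sweedler W u f = sweedler W u g"
  unfolding sweedler_list_sum using summands_carrier[OF assms(1-3)]
  by (intro list_sum_cong) (auto intro: assms(4))

text \<open>Both sides are finite sums over two stored lists, so this is the exchange of finite sums
  and asks only for closure of \<open>f\<close>.\<close>

lemma sweedler_swap:
  assumes "u \<in> carrier (tensor K X Y)" "module K X" "module K Y"
    and "v \<in> carrier (tensor K X' Y')" "module K X'" "module K Y'" "module K W"
    and "\<And>a b c d. a \<in> carrier X \<Longrightarrow> b \<in> carrier Y \<Longrightarrow> c \<in> carrier X' \<Longrightarrow> d \<in> carrier Y' \<Longrightarrow>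
      f a b c d \<in> carrier W"
  shows "sweedler W u (\<lambda>a b. sweedler W v (\<lambda>c d. f a b c d)) =
         sweedler W v (\<lambda>c d. sweedler W u (\<lambda>a b. f a b c d))"
  unfolding sweedler_list_sum using summands_carrier[OF assms(1-3)] summands_carrier[OF assms(4-6)]
  by (intro list_sum_swap[OF assms(7)]) (auto intro: assms(8))

text \<open>A Sweedler sum is an honest finite sum in its target, so a linear map passes through it
  whatever the shape of \<open>f\<close>.\<close>

lemma lin_sweedler:
  assumes "h \<in> linear_maps K V W" "u \<in> carrier (tensor K X Y)" "module K X" "module K Y"
    and "module K V" "module K W"
    and "\<And>x y. x \<in> carrier X \<Longrightarrow> y \<in> carrier Y \<Longrightarrow> f x y \<in> carrier V"
  shows "h (sweedler V u f) = sweedler W u (\<lambda>x y. h (f x y))"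
  unfolding sweedler_list_sum using summands_carrier[OF assms(2-4)]
  by (intro list_sum_lin[OF assms(1,5,6)]) (auto intro: assms(7))

lemma sweedler_lin_param:
  assumes "u \<in> carrier (tensor K X Y)" "module K X" "module K Y" "module K V" "module K W"
    and "\<And>x y. x \<in> carrier X \<Longrightarrow> y \<in> carrier Y \<Longrightarrow> (\<lambda>v. F v x y) \<in> linear_maps K V W"
  shows "(\<lambda>v. sweedler W u (F v)) \<in> linear_maps K V W"
proof -
  have *: "(\<lambda>v. list_sum W (F v) p) \<in> linear_maps K V W" if "set p \<subseteq> carrier X \<times> carrier Y" for p
    using that
  proof (induction p)
    case Nil then show ?case by (simp add: lin_const_zero assms)
  next
    case (Cons xy p)
    then show ?case by (cases xy) (simp add: lin_sum assms)
  qed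
  show ?thesis unfolding sweedler_list_sum by (rule *[OF summands_carrier[OF assms(1-3)]])
qed

lemma sweedler_tsum:
  assumes "module K X" "module K Y" "module K W" "bilin K X Y W f"
    and "set p \<subseteq> carrier X \<times> carrier Y"
  shows "sweedler W (tsum K X Y p) f = list_sum W f p"
  unfolding sweedler_list_sum
  using list_sum_tensor_rel[OF summands_tsum[OF assms(5)] assms(1-4)] by simp

lemma sweedler_tens:
  assumes "module K X" "module K Y" "module K W" "bilin K X Y W f" "x \<in> carrier X" "y \<in> carrier Y"
  shows "sweedler W (tens K X Y x y) f = f x y"
  using assms by (simp add: tens_def sweedler_tsum bilin_closed[OF assms(4)])

text \<open>Together with \<open>sweedler_tens\<close> this is the existence half of the universal
  property of the tensor product; \<open>lin_eq_tensor\<close> is the uniqueness half.\<close>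

lemma sweedler_linear:
  assumes "module K X" "module K Y" "module K W" "bilin K X Y W f"
  shows "(\<lambda>u. sweedler W u f) \<in> linear_maps K (tensor K X Y) W"
proof (rule linI)
  note c = bilin_closed[OF assms(4)]
  note [simp] = assms(1-3)
  have ex: "\<exists>p. set p \<subseteq> carrier X \<times> carrier Y \<and> u = tsum K X Y p" if "u \<in> carrier (tensor K X Y)" for u
    using that by (auto simp: tensor_carrier)
  fix u assume u: "u \<in> carrier (tensor K X Y)"
  then obtain p where p: "set p \<subseteq> carrier X \<times> carrier Y" "u = tsum K X Y p"
    using ex by blast
  show "sweedler W u f \<in> carrier W"
    by (rule sweedler_closed[OF u]) (auto intro: c)
  {
    fix v assume "v \<in> carrier (tensor K X Y)"
    then obtain q where q: "set q \<subseteq> carrier X \<times> carrier Y" "v = tsum K X Y q"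
      using ex by blast
    have "list_sum W f (p @ q) = list_sum W f p \<oplus>\<^bsub>W\<^esub> list_sum W f q"
      using p(1) q(1) by (intro list_sum_append[OF assms(3)]) (auto intro: c)
    thus "sweedler W (u \<oplus>\<^bsub>tensor K X Y\<^esub> v) f = sweedler W u f \<oplus>\<^bsub>W\<^esub> sweedler W v f"
      using p q by (simp add: tensor_add_tsum sweedler_tsum[OF assms])
  }
  {
    fix d assume d: "d \<in> carrier K"
    have "set (map (\<lambda>(x, y). (d \<odot>\<^bsub>X\<^esub> x, y)) p) \<subseteq> carrier X \<times> carrier Y"
      using p(1) d by fastforce
    moreover have "list_sum W f (map (\<lambda>(x, y). (d \<odot>\<^bsub>X\<^esub> x, y)) p) = d \<odot>\<^bsub>W\<^esub> list_sum W f p"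
      using p(1)
    proof (induction p)
      case Nil then show ?case using d by simp
    next
      case (Cons xy p)
      then obtain x y where [simp]: "xy = (x, y)" by (cases xy)
      have "list_sum W f p \<in> carrier W"
        using Cons.prems by (intro list_sum_closed) (auto intro: c)
      moreover have "x \<in> carrier X" "y \<in> carrier Y" using Cons.prems by auto
      ultimately show ?case using Cons d lin_smult[OF bilin_lin1[OF assms(4) lin_id]]
        by (simp add: module.smult_r_distr[OF assms(3)] c)
    qed
    ultimately show "sweedler W (d \<odot>\<^bsub>tensor K X Y\<^esub> u) f = d \<odot>\<^bsub>W\<^esub> sweedler W u f"
      using p d by (simp add: tensor_smult_tsum sweedler_tsum[OF assms])
  }
qed

lemma sweedler_eta:
  assumes "u \<in> carrier (tensor K X Y)" "module K X" "module K Y"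
  shows "sweedler (tensor K X Y) u (\<lambda>x y. tens K X Y x y) = u"
  unfolding sweedler_list_sum
  by (simp add: list_sum_tens[OF summands_carrier[OF assms]] tsum_summands[OF assms(1)])

lemma lin_eq_tensor:
  assumes "F \<in> linear_maps K (tensor K X Y) W" "G \<in> linear_maps K (tensor K X Y) W"
    and "module K X" "module K Y" "module K W"
    and "\<And>x y. x \<in> carrier X \<Longrightarrow> y \<in> carrier Y \<Longrightarrow> F (tens K X Y x y) = G (tens K X Y x y)"
    and "u \<in> carrier (tensor K X Y)"
  shows "F u = G u"
  using assms(7)
  by (induction rule: tensor_induct)
    (simp_all add: lin_zero[OF assms(1)] lin_zero[OF assms(2)] lin_add[OF assms(1)] lin_add[OF assms(2)] assms(3-6))

lemma lin_eq_tensor_left: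
  assumes F: "F \<in> linear_maps K (tensor K (tensor K X Y) Z) W" and G: "G \<in> linear_maps K (tensor K (tensor K X Y) Z) W"
    and [simp]: "module K X" "module K Y" "module K Z" "module K W"
    and "\<And>x y z. x \<in> carrier X \<Longrightarrow> y \<in> carrier Y \<Longrightarrow> z \<in> carrier Z \<Longrightarrow>
      F (tens K (tensor K X Y) Z (tens K X Y x y) z) = G (tens K (tensor K X Y) Z (tens K X Y x y) z)"
    and "u \<in> carrier (tensor K (tensor K X Y) Z)"
  shows "F u = G u"
proof (rule lin_eq_tensor[OF F G _ _ _ _ assms(8)])
  fix v z assume v: "v \<in> carrier (tensor K X Y)" and z: "z \<in> carrier Z"
  have *: "(\<lambda>v. F' (tens K (tensor K X Y) Z v z)) \<in> linear_maps K (tensor K X Y) W"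
    if "F' \<in> linear_maps K (tensor K (tensor K X Y) Z) W" for F'
    by (rule lin_comp[OF that tens_lin1[OF _ _ lin_id]]) (use z in auto)
  show "F (tens K (tensor K X Y) Z v z) = G (tens K (tensor K X Y) Z v z)"
    by (rule lin_eq_tensor[OF *[OF F] *[OF G] _ _ _ _ v]) (use z in \<open>auto intro: assms(7)\<close>)
qed auto

lemma lin_eq_tensor_right:
  assumes F: "F \<in> linear_maps K (tensor K X (tensor K Y Z)) W" and G: "G \<in> linear_maps K (tensor K X (tensor K Y Z)) W"
    and [simp]: "module K X" "module K Y" "module K Z" "module K W"
    and "\<And>x y z. x \<in> carrier X \<Longrightarrow> y \<in> carrier Y \<Longrightarrow> z \<in> carrier Z \<Longrightarrow>
      F (tens K X (tensor K Y Z) x (tens K Y Z y z)) = G (tens K X (tensor K Y Z) x (tens K Y Z y z))"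
    and "u \<in> carrier (tensor K X (tensor K Y Z))"
  shows "F u = G u"
proof (rule lin_eq_tensor[OF F G _ _ _ _ assms(8)])
  fix x v assume x: "x \<in> carrier X" and v: "v \<in> carrier (tensor K Y Z)"
  have *: "(\<lambda>v. F' (tens K X (tensor K Y Z) x v)) \<in> linear_maps K (tensor K Y Z) W"
    if "F' \<in> linear_maps K (tensor K X (tensor K Y Z)) W" for F'
    by (rule lin_comp[OF that tens_lin2[OF _ _ _ lin_id]]) (use x in auto)
  show "F (tens K X (tensor K Y Z) x v) = G (tens K X (tensor K Y Z) x v)"
    by (rule lin_eq_tensor[OF *[OF F] *[OF G] _ _ _ _ v]) (use x in \<open>auto intro: assms(7)\<close>)
qed auto

lemma lin_eq_tensor_left2:
  assumes F: "F \<in> linear_maps K (tensor K (tensor K (tensor K X Y) Z) Z') W"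
    and G: "G \<in> linear_maps K (tensor K (tensor K (tensor K X Y) Z) Z') W"
    and [simp]: "module K X" "module K Y" "module K Z" "module K Z'" "module K W"
    and "\<And>x y z z'. x \<in> carrier X \<Longrightarrow> y \<in> carrier Y \<Longrightarrow> z \<in> carrier Z \<Longrightarrow> z' \<in> carrier Z' \<Longrightarrow>
      F (tens K (tensor K (tensor K X Y) Z) Z' (tens K (tensor K X Y) Z (tens K X Y x y) z) z')
      = G (tens K (tensor K (tensor K X Y) Z) Z' (tens K (tensor K X Y) Z (tens K X Y x y) z) z')"
    and "u \<in> carrier (tensor K (tensor K (tensor K X Y) Z) Z')"
  shows "F u = G u"
proof (rule lin_eq_tensor[OF F G _ _ _ _ assms(9)])
  fix v z assume v: "v \<in> carrier (tensor K (tensor K X Y) Z)" and z: "z \<in> carrier Z'"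
  have *: "(\<lambda>v. F' (tens K (tensor K (tensor K X Y) Z) Z' v z)) \<in> linear_maps K (tensor K (tensor K X Y) Z) W"
    if "F' \<in> linear_maps K (tensor K (tensor K (tensor K X Y) Z) Z') W" for F'
    by (rule lin_comp[OF that tens_lin1[OF _ _ lin_id]]) (use z in auto)
  show "F (tens K (tensor K (tensor K X Y) Z) Z' v z) = G (tens K (tensor K (tensor K X Y) Z) Z' v z)"
    by (rule lin_eq_tensor_left[OF *[OF F] *[OF G] _ _ _ _ _ v]) (use z in \<open>auto intro: assms(8)\<close>)
qed auto

lemma tensor_map_lin:
  assumes "f \<in> linear_maps K X X'" "g \<in> linear_maps K Y Y'"
    and "module K X" "module K Y" "module K X'" "module K Y'"
  shows "tensor_map K X Y X' Y' f g \<in> linear_maps K (tensor K X Y) (tensor K X' Y')"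
proof -
  have "(\<lambda>u. sweedler (tensor K X' Y') u (\<lambda>x y. tens K X' Y' (f x) (g y)))
      \<in> linear_maps K (tensor K X Y) (tensor K X' Y')"
    by (intro sweedler_linear bilinI tens_lin1 tens_lin2 assms tensor_module) (auto intro: lin_closed assms)
  thus ?thesis using assms by (subst lin_cong) (auto simp: tensor_map_def)
qed

lemma tensor_map_tens:
  assumes "f \<in> linear_maps K X X'" "g \<in> linear_maps K Y Y'"
    and "module K X" "module K Y" "module K X'" "module K Y'" "x \<in> carrier X" "y \<in> carrier Y"
  shows "tensor_map K X Y X' Y' f g (tens K X Y x y) = tens K X' Y' (f x) (g y)"
  unfolding tensor_map_def using assms
  by (simp, intro sweedler_tens bilinI tens_lin1 tens_lin2) (auto intro: lin_closed)

definition tensor_assoc_inv :: "('k, ('k, 'a) univ, 'x) module_scheme \<Rightarrow> ('k, ('k, 'a) univ, 'y) module_scheme \<Rightarrow>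
   ('k, ('k, 'a) univ, 'z) module_scheme \<Rightarrow> ('k, 'a) univ \<Rightarrow> ('k, 'a) univ" where
  "tensor_assoc_inv X Y Z =
     (\<lambda>w\<in>carrier (tensor K X (tensor K Y Z)).
        sweedler (tensor K (tensor K X Y) Z) w (\<lambda>x v.
        sweedler (tensor K (tensor K X Y) Z) v (\<lambda>y z.
          tens K (tensor K X Y) Z (tens K X Y x y) z)))"

lemma sweedler_left:
  assumes "module K X" "module K Y" "module K Z" "module K W" "trilin K X Y Z W f"
  shows "bilin K (tensor K X Y) Z W (\<lambda>u z. sweedler W u (\<lambda>x y. f x y z))"
  by (intro bilinI sweedler_linear sweedler_lin_param[where X=X and Y=Y]
      trilin_lin1[OF assms(5) lin_id] trilin_lin2[OF assms(5) _ lin_id] trilin_lin3[OF assms(5) _ _ lin_id]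
      assms)

lemma sweedler_right:
  assumes "module K X" "module K Y" "module K Z" "module K W" "trilin K X Y Z W f"
  shows "bilin K X (tensor K Y Z) W (\<lambda>x u. sweedler W u (\<lambda>y z. f x y z))"
  by (intro bilinI sweedler_linear sweedler_lin_param[where X=Y and Y=Z]
      trilin_lin1[OF assms(5) lin_id] trilin_lin2[OF assms(5) _ lin_id] trilin_lin3[OF assms(5) _ _ lin_id]
      assms)

lemma
  assumes [simp]: "module K X" "module K Y" "module K Z"
  shows tensor_assoc_lin: "tensor_assoc K X Y Z \<in> linear_maps K (tensor K (tensor K X Y) Z) (tensor K X (tensor K Y Z))"
    and tensor_assoc_tens: "x \<in> carrier X \<Longrightarrow> y \<in> carrier Y \<Longrightarrow> z \<in> carrier Z \<Longrightarrow>
      tensor_assoc K X Y Z (tens K (tensor K X Y) Z (tens K X Y x y) z) = tens K X (tensor K Y Z) x (tens K Y Z y z)"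
    and tensor_assoc_inv_lin: "tensor_assoc_inv X Y Z \<in> linear_maps K (tensor K X (tensor K Y Z)) (tensor K (tensor K X Y) Z)"
    and tensor_assoc_inv_tens: "x \<in> carrier X \<Longrightarrow> y \<in> carrier Y \<Longrightarrow> z \<in> carrier Z \<Longrightarrow>
      tensor_assoc_inv X Y Z (tens K X (tensor K Y Z) x (tens K Y Z y z)) = tens K (tensor K X Y) Z (tens K X Y x y) z"
proof -
  let ?R = "tensor K X (tensor K Y Z)" and ?L = "tensor K (tensor K X Y) Z"
  have tr: "trilin K X Y Z ?R (\<lambda>x y z. tens K X (tensor K Y Z) x (tens K Y Z y z))"
    by (intro trilinI tens_lin1 tens_lin2 lin_id) auto
  have tl: "trilin K X Y Z ?L (\<lambda>x y z. tens K (tensor K X Y) Z (tens K X Y x y) z)"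
    by (intro trilinI tens_lin1 tens_lin2 lin_id) auto
  have br: "bilin K X Y ?R (\<lambda>x y. tens K X (tensor K Y Z) x (tens K Y Z y z))" if "z \<in> carrier Z" for z
    by (intro bilinI trilin_lin1[OF tr lin_id] trilin_lin2[OF tr _ lin_id] that)
  have bl: "bilin K Y Z ?L (\<lambda>y z. tens K (tensor K X Y) Z (tens K X Y x y) z)" if "x \<in> carrier X" for x
    by (intro bilinI trilin_lin2[OF tl _ lin_id] trilin_lin3[OF tl _ _ lin_id] that)
  show "tensor_assoc K X Y Z \<in> linear_maps K ?L ?R"
    using sweedler_linear[OF _ _ _ sweedler_left[OF _ _ _ _ tr]] unfolding tensor_assoc_def
    by (subst lin_cong) (auto)
  show "tensor_assoc_inv X Y Z \<in> linear_maps K ?R ?L"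
    using sweedler_linear[OF _ _ _ sweedler_right[OF _ _ _ _ tl]] unfolding tensor_assoc_inv_def
    by (subst lin_cong) (auto)
  assume xyz [simp]: "x \<in> carrier X" "y \<in> carrier Y" "z \<in> carrier Z"
  show "tensor_assoc K X Y Z (tens K (tensor K X Y) Z (tens K X Y x y) z) = tens K X (tensor K Y Z) x (tens K Y Z y z)"
    unfolding tensor_assoc_def by (simp add: sweedler_tens[OF _ _ _ sweedler_left[OF _ _ _ _ tr]] sweedler_tens[OF _ _ _ br])
  show "tensor_assoc_inv X Y Z (tens K X (tensor K Y Z) x (tens K Y Z y z)) = tens K (tensor K X Y) Z (tens K X Y x y) z"
    unfolding tensor_assoc_inv_def by (simp add: sweedler_tens[OF _ _ _ sweedler_right[OF _ _ _ _ tl]] sweedler_tens[OF _ _ _ bl])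
qed

end

section \<open>Records with the same module operations\<close>

text \<open>\<open>tensor\<close>, \<open>tens\<close>, \<open>linear_maps\<close> and
  \<open>sweedler\<close> read only these six fields, but records with different further fields are
  different values, often of different types. Multiplication and unit are included because
  \<open>tensor\<close> builds its own from them.\<close>

definition same_ops :: "('k, 'u, 'x) module_scheme \<Rightarrow> ('k, 'u, 'y) module_scheme \<Rightarrow> bool" where
  "same_ops X X' \<longleftrightarrow> carrier X = carrier X' \<and> monoid.mult X = monoid.mult X' \<and> one X = one X' \<and>
     zero X = zero X' \<and> add X = add X' \<and> smult X = smult X'"

lemma same_ops_sym: "same_ops X X' \<Longrightarrow> same_ops X' X"
  by (simp add: same_ops_def)

lemma same_ops_tensor_rel_imp:
  assumes "tensor_rel K X Y p q" "same_ops X X'" "same_ops Y Y'"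
  shows "tensor_rel K X' Y' p q"
  using assms(1)
proof induction
  note [simp] = assms(2,3)[unfolded same_ops_def]
  {
    case (refl p) then show ?case by (intro tensor_rel.refl) simp
  next
    case (sym p q) show ?case by (rule tensor_rel.sym[OF sym.IH])
  next
    case (trans p q r) show ?case by (rule tensor_rel.trans[OF trans.IH])
  next
    case (append p p' q q') show ?case by (rule tensor_rel.append[OF append.IH])
  next
    case (commute p q) then show ?case by (intro tensor_rel.commute) simp_all
  next
    case (add_left x x' y) then show ?case using tensor_rel.add_left[of x X' x' y Y' K] by simp
  next
    case (add_right x y y') then show ?case using tensor_rel.add_right[of x X' y Y' y' K] by simp
  next
    case (balanced c x y) then show ?case using tensor_rel.balanced[of c K x X' y Y'] by simp
  next
    case (zero y) then show ?case using tensor_rel.zero[of y Y' K X'] by simp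
  }
qed

lemma same_ops_tensor_rel:
  assumes "same_ops X X'" "same_ops Y Y'"
  shows "tensor_rel K X Y = tensor_rel K X' Y'"
  using same_ops_tensor_rel_imp[OF _ assms] same_ops_tensor_rel_imp[OF _ assms[THEN same_ops_sym]]
  by (intro ext) blast

text \<open>Equal relations give equal choices by \<open>SOME\<close>, so the two tensor products
  coincide literally and not just up to isomorphism.\<close>

lemma
  assumes X: "same_ops X X'" and Y: "same_ops Y Y'"
  shows same_ops_tensor: "tensor K X Y = tensor K X' Y'"
    and same_ops_tens: "tens K X Y = tens K X' Y'"
proof -
  have t: "tsum K X Y = tsum K X' Y'"
    by (intro ext) (simp add: tsum_def same_ops_tensor_rel[OF assms])
  show tens: "tens K X Y = tens K X' Y'"
    by (intro ext) (simp add: tens_def t)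
  show "tensor K X Y = tensor K X' Y'"
    using assms by (simp add: tensor_def t tens same_ops_def)
qed

lemma same_ops_simps:
  assumes "same_ops X X'"
  shows "tensor K X Y = tensor K X' Y" "tensor K Y X = tensor K Y X'"
    "tens K X Y = tens K X' Y" "tens K Y X = tens K Y X'"
    "linear_maps K X W = linear_maps K X' W" "linear_maps K W X = linear_maps K W X'"
    "sweedler X = sweedler X'"
  using assms same_ops_tensor[OF assms, of Y Y K] same_ops_tensor[OF _ assms, of Y Y K]
    same_ops_tens[OF assms, of Y Y K] same_ops_tens[OF _ assms, of Y Y K]
  by (auto simp: same_ops_def linear_maps_def sweedler_def fun_eq_iff)

lemma same_ops_module:
  assumes "same_ops X X'" "module K X'"
  shows "module K X"
proof -
  interpret module K X' by fact
  note [simp] = assms(1)[unfolded same_ops_def]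
  show ?thesis
    by (intro moduleI abelian_groupI is_cring)
      (auto simp: smult_l_distr smult_r_distr smult_assoc1 a_ac intro!: bexI[of _ "\<ominus>\<^bsub>X'\<^esub> _"] l_neg)
qed

lemma same_ops_tensor_lmod: "same_ops (tensor_lmod K d X Y) (tensor K X Y)"
  by (simp add: same_ops_def tensor_lmod_def module.defs)

lemma tensor_map_eq:
  assumes "tensor K X Y = tensor K U V" "tensor K X' Y' = tensor K U' V'" "tens K X' Y' = tens K U' V'"
  shows "tensor_map K X Y X' Y' f g = tensor_map K U V U' V' f g"
  using assms by (simp add: tensor_map_def)

text \<open>With these rules the simplifier forgets the action on a tensor product wherever only the
  vector space matters. The chains of projections pick carrier, zero, addition and scalar
  multiplication out of \<open>same_ops\<close>.\<close>

lemmas lmod_simps [simp] =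
  same_ops_tensor_lmod[unfolded same_ops_def, THEN conjunct1]
  same_ops_tensor_lmod[unfolded same_ops_def, THEN conjunct2, THEN conjunct2, THEN conjunct2, THEN conjunct1]
  same_ops_tensor_lmod[unfolded same_ops_def, THEN conjunct2, THEN conjunct2, THEN conjunct2, THEN conjunct2, THEN conjunct1]
  same_ops_tensor_lmod[unfolded same_ops_def, THEN conjunct2, THEN conjunct2, THEN conjunct2, THEN conjunct2, THEN conjunct2]
  same_ops_simps[OF same_ops_tensor_lmod]

lemma lmod_map_simps [simp]:
  "tensor_map K (tensor_lmod K d X Y) Z X' Y' f g = tensor_map K (tensor K X Y) Z X' Y' f g"
  "tensor_map K Z (tensor_lmod K d X Y) X' Y' f g = tensor_map K Z (tensor K X Y) X' Y' f g"
  "tensor_map K X' Y' (tensor_lmod K d X Y) Z f g = tensor_map K X' Y' (tensor K X Y) Z f g"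
  "tensor_map K X' Y' Z (tensor_lmod K d X Y) f g = tensor_map K X' Y' Z (tensor K X Y) f g"
  "tensor_assoc K (tensor_lmod K d X Y) Z Z' = tensor_assoc K (tensor K X Y) Z Z'"
  "tensor_assoc K Z (tensor_lmod K d X Y) Z' = tensor_assoc K Z (tensor K X Y) Z'"
  "tensor_assoc K Z Z' (tensor_lmod K d X Y) = tensor_assoc K Z Z' (tensor K X Y)"
  by (simp_all add: tensor_map_def tensor_assoc_def)

lemma tensor_lmod_act:
  "act (tensor_lmod K d Y M) a u = sweedler (tensor K Y M) (d a) (\<lambda>h b.
     sweedler (tensor K Y M) u (\<lambda>y m. tens K Y M (act Y h y) (act M b m)))"
  by (simp add: tensor_lmod_def module.defs)

section \<open>Algebras, their modules, and products in a tensor product of algebras\<close>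

context base_ring
begin

lemma module_tensor_lmod [simp]: "module K X \<Longrightarrow> module K Y \<Longrightarrow> module K (tensor_lmod K d X Y)"
  by (rule same_ops_module[OF same_ops_tensor_lmod]) simp

lemma
  assumes "assoc_algebra K A"
  shows algebra_module: "module K A"
    and algebra_mult_closed: "a \<in> carrier A \<Longrightarrow> b \<in> carrier A \<Longrightarrow> a \<otimes>\<^bsub>A\<^esub> b \<in> carrier A"
    and algebra_one_closed: "\<one>\<^bsub>A\<^esub> \<in> carrier A"
    and algebra_assoc: "a \<in> carrier A \<Longrightarrow> b \<in> carrier A \<Longrightarrow> d \<in> carrier A \<Longrightarrow>
      (a \<otimes>\<^bsub>A\<^esub> b) \<otimes>\<^bsub>A\<^esub> d = a \<otimes>\<^bsub>A\<^esub> (b \<otimes>\<^bsub>A\<^esub> d)"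
    and algebra_l_one: "a \<in> carrier A \<Longrightarrow> \<one>\<^bsub>A\<^esub> \<otimes>\<^bsub>A\<^esub> a = a"
    and algebra_r_one: "a \<in> carrier A \<Longrightarrow> a \<otimes>\<^bsub>A\<^esub> \<one>\<^bsub>A\<^esub> = a"
    and algebra_smult: "c \<in> carrier K \<Longrightarrow> a \<in> carrier A \<Longrightarrow> b \<in> carrier A \<Longrightarrow>
      (c \<odot>\<^bsub>A\<^esub> a) \<otimes>\<^bsub>A\<^esub> b = c \<odot>\<^bsub>A\<^esub> (a \<otimes>\<^bsub>A\<^esub> b)"
      "c \<in> carrier K \<Longrightarrow> a \<in> carrier A \<Longrightarrow> b \<in> carrier A \<Longrightarrow>
      a \<otimes>\<^bsub>A\<^esub> (c \<odot>\<^bsub>A\<^esub> b) = c \<odot>\<^bsub>A\<^esub> (a \<otimes>\<^bsub>A\<^esub> b)"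
    and algebra_lin1: "g \<in> linear_maps K V A \<Longrightarrow> b \<in> carrier A \<Longrightarrow> (\<lambda>x. g x \<otimes>\<^bsub>A\<^esub> b) \<in> linear_maps K V A"
    and algebra_lin2: "a \<in> carrier A \<Longrightarrow> g \<in> linear_maps K V A \<Longrightarrow> (\<lambda>x. a \<otimes>\<^bsub>A\<^esub> g x) \<in> linear_maps K V A"
proof -
  interpret A: ring A using assms by (simp add: assoc_algebra_def)
  have s: "c \<in> carrier K \<Longrightarrow> a \<in> carrier A \<Longrightarrow> b \<in> carrier A \<Longrightarrow>
      (c \<odot>\<^bsub>A\<^esub> a) \<otimes>\<^bsub>A\<^esub> b = c \<odot>\<^bsub>A\<^esub> (a \<otimes>\<^bsub>A\<^esub> b)"
      "c \<in> carrier K \<Longrightarrow> a \<in> carrier A \<Longrightarrow> b \<in> carrier A \<Longrightarrow>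
      a \<otimes>\<^bsub>A\<^esub> (c \<odot>\<^bsub>A\<^esub> b) = c \<odot>\<^bsub>A\<^esub> (a \<otimes>\<^bsub>A\<^esub> b)" for c a b
    using assms by (simp_all add: assoc_algebra_def)
  show "module K A" using assms by (simp add: assoc_algebra_def)
  show "a \<in> carrier A \<Longrightarrow> b \<in> carrier A \<Longrightarrow> a \<otimes>\<^bsub>A\<^esub> b \<in> carrier A"
    "\<one>\<^bsub>A\<^esub> \<in> carrier A"
    "a \<in> carrier A \<Longrightarrow> b \<in> carrier A \<Longrightarrow> d \<in> carrier A \<Longrightarrow>
      (a \<otimes>\<^bsub>A\<^esub> b) \<otimes>\<^bsub>A\<^esub> d = a \<otimes>\<^bsub>A\<^esub> (b \<otimes>\<^bsub>A\<^esub> d)"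
    "a \<in> carrier A \<Longrightarrow> \<one>\<^bsub>A\<^esub> \<otimes>\<^bsub>A\<^esub> a = a"
    "a \<in> carrier A \<Longrightarrow> a \<otimes>\<^bsub>A\<^esub> \<one>\<^bsub>A\<^esub> = a"
    by (simp_all add: A.m_assoc)
  show "c \<in> carrier K \<Longrightarrow> a \<in> carrier A \<Longrightarrow> b \<in> carrier A \<Longrightarrow>
      (c \<odot>\<^bsub>A\<^esub> a) \<otimes>\<^bsub>A\<^esub> b = c \<odot>\<^bsub>A\<^esub> (a \<otimes>\<^bsub>A\<^esub> b)"
      "c \<in> carrier K \<Longrightarrow> a \<in> carrier A \<Longrightarrow> b \<in> carrier A \<Longrightarrow>
      a \<otimes>\<^bsub>A\<^esub> (c \<odot>\<^bsub>A\<^esub> b) = c \<odot>\<^bsub>A\<^esub> (a \<otimes>\<^bsub>A\<^esub> b)" by (simp_all add: s)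
  show "(\<lambda>x. g x \<otimes>\<^bsub>A\<^esub> b) \<in> linear_maps K V A" if "g \<in> linear_maps K V A" "b \<in> carrier A"
    using that by (intro linI) (simp_all add: lin_closed[OF that(1)] lin_add[OF that(1)] lin_smult[OF that(1)] A.l_distr s)
  show "(\<lambda>x. a \<otimes>\<^bsub>A\<^esub> g x) \<in> linear_maps K V A" if "a \<in> carrier A" "g \<in> linear_maps K V A"
    using that by (intro linI) (simp_all add: lin_closed[OF that(2)] lin_add[OF that(2)] lin_smult[OF that(2)] A.r_distr s)
qed

lemma
  assumes "left_module K A M"
  shows lmod_module: "module K M"
    and lmod_act_closed: "a \<in> carrier A \<Longrightarrow> m \<in> carrier M \<Longrightarrow> act M a m \<in> carrier M"
    and lmod_act_one: "m \<in> carrier M \<Longrightarrow> act M \<one>\<^bsub>A\<^esub> m = m"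
    and lmod_act_mult: "a \<in> carrier A \<Longrightarrow> b \<in> carrier A \<Longrightarrow> m \<in> carrier M \<Longrightarrow>
      act M (a \<otimes>\<^bsub>A\<^esub> b) m = act M a (act M b m)"
    and lmod_lin1: "g \<in> linear_maps K V A \<Longrightarrow> m \<in> carrier M \<Longrightarrow> (\<lambda>x. act M (g x) m) \<in> linear_maps K V M"
    and lmod_lin2: "a \<in> carrier A \<Longrightarrow> h \<in> linear_maps K V M \<Longrightarrow> (\<lambda>x. act M a (h x)) \<in> linear_maps K V M"
  using assms lin_comp[where F="\<lambda>a. act M a m" and V=V and V'=A and W=M and g=g]
    lin_comp[where F="\<lambda>m. act M a m" and V=V and V'=M and W=M and g=h] lin_closed[of "act M a" M M]
  by (auto simp: left_module_def)

lemma list_sum_product: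
  assumes "module K W"
    and "\<And>x y x' y'. (x, y) \<in> set p \<Longrightarrow> (x', y') \<in> set q \<Longrightarrow> f (x \<otimes>\<^bsub>X\<^esub> x') (y \<otimes>\<^bsub>Y\<^esub> y') \<in> carrier W"
  shows "list_sum W f (map (\<lambda>((x, y), (x', y')). (x \<otimes>\<^bsub>X\<^esub> x', y \<otimes>\<^bsub>Y\<^esub> y')) (List.product p q))
    = list_sum W (\<lambda>x y. list_sum W (\<lambda>x' y'. f (x \<otimes>\<^bsub>X\<^esub> x') (y \<otimes>\<^bsub>Y\<^esub> y')) q) p"
  using assms(2)
proof (induction p)
  case Nil then show ?case by simp
next
  case (Cons xy p)
  obtain x y where [simp]: "xy = (x, y)" by (cases xy)
  have *: "list_sum W f (map ((\<lambda>((x, y), x', y'). (x \<otimes>\<^bsub>X\<^esub> x', y \<otimes>\<^bsub>Y\<^esub> y')) \<circ> Pair (x, y)) q')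
      = list_sum W (\<lambda>x' y'. f (x \<otimes>\<^bsub>X\<^esub> x') (y \<otimes>\<^bsub>Y\<^esub> y')) q'" for q'
    by (induction q') auto
  have "set (List.product p q) = set p \<times> set q" by simp
  thus ?case using Cons
    by (simp, subst list_sum_append[OF assms(1)]) (auto simp: *)
qed

context
  fixes X :: "('k, ('k, 'a) univ, 'x) module_scheme" and Y :: "('k, ('k, 'a) univ, 'y) module_scheme"
  assumes X [simp]: "module K X" and Y [simp]: "module K Y"
    and Xm: "\<And>a b. a \<in> carrier X \<Longrightarrow> b \<in> carrier X \<Longrightarrow> a \<otimes>\<^bsub>X\<^esub> b \<in> carrier X"
    and Ym: "\<And>a b. a \<in> carrier Y \<Longrightarrow> b \<in> carrier Y \<Longrightarrow> a \<otimes>\<^bsub>Y\<^esub> b \<in> carrier Y"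
begin

lemma tensor_mult_closed:
  assumes "u \<in> carrier (tensor K X Y)" "v \<in> carrier (tensor K X Y)"
  shows "u \<otimes>\<^bsub>tensor K X Y\<^esub> v \<in> carrier (tensor K X Y)"
  unfolding tensor_def
  using summands_carrier[OF assms(1) X Y] summands_carrier[OF assms(2) X Y]
  by (fastforce intro!: imageI Xm Ym)

text \<open>A product of two tensors is formed from the list of all pairs of summands, so a sum over
  it is a double sum. Products such as \<open>R13\<close> times \<open>R23\<close> are taken apart
  in this way.\<close>

lemma sweedler_tensor_mult:
  assumes "u \<in> carrier (tensor K X Y)" "v \<in> carrier (tensor K X Y)" "bilin K X Y W f" "module K W"
  shows "sweedler W (u \<otimes>\<^bsub>tensor K X Y\<^esub> v) f
    = sweedler W u (\<lambda>x y. sweedler W v (\<lambda>x' y'. f (x \<otimes>\<^bsub>X\<^esub> x') (y \<otimes>\<^bsub>Y\<^esub> y')))"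
proof -
  note s = summands_carrier[OF assms(1) X Y] summands_carrier[OF assms(2) X Y]
  let ?l = "map (\<lambda>((x, y), (x', y')). (x \<otimes>\<^bsub>X\<^esub> x', y \<otimes>\<^bsub>Y\<^esub> y')) (List.product (summands u) (summands v))"
  have l: "set ?l \<subseteq> carrier X \<times> carrier Y"
    using s by (fastforce intro!: Xm Ym)
  have "sweedler W (u \<otimes>\<^bsub>tensor K X Y\<^esub> v) f = list_sum W f ?l"
    using sweedler_tsum[OF X Y assms(4,3) l] by (simp add: tensor_def)
  also have "\<dots> = sweedler W u (\<lambda>x y. sweedler W v (\<lambda>x' y'. f (x \<otimes>\<^bsub>X\<^esub> x') (y \<otimes>\<^bsub>Y\<^esub> y')))"
    unfolding sweedler_list_sum using s
    by (intro list_sum_product[OF assms(4)]) (auto intro!: bilin_closed[OF assms(3)] Xm Ym)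
  finally show ?thesis .
qed

end

lemma algebra_mult_bilin: "assoc_algebra K A \<Longrightarrow> bilin K A A A (\<lambda>a b. a \<otimes>\<^bsub>A\<^esub> b)"
  by (intro bilinI algebra_lin1 algebra_lin2 lin_id)

lemma tensor_mult_lin:
  assumes X: "assoc_algebra K X" and Y: "assoc_algebra K Y" and "module K U"
  shows "g \<in> linear_maps K U (tensor K X Y) \<Longrightarrow> q \<in> carrier (tensor K X Y) \<Longrightarrow>
      (\<lambda>v. g v \<otimes>\<^bsub>tensor K X Y\<^esub> q) \<in> linear_maps K U (tensor K X Y)"
    and "p \<in> carrier (tensor K X Y) \<Longrightarrow> g \<in> linear_maps K U (tensor K X Y) \<Longrightarrow>
      (\<lambda>v. p \<otimes>\<^bsub>tensor K X Y\<^esub> g v) \<in> linear_maps K U (tensor K X Y)"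
proof -
  note [simp] = algebra_module[OF X] algebra_module[OF Y] algebra_mult_closed[OF X] algebra_mult_closed[OF Y] assms(3)
  note [intro] = algebra_lin1[OF X] algebra_lin2[OF X] algebra_lin1[OF Y] algebra_lin2[OF Y] lin_id
  let ?T = "tensor K X Y"
  have eq: "u \<otimes>\<^bsub>?T\<^esub> v = sweedler ?T u (\<lambda>x y. sweedler ?T v (\<lambda>x' y'. tens K X Y (x \<otimes>\<^bsub>X\<^esub> x') (y \<otimes>\<^bsub>Y\<^esub> y')))"
    if "u \<in> carrier ?T" "v \<in> carrier ?T" for u v
    using sweedler_eta[OF tensor_mult_closed[OF _ _ _ _ that]]
      sweedler_tensor_mult[OF _ _ _ _ that tens_bilin] by simp
  show "(\<lambda>v. g v \<otimes>\<^bsub>?T\<^esub> q) \<in> linear_maps K U ?T"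
    if g: "g \<in> linear_maps K U ?T" and q: "q \<in> carrier ?T"
  proof -
    have "(\<lambda>v. sweedler ?T (g v) (\<lambda>x y. sweedler ?T q (\<lambda>x' y'. tens K X Y (x \<otimes>\<^bsub>X\<^esub> x') (y \<otimes>\<^bsub>Y\<^esub> y')))) \<in> linear_maps K U ?T"
      by (rule lin_comp[OF sweedler_linear g])
        (use q in \<open>auto intro!: bilinI sweedler_lin_param[where X=X and Y=Y] tens_lin1 tens_lin2\<close>)
    thus ?thesis by (subst lin_cong) (auto simp: eq q lin_closed[OF g])
  qed
  show "(\<lambda>v. p \<otimes>\<^bsub>?T\<^esub> g v) \<in> linear_maps K U ?T"
    if p: "p \<in> carrier ?T" and g: "g \<in> linear_maps K U ?T"
  proof -
    have "(\<lambda>v. sweedler ?T p (\<lambda>x y. sweedler ?T (g v) (\<lambda>x' y'. tens K X Y (x \<otimes>\<^bsub>X\<^esub> x') (y \<otimes>\<^bsub>Y\<^esub> y')))) \<in> linear_maps K U ?T"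
      by (rule sweedler_lin_param[OF p], simp_all, rule lin_comp[OF sweedler_linear g])
        (auto intro!: bilinI tens_lin1 tens_lin2)
    thus ?thesis by (subst lin_cong) (auto simp: eq p lin_closed[OF g])
  qed
qed

lemma tensor_mult_tens:
  assumes X: "assoc_algebra K X" and Y: "assoc_algebra K Y"
    and xy [simp]: "x \<in> carrier X" "y \<in> carrier Y" "x' \<in> carrier X" "y' \<in> carrier Y"
  shows "tens K X Y x y \<otimes>\<^bsub>tensor K X Y\<^esub> tens K X Y x' y' = tens K X Y (x \<otimes>\<^bsub>X\<^esub> x') (y \<otimes>\<^bsub>Y\<^esub> y')"
proof -
  note [simp] = algebra_module[OF X] algebra_module[OF Y] algebra_mult_closed[OF X] algebra_mult_closed[OF Y]
  note [intro] = algebra_lin1[OF X] algebra_lin2[OF X] algebra_lin1[OF Y] algebra_lin2[OF Y] lin_id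
  let ?u = "tens K X Y x y" and ?v = "tens K X Y x' y'"
  have "?u \<otimes>\<^bsub>tensor K X Y\<^esub> ?v = sweedler (tensor K X Y) (?u \<otimes>\<^bsub>tensor K X Y\<^esub> ?v) (tens K X Y)"
    by (rule sweedler_eta[symmetric]) (auto intro: tensor_mult_closed)
  also have "\<dots> = sweedler (tensor K X Y) ?u (\<lambda>x y. sweedler (tensor K X Y) ?v (\<lambda>x' y'. tens K X Y (x \<otimes>\<^bsub>X\<^esub> x') (y \<otimes>\<^bsub>Y\<^esub> y')))"
    by (rule sweedler_tensor_mult) (auto intro: tens_bilin)
  also have "\<dots> = sweedler (tensor K X Y) ?v (\<lambda>x' y'. tens K X Y (x \<otimes>\<^bsub>X\<^esub> x') (y \<otimes>\<^bsub>Y\<^esub> y'))"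
    by (rule sweedler_tens) (auto intro!: bilinI sweedler_lin_param[where X=X and Y=Y] tens_lin1 tens_lin2)
  also have "\<dots> = tens K X Y (x \<otimes>\<^bsub>X\<^esub> x') (y \<otimes>\<^bsub>Y\<^esub> y')"
    by (rule sweedler_tens) (auto intro!: bilinI tens_lin1 tens_lin2)
  finally show ?thesis .
qed

lemma sweedler_sweedler_tens:
  assumes "u \<in> carrier (tensor K X Y)" "module K X" "module K Y" "module K X'" "module K Y'" "module K W"
    and "bilin K X' Y' W G"
    and "\<And>a b. a \<in> carrier X \<Longrightarrow> b \<in> carrier Y \<Longrightarrow> p a b \<in> carrier X'"
    and "\<And>a b. a \<in> carrier X \<Longrightarrow> b \<in> carrier Y \<Longrightarrow> q a b \<in> carrier Y'"
  shows "sweedler W (sweedler (tensor K X' Y') u (\<lambda>a b. tens K X' Y' (p a b) (q a b))) G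
    = sweedler W u (\<lambda>a b. G (p a b) (q a b))"
proof -
  have "sweedler W (sweedler (tensor K X' Y') u (\<lambda>a b. tens K X' Y' (p a b) (q a b))) G
    = sweedler W u (\<lambda>a b. sweedler W (tens K X' Y' (p a b) (q a b)) G)"
    using assms by (intro lin_sweedler[OF sweedler_linear, where X1=X' and Y1=Y' and X=X and Y=Y]) auto
  also have "\<dots> = sweedler W u (\<lambda>a b. G (p a b) (q a b))"
    using assms by (intro sweedler_cong[OF assms(1-3)] sweedler_tens) auto
  finally show ?thesis .
qed

text \<open>Coassociativity is defined as one equation in a triple tensor product. Applying the
  linear map induced by the trilinear \<open>f\<close> gives the instances that Sweedler
  computations use.\<close>

lemma comodule_assoc:
  assumes "left_comodule K C M \<phi>" "comult C \<in> carrier C \<rightarrow> carrier (tensor K C C)" "module K C" "module K W"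
    "m \<in> carrier M" "trilin K C C M W f"
  shows "sweedler W (\<phi> m) (\<lambda>c n. sweedler W (comult C c) (\<lambda>a b. f a b n)) =
    sweedler W (\<phi> m) (\<lambda>c n. sweedler W (\<phi> n) (\<lambda>d n'. f c d n'))"
proof -
  have [simp]: "module K M" "module K C" "module K W" "m \<in> carrier M"
    and \<phi>: "\<phi> \<in> linear_maps K M (tensor K C M)"
    using assms by (auto simp: left_comodule_def)
  let ?T = "tensor K (tensor K C C) M"
  let ?f = "\<lambda>u n. sweedler W u (\<lambda>a b. f a b n)"
  have [simp]: "n \<in> carrier M \<Longrightarrow> \<phi> n \<in> carrier (tensor K C M)"
    "c \<in> carrier C \<Longrightarrow> comult C c \<in> carrier (tensor K C C)" for n c
    using assms(2) by (auto intro: lin_closed[OF \<phi>])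
  note b = sweedler_left[OF _ _ _ _ assms(6), simplified]
  note t = sweedler_linear[OF _ _ _ b, simplified]
  have bf: "bilin K C C W (\<lambda>a b. f a b n)" if "n \<in> carrier M" for n
    using that by (intro bilinI trilin_lin1[OF assms(6) lin_id] trilin_lin2[OF assms(6) _ lin_id])
  have "sweedler W (sweedler ?T (\<phi> m) (\<lambda>c n. tens K (tensor K C C) M (comult C c) n)) ?f
      = sweedler W (sweedler ?T (\<phi> m) (\<lambda>c n. sweedler ?T (\<phi> n) (\<lambda>d n'. tens K (tensor K C C) M (tens K C C c d) n'))) ?f"
    using assms(1,5) by (simp add: left_comodule_def)
  moreover have "sweedler W (sweedler ?T (\<phi> m) (\<lambda>c n. tens K (tensor K C C) M (comult C c) n)) ?f
      = sweedler W (\<phi> m) (\<lambda>c n. sweedler W (tens K (tensor K C C) M (comult C c) n) ?f)"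
    by (rule lin_sweedler[OF t, of _ C M]) auto
  moreover have "\<dots> = sweedler W (\<phi> m) (\<lambda>c n. sweedler W (comult C c) (\<lambda>a b. f a b n))"
    by (rule sweedler_cong[of _ C M]) (auto simp: sweedler_tens[OF _ _ _ b])
  moreover have "sweedler W (sweedler ?T (\<phi> m) (\<lambda>c n. sweedler ?T (\<phi> n) (\<lambda>d n'. tens K (tensor K C C) M (tens K C C c d) n'))) ?f
      = sweedler W (\<phi> m) (\<lambda>c n. sweedler W (sweedler ?T (\<phi> n) (\<lambda>d n'. tens K (tensor K C C) M (tens K C C c d) n')) ?f)"
    by (rule lin_sweedler[OF t, of _ C M]) (auto intro!: sweedler_closed[of _ C M])
  moreover have "\<dots> = sweedler W (\<phi> m) (\<lambda>c n. sweedler W (\<phi> n) (\<lambda>d n'. sweedler W (tens K (tensor K C C) M (tens K C C c d) n') ?f))"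
    by (rule sweedler_cong[of _ C M], simp_all, rule lin_sweedler[OF t, of _ C M]) auto
  moreover have "\<dots> = sweedler W (\<phi> m) (\<lambda>c n. sweedler W (\<phi> n) (\<lambda>d n'. f c d n'))"
    by (rule sweedler_cong[of _ C M], simp_all, rule sweedler_cong[of _ C M])
      (auto simp: sweedler_tens[OF _ _ _ b] sweedler_tens[OF _ _ _ bf])
  ultimately show ?thesis by simp
qed

end

text \<open>Every Sweedler step carries the side condition that some expression is linear, bilinear
  or trilinear. These rules prove such conditions by recursion over the expression.\<close>

named_theorems lin_intros

section \<open>Comodule algebras over a bialgebra and the modules Y \<otimes> M\<close>

text \<open>The coaction is a parameter and not a record field, so that the locale can also be
  entered with \<open>H\<close> itself, coacting by its comultiplication.\<close>

locale comodule_algebra = base_ring K for K :: "('k, 'r) ring_scheme" +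
  fixes H :: "('k, 'a, 'x) coalg_scheme" and A :: "('k, ('k, 'a) univ, 'y) module_scheme"
    and \<delta> :: "('k, 'a) univ \<Rightarrow> ('k, 'a) univ"
  assumes H_algebra: "assoc_algebra K H" and H_coalgebra: "coalgebra K H"
    and comult_hom: "comult H \<in> ring_hom H (tensor K H H)"
    and counit_hom: "counit H \<in> ring_hom H K"
    and A_algebra: "assoc_algebra K A" and A_comodule: "left_comodule K H A \<delta>"
    and coact_hom: "\<delta> \<in> ring_hom A (tensor K H A)"
begin

lemmas [simp] = algebra_module[OF H_algebra] algebra_module[OF A_algebra]
  algebra_mult_closed[OF H_algebra] algebra_mult_closed[OF A_algebra]
  algebra_one_closed[OF H_algebra] algebra_one_closed[OF A_algebra]
  algebra_l_one[OF H_algebra] algebra_l_one[OF A_algebra]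
  algebra_r_one[OF H_algebra] algebra_r_one[OF A_algebra]
  lmod_module

lemmas [lin_intros] = lin_id tens_lin1 tens_lin2 bilinI trilinI
  algebra_lin1[OF H_algebra] algebra_lin1[OF A_algebra]
  algebra_lin2[OF H_algebra] algebra_lin2[OF A_algebra]

lemma H_act_lin [lin_intros]:
  "left_module K H X \<Longrightarrow> g \<in> linear_maps K V H \<Longrightarrow> x \<in> carrier X \<Longrightarrow> (\<lambda>v. act X (g v) x) \<in> linear_maps K V X"
  "left_module K H X \<Longrightarrow> h \<in> carrier H \<Longrightarrow> f \<in> linear_maps K V X \<Longrightarrow> (\<lambda>v. act X h (f v)) \<in> linear_maps K V X"
  by (rule lmod_lin1 lmod_lin2; assumption)+

lemma A_act_lin [lin_intros]:
  "left_module K A M \<Longrightarrow> g \<in> linear_maps K V A \<Longrightarrow> m \<in> carrier M \<Longrightarrow> (\<lambda>v. act M (g v) m) \<in> linear_maps K V M"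
  "left_module K A M \<Longrightarrow> a \<in> carrier A \<Longrightarrow> f \<in> linear_maps K V M \<Longrightarrow> (\<lambda>v. act M a (f v)) \<in> linear_maps K V M"
  by (rule lmod_lin1 lmod_lin2; assumption)+

lemma H_act [simp]:
  "left_module K H X \<Longrightarrow> module K X"
  "left_module K H X \<Longrightarrow> h \<in> carrier H \<Longrightarrow> x \<in> carrier X \<Longrightarrow> act X h x \<in> carrier X"
  "left_module K H X \<Longrightarrow> x \<in> carrier X \<Longrightarrow> act X \<one>\<^bsub>H\<^esub> x = x"
  "left_module K H X \<Longrightarrow> h \<in> carrier H \<Longrightarrow> h' \<in> carrier H \<Longrightarrow> x \<in> carrier X \<Longrightarrow>
    act X (h \<otimes>\<^bsub>H\<^esub> h') x = act X h (act X h' x)"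
  by (simp_all add: lmod_module lmod_act_closed lmod_act_one lmod_act_mult)

lemma A_act [simp]:
  "left_module K A M \<Longrightarrow> module K M"
  "left_module K A M \<Longrightarrow> a \<in> carrier A \<Longrightarrow> m \<in> carrier M \<Longrightarrow> act M a m \<in> carrier M"
  "left_module K A M \<Longrightarrow> m \<in> carrier M \<Longrightarrow> act M \<one>\<^bsub>A\<^esub> m = m"
  "left_module K A M \<Longrightarrow> a \<in> carrier A \<Longrightarrow> b \<in> carrier A \<Longrightarrow> m \<in> carrier M \<Longrightarrow>
    act M (a \<otimes>\<^bsub>A\<^esub> b) m = act M a (act M b m)"
  by (simp_all add: lmod_module lmod_act_closed lmod_act_one lmod_act_mult)

lemma comult_lin: "comult H \<in> linear_maps K H (tensor K H H)"
  and coact_lin: "\<delta> \<in> linear_maps K A (tensor K H A)"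
  using H_coalgebra A_comodule by (auto simp: coalgebra_def left_comodule_def)

lemma counit_closed [simp]: "h \<in> carrier H \<Longrightarrow> counit H h \<in> carrier K"
  and counit_one [simp]: "counit H \<one>\<^bsub>H\<^esub> = \<one>\<^bsub>K\<^esub>"
  and counit_mult [simp]: "h \<in> carrier H \<Longrightarrow> h' \<in> carrier H \<Longrightarrow>
    counit H (h \<otimes>\<^bsub>H\<^esub> h') = counit H h \<otimes>\<^bsub>K\<^esub> counit H h'"
  using counit_hom by (auto simp: ring_hom_def)

lemma counit_lin [lin_intros]:
  assumes "g \<in> linear_maps K V H" "w \<in> carrier W" "module K W"
  shows "(\<lambda>v. counit H (g v) \<odot>\<^bsub>W\<^esub> w) \<in> linear_maps K V W"
  using assms H_coalgebra lin_closed[OF assms(1)] module.smult_l_distr[OF assms(3)] module.smult_assoc1[OF assms(3)]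
  by (intro linI) (auto simp: lin_add[OF assms(1)] lin_smult[OF assms(1)] coalgebra_def)

lemma smult_const_lin [lin_intros]:
  "f \<in> linear_maps K V W \<Longrightarrow> h \<in> carrier H \<Longrightarrow> module K W \<Longrightarrow> (\<lambda>v. counit H h \<odot>\<^bsub>W\<^esub> f v) \<in> linear_maps K V W"
  by (rule lin_smult_const) auto

lemma comult_closed [simp]: "h \<in> carrier H \<Longrightarrow> comult H h \<in> carrier (tensor K H H)"
  and coact_closed [simp]: "a \<in> carrier A \<Longrightarrow> \<delta> a \<in> carrier (tensor K H A)"
  by (auto intro: lin_closed[OF comult_lin] lin_closed[OF coact_lin])

lemma sweedler_comult_closed [simp]:
  "h \<in> carrier H \<Longrightarrow> module K W \<Longrightarrow> (\<And>a b. a \<in> carrier H \<Longrightarrow> b \<in> carrier H \<Longrightarrow> f a b \<in> carrier W) \<Longrightarrow>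
    sweedler W (comult H h) f \<in> carrier W"
  by (rule sweedler_closed[of _ H H]) auto

lemma sweedler_coact_closed [simp]:
  "a \<in> carrier A \<Longrightarrow> module K W \<Longrightarrow> (\<And>h b. h \<in> carrier H \<Longrightarrow> b \<in> carrier A \<Longrightarrow> f h b \<in> carrier W) \<Longrightarrow>
    sweedler W (\<delta> a) f \<in> carrier W"
  by (rule sweedler_closed[of _ H A]) auto

lemma sweedler_comult_cong:
  "h \<in> carrier H \<Longrightarrow> (\<And>a b. a \<in> carrier H \<Longrightarrow> b \<in> carrier H \<Longrightarrow> f a b = g a b) \<Longrightarrow>
    sweedler W (comult H h) f = sweedler W (comult H h) g"
  by (rule sweedler_cong[of _ H H]) auto

lemma sweedler_coact_cong:
  "a \<in> carrier A \<Longrightarrow> (\<And>h b. h \<in> carrier H \<Longrightarrow> b \<in> carrier A \<Longrightarrow> f h b = g h b) \<Longrightarrow>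
    sweedler W (\<delta> a) f = sweedler W (\<delta> a) g"
  by (rule sweedler_cong[of _ H A]) auto

lemma sweedler_comult_lin [lin_intros]:
  "h \<in> carrier H \<Longrightarrow> (\<And>a b. a \<in> carrier H \<Longrightarrow> b \<in> carrier H \<Longrightarrow> (\<lambda>v. F v a b) \<in> linear_maps K V W) \<Longrightarrow>
    module K V \<Longrightarrow> module K W \<Longrightarrow> (\<lambda>v. sweedler W (comult H h) (F v)) \<in> linear_maps K V W"
  "g \<in> linear_maps K V H \<Longrightarrow> bilin K H H W f \<Longrightarrow> module K W \<Longrightarrow>
    (\<lambda>v. sweedler W (comult H (g v)) f) \<in> linear_maps K V W"
  by (rule sweedler_lin_param[of _ H H]; simp)
    (rule lin_comp[OF lin_comp[OF sweedler_linear comult_lin]]; simp)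

lemma sweedler_coact_lin [lin_intros]:
  "a \<in> carrier A \<Longrightarrow> (\<And>h b. h \<in> carrier H \<Longrightarrow> b \<in> carrier A \<Longrightarrow> (\<lambda>v. F v h b) \<in> linear_maps K V W) \<Longrightarrow>
    module K V \<Longrightarrow> module K W \<Longrightarrow> (\<lambda>v. sweedler W (\<delta> a) (F v)) \<in> linear_maps K V W"
  "g \<in> linear_maps K V A \<Longrightarrow> bilin K H A W f \<Longrightarrow> module K W \<Longrightarrow>
    (\<lambda>v. sweedler W (\<delta> (g v)) f) \<in> linear_maps K V W"
  by (rule sweedler_lin_param[of _ H A]; simp)
    (rule lin_comp[OF lin_comp[OF sweedler_linear coact_lin]]; simp)

lemma coact_coassoc:
  assumes "a \<in> carrier A" "trilin K H H A W f" "module K W"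
  shows "sweedler W (\<delta> a) (\<lambda>h b. sweedler W (comult H h) (\<lambda>h1 h2. f h1 h2 b)) =
    sweedler W (\<delta> a) (\<lambda>h b. sweedler W (\<delta> b) (\<lambda>h' b'. f h h' b'))"
  using assms by (intro comodule_assoc[OF A_comodule]) auto

lemma coact_counit:
  assumes "a \<in> carrier A" "g \<in> linear_maps K A W" "module K W"
  shows "sweedler W (\<delta> a) (\<lambda>h b. counit H h \<odot>\<^bsub>W\<^esub> g b) = g a"
proof -
  have "g (sweedler A (\<delta> a) (\<lambda>h b. counit H h \<odot>\<^bsub>A\<^esub> b)) = sweedler W (\<delta> a) (\<lambda>h b. g (counit H h \<odot>\<^bsub>A\<^esub> b))"
    using assms by (intro lin_sweedler[of _ _ _ _ H A]) auto
  also have "\<dots> = sweedler W (\<delta> a) (\<lambda>h b. counit H h \<odot>\<^bsub>W\<^esub> g b)"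
    using assms by (intro sweedler_coact_cong) (auto simp: lin_smult[OF assms(2)])
  finally show ?thesis using A_comodule assms(1) by (simp add: left_comodule_def)
qed

lemma coact_mult:
  assumes "a \<in> carrier A" "b \<in> carrier A" "bilin K H A W f" "module K W"
  shows "sweedler W (\<delta> (a \<otimes>\<^bsub>A\<^esub> b)) f
    = sweedler W (\<delta> a) (\<lambda>h c. sweedler W (\<delta> b) (\<lambda>h' c'. f (h \<otimes>\<^bsub>H\<^esub> h') (c \<otimes>\<^bsub>A\<^esub> c')))"
  using sweedler_tensor_mult[OF _ _ _ _ _ _ assms(3,4)] coact_hom assms(1,2)
  by (simp add: ring_hom_def)

lemma coact_one:
  assumes "bilin K H A W f" "module K W"
  shows "sweedler W (\<delta> \<one>\<^bsub>A\<^esub>) f = f \<one>\<^bsub>H\<^esub> \<one>\<^bsub>A\<^esub>"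
proof -
  have "\<delta> \<one>\<^bsub>A\<^esub> = tens K H A \<one>\<^bsub>H\<^esub> \<one>\<^bsub>A\<^esub>"
    using coact_hom by (simp add: ring_hom_def tensor_def)
  thus ?thesis using assms by (simp add: sweedler_tens)
qed

abbreviation "V \<equiv> tensor_lmod K \<delta>"

lemma V_act_tens:
  assumes "left_module K H X" "left_module K A M" "a \<in> carrier A" "x \<in> carrier X" "m \<in> carrier M"
  shows "act (V X M) a (tens K X M x m) = sweedler (tensor K X M) (\<delta> a) (\<lambda>h b. tens K X M (act X h x) (act M b m))"
  unfolding tensor_lmod_act using assms
  by (intro sweedler_coact_cong sweedler_tens) (simp | intro lin_intros)+

lemma V_act_lin:
  assumes "left_module K H X" "left_module K A M"
  shows "a \<in> carrier A \<Longrightarrow> act (V X M) a \<in> linear_maps K (tensor K X M) (tensor K X M)"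
    and "u \<in> carrier (tensor K X M) \<Longrightarrow> (\<lambda>a. act (V X M) a u) \<in> linear_maps K A (tensor K X M)"
  unfolding tensor_lmod_act[abs_def] using assms
  by (intro lin_intros sweedler_linear sweedler_lin_param[of _ X M]; simp)+

text \<open>Unit and multiplicativity of the action are those of the coaction as an algebra map,
  checked on pure tensors. In the multiplicative case the double sum is swapped to take the order of
  a composition.\<close>

lemma V_left_module [simp]:
  assumes X: "left_module K H X" and M: "left_module K A M"
  shows "left_module K A (V X M)"
  unfolding left_module_def
proof (intro conjI ballI)
  note [simp] = X M
  note L = V_act_lin[OF X M]
  note [simp] = lin_closed[OF L(1)] V_act_tens[OF X M]
  show "module K (V X M)" by simp
  show "act (V X M) a \<in> linear_maps K (V X M) (V X M)" if "a \<in> carrier A" for a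
    using L(1) that by simp
  show "(\<lambda>a. act (V X M) a u) \<in> linear_maps K A (V X M)" if "u \<in> carrier (V X M)" for u
    using L(2) that by simp
  show "act (V X M) \<one>\<^bsub>A\<^esub> u = u" if "u \<in> carrier (V X M)" for u
  proof (rule lin_eq_tensor[OF L(1) lin_id])
    fix x m assume [simp]: "x \<in> carrier X" "m \<in> carrier M"
    show "act (V X M) \<one>\<^bsub>A\<^esub> (tens K X M x m) = tens K X M x m"
      by (simp, subst coact_one) (simp | intro lin_intros)+
  qed (use that in auto)
  fix a b u assume [simp]: "a \<in> carrier A" "b \<in> carrier A" and u: "u \<in> carrier (V X M)"
  show "act (V X M) (a \<otimes>\<^bsub>A\<^esub> b) u = act (V X M) a (act (V X M) b u)"
  proof (rule lin_eq_tensor[OF L(1) lin_comp[OF L(1) L(1)]])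
    fix x m assume [simp]: "x \<in> carrier X" "m \<in> carrier M"
    let ?T = "tensor K X M"
    have "act (V X M) (a \<otimes>\<^bsub>A\<^esub> b) (tens K X M x m) = sweedler ?T (\<delta> a) (\<lambda>h c. sweedler ?T (\<delta> b) (\<lambda>h' c'.
        tens K X M (act X (h \<otimes>\<^bsub>H\<^esub> h') x) (act M (c \<otimes>\<^bsub>A\<^esub> c') m)))"
      by (simp del: H_act(4) A_act(4), rule coact_mult) (simp | intro lin_intros)+
    also have "\<dots> = sweedler ?T (\<delta> a) (\<lambda>h c. sweedler ?T (\<delta> b) (\<lambda>h' c'.
        tens K X M (act X h (act X h' x)) (act M c (act M c' m))))"
      by (intro sweedler_coact_cong) simp_all
    also have "\<dots> = sweedler ?T (\<delta> b) (\<lambda>h' c'. sweedler ?T (\<delta> a) (\<lambda>h c.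
        tens K X M (act X h (act X h' x)) (act M c (act M c' m))))"
      by (rule sweedler_swap[of _ H A _ H A]) simp_all
    also have "\<dots> = sweedler ?T (\<delta> b) (\<lambda>h' c'. act (V X M) a (tens K X M (act X h' x) (act M c' m)))"
      by (intro sweedler_coact_cong) simp_all
    also have "\<dots> = act (V X M) a (sweedler ?T (\<delta> b) (\<lambda>h' c'. tens K X M (act X h' x) (act M c' m)))"
      by (rule lin_sweedler[OF L(1), of _ _ H A, symmetric]) simp_all
    finally show "act (V X M) (a \<otimes>\<^bsub>A\<^esub> b) (tens K X M x m) = act (V X M) a (act (V X M) b (tens K X M x m))"
      by simp
  qed (use u in auto)
qed

end

section \<open>Inverse arrows, and the category of modules over an algebra\<close>

lemma HomsI: "f \<in> Arr C \<Longrightarrow> Dom C f = X \<Longrightarrow> Cod C f = Y \<Longrightarrow> f \<in> Homs C X Y"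
  by (simp add: Homs_def)

lemma HomsD: "f \<in> Homs C X Y \<Longrightarrow> f \<in> Arr C" "f \<in> Homs C X Y \<Longrightarrow> Dom C f = X" "f \<in> Homs C X Y \<Longrightarrow> Cod C f = Y"
  by (simp_all add: Homs_def)

context category
begin

lemma inv_arr_eq:
  assumes "inverse_arrows C f g"
  shows "inv_arr C f = g"
  unfolding inv_arr_def
proof (rule the_equality)
  show "inverse_arrows C f g" by (rule assms)
  fix h assume h: "inverse_arrows C f h"
  have f: "f \<in> Homs C (Dom C f) (Cod C f)"
    using h by (simp add: inverse_arrows_def Homs_def)
  have g: "g \<in> Homs C (Cod C f) (Dom C f)" "g \<cdot>\<^bsub>C\<^esub> f = Idn C (Dom C f)"
    using assms unfolding inverse_arrows_def by blast+
  have h': "h \<in> Homs C (Cod C f) (Dom C f)" "f \<cdot>\<^bsub>C\<^esub> h = Idn C (Cod C f)"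
    using h unfolding inverse_arrows_def by blast+
  have "h = (g \<cdot>\<^bsub>C\<^esub> f) \<cdot>\<^bsub>C\<^esub> h" unfolding g(2) by (rule Idn_Comp[OF h'(1), symmetric])
  also have "\<dots> = g \<cdot>\<^bsub>C\<^esub> (f \<cdot>\<^bsub>C\<^esub> h)" by (rule Comp_assoc[OF h'(1) f g(1)])
  also have "\<dots> = g" unfolding h'(2) by (rule Comp_Idn[OF g(1)])
  finally show "h = g" .
qed

lemma inverse_arrowsI:
  assumes "f \<in> Homs C X Y" "g \<in> Homs C Y X" "g \<cdot>\<^bsub>C\<^esub> f = Idn C X" "f \<cdot>\<^bsub>C\<^esub> g = Idn C Y"
  shows "f \<in> Isos C X Y" "inv_arr C f = g"
proof -
  have "inverse_arrows C f g" using assms by (simp add: inverse_arrows_def Homs_def)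
  thus "f \<in> Isos C X Y" "inv_arr C f = g" using assms by (auto simp: Isos_def inv_arr_eq)
qed

lemma Isos_inv:
  assumes "f \<in> Isos C X Y"
  shows "f \<in> Homs C X Y" "inv_arr C f \<in> Homs C Y X"
    "inv_arr C f \<cdot>\<^bsub>C\<^esub> f = Idn C X" "f \<cdot>\<^bsub>C\<^esub> inv_arr C f = Idn C Y"
proof -
  obtain g where g: "inverse_arrows C f g" and f: "f \<in> Homs C X Y" using assms by (auto simp: Isos_def)
  have "inv_arr C f = g" by (rule inv_arr_eq[OF g])
  thus "f \<in> Homs C X Y" "inv_arr C f \<in> Homs C Y X"
    "inv_arr C f \<cdot>\<^bsub>C\<^esub> f = Idn C X" "f \<cdot>\<^bsub>C\<^esub> inv_arr C f = Idn C Y"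
    using f g by (simp_all add: inverse_arrows_def Homs_def)
qed

end

lemma same_ops_simps' [simp]:
  "same_ops (tensor_lmod K d X Y) Z = same_ops (tensor K X Y) Z"
  "same_ops Z Z"
  using same_ops_tensor_lmod[of K d X Y] by (auto simp: same_ops_def)

context base_ring
begin

context
  fixes A :: "('k, ('k, 'a) univ, 'y) module_scheme"
begin

lemma lmod_cat_simps [simp]:
  "Obj (lmod_cat K A) = {M. left_module K A M}"
  "Dom (lmod_cat K A) = src" "Cod (lmod_cat K A) = tgt"
  "src (Idn (lmod_cat K A) M) = M" "tgt (Idn (lmod_cat K A) M) = M"
  "src (g \<cdot>\<^bsub>lmod_cat K A\<^esub> f) = src f" "tgt (g \<cdot>\<^bsub>lmod_cat K A\<^esub> f) = tgt g"
  "m \<in> carrier M \<Longrightarrow> fn (Idn (lmod_cat K A) M) m = m"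
  "m \<in> carrier (src f) \<Longrightarrow> fn (g \<cdot>\<^bsub>lmod_cat K A\<^esub> f) m = fn g (fn f m)"
  by (simp_all add: lmod_cat_def compose_def)

lemma lmod_Arr_iff:
  "f \<in> Arr (lmod_cat K A) \<longleftrightarrow> left_module K A (src f) \<and> left_module K A (tgt f) \<and>
     fn f \<in> left_module_maps K A (src f) (tgt f) \<and> fn f \<in> extensional (carrier (src f))"
  by (cases f) (auto simp: lmod_cat_def)

lemma lmod_Arr:
  assumes "f \<in> Arr (lmod_cat K A)"
  shows "left_module K A (src f)" "left_module K A (tgt f)" "module K (src f)" "module K (tgt f)"
    "fn f \<in> linear_maps K (src f) (tgt f)"
    "a \<in> carrier A \<Longrightarrow> m \<in> carrier (src f) \<Longrightarrow> fn f (act (src f) a m) = act (tgt f) a (fn f m)"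
  using assms by (auto simp: lmod_Arr_iff left_module_maps_def lmod_module)

lemma lmod_Arr_lin:
  "f \<in> Arr (lmod_cat K A) \<Longrightarrow> linear_maps K (src f) (tgt f) = linear_maps K V W \<Longrightarrow> fn f \<in> linear_maps K V W"
  using lmod_Arr(5) by metis

lemma lmod_Arr_closed:
  "f \<in> Arr (lmod_cat K A) \<Longrightarrow> m \<in> carrier (src f) \<Longrightarrow> carrier W = carrier (tgt f) \<Longrightarrow> fn f m \<in> carrier W"
  using lin_closed[OF lmod_Arr(5)] by metis

lemma lmod_Arr_eqI:
  assumes "f \<in> Arr (lmod_cat K A)" "g \<in> Arr (lmod_cat K A)" "src f = src g" "tgt f = tgt g"
    and "\<And>m. m \<in> carrier (src g) \<Longrightarrow> fn f m = fn g m"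
  shows "f = g"
  using assms by (cases f; cases g) (auto simp: lmod_Arr_iff intro!: extensionalityI)

text \<open>The source of an arrow is typically a \<open>tensor_lmod\<close>, while uniqueness on
  pure tensors is stated for maps out of \<open>tensor\<close>. The module \<open>U\<close> with the
  same operations mediates between them.\<close>

lemma lmod_Arr_eq_ops:
  assumes "f \<in> Arr (lmod_cat K A)" "g \<in> Arr (lmod_cat K A)" "src f = src g" "tgt f = tgt g"
    and ops: "same_ops (src g) U"
    and eq: "\<And>u. fn f \<in> linear_maps K U (tgt g) \<Longrightarrow> fn g \<in> linear_maps K U (tgt g) \<Longrightarrow> module K (tgt g) \<Longrightarrow>
      u \<in> carrier U \<Longrightarrow> fn f u = fn g u"
  shows "f = g"
proof (rule lmod_Arr_eqI[OF assms(1-4)])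
  fix m assume "m \<in> carrier (src g)"
  hence m: "m \<in> carrier U" using ops by (simp add: same_ops_def)
  show "fn f m = fn g m"
    by (rule eq[OF _ _ _ m])
      (use lmod_Arr(5)[OF assms(1)] lmod_Arr(5)[OF assms(2)] lmod_Arr(4)[OF assms(2)] assms(3,4) in
        \<open>simp_all add: same_ops_simps[OF ops]\<close>)
qed

lemma lmod_Arr_eq_tensor:
  assumes "f \<in> Arr (lmod_cat K A)" "g \<in> Arr (lmod_cat K A)" "src f = src g" "tgt f = tgt g"
    and "same_ops (src g) (tensor K X Y)" "module K X" "module K Y"
    and "\<And>x y. x \<in> carrier X \<Longrightarrow> y \<in> carrier Y \<Longrightarrow> fn f (tens K X Y x y) = fn g (tens K X Y x y)"
  shows "f = g"
proof (rule lmod_Arr_eq_ops[OF assms(1-5)])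
  fix u assume "fn f \<in> linear_maps K (tensor K X Y) (tgt g)" "fn g \<in> linear_maps K (tensor K X Y) (tgt g)" "module K (tgt g)" "u \<in> carrier (tensor K X Y)"
  thus "fn f u = fn g u"
    using assms(6-8) by (rule_tac lin_eq_tensor) (assumption | blast)+
qed

lemma lmod_Arr_eq_tensor_left:
  assumes "f \<in> Arr (lmod_cat K A)" "g \<in> Arr (lmod_cat K A)" "src f = src g" "tgt f = tgt g"
    and "same_ops (src g) (tensor K (tensor K X Y) Z)" "module K X" "module K Y" "module K Z"
    and "\<And>x y z. x \<in> carrier X \<Longrightarrow> y \<in> carrier Y \<Longrightarrow> z \<in> carrier Z \<Longrightarrow>
      fn f (tens K (tensor K X Y) Z (tens K X Y x y) z) = fn g (tens K (tensor K X Y) Z (tens K X Y x y) z)"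
  shows "f = g"
proof (rule lmod_Arr_eq_ops[OF assms(1-5)])
  fix u assume "fn f \<in> linear_maps K (tensor K (tensor K X Y) Z) (tgt g)" "fn g \<in> linear_maps K (tensor K (tensor K X Y) Z) (tgt g)" "module K (tgt g)" "u \<in> carrier (tensor K (tensor K X Y) Z)"
  thus "fn f u = fn g u"
    using assms(6-9) by (rule_tac lin_eq_tensor_left) (assumption | blast)+
qed

lemma lmod_Arr_eq_tensor_right:
  assumes "f \<in> Arr (lmod_cat K A)" "g \<in> Arr (lmod_cat K A)" "src f = src g" "tgt f = tgt g"
    and "same_ops (src g) (tensor K X (tensor K Y Z))" "module K X" "module K Y" "module K Z"
    and "\<And>x y z. x \<in> carrier X \<Longrightarrow> y \<in> carrier Y \<Longrightarrow> z \<in> carrier Z \<Longrightarrow>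
      fn f (tens K X (tensor K Y Z) x (tens K Y Z y z)) = fn g (tens K X (tensor K Y Z) x (tens K Y Z y z))"
  shows "f = g"
proof (rule lmod_Arr_eq_ops[OF assms(1-5)])
  fix u assume "fn f \<in> linear_maps K (tensor K X (tensor K Y Z)) (tgt g)" "fn g \<in> linear_maps K (tensor K X (tensor K Y Z)) (tgt g)" "module K (tgt g)" "u \<in> carrier (tensor K X (tensor K Y Z))"
  thus "fn f u = fn g u"
    using assms(6-9) by (rule_tac lin_eq_tensor_right) (assumption | blast)+
qed

lemma lmod_Arr_eq_tensor_left2:
  assumes "f \<in> Arr (lmod_cat K A)" "g \<in> Arr (lmod_cat K A)" "src f = src g" "tgt f = tgt g"
    and "same_ops (src g) (tensor K (tensor K (tensor K X Y) Z) Z')"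
    and "module K X" "module K Y" "module K Z" "module K Z'"
    and "\<And>x y z z'. x \<in> carrier X \<Longrightarrow> y \<in> carrier Y \<Longrightarrow> z \<in> carrier Z \<Longrightarrow> z' \<in> carrier Z' \<Longrightarrow>
      fn f (tens K (tensor K (tensor K X Y) Z) Z' (tens K (tensor K X Y) Z (tens K X Y x y) z) z')
      = fn g (tens K (tensor K (tensor K X Y) Z) Z' (tens K (tensor K X Y) Z (tens K X Y x y) z) z')"
  shows "f = g"
proof (rule lmod_Arr_eq_ops[OF assms(1-5)])
  fix u assume "fn f \<in> linear_maps K (tensor K (tensor K (tensor K X Y) Z) Z') (tgt g)" "fn g \<in> linear_maps K (tensor K (tensor K (tensor K X Y) Z) Z') (tgt g)" "module K (tgt g)" "u \<in> carrier (tensor K (tensor K (tensor K X Y) Z) Z')"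
  thus "fn f u = fn g u"
    using assms(6-10) by (rule_tac lin_eq_tensor_left2) (assumption | blast)+
qed

lemma lmod_Idn_Arr [simp]: "left_module K A M \<Longrightarrow> Idn (lmod_cat K A) M \<in> Arr (lmod_cat K A)"
  by (auto simp: lmod_Arr_iff left_module_maps_def lmod_cat_def linear_maps_def lmod_act_closed
      dest: lmod_module)

lemma lmod_Comp_Arr [simp]:
  assumes "g \<in> Arr (lmod_cat K A)" "f \<in> Arr (lmod_cat K A)" "src g = tgt f"
  shows "g \<cdot>\<^bsub>lmod_cat K A\<^esub> f \<in> Arr (lmod_cat K A)"
proof -
  note f = lmod_Arr[OF assms(2)] and g = lmod_Arr[OF assms(1)]
  have "(\<lambda>m. fn g (fn f m)) \<in> linear_maps K (src f) (tgt g)"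
    using lin_comp[OF g(5)] f(5) assms(3) by simp
  hence "fn (g \<cdot>\<^bsub>lmod_cat K A\<^esub> f) \<in> linear_maps K (src f) (tgt g)"
    using f(3) by (subst lin_cong) auto
  moreover have "fn (g \<cdot>\<^bsub>lmod_cat K A\<^esub> f) \<in> extensional (carrier (src f))"
    by (simp add: lmod_cat_def)
  moreover have "fn g (fn f (act (src f) a m)) = act (tgt g) a (fn g (fn f m))"
    if "a \<in> carrier A" "m \<in> carrier (src f)" for a m
    using that f(6) g(6)[of a "fn f m"] assms(3) lin_closed[OF f(5)] by simp
  ultimately show ?thesis
    using f(1) g(2) by (simp add: lmod_Arr_iff left_module_maps_def lmod_act_closed)
qed

lemma lmod_category: "category (lmod_cat K A)"
proof
  show "Dom (lmod_cat K A) f \<in> Obj (lmod_cat K A)" "Cod (lmod_cat K A) f \<in> Obj (lmod_cat K A)"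
    if "f \<in> Arr (lmod_cat K A)" for f
    using lmod_Arr[OF that] by auto
qed (auto simp: Homs_def lmod_Arr lmod_Arr_closed intro!: lmod_Arr_eqI)

end

text \<open>One construction for two structures: with the comultiplication as \<open>d\<close> it is
  the tensor product of arrows of \<open>H\<close>-modules, and with the coaction of
  \<open>A\<close> it is the action of an \<open>H\<close>-linear arrow on an
  \<open>A\<close>-linear one.\<close>

definition tensor_arrow where
  "tensor_arrow d g f = Arrow (tensor_lmod K d (src g) (src f))
    (tensor_map K (src g) (src f) (tgt g) (tgt f) (fn g) (fn f)) (tensor_lmod K d (tgt g) (tgt f))"

lemma tensor_arrow_simps [simp]:
  "src (tensor_arrow d g f) = tensor_lmod K d (src g) (src f)"
  "tgt (tensor_arrow d g f) = tensor_lmod K d (tgt g) (tgt f)"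
  by (simp_all add: tensor_arrow_def)

lemma tensor_assoc_lin' [simp]:
  assumes "module K X" "module K Y" "module K Z"
    "tensor K (tensor K X Y) Z = tensor K U Z'" "tensor K X (tensor K Y Z) = W"
  shows "tensor_assoc K X Y Z \<in> linear_maps K (tensor K U Z') W"
  using tensor_assoc_lin[OF assms(1-3)] assms(4,5) by simp

end

section \<open>Associativity and unit constraints\<close>

context comodule_algebra
begin

abbreviation "T \<equiv> tensor_lmod K (comult H)"
abbreviation "LH \<equiv> lmod_cat K H"
abbreviation "LA \<equiv> lmod_cat K A"

lemmas [simp] = lmod_Arr_lin[where A=H] lmod_Arr_lin[where A=A]
  lmod_Arr_closed[where A=H] lmod_Arr_closed[where A=A]

text \<open>Through this instance, facts about \<open>A\<close>-modules acted on by
  \<open>H\<close>-modules become facts about the monoidal category of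
  \<open>H\<close>-modules.\<close>

lemma self_comodule_algebra: "comodule_algebra K H H (comult H)"
  using H_algebra H_coalgebra comult_hom counit_hom by unfold_locales (simp_all add: coalgebra_def)

lemma T_left_module [simp]: "left_module K H X \<Longrightarrow> left_module K H Y \<Longrightarrow> left_module K H (T X Y)"
  using comodule_algebra.V_left_module[OF self_comodule_algebra] .

lemmas T_act_tens = comodule_algebra.V_act_tens[OF self_comodule_algebra]
lemmas T_act_lin = comodule_algebra.V_act_lin[OF self_comodule_algebra]
lemmas comult_coassoc = comodule_algebra.coact_coassoc[OF self_comodule_algebra]
lemmas comult_counit = comodule_algebra.coact_counit[OF self_comodule_algebra]
lemmas comult_mult = comodule_algebra.coact_mult[OF self_comodule_algebra]
lemmas comult_one = comodule_algebra.coact_one[OF self_comodule_algebra]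

lemma lmod_map_iff:
  assumes "left_module K A M" "left_module K A N" "f \<in> linear_maps K M N"
    and "same_ops M (tensor K X Y)" "module K X" "module K Y"
    and "\<And>a x y. a \<in> carrier A \<Longrightarrow> x \<in> carrier X \<Longrightarrow> y \<in> carrier Y \<Longrightarrow>
      f (act M a (tens K X Y x y)) = act N a (f (tens K X Y x y))"
  shows "f \<in> left_module_maps K A M N"
proof -
  note s = same_ops_simps[OF assms(4)]
  have "f (act M a m) = act N a (f m)" if a: "a \<in> carrier A" and "m \<in> carrier M" for a m
  proof (rule lin_eq_tensor[where F="\<lambda>m. f (act M a m)" and G="\<lambda>m. act N a (f m)" and X=X and Y=Y and W=N])
    have "(\<lambda>m. f (act M a m)) \<in> linear_maps K M N"
      using assms(1-3) a by (intro lin_comp[OF assms(3)] lin_intros)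
    thus "(\<lambda>m. f (act M a m)) \<in> linear_maps K (tensor K X Y) N" by (simp add: s)
    have "(\<lambda>m. act N a (f m)) \<in> linear_maps K M N"
      using assms(1-3) a by (intro lin_intros)
    thus "(\<lambda>m. act N a (f m)) \<in> linear_maps K (tensor K X Y) N" by (simp add: s)
    show "m \<in> carrier (tensor K X Y)" using that(2) assms(4) by (simp add: same_ops_def)
  qed (use assms a in auto)
  thus ?thesis using assms(3) by (simp add: left_module_maps_def)
qed

lemma lmod_tensor_ArrowI:
  assumes "left_module K A M" "left_module K A N" "f \<in> linear_maps K M N" "f \<in> extensional (carrier M)"
    and "same_ops M (tensor K X Y)" "module K X" "module K Y"
    and "\<And>a x y. a \<in> carrier A \<Longrightarrow> x \<in> carrier X \<Longrightarrow> y \<in> carrier Y \<Longrightarrow>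
      f (act M a (tens K X Y x y)) = act N a (f (tens K X Y x y))"
  shows "Arrow M f N \<in> Arr LA"
  using assms lmod_map_iff[OF assms(1-3,5-8)] by (simp add: lmod_Arr_iff)

lemma tensor_arrow_tens:
  assumes "g \<in> Arr (lmod_cat K B)" "f \<in> Arr (lmod_cat K B')" "tens K X P = tens K (src g) (src f)"
    and "x \<in> carrier (src g)" "m \<in> carrier (src f)"
  shows "fn (tensor_arrow d g f) (tens K X P x m) = tens K (tgt g) (tgt f) (fn g x) (fn f m)"
  using assms lmod_Arr[OF assms(1)] lmod_Arr[OF assms(2)]
  by (simp add: tensor_arrow_def tensor_map_tens)

lemmas [simp] = tensor_arrow_tens[where B=H and B'=H] tensor_arrow_tens[where B=H and B'=A]

lemma tensor_arrow_Arr [simp]: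
  assumes g: "g \<in> Arr LH" and f: "f \<in> Arr LA"
  shows "tensor_arrow \<delta> g f \<in> Arr LA"
proof -
  note [simp] = g f lmod_Arr[OF g] lmod_Arr[OF f]
  let ?m = "tensor_map K (src g) (src f) (tgt g) (tgt f) (fn g) (fn f)"
  have l: "?m \<in> linear_maps K (tensor K (src g) (src f)) (tensor K (tgt g) (tgt f))"
    by (rule tensor_map_lin) simp_all
  have t: "?m (tens K (src g) (src f) x y) = tens K (tgt g) (tgt f) (fn g x) (fn f y)"
    if "x \<in> carrier (src g)" "y \<in> carrier (src f)" for x y
    using that by (intro tensor_map_tens) simp_all
  show ?thesis
    unfolding tensor_arrow_def
  proof (rule lmod_tensor_ArrowI[where X="src g" and Y="src f"])
    show "?m \<in> extensional (carrier (V (src g) (src f)))"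
      by (simp add: tensor_map_def)
    fix a x m assume [simp]: "a \<in> carrier A" "x \<in> carrier (src g)" "m \<in> carrier (src f)"
    have "?m (act (V (src g) (src f)) a (tens K (src g) (src f) x m))
      = ?m (sweedler (tensor K (src g) (src f)) (\<delta> a) (\<lambda>h b. tens K (src g) (src f) (act (src g) h x) (act (src f) b m)))"
      by (simp add: V_act_tens)
    also have "\<dots> = sweedler (tensor K (tgt g) (tgt f)) (\<delta> a)
        (\<lambda>h b. ?m (tens K (src g) (src f) (act (src g) h x) (act (src f) b m)))"
      by (rule lin_sweedler[OF l, of _ H A]) simp_all
    also have "\<dots> = sweedler (tensor K (tgt g) (tgt f)) (\<delta> a)
        (\<lambda>h b. tens K (tgt g) (tgt f) (act (tgt g) h (fn g x)) (act (tgt f) b (fn f m)))"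
      by (rule sweedler_coact_cong) (simp_all add: t)
    finally show "?m (act (V (src g) (src f)) a (tens K (src g) (src f) x m))
        = act (V (tgt g) (tgt f)) a (?m (tens K (src g) (src f) x m))"
      by (simp add: t V_act_tens)
  qed (simp_all add: l)
qed

definition lassoc where "lassoc X Y M = Arrow (V (T X Y) M) (tensor_assoc K X Y M) (V X (V Y M))"
definition lassoc_inv where "lassoc_inv X Y M = Arrow (V X (V Y M)) (tensor_assoc_inv X Y M) (V (T X Y) M)"
abbreviation "I \<equiv> trivial_lmod K H"
definition lunit where
  "lunit M = Arrow (V I M) (\<lambda>u\<in>carrier (V I M). sweedler M u (\<lambda>c m. unScal c \<odot>\<^bsub>M\<^esub> m)) M"
definition lunit_inv where
  "lunit_inv M = Arrow M (\<lambda>m\<in>carrier M. tens K I M (Scal \<one>\<^bsub>K\<^esub>) m) (V I M)"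

lemma lassoc_simps [simp]:
  "src (lassoc X Y M) = V (T X Y) M" "tgt (lassoc X Y M) = V X (V Y M)" "fn (lassoc X Y M) = tensor_assoc K X Y M"
  "src (lassoc_inv X Y M) = V X (V Y M)" "tgt (lassoc_inv X Y M) = V (T X Y) M"
  "fn (lassoc_inv X Y M) = tensor_assoc_inv X Y M"
  "src (lunit M) = V I M" "tgt (lunit M) = M" "src (lunit_inv M) = M" "tgt (lunit_inv M) = V I M"
  "m \<in> carrier M \<Longrightarrow> fn (lunit_inv M) m = tens K I M (Scal \<one>\<^bsub>K\<^esub>) m"
  by (simp_all add: lassoc_def lassoc_inv_def lunit_def lunit_inv_def)

lemmas [simp] = tensor_assoc_tens tensor_assoc_inv_tens tensor_assoc_lin tensor_assoc_inv_lin

text \<open>On a pure tensor the two actions differ by (\<Delta> \<otimes> Id)\<delta> against (Id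
  \<otimes> \<delta>)\<delta>, so rebracketing is \<open>A\<close>-linear by coassociativity of the
  coaction.\<close>

lemma lassoc_Arr:
  assumes [simp]: "left_module K H X" "left_module K H Y" "left_module K A M"
  shows "lassoc X Y M \<in> Arr LA"
proof -
  let ?L = "tensor K (tensor K X Y) M" and ?R = "tensor K X (tensor K Y M)"
  let ?f = "tensor_assoc K X Y M"
  have lf: "?f \<in> linear_maps K ?L ?R" by (rule tensor_assoc_lin) simp_all
  have "?f (act (V (T X Y) M) a u) = act (V X (V Y M)) a (?f u)" if [simp]: "a \<in> carrier A" and u: "u \<in> carrier ?L" for a u
  proof (rule lin_eq_tensor_left[OF _ _ _ _ _ _ _ u])
    have "act (V (T X Y) M) a \<in> linear_maps K (tensor K (T X Y) M) (tensor K (T X Y) M)"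
      by (rule V_act_lin) simp_all
    thus "(\<lambda>u. ?f (act (V (T X Y) M) a u)) \<in> linear_maps K ?L ?R"
      by (intro lin_comp[OF lf]) simp
    have l2: "act (V X (V Y M)) a \<in> linear_maps K (tensor K X (V Y M)) (tensor K X (V Y M))"
      by (rule V_act_lin) simp_all
    thus "(\<lambda>u. act (V X (V Y M)) a (?f u)) \<in> linear_maps K ?L ?R"
      using lf by (intro lin_comp[OF _ lf]) simp
    fix x y m assume [simp]: "x \<in> carrier X" "y \<in> carrier Y" "m \<in> carrier M"
    have "act (V (T X Y) M) a (tens K (tensor K X Y) M (tens K X Y x y) m)
      = sweedler ?L (\<delta> a) (\<lambda>h b. tens K (tensor K X Y) M
          (sweedler (tensor K X Y) (comult H h) (\<lambda>h1 h2. tens K X Y (act X h1 x) (act Y h2 y))) (act M b m))"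
      using V_act_tens[of "T X Y" M a "tens K X Y x y" m]
      by simp (rule sweedler_coact_cong, simp_all add: T_act_tens)
    also have "\<dots> = sweedler ?L (\<delta> a) (\<lambda>h b. sweedler ?L (comult H h) (\<lambda>h1 h2. 
        tens K (tensor K X Y) M (tens K X Y (act X h1 x) (act Y h2 y)) (act M b m)))"
      by (rule sweedler_coact_cong, simp, rule lin_sweedler[of "\<lambda>u. tens K (tensor K X Y) M u (act M _ m)" _ _ _ H H])
        (simp | intro lin_intros)+
    also have "\<dots> = sweedler ?L (\<delta> a) (\<lambda>h b. sweedler ?L (\<delta> b) (\<lambda>h' b'. 
        tens K (tensor K X Y) M (tens K X Y (act X h x) (act Y h' y)) (act M b' m)))"
      by (rule coact_coassoc) (simp | intro lin_intros)+
    finally have "?f (act (V (T X Y) M) a (tens K (tensor K X Y) M (tens K X Y x y) m))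
      = ?f (sweedler ?L (\<delta> a) (\<lambda>h b. sweedler ?L (\<delta> b) (\<lambda>h' b'. 
        tens K (tensor K X Y) M (tens K X Y (act X h x) (act Y h' y)) (act M b' m))))"
      by simp
    also have "\<dots> = sweedler ?R (\<delta> a) (\<lambda>h b. sweedler ?R (\<delta> b) (\<lambda>h' b'.
        ?f (tens K (tensor K X Y) M (tens K X Y (act X h x) (act Y h' y)) (act M b' m))))"
      by (subst lin_sweedler[OF lf, of _ H A], simp_all, rule sweedler_coact_cong, simp,
          subst lin_sweedler[OF lf, of _ H A]) simp_all
    also have "\<dots> = sweedler ?R (\<delta> a) (\<lambda>h b. sweedler ?R (\<delta> b) (\<lambda>h' b'.
        tens K X (tensor K Y M) (act X h x) (tens K Y M (act Y h' y) (act M b' m))))"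
      by (rule sweedler_coact_cong, simp, rule sweedler_coact_cong) simp_all
    also have "\<dots> = sweedler ?R (\<delta> a) (\<lambda>h b. tens K X (tensor K Y M) (act X h x) (act (V Y M) b (tens K Y M y m)))"
      by (rule sweedler_coact_cong, simp, simp add: V_act_tens,
          rule lin_sweedler[of "\<lambda>u. tens K X (tensor K Y M) (act X _ x) u" _ _ _ H A, symmetric])
        (simp | intro lin_intros)+
    also have "\<dots> = act (V X (V Y M)) a (tens K X (tensor K Y M) x (tens K Y M y m))"
      using V_act_tens[of X "V Y M" a x "tens K Y M y m"] by simp
    finally show "?f (act (V (T X Y) M) a (tens K (tensor K X Y) M (tens K X Y x y) m))
      = act (V X (V Y M)) a (?f (tens K (tensor K X Y) M (tens K X Y x y) m))" by simp
  qed simp_all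
  thus ?thesis using lf
    by (simp add: lassoc_def lmod_Arr_iff left_module_maps_def) (simp add: tensor_assoc_def)
qed

end

context comodule_algebra
begin

lemma K_module_I [simp]: "module K I"
proof (intro moduleI abelian_groupI is_cring)
  show "\<exists>y\<in>carrier I. y \<oplus>\<^bsub>I\<^esub> x = \<zero>\<^bsub>I\<^esub>" if "x \<in> carrier I" for x
    using that by (auto simp: trivial_lmod_def intro!: bexI[of _ "\<ominus>\<^bsub>K\<^esub> _"] l_neg)
qed (auto simp: trivial_lmod_def l_distr r_distr m_assoc a_ac)

lemma I_simps [simp]:
  "carrier I = Scal ` carrier K" "Scal c \<oplus>\<^bsub>I\<^esub> Scal d = Scal (c \<oplus>\<^bsub>K\<^esub> d)" "d \<odot>\<^bsub>I\<^esub> Scal c = Scal (d \<otimes>\<^bsub>K\<^esub> c)"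
  "act I h (Scal c) = Scal (counit H h \<otimes>\<^bsub>K\<^esub> c)"
  by (simp_all add: trivial_lmod_def)

lemma counit_add_smult:
  "h \<in> carrier H \<Longrightarrow> h' \<in> carrier H \<Longrightarrow> counit H (h \<oplus>\<^bsub>H\<^esub> h') = counit H h \<oplus>\<^bsub>K\<^esub> counit H h'"
  "c \<in> carrier K \<Longrightarrow> h \<in> carrier H \<Longrightarrow> counit H (c \<odot>\<^bsub>H\<^esub> h) = c \<otimes>\<^bsub>K\<^esub> counit H h"
  using H_coalgebra by (auto simp: coalgebra_def)

lemma I_left_module [simp]: "left_module K H I"
  unfolding left_module_def
  by (auto simp: linear_maps_def counit_add_smult l_distr r_distr m_ac intro!: m_closed)

lemma unScal_lin [lin_intros]:
  assumes "module K M"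
  shows "m \<in> carrier M \<Longrightarrow> (\<lambda>c. unScal c \<odot>\<^bsub>M\<^esub> m) \<in> linear_maps K I M"
    and "c \<in> carrier I \<Longrightarrow> f \<in> linear_maps K U M \<Longrightarrow> (\<lambda>v. unScal c \<odot>\<^bsub>M\<^esub> f v) \<in> linear_maps K U M"
proof -
  show "m \<in> carrier M \<Longrightarrow> (\<lambda>c. unScal c \<odot>\<^bsub>M\<^esub> m) \<in> linear_maps K I M"
    using assms by (intro linI) (auto simp: module.smult_l_distr module.smult_assoc1)
  show "c \<in> carrier I \<Longrightarrow> f \<in> linear_maps K U M \<Longrightarrow> (\<lambda>v. unScal c \<odot>\<^bsub>M\<^esub> f v) \<in> linear_maps K U M"
    using assms by (intro lin_smult_const) auto
qed

text \<open>The inverse function of a module map commutes with the action automatically. An inverse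
  arrow therefore needs only linearity over \<open>K\<close>, extensionality and two pointwise
  equations.\<close>

lemma lmod_inverse_Arr:
  assumes f: "f \<in> Arr LA" and "src g = tgt f" "tgt g = src f" and g: "fn g \<in> linear_maps K (tgt f) (src f)"
    and "fn g \<in> extensional (carrier (src g))"
    and "\<And>x. x \<in> carrier (src f) \<Longrightarrow> fn g (fn f x) = x"
    and "\<And>y. y \<in> carrier (tgt f) \<Longrightarrow> fn f (fn g y) = y"
  shows "g \<in> Arr LA" "g \<cdot>\<^bsub>LA\<^esub> f = Idn LA (src f)" "f \<cdot>\<^bsub>LA\<^esub> g = Idn LA (tgt f)"
proof -
  note F = lmod_Arr[OF f]
  have "fn g (act (tgt f) a y) = act (src f) a (fn g y)" if "a \<in> carrier A" "y \<in> carrier (tgt f)" for a y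
  proof -
    have [simp]: "fn g y \<in> carrier (src f)" using lin_closed[OF g that(2)] .
    have "fn g (act (tgt f) a y) = fn g (fn f (act (src f) a (fn g y)))"
      using that F by (simp add: assms(7))
    also have "\<dots> = act (src f) a (fn g y)"
      using that F by (intro assms(6)) simp
    finally show ?thesis .
  qed
  thus g': "g \<in> Arr LA"
    unfolding lmod_Arr_iff left_module_maps_def using F(1,2) assms(2,3,5) g by simp
  show "g \<cdot>\<^bsub>LA\<^esub> f = Idn LA (src f)"
    by (rule lmod_Arr_eqI[of _ A]) (use f g' F(1) assms(2,3,6) in simp_all)
  show "f \<cdot>\<^bsub>LA\<^esub> g = Idn LA (tgt f)"
    by (rule lmod_Arr_eqI[of _ A]) (use f g' F(2) assms(2,3,7) in simp_all)
qed

lemma lunit_bilin: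
  "module K M \<Longrightarrow> bilin K I M M (\<lambda>c m. unScal c \<odot>\<^bsub>M\<^esub> m)"
  by (intro lin_intros)

lemma lunit_lin [simp]:
  assumes "module K M"
  shows "fn (lunit M) \<in> linear_maps K (tensor K I M) M"
proof -
  have "(\<lambda>u. sweedler M u (\<lambda>c m. unScal c \<odot>\<^bsub>M\<^esub> m)) \<in> linear_maps K (tensor K I M) M"
    by (rule sweedler_linear) (simp_all add: assms lunit_bilin)
  thus ?thesis unfolding lunit_def using assms by (subst lin_cong) auto
qed

lemma lunit_tens [simp]:
  assumes "module K M" "c \<in> carrier K" "m \<in> carrier M"
  shows "fn (lunit M) (tens K I M (Scal c) m) = c \<odot>\<^bsub>M\<^esub> m"
  unfolding lunit_def using assms by (simp add: sweedler_tens[OF _ _ _ lunit_bilin])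

text \<open>\<open>H\<close> acts on the unit object through its counit, so linearity is the counit
  axiom of the coaction.\<close>

lemma lunit_Arr [simp]:
  assumes [simp]: "left_module K A M"
  shows "lunit M \<in> Arr LA"
proof -
  have "Arrow (V I M) (fn (lunit M)) M \<in> Arr LA"
  proof (rule lmod_tensor_ArrowI[where X=I and Y=M])
    show "fn (lunit M) \<in> extensional (carrier (V I M))"
      by (simp add: lunit_def)
    fix a x m assume [simp]: "a \<in> carrier A" "x \<in> carrier I" "m \<in> carrier M"
    then obtain c where [simp]: "x = Scal c" "c \<in> carrier K" by auto
    have "fn (lunit M) (act (V I M) a (tens K I M x m)) =
       fn (lunit M) (sweedler (tensor K I M) (\<delta> a) (\<lambda>h b. tens K I M (act I h x) (act M b m)))"
      by (subst V_act_tens) (simp_all del: I_simps(4))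
    also have "\<dots> = sweedler M (\<delta> a) (\<lambda>h b. fn (lunit M) (tens K I M (act I h x) (act M b m)))"
      by (rule lin_sweedler[of _ _ _ _ H A]) simp_all
    also have "\<dots> = sweedler M (\<delta> a) (\<lambda>h b. counit H h \<odot>\<^bsub>M\<^esub> (c \<odot>\<^bsub>M\<^esub> act M b m))"
      by (rule sweedler_coact_cong) (simp_all add: module.smult_assoc1[OF lmod_module[OF assms]])
    also have "\<dots> = c \<odot>\<^bsub>M\<^esub> act M a m"
      by (rule coact_counit) (auto intro!: lin_smult_const lin_intros)
    also have "\<dots> = act M a (c \<odot>\<^bsub>M\<^esub> m)"
      using lin_smult[OF A_act_lin(2)[OF assms _ lin_id]] by simp
    finally show "fn (lunit M) (act (V I M) a (tens K I M x m)) = act M a (fn (lunit M) (tens K I M x m))"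
      by simp
  qed simp_all
  thus ?thesis by (simp add: lunit_def)
qed

lemma lunit_inverse:
  assumes [simp]: "left_module K A M"
  shows lunit_inv_Arr [simp]: "lunit_inv M \<in> Arr LA"
    and "lunit_inv M \<cdot>\<^bsub>LA\<^esub> lunit M = Idn LA (V I M)" "lunit M \<cdot>\<^bsub>LA\<^esub> lunit_inv M = Idn LA M"
proof -
  have l: "fn (lunit_inv M) \<in> linear_maps K M (tensor K I M)"
    by (subst lin_cong[where g="tens K I M (Scal \<one>\<^bsub>K\<^esub>)"]) (auto intro: tens_lin2 lin_id)
  have e: "fn (lunit_inv M) (fn (lunit M) u) = u" if "u \<in> carrier (tensor K I M)" for u
    by (rule lin_eq_tensor[OF lin_comp[OF l lunit_lin] lin_id _ _ _ _ that]) (auto simp: tens_rules(4) tens_rules(3)[symmetric])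
  note * = lmod_inverse_Arr[OF lunit_Arr[OF assms], of "lunit_inv M"]
  have e2: "fn (lunit M) (fn (lunit_inv M) y) = y" if "y \<in> carrier M" for y
    using that by simp
  have ex: "fn (lunit_inv M) \<in> extensional (carrier (src (lunit_inv M)))"
    by (simp add: lunit_inv_def)
  show "lunit_inv M \<in> Arr LA"
    by (rule *(1)[OF _ _ _ ex]) (auto simp: l e e2 simp del: lassoc_simps(11))
  show "lunit_inv M \<cdot>\<^bsub>LA\<^esub> lunit M = Idn LA (V I M)" "lunit M \<cdot>\<^bsub>LA\<^esub> lunit_inv M = Idn LA M"
    using *(2,3)[OF _ _ _ ex] by (auto simp: l e e2 simp del: lassoc_simps(11))
qed

lemmas [simp] = lassoc_Arr

lemma lassoc_inverse:
  assumes [simp]: "left_module K H X" "left_module K H Y" "left_module K A M"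
  shows lassoc_inv_Arr [simp]: "lassoc_inv X Y M \<in> Arr LA"
    and "lassoc_inv X Y M \<cdot>\<^bsub>LA\<^esub> lassoc X Y M = Idn LA (V (T X Y) M)"
    and "lassoc X Y M \<cdot>\<^bsub>LA\<^esub> lassoc_inv X Y M = Idn LA (V X (V Y M))"
proof -
  let ?L = "tensor K (tensor K X Y) M" and ?R = "tensor K X (tensor K Y M)"
  have l: "tensor_assoc K X Y M \<in> linear_maps K ?L ?R" "tensor_assoc_inv X Y M \<in> linear_maps K ?R ?L"
    by (rule tensor_assoc_lin tensor_assoc_inv_lin; simp)+
  have e: "u \<in> carrier ?L \<Longrightarrow> tensor_assoc_inv X Y M (tensor_assoc K X Y M u) = u"
    "v \<in> carrier ?R \<Longrightarrow> tensor_assoc K X Y M (tensor_assoc_inv X Y M v) = v" for u v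
    by (rule lin_eq_tensor_left[OF lin_comp[OF l(2,1)] lin_id] lin_eq_tensor_right[OF lin_comp[OF l] lin_id]; simp)+
  note * = lmod_inverse_Arr[OF lassoc_Arr[OF assms], of "lassoc_inv X Y M"]
  have ex: "fn (lassoc_inv X Y M) \<in> extensional (carrier (src (lassoc_inv X Y M)))"
    by (simp add: tensor_assoc_inv_def)
  show "lassoc_inv X Y M \<in> Arr LA"
    by (rule *(1)[OF _ _ _ ex]) (simp_all add: l e)
  show "lassoc_inv X Y M \<cdot>\<^bsub>LA\<^esub> lassoc X Y M = Idn LA (V (T X Y) M)"
    "lassoc X Y M \<cdot>\<^bsub>LA\<^esub> lassoc_inv X Y M = Idn LA (V X (V Y M))"
    using *(2,3)[OF _ _ _ ex] by (simp_all add: l e)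
qed

lemma tensor_arrow_Idn:
  assumes [simp]: "left_module K H X" "left_module K A P"
  shows "tensor_arrow \<delta> (Idn LH X) (Idn LA P) = Idn LA (V X P)"
  by (rule lmod_Arr_eq_tensor[where A=A and X=X and Y=P]) simp_all

lemma tensor_arrow_Comp:
  assumes [simp]: "g \<in> Arr LH" "g' \<in> Arr LH" "f \<in> Arr LA" "f' \<in> Arr LA" "src g' = tgt g" "src f' = tgt f"
  shows "tensor_arrow \<delta> (g' \<cdot>\<^bsub>LH\<^esub> g) (f' \<cdot>\<^bsub>LA\<^esub> f) = tensor_arrow \<delta> g' f' \<cdot>\<^bsub>LA\<^esub> tensor_arrow \<delta> g f"
  by (rule lmod_Arr_eq_tensor[where A=A and X="src g" and Y="src f"])
    (simp_all add: lmod_Arr[of g H] lmod_Arr[of f A])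

lemma T_arrow_Arr [simp]: "g \<in> Arr LH \<Longrightarrow> f \<in> Arr LH \<Longrightarrow> tensor_arrow (comult H) g f \<in> Arr LH"
  using comodule_algebra.tensor_arrow_Arr[OF self_comodule_algebra] .

lemma lassoc_nat:
  assumes [simp]: "g \<in> Arr LH" "h \<in> Arr LH" "f \<in> Arr LA"
  shows "lassoc (tgt g) (tgt h) (tgt f) \<cdot>\<^bsub>LA\<^esub> tensor_arrow \<delta> (tensor_arrow (comult H) g h) f
    = tensor_arrow \<delta> g (tensor_arrow \<delta> h f) \<cdot>\<^bsub>LA\<^esub> lassoc (src g) (src h) (src f)"
proof -
  note [simp] = lmod_Arr[OF assms(1)] lmod_Arr[OF assms(2)] lmod_Arr[OF assms(3)]
  show ?thesis
    by (rule lmod_Arr_eq_tensor_left[where A=A and X="src g" and Y="src h" and Z="src f"]) simp_all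
qed

lemma lunit_nat:
  assumes [simp]: "f \<in> Arr LA"
  shows "lunit (tgt f) \<cdot>\<^bsub>LA\<^esub> tensor_arrow \<delta> (Idn LH I) f = f \<cdot>\<^bsub>LA\<^esub> lunit (src f)"
proof -
  note [simp] = lmod_Arr[OF assms]
  have [simp]: "fn f (c \<odot>\<^bsub>src f\<^esub> m) = c \<odot>\<^bsub>tgt f\<^esub> fn f m" if "c \<in> carrier K" "m \<in> carrier (src f)" for c m
    using that by (intro lin_smult) simp_all
  show ?thesis
    by (rule lmod_Arr_eq_tensor[where A=A and X=I and Y="src f"]) auto
qed

abbreviation "Tassoc \<equiv> comodule_algebra.lassoc K H (comult H)"

lemmas Tassoc_simps [simp] = comodule_algebra.lassoc_simps(1-3)[OF self_comodule_algebra]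
  comodule_algebra.lassoc_Arr[OF self_comodule_algebra]

lemma lassoc_pentagon:
  assumes [simp]: "left_module K H X" "left_module K H Y" "left_module K H Z" "left_module K A P"
  shows "tensor_arrow \<delta> (Idn LH X) (lassoc Y Z P) \<cdot>\<^bsub>LA\<^esub> lassoc X (T Y Z) P \<cdot>\<^bsub>LA\<^esub>
      tensor_arrow \<delta> (Tassoc X Y Z) (Idn LA P)
    = lassoc X Y (V Z P) \<cdot>\<^bsub>LA\<^esub> lassoc (T X Y) Z P"
  by (rule lmod_Arr_eq_tensor_left2[where A=A and X=X and Y=Y and Z=Z and Z'=P]) simp_all

text \<open>A right unit constraint exists only for \<open>H\<close>-modules. Its linearity rests on
  the right counit axiom of \<open>H\<close>, which comodules do not have, so it is not an instance
  of the left one.\<close>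

definition runit where
  "runit X = Arrow (T X I) (\<lambda>u\<in>carrier (T X I). sweedler X u (\<lambda>x c. unScal c \<odot>\<^bsub>X\<^esub> x)) X"
definition runit_inv where
  "runit_inv X = Arrow X (\<lambda>x\<in>carrier X. tens K X I x (Scal \<one>\<^bsub>K\<^esub>)) (T X I)"

lemma runit_simps [simp]:
  "src (runit X) = T X I" "tgt (runit X) = X" "src (runit_inv X) = X" "tgt (runit_inv X) = T X I"
  "x \<in> carrier X \<Longrightarrow> fn (runit_inv X) x = tens K X I x (Scal \<one>\<^bsub>K\<^esub>)"
  by (simp_all add: runit_def runit_inv_def)

lemma runit_bilin:
  "module K X \<Longrightarrow> bilin K X I X (\<lambda>x c. unScal c \<odot>\<^bsub>X\<^esub> x)"
  by (intro lin_intros)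

lemma runit_lin [simp]:
  assumes "module K X"
  shows "fn (runit X) \<in> linear_maps K (tensor K X I) X"
proof -
  have "(\<lambda>u. sweedler X u (\<lambda>x c. unScal c \<odot>\<^bsub>X\<^esub> x)) \<in> linear_maps K (tensor K X I) X"
    by (rule sweedler_linear) (simp_all add: assms runit_bilin)
  thus ?thesis unfolding runit_def using assms by (subst lin_cong) auto
qed

lemma runit_tens [simp]:
  assumes "module K X" "c \<in> carrier K" "x \<in> carrier X"
  shows "fn (runit X) (tens K X I x (Scal c)) = c \<odot>\<^bsub>X\<^esub> x"
  unfolding runit_def using assms by (simp add: sweedler_tens[OF _ _ _ runit_bilin])

lemma comult_counit_right:
  assumes "h \<in> carrier H" "g \<in> linear_maps K H W" "module K W"
  shows "sweedler W (comult H h) (\<lambda>h1 h2. counit H h2 \<odot>\<^bsub>W\<^esub> g h1) = g h"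
proof -
  have "g (sweedler H (comult H h) (\<lambda>h1 h2. counit H h2 \<odot>\<^bsub>H\<^esub> h1)) = sweedler W (comult H h) (\<lambda>h1 h2. g (counit H h2 \<odot>\<^bsub>H\<^esub> h1))"
    using assms by (intro lin_sweedler[of _ _ _ _ H H]) auto
  also have "\<dots> = sweedler W (comult H h) (\<lambda>h1 h2. counit H h2 \<odot>\<^bsub>W\<^esub> g h1)"
    using assms by (intro sweedler_comult_cong) (auto simp: lin_smult[OF assms(2)])
  finally show ?thesis using H_coalgebra assms(1) by (simp add: coalgebra_def)
qed

lemma runit_Arr [simp]:
  assumes [simp]: "left_module K H X"
  shows "runit X \<in> Arr LH"
proof -
  have "Arrow (T X I) (fn (runit X)) X \<in> Arr LH"
  proof (rule comodule_algebra.lmod_tensor_ArrowI[OF self_comodule_algebra, where X=X and Y=I])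
    show "fn (runit X) \<in> extensional (carrier (T X I))"
      by (simp add: runit_def)
    fix h x y assume [simp]: "h \<in> carrier H" "x \<in> carrier X" "y \<in> carrier I"
    then obtain c where [simp]: "y = Scal c" "c \<in> carrier K" by auto
    have "fn (runit X) (act (T X I) h (tens K X I x y)) =
       fn (runit X) (sweedler (tensor K X I) (comult H h) (\<lambda>a b. tens K X I (act X a x) (act I b y)))"
      by (subst T_act_tens) (simp_all del: I_simps(4))
    also have "\<dots> = sweedler X (comult H h) (\<lambda>a b. fn (runit X) (tens K X I (act X a x) (act I b y)))"
      by (rule lin_sweedler[of _ _ _ _ H H]) simp_all
    also have "\<dots> = sweedler X (comult H h) (\<lambda>a b. counit H b \<odot>\<^bsub>X\<^esub> (c \<odot>\<^bsub>X\<^esub> act X a x))"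
      by (rule sweedler_comult_cong) (simp_all add: module.smult_assoc1[OF lmod_module[OF assms]])
    also have "\<dots> = c \<odot>\<^bsub>X\<^esub> act X h x"
      by (rule comult_counit_right) (simp_all add: lin_smult_const H_act_lin lin_id)
    also have "\<dots> = act X h (c \<odot>\<^bsub>X\<^esub> x)"
      using lin_smult[OF H_act_lin(2)[OF assms _ lin_id]] by simp
    finally show "fn (runit X) (act (T X I) h (tens K X I x y)) = act X h (fn (runit X) (tens K X I x y))"
      by simp
  qed simp_all
  thus ?thesis by (simp add: runit_def)
qed

lemma runit_inverse:
  assumes [simp]: "left_module K H M"
  shows runit_inv_Arr [simp]: "runit_inv M \<in> Arr LH"
    and "runit_inv M \<cdot>\<^bsub>LH\<^esub> runit M = Idn LH (T M I)" "runit M \<cdot>\<^bsub>LH\<^esub> runit_inv M = Idn LH M"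
proof -
  have l: "fn (runit_inv M) \<in> linear_maps K M (tensor K M I)"
    by (subst lin_cong[where g="\<lambda>x. tens K M I x (Scal \<one>\<^bsub>K\<^esub>)"]) (auto intro: tens_lin1 lin_id)
  have e: "fn (runit_inv M) (fn (runit M) u) = u" if "u \<in> carrier (tensor K M I)" for u
    by (rule lin_eq_tensor[OF lin_comp[OF l runit_lin] lin_id _ _ _ _ that]) (auto simp: tens_rules(4)[symmetric] tens_rules(3))
  note * = comodule_algebra.lmod_inverse_Arr[OF self_comodule_algebra runit_Arr[OF assms], of "runit_inv M"]
  have e2: "fn (runit M) (fn (runit_inv M) y) = y" if "y \<in> carrier M" for y
    using that by simp
  have ex: "fn (runit_inv M) \<in> extensional (carrier (src (runit_inv M)))"
    by (simp add: runit_inv_def)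
  show "runit_inv M \<in> Arr LH"
    by (rule *(1)[OF _ _ _ ex]) (auto simp: l e e2 simp del: runit_simps(5))
  show "runit_inv M \<cdot>\<^bsub>LH\<^esub> runit M = Idn LH (T M I)" "runit M \<cdot>\<^bsub>LH\<^esub> runit_inv M = Idn LH M"
    using *(2,3)[OF _ _ _ ex] by (auto simp: l e e2 simp del: runit_simps(5))
qed

lemma runit_nat:
  assumes [simp]: "f \<in> Arr LH"
  shows "runit (tgt f) \<cdot>\<^bsub>LH\<^esub> tensor_arrow (comult H) f (Idn LH I) = f \<cdot>\<^bsub>LH\<^esub> runit (src f)"
proof -
  note [simp] = lmod_Arr[OF assms]
  have [simp]: "fn f (c \<odot>\<^bsub>src f\<^esub> m) = c \<odot>\<^bsub>tgt f\<^esub> fn f m" if "c \<in> carrier K" "m \<in> carrier (src f)" for c m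
    using that by (intro lin_smult) simp_all
  show ?thesis
    by (rule lmod_Arr_eq_tensor[where A=H and X="src f" and Y=I]) auto
qed

lemma lunit_triangle:
  assumes [simp]: "left_module K H X" "left_module K A P"
  shows "tensor_arrow \<delta> (Idn LH X) (lunit P) \<cdot>\<^bsub>LA\<^esub> lassoc X I P = tensor_arrow \<delta> (runit X) (Idn LA P)"
  by (rule lmod_Arr_eq_tensor_left[where A=A and X=X and Y=I and Z=P])
    (auto simp: tens_rules(4)[symmetric] tens_rules(3)[symmetric], simp add: tens_rules)

end

section \<open>The antipode and the R-matrix in Sweedler form\<close>

locale quasitriangular = base_ring K for K :: "('k, 'r) ring_scheme" +
  fixes H :: "('k, 'a, 'x) qt_hopf_scheme"
  assumes qt: "quasitriangular_hopf_algebra K H"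

sublocale quasitriangular \<subseteq> S: comodule_algebra K H H "comult H"
  using qt by unfold_locales (auto simp: quasitriangular_hopf_algebra_def hopf_algebra_def coalgebra_def)

abbreviation (in quasitriangular) (input) H_mult (infixl \<open>**\<close> 70) where
  "x ** y \<equiv> x \<otimes>\<^bsub>H\<^esub> y"

context quasitriangular
begin

abbreviation "HH \<equiv> tensor K H H"
abbreviation "R \<equiv> Rmat H"
abbreviation "S \<equiv> antipode H"

lemmas [simp] = algebra_assoc[OF S.H_algebra] algebra_smult[OF S.H_algebra]

lemma S_lin: "S \<in> linear_maps K H H"
  and S_ax: "h \<in> carrier H \<Longrightarrow> sweedler H (comult H h) (\<lambda>a b. S a ** b) = counit H h \<odot>\<^bsub>H\<^esub> \<one>\<^bsub>H\<^esub>"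
    "h \<in> carrier H \<Longrightarrow> sweedler H (comult H h) (\<lambda>a b. a ** S b) = counit H h \<odot>\<^bsub>H\<^esub> \<one>\<^bsub>H\<^esub>"
  using qt by (auto simp: quasitriangular_hopf_algebra_def hopf_algebra_def)

lemma S_closed [simp]: "h \<in> carrier H \<Longrightarrow> S h \<in> carrier H"
  using lin_closed[OF S_lin] .

lemmas [lin_intros] = lin_comp[OF S_lin]

lemma S_left:
  assumes "h \<in> carrier H" "g \<in> linear_maps K H W" "module K W"
  shows "sweedler W (comult H h) (\<lambda>a b. g (S a ** b)) = counit H h \<odot>\<^bsub>W\<^esub> g \<one>\<^bsub>H\<^esub>"
proof -
  have "sweedler W (comult H h) (\<lambda>a b. g (S a ** b)) = g (sweedler H (comult H h) (\<lambda>a b. S a ** b))"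
    using assms by (intro lin_sweedler[of _ _ _ _ H H, symmetric]) auto
  thus ?thesis using assms by (simp add: S_ax lin_smult[OF assms(2)])
qed

lemma S_right:
  assumes "h \<in> carrier H" "g \<in> linear_maps K H W" "module K W"
  shows "sweedler W (comult H h) (\<lambda>a b. g (a ** S b)) = counit H h \<odot>\<^bsub>W\<^esub> g \<one>\<^bsub>H\<^esub>"
proof -
  have "sweedler W (comult H h) (\<lambda>a b. g (a ** S b)) = g (sweedler H (comult H h) (\<lambda>a b. a ** S b))"
    using assms by (intro lin_sweedler[of _ _ _ _ H H, symmetric]) auto
  thus ?thesis using assms by (simp add: S_ax lin_smult[OF assms(2)])
qed

lemma S_one [simp]: "S \<one>\<^bsub>H\<^esub> = \<one>\<^bsub>H\<^esub>"
proof -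
  have "sweedler H (comult H \<one>\<^bsub>H\<^esub>) (\<lambda>a b. S a ** b) = S \<one>\<^bsub>H\<^esub> ** \<one>\<^bsub>H\<^esub>"
    by (rule S.coact_one) (simp | intro lin_intros)+
  thus ?thesis by (simp add: S_ax)
qed

text \<open>The sum of \<open>S(x1 y1) x2 y2 S(y3) S(x3)\<close> is evaluated twice. Contracting
  \<open>y2 S(y3)\<close> and then \<open>x2 S(x3)\<close> leaves \<open>S(x y)\<close>; contracting
  \<open>S(x1 y1) x2 y2\<close>, the antipode identity of a product, leaves
  \<open>S(y) S(x)\<close>.\<close>

lemma S_mult [simp]:
  assumes [simp]: "x \<in> carrier H" "y \<in> carrier H"
  shows "S (x ** y) = S y ** S x"
proof -
  let ?F = "\<lambda>x1 x2 x3 y1 y2 y3. S (x1 ** y1) ** (x2 ** (y2 ** (S y3 ** S x3)))"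
  let ?G1 = "\<lambda>x1 x2 x3. sweedler H (comult H y) (\<lambda>y1 y'. sweedler H (comult H y') (\<lambda>y2 y3. ?F x1 x2 x3 y1 y2 y3))"
  let ?G2 = "\<lambda>x1 x2 x3. sweedler H (comult H y) (\<lambda>y' y3. sweedler H (comult H y') (\<lambda>y1 y2. ?F x1 x2 x3 y1 y2 y3))"
  have G: "?G1 x1 x2 x3 = ?G2 x1 x2 x3"
    if [simp]: "x1 \<in> carrier H" "x2 \<in> carrier H" "x3 \<in> carrier H" for x1 x2 x3
    by (rule S.comult_coassoc[symmetric]) (simp | intro lin_intros)+
  have G1: "?G1 x1 x2 x3 = S (x1 ** y) ** (x2 ** S x3)"
    if [simp]: "x1 \<in> carrier H" "x2 \<in> carrier H" "x3 \<in> carrier H" for x1 x2 x3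
  proof -
    have "?G1 x1 x2 x3 = sweedler H (comult H y) (\<lambda>y1 y'. counit H y' \<odot>\<^bsub>H\<^esub> (S (x1 ** y1) ** (x2 ** S x3)))"
    proof (rule S.sweedler_comult_cong)
      fix y1 y' assume [simp]: "y1 \<in> carrier H" "y' \<in> carrier H"
      have "sweedler H (comult H y') (\<lambda>y2 y3. ?F x1 x2 x3 y1 y2 y3)
        = sweedler H (comult H y') (\<lambda>a b. S (x1 ** y1) ** (x2 ** ((a ** S b) ** S x3)))"
        by (rule S.sweedler_comult_cong) simp_all
      also have "\<dots> = counit H y' \<odot>\<^bsub>H\<^esub> (S (x1 ** y1) ** (x2 ** (\<one>\<^bsub>H\<^esub> ** S x3)))"
        by (rule S_right) (simp | intro lin_intros)+
      finally show "sweedler H (comult H y') (\<lambda>y2 y3. ?F x1 x2 x3 y1 y2 y3) =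
        counit H y' \<odot>\<^bsub>H\<^esub> (S (x1 ** y1) ** (x2 ** S x3))" by simp
    qed simp
    also have "\<dots> = S (x1 ** y) ** (x2 ** S x3)"
      by (rule S.comult_counit_right) (simp | intro lin_intros)+
    finally show ?thesis .
  qed
  have "S (x ** y) = sweedler H (comult H x) (\<lambda>x1 x'. counit H x' \<odot>\<^bsub>H\<^esub> (S (x1 ** y) ** \<one>\<^bsub>H\<^esub>))"
    by (subst S.comult_counit_right) (simp | intro lin_intros)+
  also have "\<dots> = sweedler H (comult H x) (\<lambda>x1 x'. sweedler H (comult H x') (\<lambda>x2 x3. S (x1 ** y) ** (x2 ** S x3)))"
    by (rule S.sweedler_comult_cong, simp, rule S_right[symmetric]) (simp | intro lin_intros)+
  also have "\<dots> = sweedler H (comult H x) (\<lambda>x1 x'. sweedler H (comult H x') (\<lambda>x2 x3. ?G2 x1 x2 x3))"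
    by (rule S.sweedler_comult_cong, simp, rule S.sweedler_comult_cong, simp) (simp only: G1[symmetric] G)
  also have "\<dots> = sweedler H (comult H x) (\<lambda>x' x3. sweedler H (comult H x') (\<lambda>x1 x2. ?G2 x1 x2 x3))"
    by (rule S.comult_coassoc[symmetric]) (simp | intro lin_intros)+
  also have "\<dots> = sweedler H (comult H x) (\<lambda>x' x3. sweedler H (comult H y) (\<lambda>y' y3.
      sweedler H (comult H x') (\<lambda>x1 x2. sweedler H (comult H y') (\<lambda>y1 y2. ?F x1 x2 x3 y1 y2 y3))))"
    by (rule S.sweedler_comult_cong, simp, rule sweedler_swap[of _ H H _ H H]) simp_all
  also have "\<dots> = sweedler H (comult H x) (\<lambda>x' x3. sweedler H (comult H y) (\<lambda>y' y3.
      counit H x' \<odot>\<^bsub>H\<^esub> (counit H y' \<odot>\<^bsub>H\<^esub> (S y3 ** S x3))))"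
  proof (rule S.sweedler_comult_cong, simp, rule S.sweedler_comult_cong, simp)
    fix x' x3 y' y3 assume [simp]: "x' \<in> carrier H" "x3 \<in> carrier H" "y' \<in> carrier H" "y3 \<in> carrier H"
    have "sweedler H (comult H x') (\<lambda>x1 x2. sweedler H (comult H y') (\<lambda>y1 y2. ?F x1 x2 x3 y1 y2 y3)) =
      sweedler H (comult H x') (\<lambda>x1 x2. sweedler H (comult H y') (\<lambda>y1 y2.
        (S (x1 ** y1) ** (x2 ** y2)) ** (S y3 ** S x3)))"
      by (rule S.sweedler_comult_cong, simp, rule S.sweedler_comult_cong) simp_all
    also have "\<dots> = sweedler H (comult H (x' ** y')) (\<lambda>a b. (S a ** b) ** (S y3 ** S x3))"
      by (rule S.comult_mult[symmetric]) (simp del: algebra_assoc[OF S.H_algebra] | intro lin_intros)+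
    also have "\<dots> = counit H (x' ** y') \<odot>\<^bsub>H\<^esub> (\<one>\<^bsub>H\<^esub> ** (S y3 ** S x3))"
      by (rule S_left) (simp | intro lin_intros)+
    finally show "sweedler H (comult H x') (\<lambda>x1 x2. sweedler H (comult H y') (\<lambda>y1 y2. ?F x1 x2 x3 y1 y2 y3)) =
      counit H x' \<odot>\<^bsub>H\<^esub> (counit H y' \<odot>\<^bsub>H\<^esub> (S y3 ** S x3))"
      by (simp add: module.smult_assoc1[OF algebra_module[OF S.H_algebra]])
  qed
  also have "\<dots> = sweedler H (comult H x) (\<lambda>x' x3. counit H x' \<odot>\<^bsub>H\<^esub> (S y ** S x3))"
  proof (rule S.sweedler_comult_cong, simp)
    fix x' x3 assume [simp]: "x' \<in> carrier H" "x3 \<in> carrier H"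
    have "sweedler H (comult H y) (\<lambda>y' y3. counit H x' \<odot>\<^bsub>H\<^esub> (counit H y' \<odot>\<^bsub>H\<^esub> (S y3 ** S x3)))
      = sweedler H (comult H y) (\<lambda>y' y3. counit H y' \<odot>\<^bsub>H\<^esub> (counit H x' \<odot>\<^bsub>H\<^esub> (S y3 ** S x3)))"
      by (rule S.sweedler_comult_cong)
        (simp_all add: module.smult_assoc1[OF algebra_module[OF S.H_algebra], symmetric] m_comm)
    also have "\<dots> = counit H x' \<odot>\<^bsub>H\<^esub> (S y ** S x3)"
      by (rule S.comult_counit) (simp | intro lin_intros)+
    finally show "sweedler H (comult H y) (\<lambda>y' y3. counit H x' \<odot>\<^bsub>H\<^esub> (counit H y' \<odot>\<^bsub>H\<^esub> (S y3 ** S x3)))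
      = counit H x' \<odot>\<^bsub>H\<^esub> (S y ** S x3)" .
  qed
  also have "\<dots> = S y ** S x"
    by (rule S.comult_counit) (simp | intro lin_intros)+
  finally show ?thesis .
qed


definition Ri where "Ri = (SOME v. v \<in> carrier HH \<and> v \<otimes>\<^bsub>HH\<^esub> R = \<one>\<^bsub>HH\<^esub> \<and> R \<otimes>\<^bsub>HH\<^esub> v = \<one>\<^bsub>HH\<^esub>)"

lemma R_closed [simp]: "R \<in> carrier HH"
  and Ri_closed [simp]: "Ri \<in> carrier HH"
  and Ri_R_mult: "Ri \<otimes>\<^bsub>HH\<^esub> R = \<one>\<^bsub>HH\<^esub>" "R \<otimes>\<^bsub>HH\<^esub> Ri = \<one>\<^bsub>HH\<^esub>"
proof -
  have R: "R \<in> Units HH" using qt by (simp add: quasitriangular_hopf_algebra_def Let_def)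
  thus "R \<in> carrier HH" by (simp add: Units_def)
  have "\<exists>v. v \<in> carrier HH \<and> v \<otimes>\<^bsub>HH\<^esub> R = \<one>\<^bsub>HH\<^esub> \<and> R \<otimes>\<^bsub>HH\<^esub> v = \<one>\<^bsub>HH\<^esub>"
    using R by (auto simp: Units_def)
  from someI_ex[OF this] show "Ri \<in> carrier HH" "Ri \<otimes>\<^bsub>HH\<^esub> R = \<one>\<^bsub>HH\<^esub>" "R \<otimes>\<^bsub>HH\<^esub> Ri = \<one>\<^bsub>HH\<^esub>"
    by (simp_all add: Ri_def)
qed

lemma R_sum_closed [simp]:
  "module K W \<Longrightarrow> (\<And>a b. a \<in> carrier H \<Longrightarrow> b \<in> carrier H \<Longrightarrow> f a b \<in> carrier W) \<Longrightarrow> sweedler W R f \<in> carrier W"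
  "module K W \<Longrightarrow> (\<And>a b. a \<in> carrier H \<Longrightarrow> b \<in> carrier H \<Longrightarrow> f a b \<in> carrier W) \<Longrightarrow> sweedler W Ri f \<in> carrier W"
  by (rule sweedler_closed[of _ H H]; simp)+

lemma R_sum_cong:
  "(\<And>a b. a \<in> carrier H \<Longrightarrow> b \<in> carrier H \<Longrightarrow> f a b = g a b) \<Longrightarrow> sweedler W R f = sweedler W R g"
  "(\<And>a b. a \<in> carrier H \<Longrightarrow> b \<in> carrier H \<Longrightarrow> f a b = g a b) \<Longrightarrow> sweedler W Ri f = sweedler W Ri g"
  by (rule sweedler_cong[of _ H H]; simp)+

lemmas sum_cong = R_sum_cong S.sweedler_comult_cong

lemma R_sum_lin [lin_intros]:
  "(\<And>a b. a \<in> carrier H \<Longrightarrow> b \<in> carrier H \<Longrightarrow> (\<lambda>v. F v a b) \<in> linear_maps K V W) \<Longrightarrow>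
    module K V \<Longrightarrow> module K W \<Longrightarrow> (\<lambda>v. sweedler W R (F v)) \<in> linear_maps K V W"
  "(\<And>a b. a \<in> carrier H \<Longrightarrow> b \<in> carrier H \<Longrightarrow> (\<lambda>v. F v a b) \<in> linear_maps K V W) \<Longrightarrow>
    module K V \<Longrightarrow> module K W \<Longrightarrow> (\<lambda>v. sweedler W Ri (F v)) \<in> linear_maps K V W"
  by (rule sweedler_lin_param[of _ H H]; simp)+

lemma HH_mult:
  assumes "u \<in> carrier HH" "v \<in> carrier HH" "bilin K H H W f" "module K W"
  shows "sweedler W (u \<otimes>\<^bsub>HH\<^esub> v) f = sweedler W u (\<lambda>x y. sweedler W v (\<lambda>x' y'. f (x ** x') (y ** y')))"
  using assms by (intro sweedler_tensor_mult) simp_all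

lemma HH_one: "bilin K H H W f \<Longrightarrow> module K W \<Longrightarrow> sweedler W \<one>\<^bsub>HH\<^esub> f = f \<one>\<^bsub>H\<^esub> \<one>\<^bsub>H\<^esub>"
proof -
  have "\<one>\<^bsub>HH\<^esub> = tens K H H \<one>\<^bsub>H\<^esub> \<one>\<^bsub>H\<^esub>" by (simp add: tensor_def)
  thus "bilin K H H W f \<Longrightarrow> module K W \<Longrightarrow> sweedler W \<one>\<^bsub>HH\<^esub> f = f \<one>\<^bsub>H\<^esub> \<one>\<^bsub>H\<^esub>"
    by (simp add: sweedler_tens)
qed

lemma R_Ri:
  assumes "bilin K H H W f" "module K W"
  shows "sweedler W R (\<lambda>s t. sweedler W Ri (\<lambda>s' t'. f (s ** s') (t ** t'))) = f \<one>\<^bsub>H\<^esub> \<one>\<^bsub>H\<^esub>"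
    and "sweedler W Ri (\<lambda>s t. sweedler W R (\<lambda>s' t'. f (s ** s') (t ** t'))) = f \<one>\<^bsub>H\<^esub> \<one>\<^bsub>H\<^esub>"
  using HH_mult[of R Ri W f] HH_mult[of Ri R W f] HH_one[of W f] assms by (simp_all add: Ri_R_mult)

lemma R_comult:
  assumes [simp]: "h \<in> carrier H" "module K W" and f: "bilin K H H W f"
  shows "sweedler W R (\<lambda>s t. sweedler W (comult H h) (\<lambda>a b. f (s ** a) (t ** b)))
    = sweedler W (comult H h) (\<lambda>a b. sweedler W R (\<lambda>s t. f (b ** s) (a ** t)))"
proof -
  note [lin_intros] = bilin_lin1[OF f] bilin_lin2[OF f]
  let ?op = "sweedler HH (comult H h) (\<lambda>a b. tens K H H b a)"
  have "R \<otimes>\<^bsub>HH\<^esub> comult H h = ?op \<otimes>\<^bsub>HH\<^esub> R"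
    using qt by (simp add: quasitriangular_hopf_algebra_def Let_def)
  moreover have "sweedler W (?op \<otimes>\<^bsub>HH\<^esub> R) f = sweedler W ?op (\<lambda>b a. sweedler W R (\<lambda>s t. f (b ** s) (a ** t)))"
    by (rule HH_mult) (simp_all add: f)
  moreover have "\<dots> = sweedler W (comult H h) (\<lambda>a b. sweedler W R (\<lambda>s t. f (b ** s) (a ** t)))"
    by (rule sweedler_sweedler_tens[of _ H H]) (simp | intro lin_intros)+
  ultimately show ?thesis using HH_mult[of R "comult H h" W f] f by simp
qed

lemmas tensor_mult_lin_intros [lin_intros] = tensor_mult_lin[OF S.H_algebra S.H_algebra]

text \<open>The axioms on \<open>R\<close> equate elements of the triple tensor product with
  products of two sums over \<open>R\<close>. This takes such a product apart once and for all;
  \<open>p\<close>, \<open>q\<close>, \<open>p'\<close> and \<open>q'\<close> say how the legs are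
  filled.\<close>

lemma HHH_aux:
  assumes W [simp]: "module K W" and f: "trilin K H H H W f"
    and R1: "R1 = sweedler (tensor K HH H) R (\<lambda>s t. tens K HH H (p s t) (q s t))"
    and R2: "R2 = sweedler (tensor K HH H) R (\<lambda>s t. tens K HH H (p' s t) (q' s t))"
    and [simp]: "\<And>s t. s \<in> carrier H \<Longrightarrow> t \<in> carrier H \<Longrightarrow> p s t \<in> carrier HH \<and> q s t \<in> carrier H \<and> p' s t \<in> carrier HH \<and> q' s t \<in> carrier H"
  shows "sweedler W (R1 \<otimes>\<^bsub>tensor K HH H\<^esub> R2) (\<lambda>u c. sweedler W u (\<lambda>a b. f a b c)) =
    sweedler W R (\<lambda>s t. sweedler W R (\<lambda>s' t'.
      sweedler W (p s t \<otimes>\<^bsub>HH\<^esub> p' s' t') (\<lambda>a b. f a b (q s t ** q' s' t'))))"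
proof -
  note [lin_intros] = trilin_lin1[OF f] trilin_lin2[OF f] trilin_lin3[OF f]
  have [simp]: "u \<in> carrier HH \<Longrightarrow> v \<in> carrier HH \<Longrightarrow> u \<otimes>\<^bsub>HH\<^esub> v \<in> carrier HH" for u v
    by (rule tensor_mult_closed) simp_all
  have [simp]: "R1 \<in> carrier (tensor K HH H)" "R2 \<in> carrier (tensor K HH H)"
    unfolding R1 R2 by simp_all
  note b = sweedler_left[OF _ _ _ _ f]
  have l: "(\<lambda>u. sweedler W u (\<lambda>a b. f a b c)) \<in> linear_maps K HH W" if "c \<in> carrier H" for c
    using that by (intro sweedler_linear lin_intros) simp_all
  have l3: "(\<lambda>v. sweedler W u (\<lambda>a b. f a b (g v))) \<in> linear_maps K U W"
    if "u \<in> carrier HH" "g \<in> linear_maps K U H" "module K U" for u g and U :: "('k, 'u, 'z) module_scheme"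
    using that by (intro sweedler_lin_param[of _ H H] lin_intros) simp_all
  have "sweedler W (R1 \<otimes>\<^bsub>tensor K HH H\<^esub> R2) (\<lambda>u c. sweedler W u (\<lambda>a b. f a b c)) =
    sweedler W R1 (\<lambda>u c. sweedler W R2 (\<lambda>u' c'. sweedler W (u \<otimes>\<^bsub>HH\<^esub> u') (\<lambda>a b. f a b (c ** c'))))"
    by (rule sweedler_tensor_mult) (simp_all add: b)
  also have "\<dots> = sweedler W R (\<lambda>s t. sweedler W R2 (\<lambda>u' c'. sweedler W (p s t \<otimes>\<^bsub>HH\<^esub> u') (\<lambda>a b. f a b (q s t ** c'))))"
    unfolding R1
    by (rule sweedler_sweedler_tens[of _ H H])
      (simp | intro bilinI sweedler_lin_param[of _ HH H] lin_comp[OF l] l3 lin_intros)+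
  also have "\<dots> = sweedler W R (\<lambda>s t. sweedler W R (\<lambda>s' t'.
      sweedler W (p s t \<otimes>\<^bsub>HH\<^esub> p' s' t') (\<lambda>a b. f a b (q s t ** q' s' t'))))"
    unfolding R2
    by (rule R_sum_cong, rule sweedler_sweedler_tens[of _ H H])
      (simp | intro bilinI lin_comp[OF l] l3 lin_intros)+
  finally show ?thesis .
qed

lemma R_comult_left:
  assumes [simp]: "module K W" and f: "trilin K H H H W f"
  shows "sweedler W R (\<lambda>s t. sweedler W (comult H s) (\<lambda>a b. f a b t))
    = sweedler W R (\<lambda>s t. sweedler W R (\<lambda>s' t'. f s s' (t ** t')))"
proof -
  note [lin_intros] = trilin_lin1[OF f] trilin_lin2[OF f] trilin_lin3[OF f]
  let ?T = "tensor K HH H" and ?\<Phi> = "\<lambda>u c. sweedler W u (\<lambda>a b. f a b c)"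
  let ?R13 = "sweedler ?T R (\<lambda>s t. tens K HH H (tens K H H s \<one>\<^bsub>H\<^esub>) t)"
  let ?R23 = "sweedler ?T R (\<lambda>s t. tens K HH H (tens K H H \<one>\<^bsub>H\<^esub> s) t)"
  have "sweedler W R (\<lambda>s t. sweedler W (comult H s) (\<lambda>a b. f a b t))
      = sweedler W (sweedler ?T R (\<lambda>s t. tens K HH H (comult H s) t)) ?\<Phi>"
    by (rule sweedler_sweedler_tens[of _ H H, symmetric]) (simp_all add: sweedler_left[OF _ _ _ _ f])
  also have "sweedler ?T R (\<lambda>s t. tens K HH H (comult H s) t) = ?R13 \<otimes>\<^bsub>?T\<^esub> ?R23"
    using qt by (simp add: quasitriangular_hopf_algebra_def Let_def)
  also have "sweedler W (?R13 \<otimes>\<^bsub>?T\<^esub> ?R23) ?\<Phi> = sweedler W R (\<lambda>s t. sweedler W R (\<lambda>s' t'.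
      sweedler W (tens K H H s \<one>\<^bsub>H\<^esub> \<otimes>\<^bsub>HH\<^esub> tens K H H \<one>\<^bsub>H\<^esub> s') (\<lambda>a b. f a b (t ** t'))))"
    by (rule HHH_aux[OF _ f]) simp_all
  also have "\<dots> = sweedler W R (\<lambda>s t. sweedler W R (\<lambda>s' t'. f s s' (t ** t')))"
    by (rule R_sum_cong, rule R_sum_cong, simp add: tensor_mult_tens[OF S.H_algebra S.H_algebra], rule sweedler_tens)
      (simp | intro lin_intros)+
  finally show ?thesis .
qed

lemma R_comult_right:
  assumes [simp]: "module K W" and f: "trilin K H H H W f"
  shows "sweedler W R (\<lambda>s t. sweedler W (comult H t) (\<lambda>a b. f s a b))
    = sweedler W R (\<lambda>s t. sweedler W R (\<lambda>s' t'. f (s ** s') t' t))"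
proof -
  note [lin_intros] = trilin_lin1[OF f] trilin_lin2[OF f] trilin_lin3[OF f]
  let ?T = "tensor K HH H" and ?\<Phi> = "\<lambda>u c. sweedler W u (\<lambda>a b. f a b c)"
  let ?R13 = "sweedler ?T R (\<lambda>s t. tens K HH H (tens K H H s \<one>\<^bsub>H\<^esub>) t)"
  let ?R12 = "sweedler ?T R (\<lambda>s t. tens K HH H (tens K H H s t) \<one>\<^bsub>H\<^esub>)"
  \<comment> \<open>The axiom has R12 in the form R \<otimes> 1. Expanding \<open>R\<close> as the
    sum of its own summands brings it into the shape that \<open>HHH_aux\<close> expects.\<close>
  have r: "?R12 = tens K HH H R \<one>\<^bsub>H\<^esub>"
    using lin_sweedler[OF tens_lin1[OF _ _ lin_id, of HH H "\<one>\<^bsub>H\<^esub>"], of R H H "tens K H H"]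
    by (simp add: sweedler_eta)
  note b = sweedler_left[OF _ _ _ _ f]
  have bf: "bilin K H H W (\<lambda>a b. f a b c)" if "c \<in> carrier H" for c
    using that by (intro lin_intros)
  have "sweedler W R (\<lambda>s t. sweedler W (comult H t) (\<lambda>a b. f s a b))
      = sweedler W R (\<lambda>s t. sweedler W (sweedler ?T (comult H t) (\<lambda>a b. tens K HH H (tens K H H s a) b)) ?\<Phi>)"
    by (rule R_sum_cong, subst sweedler_sweedler_tens[of _ H H], simp_all add: b,
        rule S.sweedler_comult_cong, simp_all add: sweedler_tens[OF _ _ _ bf])
  also have "\<dots> = sweedler W (sweedler ?T R (\<lambda>s t. sweedler ?T (comult H t) (\<lambda>a b. tens K HH H (tens K H H s a) b))) ?\<Phi>"
    by (rule lin_sweedler[OF sweedler_linear, of _ _ _ _ _ H H, symmetric]) (simp_all add: b)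
  also have "sweedler ?T R (\<lambda>s t. sweedler ?T (comult H t) (\<lambda>a b. tens K HH H (tens K H H s a) b)) = ?R13 \<otimes>\<^bsub>?T\<^esub> ?R12"
    using qt unfolding r by (simp add: quasitriangular_hopf_algebra_def Let_def)
  also have "sweedler W (?R13 \<otimes>\<^bsub>?T\<^esub> ?R12) ?\<Phi> = sweedler W R (\<lambda>s t. sweedler W R (\<lambda>s' t'.
      sweedler W (tens K H H s \<one>\<^bsub>H\<^esub> \<otimes>\<^bsub>HH\<^esub> tens K H H s' t') (\<lambda>a b. f a b (t ** \<one>\<^bsub>H\<^esub>))))"
    by (rule HHH_aux[OF _ f]) simp_all
  also have "\<dots> = sweedler W R (\<lambda>s t. sweedler W R (\<lambda>s' t'. f (s ** s') t' t))"
    by (rule R_sum_cong, rule R_sum_cong, simp add: tensor_mult_tens[OF S.H_algebra S.H_algebra], rule sweedler_tens)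
      (simp | intro lin_intros)+
  finally show ?thesis .
qed

end

section \<open>Yang-Baxter, counits and antipodes of R, and the Drinfeld element\<close>

context quasitriangular
begin

lemma R_swap:
  assumes "module K W"
    "\<And>a b c d. a \<in> carrier H \<Longrightarrow> b \<in> carrier H \<Longrightarrow> c \<in> carrier H \<Longrightarrow> d \<in> carrier H \<Longrightarrow> f a b c d \<in> carrier W"
  shows "sweedler W R (\<lambda>a b. sweedler W R (\<lambda>c d. f a b c d)) = sweedler W R (\<lambda>c d. sweedler W R (\<lambda>a b. f a b c d))"
    and "sweedler W R (\<lambda>a b. sweedler W Ri (\<lambda>c d. f a b c d)) = sweedler W Ri (\<lambda>c d. sweedler W R (\<lambda>a b. f a b c d))"
    and "h \<in> carrier H \<Longrightarrow> sweedler W R (\<lambda>a b. sweedler W (comult H h) (\<lambda>c d. f a b c d)) =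
      sweedler W (comult H h) (\<lambda>c d. sweedler W R (\<lambda>a b. f a b c d))"
  using assms by (intro sweedler_swap[of _ H H _ H H]; simp)+

text \<open>This is R12 R13 R23 = R23 R13 R12. Write R13 R23 as (\<Delta> \<otimes> Id)R, move R12
  past the coproduct, which becomes the opposite one, and expand again.\<close>

lemma yang_baxter:
  assumes [simp]: "module K W" and f: "trilin K H H H W f"
  shows "sweedler W R (\<lambda>s t. sweedler W R (\<lambda>s' t'. sweedler W R (\<lambda>s'' t''.
      f (s ** s') (t ** s'') (t' ** t''))))
    = sweedler W R (\<lambda>s t. sweedler W R (\<lambda>s' t'. sweedler W R (\<lambda>s'' t''.
      f (s' ** s) (s'' ** t) (t'' ** t'))))"
proof -
  note [lin_intros] = trilin_lin1[OF f] trilin_lin2[OF f] trilin_lin3[OF f]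
  note [simp] = trilin_closed[OF f]
  have "sweedler W R (\<lambda>s t. sweedler W R (\<lambda>s' t'. sweedler W R (\<lambda>s'' t''.
      f (s ** s') (t ** s'') (t' ** t''))))
    = sweedler W R (\<lambda>s t. sweedler W R (\<lambda>s' t'. sweedler W (comult H s') (\<lambda>a b.
      f (s ** a) (t ** b) t')))"
    by (rule R_sum_cong, rule R_comult_left[symmetric]) (simp | intro lin_intros)+
  also have "\<dots> = sweedler W R (\<lambda>s' t'. sweedler W R (\<lambda>s t. sweedler W (comult H s') (\<lambda>a b.
      f (s ** a) (t ** b) t')))"
    by (rule R_swap) simp_all
  also have "\<dots> = sweedler W R (\<lambda>s' t'. sweedler W (comult H s') (\<lambda>a b. sweedler W R (\<lambda>s t.
      f (b ** s) (a ** t) t')))"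
    by (rule R_sum_cong, rule R_comult) (simp | intro lin_intros)+
  also have "\<dots> = sweedler W R (\<lambda>s'' t''. sweedler W R (\<lambda>s' t'. sweedler W R (\<lambda>s t.
      f (s' ** s) (s'' ** t) (t'' ** t'))))"
    by (rule R_comult_left) (simp | intro lin_intros)+
  also have "\<dots> = sweedler W R (\<lambda>s'' t''. sweedler W R (\<lambda>s t. sweedler W R (\<lambda>s' t'.
      f (s' ** s) (s'' ** t) (t'' ** t'))))"
    by (rule R_sum_cong, rule R_swap) simp_all
  also have "\<dots> = sweedler W R (\<lambda>s t. sweedler W R (\<lambda>s'' t''. sweedler W R (\<lambda>s' t'.
      f (s' ** s) (s'' ** t) (t'' ** t'))))"
    by (rule R_swap) simp_all
  also have "\<dots> = sweedler W R (\<lambda>s t. sweedler W R (\<lambda>s' t'. sweedler W R (\<lambda>s'' t''.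
      f (s' ** s) (s'' ** t) (t'' ** t'))))"
    by (rule R_sum_cong, rule R_swap) simp_all
  finally show ?thesis .
qed

lemma R_cancel:
  assumes [simp]: "module K W" and G: "bilin K H H W G" and [simp]: "a \<in> carrier H" "b \<in> carrier H"
  shows "sweedler W R (\<lambda>s t. sweedler W Ri (\<lambda>s' t'. G (a ** (s ** s')) (b ** (t ** t')))) = G a b"
    and "sweedler W Ri (\<lambda>s t. sweedler W R (\<lambda>s' t'. G (a ** (s ** s')) (b ** (t ** t')))) = G a b"
proof -
  note [lin_intros] = bilin_lin1[OF G] bilin_lin2[OF G]
  have "sweedler W R (\<lambda>s t. sweedler W Ri (\<lambda>s' t'. G (a ** (s ** s')) (b ** (t ** t'))))
    = G (a ** \<one>\<^bsub>H\<^esub>) (b ** \<one>\<^bsub>H\<^esub>)"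
    "sweedler W Ri (\<lambda>s t. sweedler W R (\<lambda>s' t'. G (a ** (s ** s')) (b ** (t ** t'))))
    = G (a ** \<one>\<^bsub>H\<^esub>) (b ** \<one>\<^bsub>H\<^esub>)"
    by (rule R_Ri; (simp | intro lin_intros)+)+
  thus "sweedler W R (\<lambda>s t. sweedler W Ri (\<lambda>s' t'. G (a ** (s ** s')) (b ** (t ** t')))) = G a b"
    "sweedler W Ri (\<lambda>s t. sweedler W R (\<lambda>s' t'. G (a ** (s ** s')) (b ** (t ** t')))) = G a b"
    by simp_all
qed

lemma R_cancel':
  assumes [simp]: "module K W" and G: "bilin K H H W G" and [simp]: "a \<in> carrier H" "b \<in> carrier H"
  shows "sweedler W R (\<lambda>s t. sweedler W Ri (\<lambda>s' t'. G ((a ** s) ** s') ((b ** t) ** t'))) = G a b"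
    and "sweedler W R (\<lambda>s t. sweedler W Ri (\<lambda>s' t'. G (s ** s') ((b ** t) ** t'))) = G \<one>\<^bsub>H\<^esub> b"
    and "sweedler W R (\<lambda>s t. sweedler W Ri (\<lambda>s' t'. G ((a ** s) ** s') (t ** t'))) = G a \<one>\<^bsub>H\<^esub>"
  by (subst R_cancel(1)[OF _ G, symmetric], simp_all, rule R_sum_cong, rule R_sum_cong, simp)+

text \<open>The counit on the first leg of (\<Delta> \<otimes> Id)R = R13 R23 gives R = (1 \<otimes>
  c)R, where c is the contraction of \<open>R\<close> in question. As \<open>R\<close> is
  invertible, c = 1.\<close>

lemma R_counit_left:
  assumes g: "g \<in> linear_maps K H W" and [simp]: "module K W"
  shows "sweedler W R (\<lambda>s t. counit H s \<odot>\<^bsub>W\<^esub> g t) = g \<one>\<^bsub>H\<^esub>"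
proof -
  note [lin_intros] = lin_comp[OF g]
  note [simp] = lin_closed[OF g]
  let ?G = "\<lambda>b c. counit H b \<odot>\<^bsub>W\<^esub> g c"
  have G: "bilin K H H W ?G" by (intro lin_intros) simp_all
  \<comment> \<open>\<open>?F\<close> contains multiplication by the inverse of \<open>R\<close> on
    the right, which performs the cancellation.\<close>
  let ?F = "\<lambda>b c. sweedler W Ri (\<lambda>s' t'. ?G (b ** s') (c ** t'))"
  have F: "bilin K H H W ?F" by (intro lin_intros) simp_all
  have "g \<one>\<^bsub>H\<^esub> = sweedler W R (\<lambda>s t. ?F s t)"
    using R_Ri(1)[OF G] by simp
  also have "\<dots> = sweedler W R (\<lambda>s t. sweedler W (comult H s) (\<lambda>a b. counit H a \<odot>\<^bsub>W\<^esub> ?F b t))"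
    by (rule R_sum_cong, rule S.comult_counit[symmetric]) (simp_all add: bilin_lin1[OF F lin_id])
  also have "\<dots> = sweedler W R (\<lambda>s t. sweedler W R (\<lambda>s' t'. counit H s \<odot>\<^bsub>W\<^esub> ?F s' (t ** t')))"
    by (rule R_comult_left) (simp | intro lin_intros)+
  also have "\<dots> = sweedler W R (\<lambda>s t. counit H s \<odot>\<^bsub>W\<^esub> ?G \<one>\<^bsub>H\<^esub> t)"
  proof (rule R_sum_cong)
    fix s t assume [simp]: "s \<in> carrier H" "t \<in> carrier H"
    have "sweedler W R (\<lambda>s' t'. counit H s \<odot>\<^bsub>W\<^esub> ?F s' (t ** t')) = counit H s \<odot>\<^bsub>W\<^esub> sweedler W R (\<lambda>s' t'. ?F s' (t ** t'))"
      by (rule lin_sweedler[of _ _ _ _ H H, symmetric]) (simp_all add: lin_smult_const lin_id)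
    also have "sweedler W R (\<lambda>s' t'. ?F s' (t ** t')) = ?G \<one>\<^bsub>H\<^esub> t"
      by (rule R_cancel'(2)[OF _ G, where a="\<one>\<^bsub>H\<^esub>"]) simp_all
    finally show "sweedler W R (\<lambda>s' t'. counit H s \<odot>\<^bsub>W\<^esub> ?F s' (t ** t')) = counit H s \<odot>\<^bsub>W\<^esub> ?G \<one>\<^bsub>H\<^esub> t" .
  qed
  also have "\<dots> = sweedler W R (\<lambda>s t. counit H s \<odot>\<^bsub>W\<^esub> g t)"
    by (rule R_sum_cong) simp
  finally show ?thesis by simp
qed

lemma R_counit_right:
  assumes g: "g \<in> linear_maps K H W" and [simp]: "module K W"
  shows "sweedler W R (\<lambda>s t. counit H t \<odot>\<^bsub>W\<^esub> g s) = g \<one>\<^bsub>H\<^esub>"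
proof -
  note [lin_intros] = lin_comp[OF g]
  note [simp] = lin_closed[OF g]
  let ?G = "\<lambda>b c. counit H c \<odot>\<^bsub>W\<^esub> g b"
  have G: "bilin K H H W ?G" by (intro lin_intros) simp_all
  let ?F = "\<lambda>b c. sweedler W Ri (\<lambda>s' t'. ?G (b ** s') (c ** t'))"
  have F: "bilin K H H W ?F" by (intro lin_intros) simp_all
  have "g \<one>\<^bsub>H\<^esub> = sweedler W R (\<lambda>s t. ?F s t)"
    using R_Ri(1)[OF G] by simp
  also have "\<dots> = sweedler W R (\<lambda>s t. sweedler W (comult H t) (\<lambda>a b. counit H b \<odot>\<^bsub>W\<^esub> ?F s a))"
    by (rule R_sum_cong, rule S.comult_counit_right[symmetric]) (simp_all add: bilin_lin2[OF F _ lin_id])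
  also have "\<dots> = sweedler W R (\<lambda>s t. sweedler W R (\<lambda>s' t'. counit H t \<odot>\<^bsub>W\<^esub> ?F (s ** s') t'))"
    by (rule R_comult_right) (simp | intro lin_intros)+
  also have "\<dots> = sweedler W R (\<lambda>s t. counit H t \<odot>\<^bsub>W\<^esub> ?G s \<one>\<^bsub>H\<^esub>)"
  proof (rule R_sum_cong)
    fix s t assume [simp]: "s \<in> carrier H" "t \<in> carrier H"
    have "sweedler W R (\<lambda>s' t'. counit H t \<odot>\<^bsub>W\<^esub> ?F (s ** s') t') = counit H t \<odot>\<^bsub>W\<^esub> sweedler W R (\<lambda>s' t'. ?F (s ** s') t')"
      by (rule lin_sweedler[of _ _ _ _ H H, symmetric]) (simp_all add: lin_smult_const lin_id)
    also have "sweedler W R (\<lambda>s' t'. ?F (s ** s') t') = ?G s \<one>\<^bsub>H\<^esub>"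
      by (rule R_cancel'(3)[OF _ G, where b="\<one>\<^bsub>H\<^esub>"]) simp_all
    finally show "sweedler W R (\<lambda>s' t'. counit H t \<odot>\<^bsub>W\<^esub> ?F (s ** s') t') = counit H t \<odot>\<^bsub>W\<^esub> ?G s \<one>\<^bsub>H\<^esub>" .
  qed
  also have "\<dots> = sweedler W R (\<lambda>s t. counit H t \<odot>\<^bsub>W\<^esub> g s)"
    by (rule R_sum_cong) simp
  finally show ?thesis by simp
qed

text \<open>The antipode identity on the first two legs of (\<Delta> \<otimes> Id)R = R13 R23,
  followed by the counit contraction. Hence (S \<otimes> Id)R is the inverse of
  \<open>R\<close>.\<close>

lemma SR_R:
  assumes F: "bilin K H H W F" and [simp]: "module K W"
  shows "sweedler W R (\<lambda>s t. sweedler W R (\<lambda>s' t'. F (S s ** s') (t ** t'))) = F \<one>\<^bsub>H\<^esub> \<one>\<^bsub>H\<^esub>"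
proof -
  note [lin_intros] = bilin_lin1[OF F] bilin_lin2[OF F]
  have "sweedler W R (\<lambda>s t. sweedler W R (\<lambda>s' t'. F (S s ** s') (t ** t')))
    = sweedler W R (\<lambda>s t. sweedler W (comult H s) (\<lambda>a b. F (S a ** b) t))"
    by (rule R_comult_left[symmetric]) (simp | intro lin_intros)+
  also have "\<dots> = sweedler W R (\<lambda>s t. counit H s \<odot>\<^bsub>W\<^esub> F \<one>\<^bsub>H\<^esub> t)"
    by (rule R_sum_cong, rule S_left) (simp | intro lin_intros)+
  also have "\<dots> = F \<one>\<^bsub>H\<^esub> \<one>\<^bsub>H\<^esub>"
    by (rule R_counit_left) (simp | intro lin_intros)+
  finally show ?thesis .
qed

lemma SR_eq_Ri:
  assumes f: "bilin K H H W f" and [simp]: "module K W"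
  shows "sweedler W R (\<lambda>s t. f (S s) t) = sweedler W Ri (\<lambda>s t. f s t)"
proof -
  note [lin_intros] = bilin_lin1[OF f] bilin_lin2[OF f]
  let ?F = "\<lambda>a b. sweedler W Ri (\<lambda>s t. f (a ** s) (b ** t))"
  have "sweedler W R (\<lambda>s t. f (S s) t) = sweedler W R (\<lambda>s t. sweedler W R (\<lambda>s' t'. ?F (S s ** s') (t ** t')))"
    by (rule R_sum_cong) (simp add: R_cancel'(1)[OF _ f])
  also have "\<dots> = ?F \<one>\<^bsub>H\<^esub> \<one>\<^bsub>H\<^esub>"
    by (rule SR_R) (simp | intro lin_intros)+
  also have "\<dots> = sweedler W Ri (\<lambda>s t. f s t)"
    by (rule R_sum_cong) simp
  finally show ?thesis .
qed

lemma R_SR: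
  assumes f: "bilin K H H W f" and [simp]: "module K W"
  shows "sweedler W R (\<lambda>s t. sweedler W R (\<lambda>s' t'. f (s ** S s') (t ** t'))) = f \<one>\<^bsub>H\<^esub> \<one>\<^bsub>H\<^esub>"
proof -
  note [lin_intros] = bilin_lin1[OF f] bilin_lin2[OF f]
  have "sweedler W R (\<lambda>s t. sweedler W R (\<lambda>s' t'. f (s ** S s') (t ** t'))) =
    sweedler W R (\<lambda>s t. sweedler W Ri (\<lambda>s' t'. f (s ** s') (t ** t')))"
    by (rule R_sum_cong, rule SR_eq_Ri) (simp | intro lin_intros)+
  thus ?thesis using R_Ri(1)[OF f] by simp
qed

text \<open>As (S \<otimes> Id)R is the inverse of \<open>R\<close>, the claim is that Id \<otimes>
  S takes this inverse back to \<open>R\<close>. That follows from (Id \<otimes> \<Delta>)R = R13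
  R12 with the antipode identity on the last two legs, which is the auxiliary fact
  \<open>c\<close>.\<close>

lemma R_SSR:
  assumes f: "bilin K H H W f" and [simp]: "module K W"
  shows "sweedler W R (\<lambda>s t. f (S s) (S t)) = sweedler W R (\<lambda>s t. f s t)"
proof -
  note [lin_intros] = bilin_lin1[OF f] bilin_lin2[OF f]
  note [simp] = bilin_closed[OF f]
  have c: "sweedler W R (\<lambda>s t. sweedler W R (\<lambda>s' t'. f (x ** (s ** s')) (t' ** (S t ** y)))) = f x y"
    if [simp]: "x \<in> carrier H" "y \<in> carrier H" for x y
  proof -
    have "sweedler W R (\<lambda>s t. sweedler W R (\<lambda>s' t'. f (x ** (s ** s')) (t' ** (S t ** y))))
      = sweedler W R (\<lambda>s t. sweedler W (comult H t) (\<lambda>a b. f (x ** s) (a ** (S b ** y))))"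
      by (rule R_comult_right[symmetric]) (simp | intro lin_intros)+
    also have "\<dots> = sweedler W R (\<lambda>s t. sweedler W (comult H t) (\<lambda>a b. f (x ** s) ((a ** S b) ** y)))"
      by (rule R_sum_cong, rule S.sweedler_comult_cong) simp_all
    also have "\<dots> = sweedler W R (\<lambda>s t. counit H t \<odot>\<^bsub>W\<^esub> f (x ** s) (\<one>\<^bsub>H\<^esub> ** y))"
      by (rule R_sum_cong, rule S_right) (simp | intro lin_intros)+
    also have "\<dots> = f (x ** \<one>\<^bsub>H\<^esub>) (\<one>\<^bsub>H\<^esub> ** y)"
      by (rule R_counit_right) (simp | intro lin_intros)+
    finally show ?thesis by simp
  qed
  have "sweedler W R (\<lambda>s t. f (S s) (S t)) = sweedler W Ri (\<lambda>u v. f u (S v))"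
    by (rule SR_eq_Ri) (simp | intro lin_intros)+
  \<comment> \<open>The identity \<open>c\<close> is inserted between \<open>u\<close> and
    \<open>S v\<close>. Since S reverses products, S(t) S(v) is S(v t), and the inverse of
    \<open>R\<close> stands next to a copy of \<open>R\<close>.\<close>
  also have "\<dots> = sweedler W Ri (\<lambda>u v. sweedler W R (\<lambda>s t. sweedler W R (\<lambda>s' t'.
      f (u ** (s ** s')) (t' ** (S t ** S v)))))"
    by (rule R_sum_cong) (simp add: c)
  also have "\<dots> = sweedler W Ri (\<lambda>u v. sweedler W R (\<lambda>s t. 
      (\<lambda>a b. sweedler W R (\<lambda>s' t'. f (a ** s') (t' ** S b))) (u ** s) (v ** t)))"
    by (rule R_sum_cong, rule R_sum_cong, rule R_sum_cong) simp
  also have "\<dots> = sweedler W R (\<lambda>s' t'. f (\<one>\<^bsub>H\<^esub> ** s') (t' ** S \<one>\<^bsub>H\<^esub>))"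
    by (rule R_Ri(2)) (simp | intro lin_intros)+
  also have "\<dots> = sweedler W R (\<lambda>s' t'. f s' t')"
    by (rule R_sum_cong) simp
  finally show ?thesis .
qed

text \<open>The Drinfeld element and its inverse.\<close>

definition "drinfeld = sweedler H R (\<lambda>s t. S t ** s)"
definition "drinfeld_inv = sweedler H R (\<lambda>s t. t ** S (S s))"

abbreviation "du \<equiv> drinfeld"
abbreviation "dv \<equiv> drinfeld_inv"

lemma drinfeld_closed [simp]: "du \<in> carrier H" "dv \<in> carrier H"
  by (simp_all add: drinfeld_def drinfeld_inv_def)

lemma lin_R_sum:
  assumes "g \<in> linear_maps K H W" "module K W" "\<And>s t. s \<in> carrier H \<Longrightarrow> t \<in> carrier H \<Longrightarrow> f s t \<in> carrier H"
  shows "g (sweedler H R f) = sweedler W R (\<lambda>s t. g (f s t))"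
  using assms by (intro lin_sweedler[of _ _ _ _ H H]) simp_all

text \<open>The sum of \<open>S(S(h3)) S(t h2) s h1\<close> is evaluated twice. Contracting h2 with
  h3 leaves \<open>u h\<close>. Exchanging \<open>R\<close> with the coproduct first turns it into
  \<open>S(S(h3)) S(h1 t) h2 s\<close>, where h1 and h2 contract and \<open>S(S(h)) u\<close> is
  left.\<close>

lemma drinfeld_conj:
  assumes [simp]: "h \<in> carrier H"
  shows "du ** h = S (S h) ** du"
proof -
  let ?G = "\<lambda>c a b. S (S c) ** (S b ** a)"
  have A: "sweedler H (comult H h) (\<lambda>h' h3. sweedler H R (\<lambda>s t. sweedler H (comult H h') (\<lambda>h1 h2. ?G h3 (s ** h1) (t ** h2))))
    = du ** h"
  proof -
    have "sweedler H (comult H h) (\<lambda>h' h3. sweedler H R (\<lambda>s t. sweedler H (comult H h') (\<lambda>h1 h2. ?G h3 (s ** h1) (t ** h2))))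
      = sweedler H R (\<lambda>s t. sweedler H (comult H h) (\<lambda>h' h3. sweedler H (comult H h') (\<lambda>h1 h2. ?G h3 (s ** h1) (t ** h2))))"
      by (rule R_swap(3)[symmetric]) simp_all
    also have "\<dots> = sweedler H R (\<lambda>s t. sweedler H (comult H h) (\<lambda>h' h3. sweedler H (comult H h') (\<lambda>h1 h2. S (h2 ** S h3) ** (S t ** (s ** h1)))))"
      by (rule R_sum_cong, rule S.sweedler_comult_cong, simp, rule S.sweedler_comult_cong) simp_all
    also have "\<dots> = sweedler H R (\<lambda>s t. sweedler H (comult H h) (\<lambda>h1 h'. sweedler H (comult H h') (\<lambda>h2 h3. S (h2 ** S h3) ** (S t ** (s ** h1)))))"
      by (rule R_sum_cong, rule S.comult_coassoc) ((simp del: S_mult | intro lin_intros)+)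
    also have "\<dots> = sweedler H R (\<lambda>s t. sweedler H (comult H h) (\<lambda>h1 h'. counit H h' \<odot>\<^bsub>H\<^esub> (S \<one>\<^bsub>H\<^esub> ** (S t ** (s ** h1)))))"
      by (rule R_sum_cong, rule S.sweedler_comult_cong, simp, rule S_right) ((simp del: S_mult | intro lin_intros)+)
    also have "\<dots> = sweedler H R (\<lambda>s t. S \<one>\<^bsub>H\<^esub> ** (S t ** (s ** h)))"
      by (rule R_sum_cong, rule S.comult_counit_right) ((simp del: S_mult S_one | intro lin_intros)+)
    also have "\<dots> = sweedler H R (\<lambda>s t. (S t ** s) ** h)"
      by (rule R_sum_cong) simp
    also have "\<dots> = du ** h"
      unfolding drinfeld_def by (rule lin_R_sum[symmetric]) (simp | intro lin_intros)+
    finally show ?thesis .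
  qed
  have B: "sweedler H (comult H h) (\<lambda>h' h3. sweedler H R (\<lambda>s t. sweedler H (comult H h') (\<lambda>h1 h2. ?G h3 (s ** h1) (t ** h2))))
    = S (S h) ** du"
  proof -
    have "sweedler H (comult H h) (\<lambda>h' h3. sweedler H R (\<lambda>s t. sweedler H (comult H h') (\<lambda>h1 h2. ?G h3 (s ** h1) (t ** h2))))
      = sweedler H (comult H h) (\<lambda>h' h3. sweedler H (comult H h') (\<lambda>h1 h2. sweedler H R (\<lambda>s t. ?G h3 (h2 ** s) (h1 ** t))))"
      by (rule S.sweedler_comult_cong, simp, rule R_comult) ((simp del: S_mult | intro lin_intros)+)
    also have "\<dots> = sweedler H (comult H h) (\<lambda>h' h3. sweedler H R (\<lambda>s t. sweedler H (comult H h') (\<lambda>h1 h2. ?G h3 (h2 ** s) (h1 ** t))))"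
      by (rule S.sweedler_comult_cong, simp, rule R_swap(3)[symmetric]) simp_all
    also have "\<dots> = sweedler H (comult H h) (\<lambda>h' h3. sweedler H R (\<lambda>s t. sweedler H (comult H h') (\<lambda>h1 h2. S (S h3) ** (S t ** ((S h1 ** h2) ** s)))))"
      by (rule S.sweedler_comult_cong, simp, rule R_sum_cong, rule S.sweedler_comult_cong) simp_all
    also have "\<dots> = sweedler H (comult H h) (\<lambda>h' h3. sweedler H R (\<lambda>s t. counit H h' \<odot>\<^bsub>H\<^esub> (S (S h3) ** (S t ** (\<one>\<^bsub>H\<^esub> ** s)))))"
      by (rule S.sweedler_comult_cong, simp, rule R_sum_cong, rule S_left) (simp | intro lin_intros)+
    also have "\<dots> = sweedler H R (\<lambda>s t. sweedler H (comult H h) (\<lambda>h' h3. counit H h' \<odot>\<^bsub>H\<^esub> (S (S h3) ** (S t ** (\<one>\<^bsub>H\<^esub> ** s)))))"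
      by (rule R_swap(3)[symmetric]) simp_all
    also have "\<dots> = sweedler H R (\<lambda>s t. S (S h) ** (S t ** (\<one>\<^bsub>H\<^esub> ** s)))"
      by (rule R_sum_cong, rule S.comult_counit) (simp | intro lin_intros)+
    also have "\<dots> = sweedler H R (\<lambda>s t. S (S h) ** (S t ** s))"
      by (rule R_sum_cong) simp
    also have "\<dots> = S (S h) ** du"
      unfolding drinfeld_def by (rule lin_R_sum[symmetric]) (simp | intro lin_intros)+
    finally show ?thesis .
  qed
  show ?thesis using A B by simp
qed


lemma drinfeld_conj':
  assumes "h \<in> carrier H" "k \<in> carrier H"
  shows "du ** (h ** k) = S (S h) ** (du ** k)"
proof -
  have "du ** (h ** k) = (du ** h) ** k" using assms by simp
  also have "\<dots> = (S (S h) ** du) ** k" using assms by (simp only: drinfeld_conj)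
  finally show ?thesis using assms by simp
qed

text \<open>With \<open>drinfeld_conj\<close> and (S \<otimes> S)R = R both products become the sum
  of \<open>S(t' t) s' S(s)\<close>. This is read off from \<open>R\<close> times (S \<otimes> Id)R,
  which is the unit.\<close>

lemma drinfeld_inverse [simp]: "du ** dv = \<one>\<^bsub>H\<^esub>" "dv ** du = \<one>\<^bsub>H\<^esub>"
proof -
  have "du ** dv = sweedler H R (\<lambda>s t. du ** (t ** S (S s)))"
    unfolding drinfeld_inv_def by (rule lin_R_sum) (simp | intro lin_intros)+
  also have "\<dots> = sweedler H R (\<lambda>s t. S (S t) ** (du ** S (S s)))"
    by (rule R_sum_cong) (simp add: drinfeld_conj')
  also have "\<dots> = sweedler H R (\<lambda>s t. sweedler H R (\<lambda>s' t'. S (S t) ** ((S t' ** s') ** S (S s))))"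
    unfolding drinfeld_def by (rule R_sum_cong, rule lin_R_sum) (simp | intro lin_intros)+
  also have "\<dots> = sweedler H R (\<lambda>s t. sweedler H R (\<lambda>s' t'. S t ** ((S t' ** s') ** S s)))"
    by (rule R_SSR) (simp | intro lin_intros)+
  also have "\<dots> = sweedler H R (\<lambda>s' t'. sweedler H R (\<lambda>s t. S t ** ((S t' ** s') ** S s)))"
    by (rule R_swap) simp_all
  also have "\<dots> = sweedler H R (\<lambda>s' t'. sweedler H R (\<lambda>s t. S (t' ** t) ** (s' ** S s)))"
    by (rule R_sum_cong, rule R_sum_cong) simp
  also have "\<dots> = S \<one>\<^bsub>H\<^esub> ** \<one>\<^bsub>H\<^esub>"
    by (rule R_SR) (simp del: S_mult | intro lin_intros)+
  finally show "du ** dv = \<one>\<^bsub>H\<^esub>" by simp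
  have "dv ** du = sweedler H R (\<lambda>s t. (t ** S (S s)) ** du)"
    unfolding drinfeld_inv_def by (rule lin_R_sum) (simp | intro lin_intros)+
  also have "\<dots> = sweedler H R (\<lambda>s t. t ** (du ** s))"
    by (rule R_sum_cong) (simp add: drinfeld_conj)
  also have "\<dots> = sweedler H R (\<lambda>s t. S t ** (du ** S s))"
    by (rule R_SSR[symmetric]) (simp | intro lin_intros)+
  also have "\<dots> = sweedler H R (\<lambda>s t. sweedler H R (\<lambda>s' t'. S t ** ((S t' ** s') ** S s)))"
    unfolding drinfeld_def by (rule R_sum_cong, rule lin_R_sum) (simp | intro lin_intros)+
  also have "\<dots> = sweedler H R (\<lambda>s' t'. sweedler H R (\<lambda>s t. S t ** ((S t' ** s') ** S s)))"
    by (rule R_swap) simp_all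
  also have "\<dots> = sweedler H R (\<lambda>s' t'. sweedler H R (\<lambda>s t. S (t' ** t) ** (s' ** S s)))"
    by (rule R_sum_cong, rule R_sum_cong) simp
  also have "\<dots> = S \<one>\<^bsub>H\<^esub> ** \<one>\<^bsub>H\<^esub>"
    by (rule R_SR) (simp del: S_mult | intro lin_intros)+
  finally show "dv ** du = \<one>\<^bsub>H\<^esub>" by simp
qed

lemma drinfeld_inverse' [simp]:
  "h \<in> carrier H \<Longrightarrow> du ** (dv ** h) = h" "h \<in> carrier H \<Longrightarrow> dv ** (du ** h) = h"
  by (simp_all add: algebra_assoc[OF S.H_algebra, symmetric] del: algebra_assoc[OF S.H_algebra])

text \<open>The square of S is conjugation by the invertible element \<open>du\<close>. Bijectivity
  is thus a consequence of the R-matrix; it makes the \<open>inv_into\<close> in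
  \<open>H_hat\<close> a true inverse.\<close>

lemma S_bij: "bij_betw S (carrier H) (carrier H)"
proof (rule bij_betwI')
  show "S x = S y \<longleftrightarrow> x = y" if [simp]: "x \<in> carrier H" "y \<in> carrier H" for x y
  proof
    assume "S x = S y"
    hence "du ** x = du ** y" by (simp add: drinfeld_conj)
    hence "dv ** (du ** x) = dv ** (du ** y)" by simp
    thus "x = y" by simp
  qed simp
  show "\<exists>x\<in>carrier H. y = S x" if [simp]: "y \<in> carrier H" for y
  proof
    let ?x = "dv ** (y ** du)"
    have "S (S ?x) = (S (S ?x) ** du) ** dv" by simp
    also have "S (S ?x) ** du = du ** ?x" by (rule drinfeld_conj[symmetric]) simp
    also have "\<dots> ** dv = y" by simp
    finally show "y = S (S ?x)" by simp
  qed simp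
qed simp

abbreviation "S' \<equiv> antipode_inv H"

lemma S'_closed [simp]: "h \<in> carrier H \<Longrightarrow> S' h \<in> carrier H"
  and S_S' [simp]: "h \<in> carrier H \<Longrightarrow> S (S' h) = h"
  and S'_S [simp]: "h \<in> carrier H \<Longrightarrow> S' (S h) = h"
  using S_bij by (auto simp: bij_betw_def inv_into_into f_inv_into_f)

lemma S_inject: "x \<in> carrier H \<Longrightarrow> y \<in> carrier H \<Longrightarrow> S x = S y \<Longrightarrow> x = y"
  using S_bij by (auto simp: bij_betw_def inj_on_def)

lemma S'_lin: "S' \<in> linear_maps K H H"
proof (rule linI)
  show "S' (x \<oplus>\<^bsub>H\<^esub> y) = S' x \<oplus>\<^bsub>H\<^esub> S' y" if "x \<in> carrier H" "y \<in> carrier H" for x y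
    by (rule S_inject) (simp_all add: that lin_add[OF S_lin])
  show "S' (c \<odot>\<^bsub>H\<^esub> x) = c \<odot>\<^bsub>H\<^esub> S' x" if "c \<in> carrier K" "x \<in> carrier H" for c x
    by (rule S_inject) (simp_all add: that lin_smult[OF S_lin])
qed simp

lemmas [lin_intros] = lin_comp[OF S'_lin]

lemma S'_one [simp]: "S' \<one>\<^bsub>H\<^esub> = \<one>\<^bsub>H\<^esub>"
  by (rule S_inject) simp_all

lemma S'_mult [simp]:
  assumes "x \<in> carrier H" "y \<in> carrier H"
  shows "S' (x ** y) = S' y ** S' x"
  by (rule S_inject) (simp_all add: assms)

text \<open>The image of the antipode identity under the inverse of S, which reverses products;
  hence the exchanged legs.\<close>

lemma S'_left:
  assumes [simp]: "h \<in> carrier H" and g: "g \<in> linear_maps K H W" and [simp]: "module K W"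
  shows "sweedler W (comult H h) (\<lambda>a b. g (S' b ** a)) = counit H h \<odot>\<^bsub>W\<^esub> g \<one>\<^bsub>H\<^esub>"
proof -
  note [lin_intros] = lin_comp[OF g]
  have "sweedler W (comult H h) (\<lambda>a b. g (S' b ** a)) = sweedler W (comult H h) (\<lambda>a b. g (S' (S a ** b)))"
    by (rule S.sweedler_comult_cong) simp_all
  also have "\<dots> = counit H h \<odot>\<^bsub>W\<^esub> g (S' \<one>\<^bsub>H\<^esub>)"
    by (rule S_left) (simp | intro lin_intros)+
  finally show ?thesis by simp
qed

lemma S'_right:
  assumes [simp]: "h \<in> carrier H" and g: "g \<in> linear_maps K H W" and [simp]: "module K W"
  shows "sweedler W (comult H h) (\<lambda>a b. g (b ** S' a)) = counit H h \<odot>\<^bsub>W\<^esub> g \<one>\<^bsub>H\<^esub>"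
proof -
  note [lin_intros] = lin_comp[OF g]
  have "sweedler W (comult H h) (\<lambda>a b. g (b ** S' a)) = sweedler W (comult H h) (\<lambda>a b. g (S' (a ** S b)))"
    by (rule S.sweedler_comult_cong) simp_all
  also have "\<dots> = counit H h \<odot>\<^bsub>W\<^esub> g (S' \<one>\<^bsub>H\<^esub>)"
    by (rule S_right) (simp | intro lin_intros)+
  finally show ?thesis by simp
qed

lemma R_S'S'R:
  assumes f: "bilin K H H W f" and [simp]: "module K W"
  shows "sweedler W R (\<lambda>s t. f (S' s) (S' t)) = sweedler W R (\<lambda>s t. f s t)"
proof -
  note [lin_intros] = bilin_lin1[OF f] bilin_lin2[OF f]
  have "sweedler W R (\<lambda>s t. f (S' s) (S' t)) = sweedler W R (\<lambda>s t. f (S' (S s)) (S' (S t)))"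
    by (rule R_SSR[symmetric]) (simp | intro lin_intros)+
  also have "\<dots> = sweedler W R (\<lambda>s t. f s t)" by (rule R_sum_cong) simp
  finally show ?thesis .
qed

text \<open>The inverses of \<open>R\<^sub>2\<^sub>1\<close> hidden in the definition of the twisted comultiplication.\<close>

lemma R_S'R:
  assumes f: "bilin K H H W f" and [simp]: "module K W"
  shows "sweedler W R (\<lambda>s t. sweedler W R (\<lambda>s' t'. f (t' ** t) (s ** S' s'))) = f \<one>\<^bsub>H\<^esub> \<one>\<^bsub>H\<^esub>"
    and "sweedler W R (\<lambda>s t. sweedler W R (\<lambda>s' t'. f (t' ** t) (S' s ** s'))) = f \<one>\<^bsub>H\<^esub> \<one>\<^bsub>H\<^esub>"
proof -
  note [lin_intros] = bilin_lin1[OF f] bilin_lin2[OF f]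
  note [simp] = bilin_closed[OF f]
  have "sweedler W R (\<lambda>s t. sweedler W R (\<lambda>s' t'. f (t' ** t) (s ** S' s')))
    = sweedler W R (\<lambda>s' t'. sweedler W R (\<lambda>s t. f (t' ** t) (s ** S' s')))"
    by (rule R_swap) simp_all
  also have "\<dots> = sweedler W R (\<lambda>s' t'. sweedler W R (\<lambda>s t. f (t' ** t) (S' (s' ** S s))))"
    by (rule R_sum_cong, rule R_sum_cong) simp
  also have "\<dots> = f \<one>\<^bsub>H\<^esub> (S' \<one>\<^bsub>H\<^esub>)"
    by (rule R_SR) (simp del: S'_mult | intro lin_intros)+
  finally show "sweedler W R (\<lambda>s t. sweedler W R (\<lambda>s' t'. f (t' ** t) (s ** S' s'))) = f \<one>\<^bsub>H\<^esub> \<one>\<^bsub>H\<^esub>" by simp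
  have "sweedler W R (\<lambda>s t. sweedler W R (\<lambda>s' t'. f (t' ** t) (S' s ** s')))
    = sweedler W R (\<lambda>s' t'. sweedler W R (\<lambda>s t. f (t' ** t) (S' s ** s')))"
    by (rule R_swap) simp_all
  also have "\<dots> = sweedler W R (\<lambda>s' t'. sweedler W R (\<lambda>s t. f (t' ** t) (S' (S s' ** s))))"
    by (rule R_sum_cong, rule R_sum_cong) simp
  also have "\<dots> = f \<one>\<^bsub>H\<^esub> (S' \<one>\<^bsub>H\<^esub>)"
    by (rule SR_R) (simp del: S'_mult | intro lin_intros)+
  finally show "sweedler W R (\<lambda>s t. sweedler W R (\<lambda>s' t'. f (t' ** t) (S' s ** s'))) = f \<one>\<^bsub>H\<^esub> \<one>\<^bsub>H\<^esub>" by simp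
qed

end

text \<open>Copies of the Sweedler sums over \<open>R\<close>, \<open>R\<^sup>-\<^sup>1\<close> and the coproduct as separate constants, guarded where
  necessary, so that each of them has an unconditional congruence rule by which the simplifier
  learns that the summation variables lie in \<open>H\<close>.\<close>

definition (in quasitriangular) "rsum W f = sweedler W R f"
definition (in quasitriangular) "risum W f = sweedler W Ri f"
definition (in quasitriangular) "dsum W h f = (if h \<in> carrier H then sweedler W (comult H h) f else undefined)"

context quasitriangular
begin

lemma sum_folds [simp]:
  "sweedler W R f = rsum W f" "sweedler W Ri f = risum W f"
  "h \<in> carrier H \<Longrightarrow> sweedler W (comult H h) f = dsum W h f"
  by (simp_all add: rsum_def risum_def dsum_def)

lemma sum_congs [cong]:
  assumes "W = W'" and "\<And>a b. a \<in> carrier H \<Longrightarrow> b \<in> carrier H \<Longrightarrow> f a b = g a b"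
  shows "rsum W f = rsum W' g" "risum W f = risum W' g" "h = h' \<Longrightarrow> dsum W h f = dsum W' h' g"
proof -
  have "sweedler W R f = sweedler W R g" "sweedler W Ri f = sweedler W Ri g"
    using assms(2) by (rule R_sum_cong; blast)+
  thus "rsum W f = rsum W' g" "risum W f = risum W' g" using assms(1) by (simp_all add: rsum_def risum_def del: sum_folds)
  show "dsum W h f = dsum W' h' g" if "h = h'"
    using S.sweedler_comult_cong[of h f g W] assms that by (simp add: dsum_def del: sum_folds)
qed

lemma sum_closed [simp]:
  "module K W \<Longrightarrow> (\<And>a b. a \<in> carrier H \<Longrightarrow> b \<in> carrier H \<Longrightarrow> f a b \<in> carrier W) \<Longrightarrow> rsum W f \<in> carrier W"
  "module K W \<Longrightarrow> (\<And>a b. a \<in> carrier H \<Longrightarrow> b \<in> carrier H \<Longrightarrow> f a b \<in> carrier W) \<Longrightarrow> risum W f \<in> carrier W"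
  "h \<in> carrier H \<Longrightarrow> module K W \<Longrightarrow> (\<And>a b. a \<in> carrier H \<Longrightarrow> b \<in> carrier H \<Longrightarrow> f a b \<in> carrier W) \<Longrightarrow> dsum W h f \<in> carrier W"
  by (simp_all add: rsum_def risum_def dsum_def del: sum_folds)

lemma sum_lin [lin_intros]:
  "(\<And>a b. a \<in> carrier H \<Longrightarrow> b \<in> carrier H \<Longrightarrow> (\<lambda>v. F v a b) \<in> linear_maps K V W) \<Longrightarrow>
    module K V \<Longrightarrow> module K W \<Longrightarrow> (\<lambda>v. rsum W (F v)) \<in> linear_maps K V W"
  "(\<And>a b. a \<in> carrier H \<Longrightarrow> b \<in> carrier H \<Longrightarrow> (\<lambda>v. F v a b) \<in> linear_maps K V W) \<Longrightarrow>
    module K V \<Longrightarrow> module K W \<Longrightarrow> (\<lambda>v. risum W (F v)) \<in> linear_maps K V W"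
  "h \<in> carrier H \<Longrightarrow> (\<And>a b. a \<in> carrier H \<Longrightarrow> b \<in> carrier H \<Longrightarrow> (\<lambda>v. F v a b) \<in> linear_maps K V W) \<Longrightarrow>
    module K V \<Longrightarrow> module K W \<Longrightarrow> (\<lambda>v. dsum W h (F v)) \<in> linear_maps K V W"
  unfolding rsum_def risum_def dsum_def by (simp_all add: R_sum_lin S.sweedler_comult_lin(1) del: sum_folds)

lemma dsum_lin2 [lin_intros]:
  assumes "g \<in> linear_maps K V H" "bilin K H H W f" "module K W" "module K V"
  shows "(\<lambda>v. dsum W (g v) f) \<in> linear_maps K V W"
  using S.sweedler_comult_lin(2)[OF assms(1-3)] assms(4)
  by (subst lin_cong[where g="\<lambda>v. sweedler W (comult H (g v)) f"]) (auto simp: lin_closed[OF assms(1)])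

lemma sum_out:
  assumes "F \<in> linear_maps K V W" "module K V" "module K W"
    and "\<And>a b. a \<in> carrier H \<Longrightarrow> b \<in> carrier H \<Longrightarrow> f a b \<in> carrier V"
  shows "F (rsum V f) = rsum W (\<lambda>a b. F (f a b))"
    and "F (risum V f) = risum W (\<lambda>a b. F (f a b))"
    and "h \<in> carrier H \<Longrightarrow> F (dsum V h f) = dsum W h (\<lambda>a b. F (f a b))"
  using lin_sweedler[OF assms(1), of _ H H f] assms
  by (simp_all add: rsum_def risum_def dsum_def del: sum_folds)

lemma sum_out_tens [simp]:
  assumes "module K X" "module K Y" 
    and "\<And>a b. a \<in> carrier H \<Longrightarrow> b \<in> carrier H \<Longrightarrow> f a b \<in> carrier X" "y \<in> carrier Y"
  shows "tens K X Y (rsum X f) y = rsum (tensor K X Y) (\<lambda>a b. tens K X Y (f a b) y)"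
    "tens K X Y (risum X f) y = risum (tensor K X Y) (\<lambda>a b. tens K X Y (f a b) y)"
    "h \<in> carrier H \<Longrightarrow> tens K X Y (dsum X h f) y = dsum (tensor K X Y) h (\<lambda>a b. tens K X Y (f a b) y)"
  by (rule sum_out[where F="\<lambda>u. tens K X Y u y"]; simp add: assms tens_lin1 lin_id)+

lemma sum_out_tens' [simp]:
  assumes "module K X" "module K Y" 
    and "\<And>a b. a \<in> carrier H \<Longrightarrow> b \<in> carrier H \<Longrightarrow> f a b \<in> carrier Y" "x \<in> carrier X"
  shows "tens K X Y x (rsum Y f) = rsum (tensor K X Y) (\<lambda>a b. tens K X Y x (f a b))"
    "tens K X Y x (risum Y f) = risum (tensor K X Y) (\<lambda>a b. tens K X Y x (f a b))"
    "h \<in> carrier H \<Longrightarrow> tens K X Y x (dsum Y h f) = dsum (tensor K X Y) h (\<lambda>a b. tens K X Y x (f a b))"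
  by (rule sum_out[where F="\<lambda>u. tens K X Y x u"]; simp add: assms tens_lin2 lin_id)+

lemma same_ops_sums:
  assumes "same_ops W W'"
  shows "rsum W = rsum W'" "risum W = risum W'" "dsum W = dsum W'"
  using assms by (auto simp: rsum_def risum_def dsum_def sweedler_def same_ops_def fun_eq_iff simp del: sum_folds)

lemmas [simp] = same_ops_sums[OF same_ops_tensor_lmod]

lemma sum_out_fn:
  assumes "g \<in> Arr (lmod_cat K B)" "linear_maps K (src g) (tgt g) = linear_maps K V (tgt g)" "module K V"
    and "\<And>a b. a \<in> carrier H \<Longrightarrow> b \<in> carrier H \<Longrightarrow> f a b \<in> carrier V"
  shows "fn g (rsum V f) = rsum (tgt g) (\<lambda>a b. fn g (f a b))"
    "fn g (risum V f) = risum (tgt g) (\<lambda>a b. fn g (f a b))"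
    "h \<in> carrier H \<Longrightarrow> fn g (dsum V h f) = dsum (tgt g) h (\<lambda>a b. fn g (f a b))"
  using lmod_Arr[OF assms(1)] assms(2-4)
  by (auto intro!: sum_out[where F="fn g"])

lemmas [simp] = sum_out_fn[where B=H]

lemma sum_out_act [simp]:
  assumes "left_module K H X" "h \<in> carrier H" "linear_maps K X X = linear_maps K W W" "module K W"
    and "\<And>a b. a \<in> carrier H \<Longrightarrow> b \<in> carrier H \<Longrightarrow> f a b \<in> carrier W"
  shows "act X h (rsum W f) = rsum W (\<lambda>a b. act X h (f a b))"
    "act X h (risum W f) = risum W (\<lambda>a b. act X h (f a b))"
    "h' \<in> carrier H \<Longrightarrow> act X h (dsum W h' f) = dsum W h' (\<lambda>a b. act X h (f a b))"
  using S.H_act_lin(2)[OF assms(1,2) lin_id] assms(3-5)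
  by (auto intro!: sum_out[where F="act X h"])

lemma T_act_tens [simp]:
  assumes "left_module K H X" "left_module K H Y" "h \<in> carrier H" "x \<in> carrier X" "y \<in> carrier Y"
    "tens K X' Y' = tens K X Y"
  shows "act (S.T X Y) h (tens K X' Y' x y) = dsum (tensor K X Y) h (\<lambda>a b. tens K X Y (act X a x) (act Y b y))"
  using S.T_act_tens[OF assms(1-5)] assms by simp

lemma rsum_swap:
  assumes "module K W"
    "\<And>a b c d. a \<in> carrier H \<Longrightarrow> b \<in> carrier H \<Longrightarrow> c \<in> carrier H \<Longrightarrow> d \<in> carrier H \<Longrightarrow> f a b c d \<in> carrier W"
  shows "rsum W (\<lambda>a b. rsum W (\<lambda>c d. f a b c d)) = rsum W (\<lambda>c d. rsum W (\<lambda>a b. f a b c d))"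
    and "rsum W (\<lambda>a b. risum W (\<lambda>c d. f a b c d)) = risum W (\<lambda>c d. rsum W (\<lambda>a b. f a b c d))"
    and "h \<in> carrier H \<Longrightarrow> rsum W (\<lambda>a b. dsum W h (\<lambda>c d. f a b c d)) = dsum W h (\<lambda>c d. rsum W (\<lambda>a b. f a b c d))"
proof -
  show "rsum W (\<lambda>a b. rsum W (\<lambda>c d. f a b c d)) = rsum W (\<lambda>c d. rsum W (\<lambda>a b. f a b c d))"
    "rsum W (\<lambda>a b. risum W (\<lambda>c d. f a b c d)) = risum W (\<lambda>c d. rsum W (\<lambda>a b. f a b c d))"
    by (rule R_swap(1,2)[OF assms, folded rsum_def risum_def]; assumption)+
  show "rsum W (\<lambda>a b. dsum W h (\<lambda>c d. f a b c d)) = dsum W h (\<lambda>c d. rsum W (\<lambda>a b. f a b c d))" if "h \<in> carrier H"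
    using R_swap(3)[OF assms that] that by (simp only: rsum_def dsum_def if_True simp_thms)
qed

lemma rsum_risum:
  assumes "bilin K H H W f" "module K W"
  shows "rsum W (\<lambda>s t. risum W (\<lambda>s' t'. f (s ** s') (t ** t'))) = f \<one>\<^bsub>H\<^esub> \<one>\<^bsub>H\<^esub>"
    and "risum W (\<lambda>s t. rsum W (\<lambda>s' t'. f (s ** s') (t ** t'))) = f \<one>\<^bsub>H\<^esub> \<one>\<^bsub>H\<^esub>"
  using R_Ri[OF assms] by simp_all

lemma rsum_dsum:
  assumes "h \<in> carrier H" "module K W" "bilin K H H W f"
  shows "rsum W (\<lambda>s t. dsum W h (\<lambda>a b. f (s ** a) (t ** b)))
    = dsum W h (\<lambda>a b. rsum W (\<lambda>s t. f (b ** s) (a ** t)))"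
  using R_comult[OF assms] assms(1) by simp

lemma rsum_dsum_left:
  assumes "module K W" "trilin K H H H W f"
  shows "rsum W (\<lambda>s t. dsum W s (\<lambda>a b. f a b t)) = rsum W (\<lambda>s t. rsum W (\<lambda>s' t'. f s s' (t ** t')))"
proof -
  have "rsum W (\<lambda>s t. dsum W s (\<lambda>a b. f a b t)) = sweedler W R (\<lambda>s t. sweedler W (comult H s) (\<lambda>a b. f a b t))"
    by simp
  thus ?thesis using R_comult_left[OF assms] by simp
qed

lemma rsum_dsum_right:
  assumes "module K W" "trilin K H H H W f"
  shows "rsum W (\<lambda>s t. dsum W t (\<lambda>a b. f s a b)) = rsum W (\<lambda>s t. rsum W (\<lambda>s' t'. f (s ** s') t' t))"
proof -
  have "rsum W (\<lambda>s t. dsum W t (\<lambda>a b. f s a b)) = sweedler W R (\<lambda>s t. sweedler W (comult H t) (\<lambda>a b. f s a b))"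
    by simp
  thus ?thesis using R_comult_right[OF assms] by simp
qed

section \<open>The braided monoidal category of H-modules\<close>

definition braid where "braid X Y = Arrow (S.T X Y)
  (\<lambda>u\<in>carrier (S.T X Y). sweedler (S.T Y X) u (\<lambda>x y.
     sweedler (S.T Y X) R (\<lambda>s t. tens K Y X (act Y t y) (act X s x)))) (S.T Y X)"

definition braid_inv where "braid_inv X Y = Arrow (S.T Y X)
  (\<lambda>u\<in>carrier (S.T Y X). sweedler (S.T X Y) u (\<lambda>y x.
     sweedler (S.T X Y) Ri (\<lambda>s t. tens K X Y (act X s x) (act Y t y)))) (S.T X Y)"

lemma braid_simps [simp]:
  "src (braid X Y) = S.T X Y" "tgt (braid X Y) = S.T Y X"
  "src (braid_inv X Y) = S.T Y X" "tgt (braid_inv X Y) = S.T X Y"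
  by (simp_all add: braid_def braid_inv_def)

context
  fixes X Y :: "('k, ('k, 'a) univ) lmod"
  assumes XY [simp]: "left_module K H X" "left_module K H Y"
begin

lemma braid_bilin:
  "bilin K X Y (tensor K Y X) (\<lambda>x y. rsum (tensor K Y X) (\<lambda>s t. tens K Y X (act Y t y) (act X s x)))"
  "bilin K Y X (tensor K X Y) (\<lambda>y x. risum (tensor K X Y) (\<lambda>s t. tens K X Y (act X s x) (act Y t y)))"
  by (intro lin_intros; simp)+

lemma braid_lin [simp]:
  "fn (braid X Y) \<in> linear_maps K (tensor K X Y) (tensor K Y X)"
  "fn (braid_inv X Y) \<in> linear_maps K (tensor K Y X) (tensor K X Y)"
  using sweedler_linear[OF _ _ _ braid_bilin(1)] sweedler_linear[OF _ _ _ braid_bilin(2)]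
  by (simp_all add: braid_def braid_inv_def) (subst lin_cong; simp)+

lemma braid_tens [simp]:
  assumes "x \<in> carrier X" "y \<in> carrier Y"
  shows "tens K X' Y' = tens K X Y \<Longrightarrow> fn (braid X Y) (tens K X' Y' x y) = rsum (tensor K Y X) (\<lambda>s t. tens K Y X (act Y t y) (act X s x))"
    and "tens K Y' X' = tens K Y X \<Longrightarrow> fn (braid_inv X Y) (tens K Y' X' y x) = risum (tensor K X Y) (\<lambda>s t. tens K X Y (act X s x) (act Y t y))"
  using assms sweedler_tens[OF _ _ _ braid_bilin(1) assms] sweedler_tens[OF _ _ _ braid_bilin(2) assms(2,1)]
  by (simp_all add: braid_def braid_inv_def)

text \<open>Linearity over \<open>H\<close> is the axiom that \<open>R\<close> intertwines the
  coproduct with its opposite.\<close>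

lemma braid_Arr [simp]: "braid X Y \<in> Arr S.LH"
proof -
  have "Arrow (S.T X Y) (fn (braid X Y)) (S.T Y X) \<in> Arr S.LH"
  proof (rule S.lmod_tensor_ArrowI[where X=X and Y=Y])
    show "fn (braid X Y) \<in> extensional (carrier (S.T X Y))" by (simp add: braid_def)
    fix h x y assume [simp]: "h \<in> carrier H" "x \<in> carrier X" "y \<in> carrier Y"
    let ?W = "tensor K Y X"
    have "fn (braid X Y) (act (S.T X Y) h (tens K X Y x y)) =
      dsum ?W h (\<lambda>a b. rsum ?W (\<lambda>s t. tens K Y X (act Y (t ** b) y) (act X (s ** a) x)))"
      by (simp add: sum_out[where F="fn (braid X Y)" and W="?W"])
    also have "\<dots> = rsum ?W (\<lambda>s t. dsum ?W h (\<lambda>a b. tens K Y X (act Y (t ** b) y) (act X (s ** a) x)))"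
      by (rule rsum_swap[symmetric]) simp_all
    also have "\<dots> = dsum ?W h (\<lambda>a b. rsum ?W (\<lambda>s t. tens K Y X (act Y (a ** t) y) (act X (b ** s) x)))"
      by (rule rsum_dsum[where f="\<lambda>c d. tens K Y X (act Y d y) (act X c x)"]; (intro lin_intros)?; simp)
    also have "\<dots> = rsum ?W (\<lambda>s t. dsum ?W h (\<lambda>a b. tens K Y X (act Y (a ** t) y) (act X (b ** s) x)))"
      by (rule rsum_swap[symmetric]) simp_all
    also have "\<dots> = act (S.T Y X) h (fn (braid X Y) (tens K X Y x y))"
      by simp
    finally show "fn (braid X Y) (act (S.T X Y) h (tens K X Y x y)) = act (S.T Y X) h (fn (braid X Y) (tens K X Y x y))" .
  qed simp_all
  thus ?thesis by (simp add: braid_def)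
qed

text \<open>The two composites act by the two products of \<open>R\<close> with its inverse.\<close>

lemma braid_inverse:
  "braid_inv X Y \<in> Arr S.LH"
  "braid_inv X Y \<cdot>\<^bsub>S.LH\<^esub> braid X Y = Idn S.LH (S.T X Y)"
  "braid X Y \<cdot>\<^bsub>S.LH\<^esub> braid_inv X Y = Idn S.LH (S.T Y X)"
proof -
  note l = lin_comp[OF braid_lin(2,1)] lin_comp[OF braid_lin(1,2)]
  have 1: "fn (braid_inv X Y) (fn (braid X Y) u) = u" if "u \<in> carrier (tensor K X Y)" for u
  proof (rule lin_eq_tensor[OF l(1) lin_id _ _ _ _ that])
    fix x y assume [simp]: "x \<in> carrier X" "y \<in> carrier Y"
    let ?W = "tensor K X Y"
    have "fn (braid_inv X Y) (fn (braid X Y) (tens K X Y x y)) = 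
      rsum ?W (\<lambda>s t. risum ?W (\<lambda>s' t'. tens K X Y (act X (s' ** s) x) (act Y (t' ** t) y)))"
      by (simp add: sum_out[where F="fn (braid_inv X Y)" and W="?W"])
    also have "\<dots> = risum ?W (\<lambda>s' t'. rsum ?W (\<lambda>s t. tens K X Y (act X (s' ** s) x) (act Y (t' ** t) y)))"
      by (rule rsum_swap) simp_all
    also have "\<dots> = tens K X Y (act X \<one>\<^bsub>H\<^esub> x) (act Y \<one>\<^bsub>H\<^esub> y)"
      by (rule rsum_risum[where f="\<lambda>a b. tens K X Y (act X a x) (act Y b y)"]; (intro lin_intros)?; simp)
    finally show "fn (braid_inv X Y) (fn (braid X Y) (tens K X Y x y)) = tens K X Y x y" by simp
  qed simp_all
  have 2: "fn (braid X Y) (fn (braid_inv X Y) u) = u" if "u \<in> carrier (tensor K Y X)" for u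
  proof (rule lin_eq_tensor[OF l(2) lin_id _ _ _ _ that])
    fix y x assume [simp]: "y \<in> carrier Y" "x \<in> carrier X"
    let ?W = "tensor K Y X"
    have "fn (braid X Y) (fn (braid_inv X Y) (tens K Y X y x)) = 
      risum ?W (\<lambda>s t. rsum ?W (\<lambda>s' t'. tens K Y X (act Y (t' ** t) y) (act X (s' ** s) x)))"
      by (simp add: sum_out[where F="fn (braid X Y)" and W="?W"])
    also have "\<dots> = rsum ?W (\<lambda>s' t'. risum ?W (\<lambda>s t. tens K Y X (act Y (t' ** t) y) (act X (s' ** s) x)))"
      by (rule rsum_swap[symmetric]) simp_all
    also have "\<dots> = tens K Y X (act Y \<one>\<^bsub>H\<^esub> y) (act X \<one>\<^bsub>H\<^esub> x)"
      by (rule rsum_risum[where f="\<lambda>a b. tens K Y X (act Y b y) (act X a x)"]; (intro lin_intros)?; simp)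
    finally show "fn (braid X Y) (fn (braid_inv X Y) (tens K Y X y x)) = tens K Y X y x" by simp
  qed simp_all
  have ex: "fn (braid_inv X Y) \<in> extensional (carrier (src (braid_inv X Y)))"
    by (simp add: braid_inv_def)
  note * = S.lmod_inverse_Arr[OF braid_Arr, of "braid_inv X Y", OF _ _ _ ex]
  show "braid_inv X Y \<in> Arr S.LH" by (rule *(1)) (simp_all add: 1 2)
  show "braid_inv X Y \<cdot>\<^bsub>S.LH\<^esub> braid X Y = Idn S.LH (S.T X Y)"
    "braid X Y \<cdot>\<^bsub>S.LH\<^esub> braid_inv X Y = Idn S.LH (S.T Y X)"
    using *(2,3) by (simp_all add: 1 2)
qed

end

lemmas [simp] = braid_inverse(1)

lemma braid_nat:
  assumes [simp]: "f \<in> Arr S.LH" "g \<in> Arr S.LH"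
  shows "braid (tgt f) (tgt g) \<cdot>\<^bsub>S.LH\<^esub> tensor_arrow (comult H) f g
    = tensor_arrow (comult H) g f \<cdot>\<^bsub>S.LH\<^esub> braid (src f) (src g)"
proof -
  note [simp] = lmod_Arr[OF assms(1)] lmod_Arr[OF assms(2)]
  show ?thesis
    by (rule lmod_Arr_eq_tensor[where A=H and X="src f" and Y="src g"]) simp_all
qed

text \<open>On pure tensors this hexagon is (Id \<otimes> \<Delta>)R = R13 R12.\<close>

lemma braid_hexagon1:
  assumes [simp]: "left_module K H X" "left_module K H Y" "left_module K H Z"
  shows "S.lassoc Y Z X \<cdot>\<^bsub>S.LH\<^esub> braid X (S.T Y Z) \<cdot>\<^bsub>S.LH\<^esub> S.lassoc X Y Z =
    tensor_arrow (comult H) (Idn S.LH Y) (braid X Z) \<cdot>\<^bsub>S.LH\<^esub> S.lassoc Y X Z \<cdot>\<^bsub>S.LH\<^esub>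
      tensor_arrow (comult H) (braid X Y) (Idn S.LH Z)"
proof (rule lmod_Arr_eq_tensor_left[where A=H and X=X and Y=Y and Z=Z])
  fix x y z assume [simp]: "x \<in> carrier X" "y \<in> carrier Y" "z \<in> carrier Z"
  let ?W = "tensor K Y (tensor K Z X)"
  let ?G = "\<lambda>a b c. tens K Y (tensor K Z X) (act Y b y) (tens K Z X (act Z c z) (act X a x))"
  have "rsum ?W (\<lambda>s t. dsum ?W t (\<lambda>a b. ?G s a b)) = rsum ?W (\<lambda>s t. rsum ?W (\<lambda>s' t'. ?G (s ** s') t' t))"
    by (rule rsum_dsum_right; (intro lin_intros)?; simp)
  also have "\<dots> = rsum ?W (\<lambda>s' t'. rsum ?W (\<lambda>s t. ?G (s ** s') t' t))"
    by (rule rsum_swap) simp_all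
  finally show "fn (S.lassoc Y Z X \<cdot>\<^bsub>S.LH\<^esub> braid X (S.T Y Z) \<cdot>\<^bsub>S.LH\<^esub> S.lassoc X Y Z)
      (tens K (tensor K X Y) Z (tens K X Y x y) z) =
    fn (tensor_arrow (comult H) (Idn S.LH Y) (braid X Z) \<cdot>\<^bsub>S.LH\<^esub> S.lassoc Y X Z \<cdot>\<^bsub>S.LH\<^esub>
      tensor_arrow (comult H) (braid X Y) (Idn S.LH Z)) (tens K (tensor K X Y) Z (tens K X Y x y) z)"
    by (simp add: sum_out[OF tensor_assoc_lin])
qed simp_all

text \<open>On pure tensors this hexagon is (\<Delta> \<otimes> Id)R = R13 R23.\<close>

lemma braid_hexagon2:
  assumes [simp]: "left_module K H X" "left_module K H Y" "left_module K H Z"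
  shows "S.lassoc_inv Z X Y \<cdot>\<^bsub>S.LH\<^esub> braid (S.T X Y) Z \<cdot>\<^bsub>S.LH\<^esub> S.lassoc_inv X Y Z =
    tensor_arrow (comult H) (braid X Z) (Idn S.LH Y) \<cdot>\<^bsub>S.LH\<^esub> S.lassoc_inv X Z Y \<cdot>\<^bsub>S.LH\<^esub>
      tensor_arrow (comult H) (Idn S.LH X) (braid Y Z)"
proof (rule lmod_Arr_eq_tensor_right[where A=H and X=X and Y=Y and Z=Z])
  fix x y z assume [simp]: "x \<in> carrier X" "y \<in> carrier Y" "z \<in> carrier Z"
  let ?W = "tensor K (tensor K Z X) Y"
  let ?G = "\<lambda>a b c. tens K (tensor K Z X) Y (tens K Z X (act Z c z) (act X a x)) (act Y b y)"
  have "rsum ?W (\<lambda>s t. dsum ?W s (\<lambda>a b. ?G a b t)) = rsum ?W (\<lambda>s t. rsum ?W (\<lambda>s' t'. ?G s s' (t ** t')))"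
    by (rule rsum_dsum_left; (intro lin_intros)?; simp)
  also have "\<dots> = rsum ?W (\<lambda>s' t'. rsum ?W (\<lambda>s t. ?G s s' (t ** t')))"
    by (rule rsum_swap) simp_all
  finally show "fn (S.lassoc_inv Z X Y \<cdot>\<^bsub>S.LH\<^esub> braid (S.T X Y) Z \<cdot>\<^bsub>S.LH\<^esub> S.lassoc_inv X Y Z)
      (tens K X (tensor K Y Z) x (tens K Y Z y z)) =
    fn (tensor_arrow (comult H) (braid X Z) (Idn S.LH Y) \<cdot>\<^bsub>S.LH\<^esub> S.lassoc_inv X Z Y \<cdot>\<^bsub>S.LH\<^esub>
      tensor_arrow (comult H) (Idn S.LH X) (braid Y Z)) (tens K X (tensor K Y Z) x (tens K Y Z y z))"
    by (simp add: sum_out[OF tensor_assoc_inv_lin])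
qed simp_all

lemma H_mod_simps [simp]:
  "Obj (H_mod K H) = {M. left_module K H M}" "Arr (H_mod K H) = Arr S.LH" "Dom (H_mod K H) = src" "Cod (H_mod K H) = tgt"
  "Idn (H_mod K H) = Idn S.LH" "Comp (H_mod K H) = Comp S.LH"
  "tensor_obj (H_mod K H) = S.T" "tensor_arr (H_mod K H) = tensor_arrow (comult H)" "unit_obj (H_mod K H) = S.I"
  "associator (H_mod K H) = S.lassoc" "left_unitor (H_mod K H) = S.lunit" "right_unitor (H_mod K H) = S.runit"
  "braiding (H_mod K H) = braid"
  by (simp_all add: H_mod_def cat.defs Let_def lmod_cat_def fun_eq_iff tensor_arrow_def S.lassoc_def S.lunit_def S.runit_def
      braid_def del: sum_folds)

lemma category_H_mod: "category (H_mod K H)"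
proof -
  interpret category S.LH by (rule lmod_category)
  show ?thesis
    using Dom_Obj Cod_Obj Idn_Homs Comp_Homs Comp_Idn Idn_Comp Comp_assoc
    by unfold_locales (simp_all add: Homs_def)
qed

lemma H_mod_inverse:
  assumes "f \<in> Arr S.LH" "g \<in> Arr S.LH" "src g = tgt f" "tgt g = src f"
    "g \<cdot>\<^bsub>S.LH\<^esub> f = Idn S.LH (src f)" "f \<cdot>\<^bsub>S.LH\<^esub> g = Idn S.LH (tgt f)"
  shows "f \<in> Isos (H_mod K H) (src f) (tgt f)" "inv_arr (H_mod K H) f = g"
  using category.inverse_arrowsI[OF category_H_mod, of f "src f" "tgt f" g] assms
  by (auto simp: Homs_def)

lemma H_mod_isos:
  assumes "left_module K H X" "left_module K H Y" "left_module K H Z"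
  shows "S.lassoc X Y Z \<in> Isos (H_mod K H) (S.T (S.T X Y) Z) (S.T X (S.T Y Z))"
    "S.lunit X \<in> Isos (H_mod K H) (S.T S.I X) X" "S.runit X \<in> Isos (H_mod K H) (S.T X S.I) X"
    "braid X Y \<in> Isos (H_mod K H) (S.T X Y) (S.T Y X)"
    and H_mod_inv_simps: "inv_arr (H_mod K H) (S.lassoc X Y Z) = S.lassoc_inv X Y Z"
    "inv_arr (H_mod K H) (braid X Y) = braid_inv X Y"
  using H_mod_inverse[of "S.lassoc X Y Z" "S.lassoc_inv X Y Z"] H_mod_inverse[of "S.lunit X" "S.lunit_inv X"]
    H_mod_inverse[of "S.runit X" "S.runit_inv X"] H_mod_inverse[of "braid X Y" "braid_inv X Y"]
    S.lassoc_inverse[of X Y Z] S.lunit_inverse[of X] S.runit_inverse[of X] braid_inverse[of X Y] assms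
  by simp_all

lemma H_mod_braided_category: "braided_category (H_mod K H)"
proof -
  interpret category "H_mod K H" by (rule category_H_mod)
  note [simp] = Homs_def lmod_Arr H_mod_inv_simps
  show ?thesis
  proof (unfold_locales, goal_cases)
    case (4 f X X' f' X'' g Y Y' g' Y'')
    then show ?case using S.tensor_arrow_Comp[of f f' g g'] by simp
  next
    case (7 f X X' g Y Y' h Z Z')
    then show ?case using S.lassoc_nat[of f g h] by auto
  next
    case (9 f X Y)
    then show ?case using S.lunit_nat[of f] by auto
  next
    case (11 f X Y)
    then show ?case using S.runit_nat[of f] by auto
  next
    case (12 W X Y Z)
    then show ?case using S.lassoc_pentagon[of W X Y Z] by auto
  next
    case (13 X Y)
    then show ?case using S.lunit_triangle[of X Y] by auto
  next
    case (15 f X X' g Y Y')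
    then show ?case using braid_nat[of f g] by auto
  next
    case (16 X Y Z)
    then show ?case using braid_hexagon1[of X Y Z] by auto
  next
    case (17 X Y Z)
    then show ?case using braid_hexagon2[of X Y Z] by auto
  qed (simp_all add: S.tensor_arrow_Idn H_mod_isos[simplified])
qed

end

section \<open>The A-modules as a module category over the H-modules\<close>

locale quasitriangular_comodule = quasitriangular K H
  for K :: "('k, 'r) ring_scheme" and H :: "('k, 'a, 'x) qt_hopf_scheme" +
  fixes A :: "('k, 'a, 'y) comod_alg_scheme"
  assumes comodule: "left_comodule_algebra K H A"

sublocale quasitriangular_comodule \<subseteq> M: comodule_algebra K H A "coact A"
  using comodule S.H_algebra S.H_coalgebra S.comult_hom S.counit_hom
  by unfold_locales (auto simp: left_comodule_algebra_def)

text \<open>Guarded sums over the coaction of \<open>A\<close> and over a coaction on a module.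
  \<open>psum\<close> takes the module as an argument and tests \<open>\<phi> m\<close> itself, so
  that its congruence rule, which places the summation variables in \<open>H\<close> and in that
  module, is unconditional.\<close>

definition (in quasitriangular_comodule)
  "csum W a f = (if a \<in> carrier A then sweedler W (coact A a) f else undefined)"
definition (in quasitriangular_comodule) psum ::
  "('k, ('k, 'a) univ, 'u) module_scheme \<Rightarrow> (('k, 'a) univ \<Rightarrow> ('k, 'a) univ) \<Rightarrow> ('w, 'z) ring_scheme \<Rightarrow>
    ('k, 'a) univ \<Rightarrow> (('k, 'a) univ \<Rightarrow> ('k, 'a) univ \<Rightarrow> 'w) \<Rightarrow> 'w" where
  "psum M \<phi> W m f = (if module K M \<and> \<phi> m \<in> carrier (tensor K H M) then sweedler W (\<phi> m) f else undefined)"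

context quasitriangular_comodule
begin

abbreviation "V \<equiv> tensor_lmod K (coact A)"

lemma csum_fold [simp]: "a \<in> carrier A \<Longrightarrow> sweedler W (coact A a) f = csum W a f"
  by (simp add: csum_def)

lemma csum_cong [cong]:
  assumes "W = W'" "a = a'" "\<And>h b. h \<in> carrier H \<Longrightarrow> b \<in> carrier A \<Longrightarrow> f h b = g h b"
  shows "csum W a f = csum W' a' g"
  using M.sweedler_coact_cong[of a f g W] assms by (simp add: csum_def del: csum_fold)

lemma psum_cong [cong]:
  assumes "W = W'" "m = m'" "\<And>h n. h \<in> carrier H \<Longrightarrow> n \<in> carrier M \<Longrightarrow> f h n = g h n"
  shows "psum M \<phi> W m f = psum M \<phi> W' m' g"
  using sweedler_cong[of "\<phi> m" H M f g W] assms by (simp add: psum_def)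

lemma psum_fold [simp]:
  "\<phi> \<in> linear_maps K M (tensor K H M) \<Longrightarrow> module K M \<Longrightarrow> m \<in> carrier M \<Longrightarrow> sweedler W (\<phi> m) f = psum M \<phi> W m f"
  by (simp add: psum_def lin_closed)

lemma csum_closed [simp]:
  "a \<in> carrier A \<Longrightarrow> module K W \<Longrightarrow> (\<And>h b. h \<in> carrier H \<Longrightarrow> b \<in> carrier A \<Longrightarrow> f h b \<in> carrier W) \<Longrightarrow>
    csum W a f \<in> carrier W"
  by (simp add: csum_def del: csum_fold)

lemma psum_closed [simp]:
  assumes "\<phi> \<in> linear_maps K M (tensor K H M)" "module K M" "m \<in> carrier M" "module K W"
    "\<And>h n. h \<in> carrier H \<Longrightarrow> n \<in> carrier M \<Longrightarrow> f h n \<in> carrier W"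
  shows "psum M \<phi> W m f \<in> carrier W"
  using sweedler_closed[of "\<phi> m" H M W f] assms lin_closed[OF assms(1)] by (simp add: psum_def del: psum_fold)

lemma csum_lin [lin_intros]:
  "a \<in> carrier A \<Longrightarrow> (\<And>h b. h \<in> carrier H \<Longrightarrow> b \<in> carrier A \<Longrightarrow> (\<lambda>v. F v h b) \<in> linear_maps K U W) \<Longrightarrow>
    module K U \<Longrightarrow> module K W \<Longrightarrow> (\<lambda>v. csum W a (F v)) \<in> linear_maps K U W"
  by (simp add: csum_def M.sweedler_coact_lin(1) del: csum_fold)

lemma csum_lin2 [lin_intros]:
  assumes "g \<in> linear_maps K U A" "bilin K H A W f" "module K W" "module K U"
  shows "(\<lambda>v. csum W (g v) f) \<in> linear_maps K U W"
  using M.sweedler_coact_lin(2)[OF assms(1-3)] assms(4)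
  by (subst lin_cong[where g="\<lambda>v. sweedler W (coact A (g v)) f"]) (auto simp: lin_closed[OF assms(1)])

lemma psum_lin [lin_intros]:
  assumes "\<phi> \<in> linear_maps K M (tensor K H M)" "module K M" "m \<in> carrier M"
    "\<And>h n. h \<in> carrier H \<Longrightarrow> n \<in> carrier M \<Longrightarrow> (\<lambda>v. F v h n) \<in> linear_maps K U W" "module K U" "module K W"
  shows "(\<lambda>v. psum M \<phi> W m (F v)) \<in> linear_maps K U W"
  using sweedler_lin_param[of "\<phi> m" H M U W F] assms lin_closed[OF assms(1)] by (simp add: psum_def del: psum_fold)

lemma psum_lin2 [lin_intros]:
  assumes "\<phi> \<in> linear_maps K M (tensor K H M)" "module K M"
    "g \<in> linear_maps K U M" "bilin K H M W f" "module K W" "module K U"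
  shows "(\<lambda>v. psum M \<phi> W (g v) f) \<in> linear_maps K U W"
  using lin_comp[OF lin_comp[OF sweedler_linear[OF _ assms(2,5,4)] assms(1)] assms(3)] assms
  by (subst lin_cong[where g="\<lambda>v. sweedler W (\<phi> (g v)) f"]) (auto simp: lin_closed[OF assms(3)])

lemma csum_out:
  assumes "F \<in> linear_maps K U W" "module K U" "module K W"
    and "\<And>h b. h \<in> carrier H \<Longrightarrow> b \<in> carrier A \<Longrightarrow> f h b \<in> carrier U" "a \<in> carrier A"
  shows "F (csum U a f) = csum W a (\<lambda>h b. F (f h b))"
  using lin_sweedler[OF assms(1), of _ H A f] assms by (simp add: csum_def del: csum_fold)

lemma psum_out:
  assumes "F \<in> linear_maps K U W" "module K U" "module K W"
    and "\<And>h n. h \<in> carrier H \<Longrightarrow> n \<in> carrier M \<Longrightarrow> f h n \<in> carrier U"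
    and "\<phi> \<in> linear_maps K M (tensor K H M)" "module K M" "m \<in> carrier M"
  shows "F (psum M \<phi> U m f) = psum M \<phi> W m (\<lambda>h n. F (f h n))"
  using lin_sweedler[OF assms(1), of "\<phi> m" H M f] assms lin_closed[OF assms(5)] by (simp add: psum_def del: psum_fold)

lemma csum_out_tens [simp]:
  assumes "module K X" "module K Y" "a \<in> carrier A"
  shows "(\<And>h b. h \<in> carrier H \<Longrightarrow> b \<in> carrier A \<Longrightarrow> f h b \<in> carrier X) \<Longrightarrow> y \<in> carrier Y \<Longrightarrow>
      tens K X Y (csum X a f) y = csum (tensor K X Y) a (\<lambda>h b. tens K X Y (f h b) y)"
    and "(\<And>h b. h \<in> carrier H \<Longrightarrow> b \<in> carrier A \<Longrightarrow> f h b \<in> carrier Y) \<Longrightarrow> x \<in> carrier X \<Longrightarrow>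
      tens K X Y x (csum Y a f) = csum (tensor K X Y) a (\<lambda>h b. tens K X Y x (f h b))"
  by (rule csum_out[where F="\<lambda>u. tens K X Y u y"]; simp add: assms tens_lin1 lin_id)
    (rule csum_out[where F="\<lambda>u. tens K X Y x u"]; simp add: assms tens_lin2 lin_id)

lemma psum_out_tens [simp]:
  assumes "module K X" "module K Y" "\<phi> \<in> linear_maps K M (tensor K H M)" "module K M" "m \<in> carrier M"
  shows "(\<And>h b. h \<in> carrier H \<Longrightarrow> b \<in> carrier M \<Longrightarrow> f h b \<in> carrier X) \<Longrightarrow> y \<in> carrier Y \<Longrightarrow>
      tens K X Y (psum M \<phi> X m f) y = psum M \<phi> (tensor K X Y) m (\<lambda>h b. tens K X Y (f h b) y)"
    and "(\<And>h b. h \<in> carrier H \<Longrightarrow> b \<in> carrier M \<Longrightarrow> f h b \<in> carrier Y) \<Longrightarrow> x \<in> carrier X \<Longrightarrow>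
      tens K X Y x (psum M \<phi> Y m f) = psum M \<phi> (tensor K X Y) m (\<lambda>h b. tens K X Y x (f h b))"
  by (rule psum_out[where F="\<lambda>u. tens K X Y u y"]; simp add: assms tens_lin1 lin_id)
    (rule psum_out[where F="\<lambda>u. tens K X Y x u"]; simp add: assms tens_lin2 lin_id)

lemma same_ops_csum: "same_ops W W' \<Longrightarrow> csum W = csum W'"
  by (auto simp: csum_def sweedler_def same_ops_def fun_eq_iff simp del: csum_fold)

lemma same_ops_psum: "same_ops W W' \<Longrightarrow> psum M \<phi> W = psum M \<phi> W'"
  by (auto simp: psum_def sweedler_def same_ops_def fun_eq_iff simp del: psum_fold)

lemmas [simp] = same_ops_csum[OF same_ops_tensor_lmod] same_ops_psum[OF same_ops_tensor_lmod]

lemma psum_tensor_lmod [simp]: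
  assumes "module K X" "module K Y"
  shows "psum (tensor_lmod K d X Y) \<phi> = psum (tensor K X Y) \<phi>"
  using assms by (simp add: psum_def fun_eq_iff)

lemmas [simp] = sum_out_fn[where B=A]

lemma csum_out_fn:
  assumes "g \<in> Arr (lmod_cat K B)" "linear_maps K (src g) (tgt g) = linear_maps K U (tgt g)" "module K U" "a \<in> carrier A"
    and "\<And>h b. h \<in> carrier H \<Longrightarrow> b \<in> carrier A \<Longrightarrow> f h b \<in> carrier U"
  shows "fn g (csum U a f) = csum (tgt g) a (\<lambda>h b. fn g (f h b))"
  using lmod_Arr[OF assms(1)] assms(2-) by (auto intro!: csum_out[where F="fn g"])

lemma psum_out_fn:
  assumes "g \<in> Arr (lmod_cat K B)" "linear_maps K (src g) (tgt g) = linear_maps K U (tgt g)" "module K U"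
    "\<phi> \<in> linear_maps K M (tensor K H M)" "module K M" "m \<in> carrier M"
    and "\<And>h b. h \<in> carrier H \<Longrightarrow> b \<in> carrier M \<Longrightarrow> f h b \<in> carrier U"
  shows "fn g (psum M \<phi> U m f) = psum M \<phi> (tgt g) m (\<lambda>h b. fn g (f h b))"
  using lmod_Arr[OF assms(1)] assms(2-) by (auto intro!: psum_out[where F="fn g"])

lemmas [simp] = csum_out_fn[where B=A] psum_out_fn[where B=A] csum_out_fn[where B=H] psum_out_fn[where B=H]

lemma A_out_act [simp]:
  assumes "left_module K A X" "a \<in> carrier A" "linear_maps K X X = linear_maps K W W" "module K W"
    and "\<And>a b. a \<in> carrier H \<Longrightarrow> b \<in> carrier H \<Longrightarrow> f a b \<in> carrier W"
  shows "act X a (rsum W f) = rsum W (\<lambda>c b. act X a (f c b))"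
    "act X a (risum W f) = risum W (\<lambda>c b. act X a (f c b))"
    "h' \<in> carrier H \<Longrightarrow> act X a (dsum W h' f) = dsum W h' (\<lambda>c b. act X a (f c b))"
  using M.A_act_lin(2)[OF assms(1,2) lin_id] assms(3-5)
  by (auto intro!: sum_out[where F="act X a"])

lemma psum_out_act [simp]:
  assumes "left_module K A X" "a \<in> carrier A" "linear_maps K X X = linear_maps K W W" "module K W"
    "\<phi> \<in> linear_maps K M (tensor K H M)" "module K M" "m \<in> carrier M"
    and "\<And>h b. h \<in> carrier H \<Longrightarrow> b \<in> carrier M \<Longrightarrow> f h b \<in> carrier W"
  shows "act X a (psum M \<phi> W m f) = psum M \<phi> W m (\<lambda>c b. act X a (f c b))"
  using M.A_act_lin(2)[OF assms(1,2) lin_id] assms(3-)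
  by (auto intro!: psum_out[where F="act X a"])

lemma V_act_tens [simp]:
  assumes "left_module K H X" "left_module K A Y" "a \<in> carrier A" "x \<in> carrier X" "y \<in> carrier Y"
    "tens K X' Y' = tens K X Y"
  shows "act (V X Y) a (tens K X' Y' x y) = csum (tensor K X Y) a (\<lambda>h b. tens K X Y (act X h x) (act Y b y))"
  using M.V_act_tens[OF assms(1-5)] assms by simp

lemma csum_psum_swap:
  assumes "module K W" "\<phi> \<in> linear_maps K M (tensor K H M)" "module K M" "m \<in> carrier M"
  shows "a \<in> carrier A \<Longrightarrow>
    (\<And>h b g n. h \<in> carrier H \<Longrightarrow> b \<in> carrier A \<Longrightarrow> g \<in> carrier H \<Longrightarrow> n \<in> carrier M \<Longrightarrow> f h b g n \<in> carrier W) \<Longrightarrow>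
    csum W a (\<lambda>h b. psum M \<phi> W m (\<lambda>g n. f h b g n)) = psum M \<phi> W m (\<lambda>g n. csum W a (\<lambda>h b. f h b g n))"
  and psum_dsum_swap: "h' \<in> carrier H \<Longrightarrow>
    (\<And>h b g n. h \<in> carrier H \<Longrightarrow> b \<in> carrier H \<Longrightarrow> g \<in> carrier H \<Longrightarrow> n \<in> carrier M \<Longrightarrow> f' h b g n \<in> carrier W) \<Longrightarrow>
    psum M \<phi> W m (\<lambda>g n. dsum W h' (\<lambda>h b. f' h b g n)) = dsum W h' (\<lambda>h b. psum M \<phi> W m (\<lambda>g n. f' h b g n))"
  and psum_rsum_swap: "
    (\<And>h b g n. h \<in> carrier H \<Longrightarrow> b \<in> carrier H \<Longrightarrow> g \<in> carrier H \<Longrightarrow> n \<in> carrier M \<Longrightarrow> f' h b g n \<in> carrier W) \<Longrightarrow>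
    psum M \<phi> W m (\<lambda>g n. rsum W (\<lambda>h b. f' h b g n)) = rsum W (\<lambda>h b. psum M \<phi> W m (\<lambda>g n. f' h b g n))"
  and psum_risum_swap: "
    (\<And>h b g n. h \<in> carrier H \<Longrightarrow> b \<in> carrier H \<Longrightarrow> g \<in> carrier H \<Longrightarrow> n \<in> carrier M \<Longrightarrow> f' h b g n \<in> carrier W) \<Longrightarrow>
    psum M \<phi> W m (\<lambda>g n. risum W (\<lambda>h b. f' h b g n)) = risum W (\<lambda>h b. psum M \<phi> W m (\<lambda>g n. f' h b g n))"
  using assms lin_closed[OF assms(2)] sweedler_swap[of "coact A a" H A "\<phi> m" H M W f]
    sweedler_swap[of "\<phi> m" H M "comult H h'" H H W "\<lambda>g n h b. f' h b g n"]
    sweedler_swap[of "\<phi> m" H M R H H W "\<lambda>g n h b. f' h b g n"]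
    sweedler_swap[of "\<phi> m" H M Ri H H W "\<lambda>g n h b. f' h b g n"]
  by (simp_all add: psum_def dsum_def rsum_def risum_def csum_def del: sum_folds csum_fold psum_fold)

lemma csum_rsum_swap:
  assumes "module K W" "a \<in> carrier A"
    "\<And>h b g n. h \<in> carrier H \<Longrightarrow> b \<in> carrier A \<Longrightarrow> g \<in> carrier H \<Longrightarrow> n \<in> carrier H \<Longrightarrow> f h b g n \<in> carrier W"
  shows "rsum W (\<lambda>g n. csum W a (\<lambda>h b. f h b g n)) = csum W a (\<lambda>h b. rsum W (\<lambda>g n. f h b g n))"
  using assms sweedler_swap[of R H H "coact A a" H A W "\<lambda>g n h b. f h b g n"]
  by (simp add: rsum_def csum_def del: sum_folds csum_fold)

lemma csum_coassoc:
  assumes "a \<in> carrier A" "trilin K H H A W f" "module K W"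
  shows "csum W a (\<lambda>h b. dsum W h (\<lambda>h1 h2. f h1 h2 b)) = csum W a (\<lambda>h b. csum W b (\<lambda>h' b'. f h h' b'))"
proof -
  have "csum W a (\<lambda>h b. dsum W h (\<lambda>h1 h2. f h1 h2 b)) = sweedler W (coact A a) (\<lambda>h b. sweedler W (comult H h) (\<lambda>h1 h2. f h1 h2 b))"
    using assms(1) by simp
  thus ?thesis using M.coact_coassoc[OF assms] assms(1) by simp
qed

lemma dsum_coassoc:
  assumes "h \<in> carrier H" "trilin K H H H W f" "module K W"
  shows "dsum W h (\<lambda>y c. dsum W y (\<lambda>a b. f a b c)) = dsum W h (\<lambda>a y. dsum W y (\<lambda>b c. f a b c))"
proof -
  have "dsum W h (\<lambda>y c. dsum W y (\<lambda>a b. f a b c)) = sweedler W (comult H h) (\<lambda>y c. sweedler W (comult H y) (\<lambda>a b. f a b c))"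
    using assms(1) by simp
  thus ?thesis using S.comult_coassoc[OF assms] assms(1) by simp
qed

lemma A_mod_simps [simp]:
  "Obj (A_mod K H A) = {M. left_module K A M}" "Arr (A_mod K H A) = Arr M.LA" "Dom (A_mod K H A) = src" "Cod (A_mod K H A) = tgt"
  "Idn (A_mod K H A) = Idn M.LA" "Comp (A_mod K H A) = Comp M.LA"
  "act_obj (A_mod K H A) = V" "act_arr (A_mod K H A) = tensor_arrow (coact A)"
  "act_assoc (A_mod K H A) = M.lassoc" "act_unit (A_mod K H A) = M.lunit"
  by (simp_all add: A_mod_def cat.defs Let_def lmod_cat_def fun_eq_iff tensor_arrow_def M.lassoc_def M.lunit_def)

lemma category_A_mod: "category (A_mod K H A)"
proof -
  interpret category M.LA by (rule lmod_category)
  show ?thesis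
    using Dom_Obj Cod_Obj Idn_Homs Comp_Homs Comp_Idn Idn_Comp Comp_assoc
    by unfold_locales (simp_all add: Homs_def)
qed

lemma A_mod_inverse:
  assumes "f \<in> Arr M.LA" "g \<in> Arr M.LA" "src g = tgt f" "tgt g = src f"
    "g \<cdot>\<^bsub>M.LA\<^esub> f = Idn M.LA (src f)" "f \<cdot>\<^bsub>M.LA\<^esub> g = Idn M.LA (tgt f)"
  shows "f \<in> Isos (A_mod K H A) (src f) (tgt f)" "inv_arr (A_mod K H A) f = g"
  using category.inverse_arrowsI[OF category_A_mod, of f "src f" "tgt f" g] assms
  by (auto simp: Homs_def)

lemma A_mod_isos:
  assumes "left_module K H X" "left_module K H Y" "left_module K A P"
  shows "M.lassoc X Y P \<in> Isos (A_mod K H A) (V (S.T X Y) P) (V X (V Y P))"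
    "M.lunit P \<in> Isos (A_mod K H A) (V S.I P) P"
    and A_mod_inv_simps [simp]: "inv_arr (A_mod K H A) (M.lassoc X Y P) = M.lassoc_inv X Y P"
  using A_mod_inverse[of "M.lassoc X Y P" "M.lassoc_inv X Y P"] A_mod_inverse[of "M.lunit P" "M.lunit_inv P"]
    M.lassoc_inverse[of X Y P] M.lunit_inverse[of P] assms
  by simp_all

lemma A_mod_module_category: "module_category (H_mod K H) (A_mod K H A)"
proof -
  interpret C: braided_category "H_mod K H" by (rule H_mod_braided_category)
  interpret category "A_mod K H A" by (rule category_A_mod)
  note [simp] = Homs_def lmod_Arr
  show ?thesis
  proof (unfold_locales, goal_cases)
    case (4 g X X' g' X'' f P P' f' P'')
    then show ?case using M.tensor_arrow_Comp[of g g' f f'] by simp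
  next
    case (6 g X X' h Y Y' f P P')
    then show ?case using M.lassoc_nat[of g h f] by auto
  next
    case (8 f P P')
    then show ?case using M.lunit_nat[of f] by auto
  next
    case (9 X Y Z P)
    then show ?case using M.lassoc_pentagon[of X Y Z P] by auto
  next
    case (10 X P)
    then show ?case using M.lunit_triangle[of X P] by auto
  qed (simp_all add: M.tensor_arrow_Idn A_mod_isos(1)[simplified]
      A_mod_isos(2)[OF S.I_left_module S.I_left_module, simplified])
qed

end

section \<open>Doi-Hopf modules described without the antipode\<close>

context base_ring
begin

lemma bilin_lift:
  assumes "module K X" "module K Y" "module K W" "bilin K X Y W f"
  obtains F where "F \<in> linear_maps K (tensor K X Y) W"
    "\<And>x y. x \<in> carrier X \<Longrightarrow> y \<in> carrier Y \<Longrightarrow> F (tens K X Y x y) = f x y"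
  using sweedler_linear[OF assms] sweedler_tens[OF assms] by blast

lemma trilin_lift:
  assumes "module K X" "module K Y" "module K Z" "module K W" and f: "trilin K X Y Z W f"
  obtains F where "F \<in> linear_maps K (tensor K (tensor K X Y) Z) W"
    "\<And>x y z. x \<in> carrier X \<Longrightarrow> y \<in> carrier Y \<Longrightarrow> z \<in> carrier Z \<Longrightarrow>
      F (tens K (tensor K X Y) Z (tens K X Y x y) z) = f x y z"
proof (rule that)
  note b = sweedler_left[OF assms]
  show "(\<lambda>w. sweedler W w (\<lambda>u z. sweedler W u (\<lambda>x y. f x y z))) \<in> linear_maps K (tensor K (tensor K X Y) Z) W"
    by (rule sweedler_linear) (simp_all add: assms b)
  fix x y z assume [simp]: "x \<in> carrier X" "y \<in> carrier Y" "z \<in> carrier Z"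
  have "bilin K X Y W (\<lambda>x y. f x y z)"
    by (intro bilinI trilin_lin1[OF f lin_id] trilin_lin2[OF f _ lin_id]) simp_all
  thus "sweedler W (tens K (tensor K X Y) Z (tens K X Y x y) z) (\<lambda>u z. sweedler W u (\<lambda>x y. f x y z)) = f x y z"
    by (simp add: sweedler_tens[OF _ _ _ b] sweedler_tens assms)
qed

end

context quasitriangular_comodule
begin

lemma H_hat_same_ops: "same_ops (H_hat K H) H"
  by (simp add: same_ops_def H_hat_def module.defs)

lemmas H_hat_simps [simp] = same_ops_simps[OF H_hat_same_ops]

lemma H_hat_simps' [simp]: "carrier (H_hat K H) = carrier H" "counit (H_hat K H) = counit H"
  "module K (H_hat K H)"
  using H_hat_same_ops same_ops_module[OF H_hat_same_ops algebra_module[OF S.H_algebra]]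
  by (simp_all add: same_ops_def) (simp add: H_hat_def module.defs)

lemma H_hat_comult [simp]:
  "c \<in> carrier H \<Longrightarrow> comult (H_hat K H) c = rsum HH (\<lambda>s t. rsum HH (\<lambda>s' t'. dsum HH c (\<lambda>a b.
    tens K H H (t' ** (a ** t)) (b ** (s ** S' s')))))"
  by (simp add: H_hat_def module.defs)

lemma H_hat_act_eq [simp]:
  "l \<in> carrier H \<Longrightarrow> h \<in> carrier H \<Longrightarrow> H_hat_act H l h = dsum H l (\<lambda>a b. b ** (h ** S' a))"
  by (simp add: H_hat_act_def)

text \<open>A Doi-Hopf module with the antipodes cleared and the comultiplication of
  \<open>H\<close> in place of that of \<open>H_hat\<close>. For the operators x \<otimes> m
  \<mapsto> m_{-1} x \<otimes> m_0 the equation with \<open>tt\<close> is a form of BM1, and the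
  last equation is linearity over \<open>A\<close>.\<close>

definition refl_coaction :: "('k, ('k, 'a) univ) lmod \<Rightarrow> (('k, 'a) univ \<Rightarrow> ('k, 'a) univ) \<Rightarrow> bool" where
  "refl_coaction M \<phi> \<longleftrightarrow> (let HM = tensor K H M; HHM = tensor K HH M; tt = (\<lambda>a b. tens K HH M (tens K H H a b)) in
    left_module K A M \<and> \<phi> \<in> extensional (carrier M) \<and> \<phi> \<in> linear_maps K M HM \<and>
    (\<forall>m\<in>carrier M. psum M \<phi> M m (\<lambda>h n. counit H h \<odot>\<^bsub>M\<^esub> n) = m) \<and>
    (\<forall>m\<in>carrier M.
       psum M \<phi> HHM m (\<lambda>h n. dsum HHM h (\<lambda>a b. rsum HHM (\<lambda>s t. tt (a ** t) (b ** s) n)))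
       = psum M \<phi> HHM m (\<lambda>h n. psum M \<phi> HHM n (\<lambda>g n'. rsum HHM (\<lambda>s t. tt (t ** h) (g ** s) n')))) \<and>
    (\<forall>a\<in>carrier A. \<forall>m\<in>carrier M.
       csum HM a (\<lambda>l b. psum M \<phi> HM (act M b m) (\<lambda>h n. tens K H M (h ** l) n))
       = csum HM a (\<lambda>l b. psum M \<phi> HM m (\<lambda>h n. tens K H M (l ** h) (act M b n)))))"

lemma refl_coactionD:
  assumes "refl_coaction M \<phi>"
  shows "left_module K A M" "\<phi> \<in> extensional (carrier M)" "\<phi> \<in> linear_maps K M (tensor K H M)" "module K M"
  using assms by (simp_all add: refl_coaction_def Let_def)

context
  fixes M :: "('k, ('k, 'a) univ) lmod" and \<phi> :: "('k, 'a) univ \<Rightarrow> ('k, 'a) univ"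
  assumes M\<phi>: "refl_coaction M \<phi>"
begin

lemmas [simp] = refl_coactionD[OF M\<phi>] psum_fold[OF refl_coactionD(3,4)[OF M\<phi>]]

lemma refl_counit:
  assumes g: "g \<in> linear_maps K M W" and [simp]: "m \<in> carrier M" "module K W"
  shows "psum M \<phi> W m (\<lambda>h n. counit H h \<odot>\<^bsub>W\<^esub> g n) = g m"
proof -
  have "g m = g (psum M \<phi> M m (\<lambda>h n. counit H h \<odot>\<^bsub>M\<^esub> n))"
    using M\<phi> by (simp add: refl_coaction_def Let_def)
  also have "\<dots> = psum M \<phi> W m (\<lambda>h n. g (counit H h \<odot>\<^bsub>M\<^esub> n))"
    by (rule psum_out[OF g]) simp_all
  finally show ?thesis by (simp add: lin_smult[OF g])
qed

text \<open>The defining equation lives in one fixed tensor space; the linear map induced by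
  \<open>f\<close> carries it to the place where a computation needs it.\<close>

lemma refl_braid:
  assumes [simp]: "m \<in> carrier M" "module K W" and f: "trilin K H H M W f"
  shows "psum M \<phi> W m (\<lambda>h n. dsum W h (\<lambda>a b. rsum W (\<lambda>s t. f (a ** t) (b ** s) n)))
       = psum M \<phi> W m (\<lambda>h n. psum M \<phi> W n (\<lambda>g n'. rsum W (\<lambda>s t. f (t ** h) (g ** s) n')))"
proof -
  obtain F where F: "F \<in> linear_maps K (tensor K HH M) W"
    and Ft [simp]: "\<And>x y z. x \<in> carrier H \<Longrightarrow> y \<in> carrier H \<Longrightarrow> z \<in> carrier M \<Longrightarrow>
      F (tens K HH M (tens K H H x y) z) = f x y z"
    using trilin_lift[OF _ _ _ _ f] by auto
  let ?W = "tensor K HH M" and ?tt = "\<lambda>a b. tens K HH M (tens K H H a b)"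
  have "psum M \<phi> ?W m (\<lambda>h n. dsum ?W h (\<lambda>a b. rsum ?W (\<lambda>s t. ?tt (a ** t) (b ** s) n)))
       = psum M \<phi> ?W m (\<lambda>h n. psum M \<phi> ?W n (\<lambda>g n'. rsum ?W (\<lambda>s t. ?tt (t ** h) (g ** s) n')))"
    using M\<phi> by (simp add: refl_coaction_def Let_def)
  from arg_cong[OF this, of F] show ?thesis
    by (simp add: psum_out[OF F] sum_out[OF F])
qed

lemma refl_act:
  assumes [simp]: "a \<in> carrier A" "m \<in> carrier M" "module K W" and f: "bilin K H M W f"
  shows "csum W a (\<lambda>l b. psum M \<phi> W (act M b m) (\<lambda>h n. f (h ** l) n))
       = csum W a (\<lambda>l b. psum M \<phi> W m (\<lambda>h n. f (l ** h) (act M b n)))"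
proof -
  obtain F where F: "F \<in> linear_maps K (tensor K H M) W"
    and Ft [simp]: "\<And>x y. x \<in> carrier H \<Longrightarrow> y \<in> carrier M \<Longrightarrow> F (tens K H M x y) = f x y"
    using bilin_lift[OF _ _ _ f] by auto
  let ?W = "tensor K H M"
  have "csum ?W a (\<lambda>l b. psum M \<phi> ?W (act M b m) (\<lambda>h n. tens K H M (h ** l) n))
       = csum ?W a (\<lambda>l b. psum M \<phi> ?W m (\<lambda>h n. tens K H M (l ** h) (act M b n)))"
    using M\<phi> by (simp add: refl_coaction_def Let_def)
  from arg_cong[OF this, of F] show ?thesis
    by (simp add: psum_out[OF F] csum_out[OF F])
qed

text \<open>Coassociativity for the comultiplication of \<open>H_hat\<close>.
  \<open>refl_braid\<close> replaces the coproduct by the iterated coaction, and then the two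
  remaining copies of \<open>R\<close>, one of them with an inverse antipode, cancel.\<close>

lemma refl_coassoc:
  assumes [simp]: "m \<in> carrier M" "module K W" and F: "trilin K H H M W F"
  shows "psum M \<phi> W m (\<lambda>c n. rsum W (\<lambda>s t. rsum W (\<lambda>s' t'. dsum W c (\<lambda>a b.
      F (t' ** (a ** t)) (b ** (s ** S' s')) n))))
    = psum M \<phi> W m (\<lambda>h n. psum M \<phi> W n (\<lambda>g n'. F h g n'))"
proof -
  note [lin_intros] = trilin_lin1[OF F] trilin_lin2[OF F] trilin_lin3[OF F]
  note [simp] = trilin_closed[OF F]
  have "psum M \<phi> W m (\<lambda>c n. rsum W (\<lambda>s t. rsum W (\<lambda>s' t'. dsum W c (\<lambda>a b.
      F (t' ** (a ** t)) (b ** (s ** S' s')) n))))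
    = psum M \<phi> W m (\<lambda>c n. dsum W c (\<lambda>a b. rsum W (\<lambda>s t. rsum W (\<lambda>s' t'.
      F (t' ** (a ** t)) ((b ** s) ** S' s') n))))"
    by (simp add: rsum_swap(3))
  also have "\<dots> = psum M \<phi> W m (\<lambda>h n. psum M \<phi> W n (\<lambda>g n'. rsum W (\<lambda>s t. rsum W (\<lambda>s' t'.
      F (t' ** (t ** h)) ((g ** s) ** S' s') n'))))"
    by (rule refl_braid; (intro lin_intros)?; simp)
  also have "\<dots> = psum M \<phi> W m (\<lambda>h n. psum M \<phi> W n (\<lambda>g n'. F h g n'))"
  proof (intro psum_cong HOL.refl)
    fix h n g n' assume [simp]: "h \<in> carrier H" "n \<in> carrier M" "g \<in> carrier H" "n' \<in> carrier M"
    have "sweedler W R (\<lambda>s t. sweedler W R (\<lambda>s' t'. F ((t' ** t) ** h) (g ** (s ** S' s')) n'))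
      = F (\<one>\<^bsub>H\<^esub> ** h) (g ** \<one>\<^bsub>H\<^esub>) n'"
      by (rule R_S'R(1); (intro lin_intros)?; simp)
    thus "rsum W (\<lambda>s t. rsum W (\<lambda>s' t'. F (t' ** (t ** h)) ((g ** s) ** S' s') n')) = F h g n'"
      by simp
  qed
  finally show ?thesis .
qed

text \<open>The counit of l is expanded as \<open>l2 S'(l1)\<close> to the right of the
  \<open>H\<close>-part h of the coaction. By coassociativity l2 is available to
  \<open>refl_act\<close>, which moves it to the left of h.\<close>

lemma refl_compat:
  assumes [simp]: "a \<in> carrier A" "m \<in> carrier M"
  shows "\<phi> (act M a m) = csum (tensor K H M) a (\<lambda>l b. psum M \<phi> (tensor K H M) m (\<lambda>h n. dsum (tensor K H M) l (\<lambda>l1 l2.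
    tens K H M (l2 ** (h ** S' l1)) (act M b n))))"
proof -
  let ?W = "tensor K H M"
  note [lin_intros] = lin_comp[OF refl_coactionD(3)[OF M\<phi>]]
  have [simp]: "n \<in> carrier M \<Longrightarrow> \<phi> n \<in> carrier ?W" for n
    by (rule lin_closed) auto
  have eta: "\<phi> n = psum M \<phi> ?W n (\<lambda>h n. tens K H M h n)" if "n \<in> carrier M" for n
  proof -
    have "psum M \<phi> ?W n (\<lambda>h n. tens K H M h n) = sweedler ?W (\<phi> n) (\<lambda>h n. tens K H M h n)"
      using that by simp
    also have "\<dots> = \<phi> n" by (rule sweedler_eta) (simp_all add: that)
    finally show ?thesis by (rule HOL.sym)
  qed
  have "\<phi> (act M a m) = sweedler ?W (coact A a) (\<lambda>l b. counit H l \<odot>\<^bsub>?W\<^esub> \<phi> (act M b m))"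
    by (rule M.coact_counit[symmetric]; (intro lin_intros)?; simp)
  also have "\<dots> = csum ?W a (\<lambda>l b. counit H l \<odot>\<^bsub>?W\<^esub> psum M \<phi> ?W (act M b m) (\<lambda>h n. tens K H M h n))"
    by (simp, intro csum_cong HOL.refl, subst eta, simp_all)
  also have "\<dots> = csum ?W a (\<lambda>l b. psum M \<phi> ?W (act M b m) (\<lambda>h n. counit H l \<odot>\<^bsub>?W\<^esub> tens K H M (h ** \<one>\<^bsub>H\<^esub>) n))"
    by (intro csum_cong HOL.refl, subst psum_out[OF lin_smult_const[OF lin_id]]) simp_all
  \<comment> \<open>The sum is written with \<open>sweedler\<close> because \<open>S'_right\<close>
    is stated in that form; the simplifier folds it into \<open>dsum\<close> afterwards.\<close>
  also have "\<dots> = csum ?W a (\<lambda>l b. psum M \<phi> ?W (act M b m) (\<lambda>h n. sweedler ?W (comult H l) (\<lambda>l1 l2. tens K H M (h ** (l2 ** S' l1)) n)))"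
    by (intro csum_cong psum_cong HOL.refl, rule S'_right[symmetric]; (intro lin_intros)?; simp)
  also have "\<dots> = csum ?W a (\<lambda>l b. dsum ?W l (\<lambda>l1 l2. psum M \<phi> ?W (act M b m) (\<lambda>h n. tens K H M (h ** (l2 ** S' l1)) n)))"
    by (simp add: psum_dsum_swap)
  also have "\<dots> = csum ?W a (\<lambda>l1 b. csum ?W b (\<lambda>l2 b. psum M \<phi> ?W (act M b m) (\<lambda>h n. tens K H M ((h ** l2) ** S' l1) n)))"
    by (subst csum_coassoc; (intro lin_intros)?; simp)
  also have "\<dots> = csum ?W a (\<lambda>l1 b. csum ?W b (\<lambda>l2 b. psum M \<phi> ?W m (\<lambda>h n. tens K H M ((l2 ** h) ** S' l1) (act M b n))))"
    by (rule csum_cong[OF HOL.refl HOL.refl], rule refl_act; (intro lin_intros)?; simp)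
  also have "\<dots> = csum ?W a (\<lambda>l b. dsum ?W l (\<lambda>l1 l2. psum M \<phi> ?W m (\<lambda>h n. tens K H M ((l2 ** h) ** S' l1) (act M b n))))"
    by (rule csum_coassoc[symmetric]; (intro lin_intros)?; simp)
  finally show ?thesis by (simp add: psum_dsum_swap)
qed

lemma refl_coaction_DH_obj: "(M, \<phi>) \<in> DH_obj K H A"
proof -
  have ext: "\<phi> (act M a m) = csum (tensor K H M) a (\<lambda>l b. psum M \<phi> (tensor K H M) m (\<lambda>h n. tens K H M (H_hat_act H l h) (act M b n)))"
    if "a \<in> carrier A" "m \<in> carrier M" for a m
    using refl_compat[OF that] that by simp
  have "psum M \<phi> (tensor K HH M) m (\<lambda>c n. tens K HH M (comult (H_hat K H) c) n) =
    psum M \<phi> (tensor K HH M) m (\<lambda>c n. psum M \<phi> (tensor K HH M) n (\<lambda>d n'. tens K HH M (tens K H H c d) n'))"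
    if [simp]: "m \<in> carrier M" for m
  proof -
    have "trilin K H H M (tensor K HH M) (\<lambda>a b n. tens K HH M (tens K H H a b) n)"
      by (intro lin_intros) simp_all
    from refl_coassoc[OF that _ this] show ?thesis by simp
  qed
  moreover have "psum M \<phi> M m (\<lambda>h n. counit H h \<odot>\<^bsub>M\<^esub> n) = m" if "m \<in> carrier M" for m
    using refl_counit[OF lin_id] that by simp
  ultimately show ?thesis
    using ext refl_coactionD[OF M\<phi>] by (simp add: DH_obj_def left_comodule_def)
qed

end

text \<open>The converse of \<open>refl_coaction_DH_obj\<close>. Multiplying coassociativity by
  \<open>t\<close> on the left of its first leg and by \<open>s\<close> on the right of its second
  removes the copy of \<open>R\<close> with the inverse antipode; multiplying the compatibility by l
  on the right removes the inverse antipode there.\<close>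

lemma DH_obj_refl_coaction:
  assumes "(M, \<phi>) \<in> DH_obj K H A"
  shows "refl_coaction M \<phi>"
proof -
  let ?W = "tensor K HH M" and ?tt = "\<lambda>a b. tens K HH M (tens K H H a b)"
  have [simp]: "left_module K A M" and ext: "\<phi> \<in> extensional (carrier M)" and com: "left_comodule K (H_hat K H) M \<phi>"
    using assms by (simp_all add: DH_obj_def)
  have [simp]: "module K M" "\<phi> \<in> linear_maps K M (tensor K H M)"
    using com by (simp_all add: left_comodule_def)
  note [simp] = psum_fold[of \<phi> M]
  have [simp]: "n \<in> carrier M \<Longrightarrow> \<phi> n \<in> carrier (tensor K H M)" for n
    by (rule lin_closed) auto
  have coassoc: "psum M \<phi> U m (\<lambda>c n. rsum U (\<lambda>s t. rsum U (\<lambda>s' t'. dsum U c (\<lambda>a b.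
      F (t' ** (a ** t)) (b ** (s ** S' s')) n))))
    = psum M \<phi> U m (\<lambda>h n. psum M \<phi> U n (\<lambda>g n'. F h g n'))"
    if [simp]: "m \<in> carrier M" "module K U" and F: "trilin K H H M U F"
    for m F and U :: "('k, ('k, 'a) univ) module"
  proof -
    note [lin_intros] = trilin_lin1[OF F] trilin_lin2[OF F] trilin_lin3[OF F]
    note [simp] = trilin_closed[OF F]
    have "sweedler U (\<phi> m) (\<lambda>c n. sweedler U (comult (H_hat K H) c) (\<lambda>a b. F a b n)) =
      sweedler U (\<phi> m) (\<lambda>c n. sweedler U (\<phi> n) (\<lambda>d n'. F c d n'))"
      by (rule comodule_assoc[OF com]) (simp_all add: F trilin_def bilin_def F[unfolded trilin_def bilin_def])
    moreover have "sweedler U (rsum HH (\<lambda>s t. rsum HH (\<lambda>s' t'. dsum HH c (\<lambda>a b.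
        tens K H H (t' ** (a ** t)) (b ** (s ** S' s')))))) (\<lambda>a b. F a b n)
      = rsum U (\<lambda>s t. rsum U (\<lambda>s' t'. dsum U c (\<lambda>a b. F (t' ** (a ** t)) (b ** (s ** S' s')) n)))"
      if [simp]: "c \<in> carrier H" "n \<in> carrier M" for c n
    proof -
      have b: "bilin K H H U (\<lambda>a b. F a b n)" by (intro lin_intros) simp_all
      note l = sweedler_linear[OF _ _ _ b]
      show ?thesis by (simp add: sum_out[OF l] sweedler_tens[OF _ _ _ b])
    qed
    ultimately show ?thesis by simp
  qed
  have compat: "\<phi> (act M a m) = csum (tensor K H M) a (\<lambda>l b. psum M \<phi> (tensor K H M) m (\<lambda>h n. dsum (tensor K H M) l (\<lambda>l1 l2.
    tens K H M (l2 ** (h ** S' l1)) (act M b n))))" if [simp]: "a \<in> carrier A" "m \<in> carrier M" for a m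
    using assms that by (simp add: DH_obj_def)
  have 1: "psum M \<phi> M m (\<lambda>h n. counit H h \<odot>\<^bsub>M\<^esub> n) = m" if "m \<in> carrier M" for m
    using com that by (simp add: left_comodule_def)
  have 2: "psum M \<phi> ?W m (\<lambda>h n. dsum ?W h (\<lambda>a b. rsum ?W (\<lambda>s t. ?tt (a ** t) (b ** s) n)))
    = psum M \<phi> ?W m (\<lambda>h n. psum M \<phi> ?W n (\<lambda>g n'. rsum ?W (\<lambda>s t. ?tt (t ** h) (g ** s) n')))"
    if [simp]: "m \<in> carrier M" for m
  proof -
    have "psum M \<phi> ?W m (\<lambda>h n. psum M \<phi> ?W n (\<lambda>g n'. rsum ?W (\<lambda>s t. ?tt (t ** h) (g ** s) n')))
      = psum M \<phi> ?W m (\<lambda>c n. rsum ?W (\<lambda>s t. rsum ?W (\<lambda>s' t'. dsum ?W c (\<lambda>a b.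
        rsum ?W (\<lambda>s'' t''. ?tt (t'' ** (t' ** (a ** t))) ((b ** (s ** S' s')) ** s'') n)))))"
      by (rule coassoc[symmetric]; (intro lin_intros)?; simp)
    also have "\<dots> = psum M \<phi> ?W m (\<lambda>c n. dsum ?W c (\<lambda>a b. rsum ?W (\<lambda>s t. rsum ?W (\<lambda>s' t'.
        rsum ?W (\<lambda>s'' t''. ?tt ((t'' ** t') ** (a ** t)) (b ** (s ** (S' s' ** s''))) n)))))"
      by (simp add: rsum_swap(3))
    \<comment> \<open>The legs \<open>t'' t'\<close> and \<open>S'(s') s''\<close> cancel: the added
      copy of \<open>R\<close> undoes the one with the inverse antipode.\<close>
    also have "\<dots> = psum M \<phi> ?W m (\<lambda>c n. dsum ?W c (\<lambda>a b. rsum ?W (\<lambda>s t.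
        ?tt (\<one>\<^bsub>H\<^esub> ** (a ** t)) (b ** (s ** \<one>\<^bsub>H\<^esub>)) n)))"
      by (intro psum_cong sum_congs HOL.refl, rule R_S'R(2)[unfolded sum_folds]; (intro lin_intros)?; simp)
    finally show ?thesis by simp
  qed
  have 3: "csum (tensor K H M) a (\<lambda>l b. psum M \<phi> (tensor K H M) (act M b m) (\<lambda>h n. tens K H M (h ** l) n))
       = csum (tensor K H M) a (\<lambda>l b. psum M \<phi> (tensor K H M) m (\<lambda>h n. tens K H M (l ** h) (act M b n)))"
    if [simp]: "a \<in> carrier A" "m \<in> carrier M" for a m
  proof -
    let ?U = "tensor K H M"
    have "psum M \<phi> ?U (act M b m) (\<lambda>h n. tens K H M (h ** l) n) =
      csum ?U b (\<lambda>l' b. psum M \<phi> ?U m (\<lambda>h n. dsum ?U l' (\<lambda>l1 l2. tens K H M (l2 ** (h ** (S' l1 ** l))) (act M b n))))"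
      if [simp]: "l \<in> carrier H" "b \<in> carrier A" for l b
    proof -
      have b: "bilin K H M ?U (\<lambda>h n. tens K H M (h ** l) n)" by (intro lin_intros) simp_all
      note l = sweedler_linear[OF _ _ _ b]
      have "psum M \<phi> ?U (act M b m) (\<lambda>h n. tens K H M (h ** l) n) =
        sweedler ?U (\<phi> (act M b m)) (\<lambda>h n. tens K H M (h ** l) n)" by simp
      also have "\<dots> = csum ?U b (\<lambda>l' b. psum M \<phi> ?U m (\<lambda>h n. dsum ?U l' (\<lambda>l1 l2. tens K H M (l2 ** (h ** (S' l1 ** l))) (act M b n))))"
        by (subst compat) (simp_all add: csum_out[OF l] psum_out[OF l] sum_out[OF l] sweedler_tens[OF _ _ _ b])
      finally show ?thesis .
    qed
    hence "csum ?U a (\<lambda>l b. psum M \<phi> ?U (act M b m) (\<lambda>h n. tens K H M (h ** l) n)) =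
      csum ?U a (\<lambda>l b. csum ?U b (\<lambda>l' b. psum M \<phi> ?U m (\<lambda>h n. dsum ?U l' (\<lambda>l1 l2. tens K H M (l2 ** (h ** (S' l1 ** l))) (act M b n)))))"
      by simp
    also have "\<dots> = csum ?U a (\<lambda>y b. dsum ?U y (\<lambda>l l'. psum M \<phi> ?U m (\<lambda>h n. dsum ?U l' (\<lambda>l1 l2. tens K H M (l2 ** (h ** (S' l1 ** l))) (act M b n)))))"
      by (rule csum_coassoc[symmetric]; (intro lin_intros)?; simp)
    also have "\<dots> = csum ?U a (\<lambda>y b. psum M \<phi> ?U m (\<lambda>h n. dsum ?U y (\<lambda>l l'. dsum ?U l' (\<lambda>l1 l2. tens K H M (l2 ** (h ** (S' l1 ** l))) (act M b n)))))"
      by (simp add: psum_dsum_swap)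
    \<comment> \<open>Coassociativity groups l with l1, whose product \<open>S'(l1) l\<close>
      contracts to the counit.\<close>
    also have "\<dots> = csum ?U a (\<lambda>y b. psum M \<phi> ?U m (\<lambda>h n. dsum ?U y (\<lambda>y' l2. dsum ?U y' (\<lambda>l l1. tens K H M (l2 ** (h ** (S' l1 ** l))) (act M b n)))))"
      by (intro csum_cong psum_cong HOL.refl, rule dsum_coassoc[symmetric]; (intro lin_intros)?; simp)
    also have "\<dots> = csum ?U a (\<lambda>y b. psum M \<phi> ?U m (\<lambda>h n. sweedler ?U (comult H y) (\<lambda>y' l2. sweedler ?U (comult H y') (\<lambda>l l1. tens K H M (l2 ** (h ** (S' l1 ** l))) (act M b n)))))"
      by simp
    also have "\<dots> = csum ?U a (\<lambda>y b. psum M \<phi> ?U m (\<lambda>h n. sweedler ?U (comult H y) (\<lambda>y' l2. counit H y' \<odot>\<^bsub>?U\<^esub> tens K H M (l2 ** (h ** \<one>\<^bsub>H\<^esub>)) (act M b n))))"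
      by (intro csum_cong psum_cong S.sweedler_comult_cong HOL.refl, simp, rule S'_left; (intro lin_intros)?; simp)
    also have "\<dots> = csum ?U a (\<lambda>y b. psum M \<phi> ?U m (\<lambda>h n. tens K H M (y ** (h ** \<one>\<^bsub>H\<^esub>)) (act M b n)))"
      by (intro csum_cong psum_cong HOL.refl, rule S.comult_counit; (intro lin_intros)?; simp)
    finally show ?thesis by simp
  qed
  show ?thesis
    unfolding refl_coaction_def Let_def
    by (intro conjI ballI) (rule 1 2 3 ext; assumption | simp)+
qed

lemma DH_obj_iff: "P \<in> DH_obj K H A \<longleftrightarrow> refl_coaction (fst P) (snd P)"
  using refl_coaction_DH_obj DH_obj_refl_coaction by (cases P) auto

end

section \<open>The braiding operators and their inverses\<close>

context quasitriangular
begin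

text \<open>Conjugation by this element is \<open>S\<^sup>2\<close>; it makes the inverse of the braiding explicit.\<close>

definition "dz = S drinfeld_inv"

lemma dz_closed [simp]: "dz \<in> carrier H"
  by (simp add: dz_def)

text \<open>The inverse v of the Drinfeld element satisfies x v = v S(S(x)). This is taken at x =
  S'(S'(h)) and mapped by S.\<close>

lemma dz_S':
  assumes [simp]: "h \<in> carrier H" "k \<in> carrier H"
  shows "dz ** (S' h ** k) = S h ** (dz ** k)"
proof -
  have *: "x ** dv = dv ** S (S x)" if [simp]: "x \<in> carrier H" for x
  proof -
    have "x ** dv = dv ** ((du ** x) ** dv)" by simp
    also have "\<dots> = dv ** S (S x)" by (simp add: drinfeld_conj)
    finally show ?thesis .
  qed
  have "S (S' (S' h) ** dv) = S (dv ** S (S (S' (S' h))))" by (simp only: * S'_closed assms)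
  hence "dz ** S' h = S h ** dz" by (simp add: dz_def)
  hence "(dz ** S' h) ** k = (S h ** dz) ** k" by simp
  thus ?thesis by simp
qed

lemma dz_inverse: "S du ** dz = \<one>\<^bsub>H\<^esub>" "dz ** S du = \<one>\<^bsub>H\<^esub>"
  unfolding dz_def using arg_cong[OF drinfeld_inverse(2), of S] arg_cong[OF drinfeld_inverse(1), of S]
  by (simp_all del: drinfeld_inverse)

text \<open>By (S \<otimes> S)R = R both sums agree with the sum of \<open>S(s) S(S(t))\<close>,
  which is S applied to the defining sum of \<open>du\<close>. They are the remainders of the two
  composites in \<open>earr_inverse\<close>.\<close>

lemma S_drinfeld:
  assumes g: "g \<in> linear_maps K H W" and [simp]: "module K W"
  shows "rsum W (\<lambda>s t. g (s ** S t)) = g (S du)" "rsum W (\<lambda>s t. g (S' s ** t)) = g (S du)"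
proof -
  note [lin_intros] = lin_comp[OF g]
  note [simp] = lin_closed[OF g]
  have "g (S du) = sweedler W R (\<lambda>s t. g (S (S t ** s)))"
    unfolding drinfeld_def by (rule lin_R_sum[where g="\<lambda>x. g (S x)"]; (intro lin_intros)?; simp)
  also have "\<dots> = sweedler W R (\<lambda>s t. g (S s ** S (S t)))"
    by (rule R_sum_cong) simp
  also have "\<dots> = sweedler W R (\<lambda>s t. g (s ** S t))"
    by (rule R_SSR; (intro lin_intros)?; simp)
  finally show 1: "rsum W (\<lambda>s t. g (s ** S t)) = g (S du)" by simp
  have "sweedler W R (\<lambda>s t. g (S' s ** t)) = sweedler W R (\<lambda>s t. g (S' (S s) ** S t))"
    by (rule R_SSR[symmetric]; (intro lin_intros)?; simp)
  thus "rsum W (\<lambda>s t. g (S' s ** t)) = g (S du)" using 1 by simp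
qed

lemma dsum_mult:
  assumes "h \<in> carrier H" "h' \<in> carrier H" "bilin K H H W f" "module K W"
  shows "dsum W (h ** h') f = dsum W h (\<lambda>a b. dsum W h' (\<lambda>a' b'. f (a ** a') (b ** b')))"
  using S.comult_mult[OF assms] assms by simp

lemma dsum_S':
  assumes "h \<in> carrier H" "g \<in> linear_maps K H W" "module K W"
  shows "dsum W h (\<lambda>a b. g (S' b ** a)) = counit H h \<odot>\<^bsub>W\<^esub> g \<one>\<^bsub>H\<^esub>"
    "dsum W h (\<lambda>a b. g (b ** S' a)) = counit H h \<odot>\<^bsub>W\<^esub> g \<one>\<^bsub>H\<^esub>"
  using S'_left[OF assms] S'_right[OF assms] assms by simp_all

end

context quasitriangular_comodule
begin

definition earr where "earr X M \<phi> = Arrow (V X M)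
  (\<lambda>u\<in>carrier (V X M). sweedler (V X M) u (\<lambda>x m. sweedler (V X M) (\<phi> m) (\<lambda>h n. tens K X M (act X h x) n))) (V X M)"

text \<open>For an untwisted comultiplication acting by \<open>S'\<close> of the coaction would
  invert \<open>earr\<close>. The legs of the inverse of \<open>R\<close> around it, together with
  \<open>dz\<close>, compensate for the copies of \<open>R\<close> in the comultiplication of
  \<open>H_hat\<close>.\<close>

definition earr_inv where "earr_inv X M \<phi> = Arrow (V X M)
  (\<lambda>u\<in>carrier (V X M). sweedler (V X M) u (\<lambda>x m. psum M \<phi> (V X M) m (\<lambda>h n.
     risum (V X M) (\<lambda>s t. tens K X M (act X (s ** (dz ** (S' h ** t))) x) n)))) (V X M)"

lemma earr_simps [simp]:
  "src (earr X M \<phi>) = V X M" "tgt (earr X M \<phi>) = V X M" "src (earr_inv X M \<phi>) = V X M" "tgt (earr_inv X M \<phi>) = V X M"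
  by (simp_all add: earr_def earr_inv_def)

context
  fixes M :: "('k, ('k, 'a) univ) lmod" and \<phi> :: "('k, 'a) univ \<Rightarrow> ('k, 'a) univ"
  assumes lin [simp]: "left_module K A M" "\<phi> \<in> linear_maps K M (tensor K H M)"
begin

lemma earr_bilin:
  assumes [simp]: "left_module K H X"
  shows "bilin K X M (tensor K X M) (\<lambda>x m. psum M \<phi> (tensor K X M) m (\<lambda>h n. tens K X M (act X h x) n))"
    "bilin K X M (tensor K X M) (\<lambda>x m. psum M \<phi> (tensor K X M) m (\<lambda>h n.
      risum (tensor K X M) (\<lambda>s t. tens K X M (act X (s ** (dz ** (S' h ** t))) x) n)))"
  by ((rule bilinI; (intro lin_intros)?; (simp del: S.H_act(4) M.H_act(4) S.A_act(4))?), (intro lin_intros; simp)?)+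

lemma earr_eq:
  assumes [simp]: "left_module K H X"
  shows "u \<in> carrier (tensor K X M) \<Longrightarrow> fn (earr X M \<phi>) u = sweedler (tensor K X M) u
    (\<lambda>x m. psum M \<phi> (tensor K X M) m (\<lambda>h n. tens K X M (act X h x) n))"
    "u \<in> carrier (tensor K X M) \<Longrightarrow> fn (earr_inv X M \<phi>) u = sweedler (tensor K X M) u
    (\<lambda>x m. psum M \<phi> (tensor K X M) m (\<lambda>h n.
      risum (tensor K X M) (\<lambda>s t. tens K X M (act X (s ** (dz ** (S' h ** t))) x) n)))"
  unfolding earr_def earr_inv_def
  by (simp del: S.H_act(4) M.H_act(4) S.A_act(4), rule sweedler_cong[of u X M], simp_all add: psum_fold[of \<phi> M] del: S.H_act(4) M.H_act(4) S.A_act(4))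

lemma earr_lin [simp]:
  assumes [simp]: "left_module K H X"
  shows "fn (earr X M \<phi>) \<in> linear_maps K (tensor K X M) (tensor K X M)"
    "fn (earr_inv X M \<phi>) \<in> linear_maps K (tensor K X M) (tensor K X M)"
proof -
  have m: "module K X" "module K M" "module K (tensor K X M)" by simp_all
  show "fn (earr X M \<phi>) \<in> linear_maps K (tensor K X M) (tensor K X M)"
    by (rule iffD2[OF lin_cong[OF _ m(3)] sweedler_linear[OF m earr_bilin(1)[OF assms]]]) (rule earr_eq(1)[OF assms])
  show "fn (earr_inv X M \<phi>) \<in> linear_maps K (tensor K X M) (tensor K X M)"
    by (rule iffD2[OF lin_cong[OF _ m(3)] sweedler_linear[OF m earr_bilin(2)[OF assms]]]) (rule earr_eq(2)[OF assms])
qed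

lemma earr_tens [simp]:
  assumes [simp]: "left_module K H X" "x \<in> carrier X" "m \<in> carrier M" and t: "tens K X' M' = tens K X M"
  shows "fn (earr X M \<phi>) (tens K X' M' x m) = psum M \<phi> (tensor K X M) m (\<lambda>h n. tens K X M (act X h x) n)"
    "fn (earr_inv X M \<phi>) (tens K X' M' x m) = psum M \<phi> (tensor K X M) m (\<lambda>h n.
      risum (tensor K X M) (\<lambda>s t. tens K X M (act X (s ** (dz ** (S' h ** t))) x) n))"
  unfolding t
  by (simp add: earr_eq sweedler_tens[OF _ _ _ earr_bilin(1)] del: S.H_act(4) M.H_act(4) S.A_act(4))
    (simp add: earr_eq sweedler_tens[OF _ _ _ earr_bilin(2)] del: S.H_act(4) M.H_act(4) S.A_act(4))

end

text \<open>On pure tensors, linearity over \<open>A\<close> is \<open>refl_act\<close>.\<close>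

lemma earr_Arr [simp]:
  assumes r: "refl_coaction M \<phi>" and [simp]: "left_module K H X"
  shows "earr X M \<phi> \<in> Arr M.LA"
proof -
  note [simp] = refl_coactionD[OF r]
  have "Arrow (V X M) (fn (earr X M \<phi>)) (V X M) \<in> Arr M.LA"
  proof (rule M.lmod_tensor_ArrowI[where X=X and Y=M])
    show "fn (earr X M \<phi>) \<in> extensional (carrier (V X M))" by (simp add: earr_def)
    fix a x m assume [simp]: "a \<in> carrier A" "x \<in> carrier X" "m \<in> carrier M"
    let ?W = "tensor K X M"
    have "fn (earr X M \<phi>) (act (V X M) a (tens K X M x m)) =
      csum ?W a (\<lambda>l b. psum M \<phi> ?W (act M b m) (\<lambda>h n. tens K X M (act X (h ** l) x) n))"
      by (simp add: csum_out[OF earr_lin(1)])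
    also have "\<dots> = csum ?W a (\<lambda>l b. psum M \<phi> ?W m (\<lambda>h n. tens K X M (act X (l ** h) x) (act M b n)))"
      by (rule refl_act[OF r]; (intro lin_intros)?; simp)
    also have "\<dots> = psum M \<phi> ?W m (\<lambda>h n. csum ?W a (\<lambda>l b. tens K X M (act X (l ** h) x) (act M b n)))"
      by (rule csum_psum_swap) simp_all
    also have "\<dots> = act (V X M) a (fn (earr X M \<phi>) (tens K X M x m))"
      by simp
    finally show "fn (earr X M \<phi>) (act (V X M) a (tens K X M x m)) = act (V X M) a (fn (earr X M \<phi>) (tens K X M x m))" .
  qed simp_all
  thus ?thesis by (simp add: earr_def)
qed

text \<open>\<open>refl_coassoc\<close> trades the two coactions in a composite for one coaction and
  its twisted coproduct. Then everything cancels in pairs: a copy of \<open>R\<close> against its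
  inverse, the two halves of the coproduct against each other through \<open>S'\<close>, and the
  remaining sum \<open>S'(s) t\<close> or \<open>s S(t)\<close>, which is S of the Drinfeld element,
  against \<open>dz\<close>.\<close>

lemma earr_inverse:
  assumes r: "refl_coaction M \<phi>" and [simp]: "left_module K H X"
  shows "earr_inv X M \<phi> \<in> Arr M.LA"
    "earr_inv X M \<phi> \<cdot>\<^bsub>M.LA\<^esub> earr X M \<phi> = Idn M.LA (V X M)"
    "earr X M \<phi> \<cdot>\<^bsub>M.LA\<^esub> earr_inv X M \<phi> = Idn M.LA (V X M)"
proof -
  note [simp] = refl_coactionD[OF r]
  \<comment> \<open>The rule that splits the action of a product is switched off and used backwards,
    so that the computation takes place inside \<open>H\<close>.\<close>
  note [simp del] = S.H_act(4) M.H_act(4) S.A_act(4)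
  note act = S.H_act(4)[symmetric]
  let ?W = "tensor K X M"
  have e: "fn (earr X M \<phi>) \<in> linear_maps K ?W ?W" "fn (earr_inv X M \<phi>) \<in> linear_maps K ?W ?W"
    by simp_all
  have 1: "fn (earr_inv X M \<phi>) (fn (earr X M \<phi>) u) = u" if "u \<in> carrier ?W" for u
  proof (rule lin_eq_tensor[OF lin_comp[OF e(2,1)] lin_id _ _ _ _ that])
    fix x m assume [simp]: "x \<in> carrier X" "m \<in> carrier M"
    define f where "f k n = tens K X M (act X k x) n" for k n
    have [lin_intros]: "h \<in> linear_maps K U M \<Longrightarrow> k \<in> carrier H \<Longrightarrow> (\<lambda>v. f k (h v)) \<in> linear_maps K U ?W"
      "k' \<in> linear_maps K U H \<Longrightarrow> n \<in> carrier M \<Longrightarrow> (\<lambda>v. f (k' v) n) \<in> linear_maps K U ?W"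
      for h k k' n and U :: "('k, ('k, 'a) univ) module" unfolding f_def by (intro lin_intros; simp)+
    have [lin_intros]: "k \<in> carrier H \<Longrightarrow> (\<lambda>v. f k v) \<in> linear_maps K M ?W"
      "k' \<in> linear_maps K H H \<Longrightarrow> n \<in> carrier M \<Longrightarrow> (\<lambda>v. f (k' v) n) \<in> linear_maps K H ?W"
      for k k' n unfolding f_def by (intro lin_intros; simp)+
    have [simp]: "k \<in> carrier H \<Longrightarrow> n \<in> carrier M \<Longrightarrow> f k n \<in> carrier ?W" for k n by (simp add: f_def)
    have "fn (earr_inv X M \<phi>) (fn (earr X M \<phi>) (tens K X M x m)) =
      psum M \<phi> ?W m (\<lambda>h n. psum M \<phi> ?W n (\<lambda>g n'. risum ?W (\<lambda>p q.
        f (p ** (dz ** (S' g ** (q ** h)))) n')))"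
      by (simp add: psum_out[OF e(2)] act f_def)
    also have "\<dots> = psum M \<phi> ?W m (\<lambda>c n. rsum ?W (\<lambda>s t. rsum ?W (\<lambda>s' t'. dsum ?W c (\<lambda>a b. risum ?W (\<lambda>p q.
        f (p ** (dz ** (S' (b ** (s ** S' s')) ** (q ** (t' ** (a ** t)))))) n)))))"
      by (rule refl_coassoc[OF r, symmetric]; (intro lin_intros)?; simp)
    \<comment> \<open>\<open>dz_S'\<close> carries the factor \<open>S'(S'(s'))\<close> across
      \<open>dz\<close>, where it becomes \<open>s'\<close> and stands next to
      \<open>p\<close>.\<close>
    also have "\<dots> = psum M \<phi> ?W m (\<lambda>c n. dsum ?W c (\<lambda>a b. rsum ?W (\<lambda>s t. risum ?W (\<lambda>p q. rsum ?W (\<lambda>s' t'.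
        f ((p ** s') ** (dz ** (S' s ** (S' b ** ((q ** t') ** (a ** t)))))) n)))))"
      by (simp add: rsum_swap(2,3) dz_S')
    also have "\<dots> = psum M \<phi> ?W m (\<lambda>c n. dsum ?W c (\<lambda>a b. rsum ?W (\<lambda>s t.
        f (\<one>\<^bsub>H\<^esub> ** (dz ** (S' s ** (S' b ** (\<one>\<^bsub>H\<^esub> ** (a ** t)))))) n)))"
      by (intro psum_cong sum_congs HOL.refl, rule rsum_risum(2); (intro lin_intros)?; simp)
    also have "\<dots> = psum M \<phi> ?W m (\<lambda>c n. rsum ?W (\<lambda>s t. dsum ?W c (\<lambda>a b.
        f (dz ** (S' s ** ((S' b ** a) ** t))) n)))"
      by (simp add: rsum_swap(3))
    also have "\<dots> = psum M \<phi> ?W m (\<lambda>c n. rsum ?W (\<lambda>s t. counit H c \<odot>\<^bsub>?W\<^esub>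
        f (dz ** (S' s ** (\<one>\<^bsub>H\<^esub> ** t))) n))"
      by (intro psum_cong sum_congs HOL.refl, rule dsum_S'(1); (intro lin_intros)?; simp)
    also have "\<dots> = psum M \<phi> ?W m (\<lambda>c n. rsum ?W (\<lambda>s t. counit H c \<odot>\<^bsub>?W\<^esub>
        f (dz ** (S' s ** t)) n))"
      by simp
    also have "\<dots> = psum M \<phi> ?W m (\<lambda>c n. counit H c \<odot>\<^bsub>?W\<^esub> f (dz ** S du) n)"
      by (intro psum_cong HOL.refl, rule S_drinfeld(2); (intro lin_intros)?; simp)
    also have "\<dots> = f (dz ** S du) m"
      by (rule refl_counit[OF r]; (intro lin_intros)?; simp)
    finally show "fn (earr_inv X M \<phi>) (fn (earr X M \<phi>) (tens K X M x m)) = tens K X M x m"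
      by (simp add: f_def dz_inverse)
  qed simp_all
  have 2: "fn (earr X M \<phi>) (fn (earr_inv X M \<phi>) u) = u" if "u \<in> carrier ?W" for u
  proof (rule lin_eq_tensor[OF lin_comp[OF e] lin_id _ _ _ _ that])
    fix x m assume [simp]: "x \<in> carrier X" "m \<in> carrier M"
    define f where "f k n = tens K X M (act X k x) n" for k n
    have [lin_intros]: "k \<in> carrier H \<Longrightarrow> (\<lambda>v. f k v) \<in> linear_maps K M ?W"
      "k' \<in> linear_maps K H H \<Longrightarrow> n \<in> carrier M \<Longrightarrow> (\<lambda>v. f (k' v) n) \<in> linear_maps K H ?W"
      for k k' n unfolding f_def by (intro lin_intros; simp)+
    have [simp]: "k \<in> carrier H \<Longrightarrow> n \<in> carrier M \<Longrightarrow> f k n \<in> carrier ?W" for k n by (simp add: f_def)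
    have "fn (earr X M \<phi>) (fn (earr_inv X M \<phi>) (tens K X M x m)) =
      psum M \<phi> ?W m (\<lambda>h n. risum ?W (\<lambda>p q. psum M \<phi> ?W n (\<lambda>g n'. 
        f (g ** (p ** (dz ** (S' h ** q)))) n')))"
      by (simp add: psum_out[OF e(1)] sum_out[OF e(1)] act f_def)
    also have "\<dots> = psum M \<phi> ?W m (\<lambda>h n. psum M \<phi> ?W n (\<lambda>g n'. risum ?W (\<lambda>p q. 
        f (g ** (p ** (dz ** (S' h ** q)))) n')))"
      by (intro psum_cong HOL.refl, rule psum_risum_swap[symmetric]) simp_all
    also have "\<dots> = psum M \<phi> ?W m (\<lambda>c n. rsum ?W (\<lambda>s t. rsum ?W (\<lambda>s' t'. dsum ?W c (\<lambda>a b. risum ?W (\<lambda>p q.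
        f ((b ** (s ** S' s')) ** (p ** (dz ** (S' (t' ** (a ** t)) ** q)))) n)))))"
      by (rule refl_coassoc[OF r, symmetric]; (intro lin_intros)?; simp)
    also have "\<dots> = psum M \<phi> ?W m (\<lambda>c n. dsum ?W c (\<lambda>a b. rsum ?W (\<lambda>s t. sweedler ?W R (\<lambda>s' t'. risum ?W (\<lambda>p q. 
        f (b ** (s ** ((S' s' ** p) ** (dz ** (S' t ** (S' a ** (S' t' ** q))))))) n)))))"
      by (simp add: rsum_swap(3))
    \<comment> \<open>\<open>R\<close> is invariant under \<open>S'\<close> on both legs. With
      \<open>S'\<close> removed, its legs cancel against \<open>p\<close> and
      \<open>q\<close>.\<close>
    also have "\<dots> = psum M \<phi> ?W m (\<lambda>c n. dsum ?W c (\<lambda>a b. rsum ?W (\<lambda>s t. sweedler ?W R (\<lambda>s' t'. risum ?W (\<lambda>p q. 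
        f (b ** (s ** ((s' ** p) ** (dz ** (S' t ** (S' a ** (t' ** q))))))) n)))))"
      by (intro psum_cong sum_congs HOL.refl, rule R_S'S'R; (intro lin_intros)?; simp)
    also have "\<dots> = psum M \<phi> ?W m (\<lambda>c n. dsum ?W c (\<lambda>a b. rsum ?W (\<lambda>s t. 
        f (b ** (s ** (\<one>\<^bsub>H\<^esub> ** (dz ** (S' t ** (S' a ** \<one>\<^bsub>H\<^esub>)))))) n)))"
      unfolding sum_folds
      by (intro psum_cong sum_congs HOL.refl, rule rsum_risum(1); (intro lin_intros)?; simp)
    also have "\<dots> = psum M \<phi> ?W m (\<lambda>c n. dsum ?W c (\<lambda>a b. rsum ?W (\<lambda>s t. 
        f (b ** ((s ** S t) ** (dz ** S' a))) n)))"
      by (simp add: dz_S')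
    also have "\<dots> = psum M \<phi> ?W m (\<lambda>c n. dsum ?W c (\<lambda>a b. f (b ** (S du ** (dz ** S' a))) n))"
      by (intro psum_cong sum_congs HOL.refl, rule S_drinfeld(1); (intro lin_intros)?; simp)
    also have "\<dots> = psum M \<phi> ?W m (\<lambda>c n. dsum ?W c (\<lambda>a b. f (b ** ((S du ** dz) ** S' a)) n))"
      by simp
    also have "\<dots> = psum M \<phi> ?W m (\<lambda>c n. dsum ?W c (\<lambda>a b. f (b ** S' a) n))"
      unfolding dz_inverse by simp
    also have "\<dots> = psum M \<phi> ?W m (\<lambda>c n. counit H c \<odot>\<^bsub>?W\<^esub> f \<one>\<^bsub>H\<^esub> n)"
      by (intro psum_cong HOL.refl, rule dsum_S'(2); (intro lin_intros)?; simp)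
    also have "\<dots> = f \<one>\<^bsub>H\<^esub> m"
      by (rule refl_counit[OF r]; (intro lin_intros)?; simp)
    finally show "fn (earr X M \<phi>) (fn (earr_inv X M \<phi>) (tens K X M x m)) = tens K X M x m"
      by (simp add: f_def)
  qed simp_all
  have ex: "fn (earr_inv X M \<phi>) \<in> extensional (carrier (src (earr_inv X M \<phi>)))"
    by (simp add: earr_inv_def)
  note * = M.lmod_inverse_Arr[OF earr_Arr[OF r assms(2)], of "earr_inv X M \<phi>", OF _ _ _ ex]
  show "earr_inv X M \<phi> \<in> Arr M.LA" by (rule *(1)) (simp_all add: 1 2)
  show "earr_inv X M \<phi> \<cdot>\<^bsub>M.LA\<^esub> earr X M \<phi> = Idn M.LA (V X M)"
    "earr X M \<phi> \<cdot>\<^bsub>M.LA\<^esub> earr_inv X M \<phi> = Idn M.LA (V X M)"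
    using *(2,3) by (simp_all add: 1 2)
qed

end

section \<open>The coaction on Y \<otimes> M\<close>

context quasitriangular_comodule
begin

lemma rsum_dsum_swap: "module K W \<Longrightarrow> h \<in> carrier H \<Longrightarrow>
    (\<And>a b c d. a \<in> carrier H \<Longrightarrow> b \<in> carrier H \<Longrightarrow> c \<in> carrier H \<Longrightarrow> d \<in> carrier H \<Longrightarrow> f a b c d \<in> carrier W) \<Longrightarrow>
    rsum W (\<lambda>a b. dsum W h (\<lambda>c d. f a b c d)) = dsum W h (\<lambda>c d. rsum W (\<lambda>a b. f a b c d))"
  by (rule rsum_swap(3)) auto

lemma YB_rsum:
  assumes "module K W" "trilin K H H H W f"
  shows "rsum W (\<lambda>s t. rsum W (\<lambda>s' t'. rsum W (\<lambda>s'' t''. f (s ** s') (t ** s'') (t' ** t''))))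
    = rsum W (\<lambda>s t. rsum W (\<lambda>s' t'. rsum W (\<lambda>s'' t''. f (s' ** s) (s'' ** t) (t'' ** t'))))"
  using yang_baxter[OF assms] by (simp only: rsum_def)

definition phit where "phit Y M \<phi> = snd (DH_act K H A Y (M, \<phi>))"

lemma DH_act_eq [simp]: "DH_act K H A Y (M, \<phi>) = (V Y M, phit Y M \<phi>)"
  by (simp add: phit_def DH_act_def Let_def)

context
  fixes Y M :: "('k, ('k, 'a) univ) lmod" and \<phi> :: "('k, 'a) univ \<Rightarrow> ('k, 'a) univ"
  assumes r: "refl_coaction M \<phi>" and Y [simp]: "left_module K H Y"
begin

lemmas [simp] = refl_coactionD[OF r] psum_fold[OF refl_coactionD(3,4)[OF r]]
declare S.H_act(4) [simp del] M.H_act(4) [simp del] S.A_act(4) [simp del]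

lemma phit_bilin:
  "bilin K Y M (tensor K H (tensor K Y M)) (\<lambda>y m. rsum (tensor K H (tensor K Y M)) (\<lambda>s t.
     rsum (tensor K H (tensor K Y M)) (\<lambda>s' t'. psum M \<phi> (tensor K H (tensor K Y M)) m (\<lambda>h n.
       tens K H (tensor K Y M) (t' ** (h ** s)) (tens K Y M (act Y (s' ** t) y) n)))))"
  by (intro lin_intros; simp)

lemma phit_eq: "u \<in> carrier (tensor K Y M) \<Longrightarrow> phit Y M \<phi> u = sweedler (tensor K H (tensor K Y M)) u
    (\<lambda>y m. rsum (tensor K H (tensor K Y M)) (\<lambda>s t.
     rsum (tensor K H (tensor K Y M)) (\<lambda>s' t'. psum M \<phi> (tensor K H (tensor K Y M)) m (\<lambda>h n.
       tens K H (tensor K Y M) (t' ** (h ** s)) (tens K Y M (act Y (s' ** t) y) n)))))"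
  unfolding phit_def DH_act_def Let_def
  by simp (rule sweedler_cong[of u Y M]; simp)

lemma phit_lin [simp]: "phit Y M \<phi> \<in> linear_maps K (tensor K Y M) (tensor K H (tensor K Y M))"
  by (rule iffD2[OF lin_cong sweedler_linear[OF _ _ _ phit_bilin]], rule phit_eq) simp_all

lemma phit_ext: "phit Y M \<phi> \<in> extensional (carrier (V Y M))"
  by (simp add: phit_def DH_act_def Let_def)

lemma phit_tens:
  assumes "y \<in> carrier Y" "m \<in> carrier M"
  shows "phit Y M \<phi> (tens K Y M y m) = rsum (tensor K H (tensor K Y M)) (\<lambda>s t.
     rsum (tensor K H (tensor K Y M)) (\<lambda>s' t'. psum M \<phi> (tensor K H (tensor K Y M)) m (\<lambda>h n.
       tens K H (tensor K Y M) (t' ** (h ** s)) (tens K Y M (act Y (s' ** t) y) n))))"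
  using assms by (simp add: phit_eq sweedler_tens[OF _ _ _ phit_bilin])

lemmas psum_fold_phit [simp] = psum_fold[OF phit_lin]

lemma psum_phit:
  assumes [simp]: "y \<in> carrier Y" "m \<in> carrier M" "module K W" and G: "bilin K H (tensor K Y M) W G"
  shows "psum (tensor K Y M) (phit Y M \<phi>) W (tens K Y M y m) G =
    psum M \<phi> W m (\<lambda>h n. rsum W (\<lambda>s' t'. rsum W (\<lambda>s t. G (t' ** (h ** s)) (tens K Y M (act Y (s' ** t) y) n))))"
proof -
  note l = sweedler_linear[OF _ _ _ G]
  note [simp] = bilin_closed[OF G]
  have "psum (tensor K Y M) (phit Y M \<phi>) W (tens K Y M y m) G = sweedler W (phit Y M \<phi> (tens K Y M y m)) G"
    by simp
  also have "\<dots> = rsum W (\<lambda>s t. rsum W (\<lambda>s' t'. psum M \<phi> W m (\<lambda>h n. G (t' ** (h ** s)) (tens K Y M (act Y (s' ** t) y) n))))"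
    by (simp add: phit_tens sum_out[OF l] psum_out[OF l] sweedler_tens[OF _ _ _ G] del: psum_fold_phit)
  also have "\<dots> = rsum W (\<lambda>s' t'. rsum W (\<lambda>s t. psum M \<phi> W m (\<lambda>h n. G (t' ** (h ** s)) (tens K Y M (act Y (s' ** t) y) n))))"
    by (rule rsum_swap) simp_all
  finally show ?thesis by (simp add: psum_rsum_swap)
qed

text \<open>The counit contracts one copy of \<open>R\<close> in its first leg and the other in its
  second, each to the unit; what is left is the counit axiom of \<phi>.\<close>

lemma phit_counit:
  assumes "u \<in> carrier (tensor K Y M)"
  shows "psum (tensor K Y M) (phit Y M \<phi>) (tensor K Y M) u (\<lambda>h u'. counit H h \<odot>\<^bsub>tensor K Y M\<^esub> u') = u"
proof (rule lin_eq_tensor[where F="\<lambda>u. psum (tensor K Y M) (phit Y M \<phi>) (tensor K Y M) u (\<lambda>h u'. counit H h \<odot>\<^bsub>tensor K Y M\<^esub> u')"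
      and G="\<lambda>u. u", OF _ lin_id _ _ _ _ assms])
  let ?W = "tensor K Y M"
  interpret W: module K ?W by simp
  show "(\<lambda>u. psum ?W (phit Y M \<phi>) ?W u (\<lambda>h u'. counit H h \<odot>\<^bsub>?W\<^esub> u')) \<in> linear_maps K ?W ?W"
    by (intro lin_intros; simp)
  fix y m assume [simp]: "y \<in> carrier Y" "m \<in> carrier M"
  have "psum ?W (phit Y M \<phi>) ?W (tens K Y M y m) (\<lambda>h u'. counit H h \<odot>\<^bsub>?W\<^esub> u') =
    psum M \<phi> ?W m (\<lambda>h n. rsum ?W (\<lambda>s' t'. rsum ?W (\<lambda>s t. counit H (t' ** (h ** s)) \<odot>\<^bsub>?W\<^esub> tens K Y M (act Y (s' ** t) y) n)))"
    by (rule psum_phit; (intro lin_intros)?; simp)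
  also have "\<dots> = psum M \<phi> ?W m (\<lambda>h n. sweedler ?W R (\<lambda>s' t'. sweedler ?W R (\<lambda>s t. counit H s \<odot>\<^bsub>?W\<^esub> (counit H t' \<odot>\<^bsub>?W\<^esub> (counit H h \<odot>\<^bsub>?W\<^esub> tens K Y M (act Y (s' ** t) y) n)))))"
    by (simp add: W.smult_assoc1[symmetric] m_ac)
  also have "\<dots> = psum M \<phi> ?W m (\<lambda>h n. sweedler ?W R (\<lambda>s' t'. counit H t' \<odot>\<^bsub>?W\<^esub> (counit H h \<odot>\<^bsub>?W\<^esub> tens K Y M (act Y (s' ** \<one>\<^bsub>H\<^esub>) y) n)))"
    by (intro psum_cong R_sum_cong HOL.refl, rule R_counit_left; (intro lin_intros)?; simp)
  also have "\<dots> = psum M \<phi> ?W m (\<lambda>h n. counit H h \<odot>\<^bsub>?W\<^esub> tens K Y M (act Y (\<one>\<^bsub>H\<^esub> ** \<one>\<^bsub>H\<^esub>) y) n)"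
    by (intro psum_cong HOL.refl, rule R_counit_right; (intro lin_intros)?; simp)
  also have "\<dots> = tens K Y M (act Y (\<one>\<^bsub>H\<^esub> ** \<one>\<^bsub>H\<^esub>) y) m"
    by (rule refl_counit[OF r]; (intro lin_intros)?; simp)
  finally show "psum ?W (phit Y M \<phi>) ?W (tens K Y M y m) (\<lambda>h u'. counit H h \<odot>\<^bsub>?W\<^esub> u') = tens K Y M y m" by simp
qed simp_all

text \<open>A factor from the coaction of \<open>A\<close> is moved from the right end of
  \<open>t' h s\<close> to the left end. It passes the right-hand copy of \<open>R\<close> because
  \<open>R\<close> intertwines the coproduct with its opposite, passes h by \<open>refl_act\<close>,
  and passes the left-hand copy of \<open>R\<close> again by intertwining. Coassociativity supplies
  the factors in between.\<close>

lemma phit_act: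
  assumes [simp]: "a \<in> carrier A" and u: "u \<in> carrier (tensor K Y M)"
  shows "csum (tensor K H (tensor K Y M)) a (\<lambda>l b. psum (tensor K Y M) (phit Y M \<phi>) (tensor K H (tensor K Y M)) (act (V Y M) b u)
      (\<lambda>h u'. tens K H (tensor K Y M) (h ** l) u'))
    = csum (tensor K H (tensor K Y M)) a (\<lambda>l b. psum (tensor K Y M) (phit Y M \<phi>) (tensor K H (tensor K Y M)) u
      (\<lambda>h u'. tens K H (tensor K Y M) (l ** h) (act (V Y M) b u')))"
proof -
  let ?U = "tensor K Y M" and ?W = "tensor K H (tensor K Y M)"
  have Vlin: "(\<lambda>u. act (V Y M) b (g u)) \<in> linear_maps K U ?U"
    if "g \<in> linear_maps K U ?U" "b \<in> carrier A" for g b and U :: "('k, ('k, 'a) univ) module"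
    using lin_comp[OF M.V_act_lin(1)[of Y M b] that(1)] that(2) by simp
  have Vlin2: "(\<lambda>b. act (V Y M) b u) \<in> linear_maps K A ?U" if "u \<in> carrier ?U" for u
    using M.V_act_lin(2)[of Y M u] that by simp
  have [simp]: "b \<in> carrier A \<Longrightarrow> u \<in> carrier ?U \<Longrightarrow> act (V Y M) b u \<in> carrier ?U" for b u
    using M.A_act(2)[of "V Y M" b u] by simp
  show ?thesis
  proof (rule lin_eq_tensor[where F="\<lambda>u. csum ?W a (\<lambda>l b. psum ?U (phit Y M \<phi>) ?W (act (V Y M) b u) (\<lambda>h u'. tens K H ?U (h ** l) u'))"
        and G="\<lambda>u. csum ?W a (\<lambda>l b. psum ?U (phit Y M \<phi>) ?W u (\<lambda>h u'. tens K H ?U (l ** h) (act (V Y M) b u')))", OF _ _ _ _ _ _ u])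
    show "(\<lambda>u. csum ?W a (\<lambda>l b. psum ?U (phit Y M \<phi>) ?W (act (V Y M) b u) (\<lambda>h u'. tens K H ?U (h ** l) u'))) \<in> linear_maps K ?U ?W"
      "(\<lambda>u. csum ?W a (\<lambda>l b. psum ?U (phit Y M \<phi>) ?W u (\<lambda>h u'. tens K H ?U (l ** h) (act (V Y M) b u')))) \<in> linear_maps K ?U ?W"
      by (intro Vlin lin_intros; simp)+
    fix y m assume [simp]: "y \<in> carrier Y" "m \<in> carrier M"
    define f where "f k k' n = tens K H ?U k (tens K Y M (act Y k' y) n)" for k k' n
    have [lin_intros]: "(\<lambda>v. f k k' v) \<in> linear_maps K M ?W" if "k \<in> carrier H" "k' \<in> carrier H" for k k'
      using that unfolding f_def by (intro lin_intros; simp)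
    have [lin_intros]: "(\<lambda>v. f k k' (act M v n)) \<in> linear_maps K A ?W" if "k \<in> carrier H" "k' \<in> carrier H" "n \<in> carrier M" for k k' n
      using that unfolding f_def by (intro lin_intros; simp)
    have [lin_intros]: "(\<lambda>v. f (g v) k' n) \<in> linear_maps K H ?W" if "g \<in> linear_maps K H H" "k' \<in> carrier H" "n \<in> carrier M" for g k' n
      using that unfolding f_def by (intro lin_intros; simp)
    have [lin_intros]: "(\<lambda>v. f k (g v) n) \<in> linear_maps K H ?W" if "g \<in> linear_maps K H H" "k \<in> carrier H" "n \<in> carrier M" for g k n
      using that unfolding f_def by (intro lin_intros; simp)
    have [simp]: "k \<in> carrier H \<Longrightarrow> k' \<in> carrier H \<Longrightarrow> n \<in> carrier M \<Longrightarrow> f k k' n \<in> carrier ?W" for k k' n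
      by (simp add: f_def)
    have pl: "(\<lambda>u. psum ?U (phit Y M \<phi>) ?W u (\<lambda>h u'. tens K H ?U (h ** l) u')) \<in> linear_maps K ?U ?W"
      if "l \<in> carrier H" for l
      by (intro lin_intros; simp add: that)
    have 1: "psum ?U (phit Y M \<phi>) ?W (act (V Y M) b (tens K Y M y m)) (\<lambda>h u'. tens K H ?U (h ** l) u')
      = csum ?W b (\<lambda>l' b'. psum M \<phi> ?W (act M b' m) (\<lambda>h n. rsum ?W (\<lambda>s' t'. rsum ?W (\<lambda>s t.
          f (t' ** (h ** (s ** l))) (s' ** (t ** l')) n))))"
      if [simp]: "l \<in> carrier H" "b \<in> carrier A" for l b
    proof -
      have "psum ?U (phit Y M \<phi>) ?W (act (V Y M) b (tens K Y M y m)) (\<lambda>h u'. tens K H ?U (h ** l) u')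
        = csum ?W b (\<lambda>l' b'. psum ?U (phit Y M \<phi>) ?W (tens K Y M (act Y l' y) (act M b' m)) (\<lambda>h u'. tens K H ?U (h ** l) u'))"
        by (simp add: csum_out[OF pl])
      also have "\<dots> = csum ?W b (\<lambda>l' b'. psum M \<phi> ?W (act M b' m) (\<lambda>h n. rsum ?W (\<lambda>s' t'. rsum ?W (\<lambda>s t.
          tens K H ?U ((t' ** (h ** s)) ** l) (tens K Y M (act Y (s' ** t) (act Y l' y)) n)))))"
        by (rule csum_cong[OF HOL.refl HOL.refl], rule psum_phit; (intro lin_intros)?; simp)
      finally show ?thesis by (simp add: f_def S.H_act(4)[symmetric])
    qed
    have 2: "psum ?U (phit Y M \<phi>) ?W (tens K Y M y m) (\<lambda>h u'. tens K H ?U (l ** h) (act (V Y M) b u'))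
      = csum ?W b (\<lambda>l' b'. psum M \<phi> ?W m (\<lambda>h n. rsum ?W (\<lambda>s' t'. rsum ?W (\<lambda>s t.
          f (l ** (t' ** (h ** s))) (l' ** (s' ** t)) (act M b' n)))))"
      if [simp]: "l \<in> carrier H" "b \<in> carrier A" for l b
    proof -
      have "psum ?U (phit Y M \<phi>) ?W (tens K Y M y m) (\<lambda>h u'. tens K H ?U (l ** h) (act (V Y M) b u'))
        = psum M \<phi> ?W m (\<lambda>h n. rsum ?W (\<lambda>s' t'. rsum ?W (\<lambda>s t.
          tens K H ?U (l ** (t' ** (h ** s))) (act (V Y M) b (tens K Y M (act Y (s' ** t) y) n)))))"
        by (rule psum_phit; (intro Vlin lin_intros)?; simp)
      also have "\<dots> = psum M \<phi> ?W m (\<lambda>h n. rsum ?W (\<lambda>s' t'. rsum ?W (\<lambda>s t. csum ?W b (\<lambda>l' b'. 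
          f (l ** (t' ** (h ** s))) (l' ** (s' ** t)) (act M b' n)))))"
        by (simp add: f_def S.H_act(4)[symmetric])
      also have "\<dots> = psum M \<phi> ?W m (\<lambda>h n. csum ?W b (\<lambda>l' b'. rsum ?W (\<lambda>s' t'. rsum ?W (\<lambda>s t. 
          f (l ** (t' ** (h ** s))) (l' ** (s' ** t)) (act M b' n)))))"
        by (simp add: csum_rsum_swap)
      finally show ?thesis by (simp add: csum_psum_swap(1))
    qed
    have "csum ?W a (\<lambda>l b. csum ?W b (\<lambda>l' b'. psum M \<phi> ?W (act M b' m) (\<lambda>h n. rsum ?W (\<lambda>s' t'. rsum ?W (\<lambda>s t.
          f (t' ** (h ** (s ** l))) (s' ** (t ** l')) n)))))
      = csum ?W a (\<lambda>x b. dsum ?W x (\<lambda>l l'. psum M \<phi> ?W (act M b m) (\<lambda>h n. rsum ?W (\<lambda>s' t'. rsum ?W (\<lambda>s t.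
          f (t' ** (h ** (s ** l))) (s' ** (t ** l')) n)))))"
      by (rule csum_coassoc[symmetric]; (intro lin_intros)?; simp)
    also have "\<dots> = csum ?W a (\<lambda>x b. psum M \<phi> ?W (act M b m) (\<lambda>h n. rsum ?W (\<lambda>s' t'. dsum ?W x (\<lambda>l l'. rsum ?W (\<lambda>s t.
          f (t' ** (h ** (s ** l))) (s' ** (t ** l')) n)))))"
      by (simp add: psum_dsum_swap rsum_dsum_swap)
    also have "\<dots> = csum ?W a (\<lambda>x b. psum M \<phi> ?W (act M b m) (\<lambda>h n. rsum ?W (\<lambda>s' t'. rsum ?W (\<lambda>s t. dsum ?W x (\<lambda>l l'. 
          f (t' ** (h ** (s ** l))) (s' ** (t ** l')) n)))))"
      by (simp add: rsum_dsum_swap)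
    also have "\<dots> = csum ?W a (\<lambda>x b. psum M \<phi> ?W (act M b m) (\<lambda>h n. rsum ?W (\<lambda>s' t'. dsum ?W x (\<lambda>l l'. rsum ?W (\<lambda>s t. 
          f (t' ** (h ** (l' ** s))) (s' ** (l ** t)) n)))))"
      by (intro csum_cong psum_cong sum_congs(1) HOL.refl, rule rsum_dsum; (intro lin_intros)?; simp)
    also have "\<dots> = csum ?W a (\<lambda>x b. dsum ?W x (\<lambda>l l'. psum M \<phi> ?W (act M b m) (\<lambda>h n. rsum ?W (\<lambda>s' t'. rsum ?W (\<lambda>s t. 
          f (t' ** ((h ** l') ** s)) (s' ** (l ** t)) n)))))"
      by (simp add: psum_dsum_swap rsum_dsum_swap)
    also have "\<dots> = csum ?W a (\<lambda>l b. csum ?W b (\<lambda>l' b'. psum M \<phi> ?W (act M b' m) (\<lambda>h n. rsum ?W (\<lambda>s' t'. rsum ?W (\<lambda>s t. 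
          f (t' ** ((h ** l') ** s)) (s' ** (l ** t)) n)))))"
      by (rule csum_coassoc; (intro lin_intros)?; simp)
    also have "\<dots> = csum ?W a (\<lambda>l b. csum ?W b (\<lambda>l' b'. psum M \<phi> ?W m (\<lambda>h n. rsum ?W (\<lambda>s' t'. rsum ?W (\<lambda>s t. 
          f (t' ** ((l' ** h) ** s)) (s' ** (l ** t)) (act M b' n))))))"
      by (rule csum_cong[OF HOL.refl HOL.refl], rule refl_act[OF r]; (intro lin_intros)?; simp)
    also have "\<dots> = csum ?W a (\<lambda>x b. dsum ?W x (\<lambda>l l'. psum M \<phi> ?W m (\<lambda>h n. rsum ?W (\<lambda>s' t'. rsum ?W (\<lambda>s t. 
          f (t' ** ((l' ** h) ** s)) (s' ** (l ** t)) (act M b n))))))"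
      by (rule csum_coassoc[symmetric]; (intro lin_intros)?; simp)
    also have "\<dots> = csum ?W a (\<lambda>x b. psum M \<phi> ?W m (\<lambda>h n. rsum ?W (\<lambda>s' t'. dsum ?W x (\<lambda>l l'. rsum ?W (\<lambda>s t. 
          f ((t' ** l') ** (h ** s)) ((s' ** l) ** t) (act M b n))))))"
      by (simp add: psum_dsum_swap rsum_dsum_swap)
    also have "\<dots> = csum ?W a (\<lambda>x b. psum M \<phi> ?W m (\<lambda>h n. dsum ?W x (\<lambda>l l'. rsum ?W (\<lambda>s' t'. rsum ?W (\<lambda>s t. 
          f ((l ** t') ** (h ** s)) ((l' ** s') ** t) (act M b n))))))"
      by (intro csum_cong psum_cong HOL.refl, rule rsum_dsum; (intro lin_intros)?; simp)
    also have "\<dots> = csum ?W a (\<lambda>x b. dsum ?W x (\<lambda>l l'. psum M \<phi> ?W m (\<lambda>h n. rsum ?W (\<lambda>s' t'. rsum ?W (\<lambda>s t. 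
          f (l ** (t' ** (h ** s))) (l' ** (s' ** t)) (act M b n))))))"
      by (simp add: psum_dsum_swap)
    also have "\<dots> = csum ?W a (\<lambda>l b. csum ?W b (\<lambda>l' b'. psum M \<phi> ?W m (\<lambda>h n. rsum ?W (\<lambda>s' t'. rsum ?W (\<lambda>s t. 
          f (l ** (t' ** (h ** s))) (l' ** (s' ** t)) (act M b' n))))))"
      by (rule csum_coassoc; (intro lin_intros)?; simp)
    finally show "csum ?W a (\<lambda>l b. psum ?U (phit Y M \<phi>) ?W (act (V Y M) b (tens K Y M y m)) (\<lambda>h u'. tens K H ?U (h ** l) u'))
      = csum ?W a (\<lambda>l b. psum ?U (phit Y M \<phi>) ?W (tens K Y M y m) (\<lambda>h u'. tens K H ?U (l ** h) (act (V Y M) b u')))"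
      by (simp add: 1 2 del: V_act_tens)
  qed simp_all
qed

text \<open>Of the five copies of \<open>R\<close> only p \<otimes> q, u' \<otimes> v' and u
  \<otimes> v are affected. They occur in the products \<open>v' q\<close>, \<open>p u\<close>,
  \<open>u' v\<close> on one side and in the reversed products on the other, which is the
  Yang-Baxter equation. The remaining steps reorder sums.\<close>

lemma YB_phit:
  assumes [simp]: "module K W" and f: "trilin K H H H W f"
    and [simp]: "g \<in> carrier H" "h \<in> carrier H"
  shows "rsum W (\<lambda>p q. rsum W (\<lambda>s' t'. rsum W (\<lambda>u' v'. rsum W (\<lambda>u v. rsum W (\<lambda>s t.
      f (v' ** (q ** (h ** s))) (t' ** (g ** (p ** u))) (s' ** (u' ** (v ** t))))))))
    = rsum W (\<lambda>u' v'. rsum W (\<lambda>s t. rsum W (\<lambda>s' t'. rsum W (\<lambda>u v. rsum W (\<lambda>p q.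
      f (q ** (v' ** (h ** s))) (t' ** (g ** (u ** p))) (s' ** (v ** (u' ** t))))))))"
proof -
  note [lin_intros] = trilin_lin1[OF f] trilin_lin2[OF f] trilin_lin3[OF f]
  note [simp] = trilin_closed[OF f]
  let ?L = "\<lambda>p q s' t' u' v' u v s t. f (v' ** (q ** (h ** s))) (t' ** (g ** (p ** u))) (s' ** (u' ** (v ** t)))"
  let ?R = "\<lambda>p q s' t' u' v' u v s t. f (q ** (v' ** (h ** s))) (t' ** (g ** (u ** p))) (s' ** (v ** (u' ** t)))"
  note c = sum_congs(1)[OF HOL.refl]
  have "rsum W (\<lambda>p q. rsum W (\<lambda>s' t'. rsum W (\<lambda>u' v'. rsum W (\<lambda>u v. rsum W (\<lambda>s t. ?L p q s' t' u' v' u v s t)))))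
    = rsum W (\<lambda>s' t'. rsum W (\<lambda>p q. rsum W (\<lambda>u' v'. rsum W (\<lambda>u v. rsum W (\<lambda>s t. ?L p q s' t' u' v' u v s t)))))"
    by (rule rsum_swap(1)) simp_all
  also have "\<dots> = rsum W (\<lambda>s' t'. rsum W (\<lambda>p q. rsum W (\<lambda>u' v'. rsum W (\<lambda>s t. rsum W (\<lambda>u v. ?L p q s' t' u' v' u v s t)))))"
    by (rule c, rule c, rule c, rule rsum_swap(1)) simp_all
  also have "\<dots> = rsum W (\<lambda>s' t'. rsum W (\<lambda>p q. rsum W (\<lambda>s t. rsum W (\<lambda>u' v'. rsum W (\<lambda>u v. ?L p q s' t' u' v' u v s t)))))"
    by (rule c, rule c, rule rsum_swap(1)) simp_all
  also have "\<dots> = rsum W (\<lambda>s' t'. rsum W (\<lambda>s t. rsum W (\<lambda>p q. rsum W (\<lambda>u' v'. rsum W (\<lambda>u v. ?L p q s' t' u' v' u v s t)))))"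
    by (rule c, rule rsum_swap(1)) simp_all
  also have "\<dots> = rsum W (\<lambda>s' t'. rsum W (\<lambda>s t. rsum W (\<lambda>u v. rsum W (\<lambda>p q. rsum W (\<lambda>u' v'. 
      f ((v' ** q) ** (h ** s)) (t' ** (g ** (p ** u))) (s' ** ((u' ** v) ** t)))))))"
  proof (rule c, rule c)
    fix s' t' s t assume [simp]: "s' \<in> carrier H" "t' \<in> carrier H" "s \<in> carrier H" "t \<in> carrier H"
    have "rsum W (\<lambda>p q. rsum W (\<lambda>u' v'. rsum W (\<lambda>u v. ?L p q s' t' u' v' u v s t)))
      = rsum W (\<lambda>p q. rsum W (\<lambda>u v. rsum W (\<lambda>u' v'. ?L p q s' t' u' v' u v s t)))"
      by (rule c, rule rsum_swap(1)) simp_all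
    also have "\<dots> = rsum W (\<lambda>u v. rsum W (\<lambda>p q. rsum W (\<lambda>u' v'. ?L p q s' t' u' v' u v s t)))"
      by (rule rsum_swap(1)) simp_all
    finally show "rsum W (\<lambda>p q. rsum W (\<lambda>u' v'. rsum W (\<lambda>u v. ?L p q s' t' u' v' u v s t)))
      = rsum W (\<lambda>u v. rsum W (\<lambda>p q. rsum W (\<lambda>u' v'. 
      f ((v' ** q) ** (h ** s)) (t' ** (g ** (p ** u))) (s' ** ((u' ** v) ** t)))))" by simp
  qed
  also have "\<dots> = rsum W (\<lambda>s' t'. rsum W (\<lambda>s t. rsum W (\<lambda>u v. rsum W (\<lambda>p q. rsum W (\<lambda>u' v'. 
      f ((q ** v') ** (h ** s)) (t' ** (g ** (u ** p))) (s' ** ((v ** u') ** t)))))))"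
    by (rule c, rule c, rule YB_rsum[symmetric, where f="\<lambda>x y z. f (z ** (h ** _)) (_ ** (g ** x)) (_ ** (y ** _))"]; (intro lin_intros)?; simp)
  also have "\<dots> = rsum W (\<lambda>s' t'. rsum W (\<lambda>s t. rsum W (\<lambda>u v. rsum W (\<lambda>p q. rsum W (\<lambda>u' v'. ?R p q s' t' u' v' u v s t)))))"
    by simp
  also have "\<dots> = rsum W (\<lambda>s' t'. rsum W (\<lambda>s t. rsum W (\<lambda>u v. rsum W (\<lambda>u' v'. rsum W (\<lambda>p q. ?R p q s' t' u' v' u v s t)))))"
    by (rule c, rule c, rule c, rule rsum_swap(1)) simp_all
  also have "\<dots> = rsum W (\<lambda>s' t'. rsum W (\<lambda>s t. rsum W (\<lambda>u' v'. rsum W (\<lambda>u v. rsum W (\<lambda>p q. ?R p q s' t' u' v' u v s t)))))"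
    by (rule c, rule c, rule rsum_swap(1)) simp_all
  also have "\<dots> = rsum W (\<lambda>s' t'. rsum W (\<lambda>u' v'. rsum W (\<lambda>s t. rsum W (\<lambda>u v. rsum W (\<lambda>p q. ?R p q s' t' u' v' u v s t)))))"
    by (rule c, rule rsum_swap(1)) simp_all
  also have "\<dots> = rsum W (\<lambda>u' v'. rsum W (\<lambda>s' t'. rsum W (\<lambda>s t. rsum W (\<lambda>u v. rsum W (\<lambda>p q. ?R p q s' t' u' v' u v s t)))))"
    by (rule rsum_swap(1)) simp_all
  also have "\<dots> = rsum W (\<lambda>u' v'. rsum W (\<lambda>s t. rsum W (\<lambda>s' t'. rsum W (\<lambda>u v. rsum W (\<lambda>p q. ?R p q s' t' u' v' u v s t)))))"
    by (rule c, rule rsum_swap(1)) simp_all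
  finally show ?thesis .
qed

text \<open>The reflection equation for Y \<otimes> M is reduced to the one for M. The coproduct of
  \<open>t' h s\<close> is expanded by multiplicativity and by the axioms on the coproducts of the
  legs of \<open>R\<close>. Yang-Baxter brings one copy of \<open>R\<close> next to the coproduct of
  h, where \<open>refl_braid\<close> applies, and a second use in \<open>YB_phit\<close> restores
  the order of the iterated coaction.\<close>

lemma phit_braid:
  assumes u: "u \<in> carrier (tensor K Y M)"
  defines "U \<equiv> tensor K Y M" and "W \<equiv> tensor K HH (tensor K Y M)"
  shows "psum U (phit Y M \<phi>) W u (\<lambda>h u'. dsum W h (\<lambda>a b. rsum W (\<lambda>s t.
      tens K HH U (tens K H H (a ** t) (b ** s)) u')))
    = psum U (phit Y M \<phi>) W u (\<lambda>h u'. psum U (phit Y M \<phi>) W u' (\<lambda>g u''. rsum W (\<lambda>s t.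
      tens K HH U (tens K H H (t ** h) (g ** s)) u'')))"
    (is "?F u = ?G u")
proof -
  have U [simp]: "module K U" "module K W" "phit Y M \<phi> \<in> linear_maps K U (tensor K H U)" by (simp_all add: U_def W_def)
  have Wc [simp]: "tensor K HH U = W" by (simp add: U_def W_def)
  have Ut [simp]: "y \<in> carrier Y \<Longrightarrow> n \<in> carrier M \<Longrightarrow> tens K Y M y n \<in> carrier U" for y n by (simp add: U_def)
  have W1 [simp]: "a \<in> carrier HH \<Longrightarrow> b \<in> carrier U \<Longrightarrow> tens K HH U a b \<in> carrier W" for a b unfolding W_def U_def by simp
  have [lin_intros]: "g \<in> linear_maps K Z HH \<Longrightarrow> b \<in> carrier U \<Longrightarrow> (\<lambda>v. tens K HH U (g v) b) \<in> linear_maps K Z W"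
    "a \<in> carrier HH \<Longrightarrow> g' \<in> linear_maps K Z U \<Longrightarrow> (\<lambda>v. tens K HH U a (g' v)) \<in> linear_maps K Z W"
    for g g' a b and Z :: "('k, ('k, 'a) univ) module"
    unfolding Wc[symmetric] by (intro lin_intros; simp)+
  have [lin_intros]: "g \<in> linear_maps K H HH \<Longrightarrow> b \<in> carrier U \<Longrightarrow> (\<lambda>v. tens K HH U (g v) b) \<in> linear_maps K H W"
    for g b unfolding Wc[symmetric] by (intro lin_intros; simp)
  show ?thesis
  proof (rule lin_eq_tensor[where F="?F" and G="?G", OF _ _ _ _ _ _ u])
    show "?F \<in> linear_maps K (tensor K Y M) W" "?G \<in> linear_maps K (tensor K Y M) W"
      unfolding U_def[symmetric] by (intro lin_intros; simp)+
    fix y m assume [simp]: "y \<in> carrier Y" "m \<in> carrier M"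
    define f where "f a b k n = tens K HH U (tens K H H a b) (tens K Y M (act Y k y) n)" for a b k n
    have [lin_intros]: "(\<lambda>v. f a b k v) \<in> linear_maps K M W" if "a \<in> carrier H" "b \<in> carrier H" "k \<in> carrier H" for a b k
      using that unfolding f_def U_def Wc[unfolded U_def, symmetric] by (intro tens_lin2 lin_id; simp)
    have [lin_intros]: "(\<lambda>v. f (g v) b k n) \<in> linear_maps K H W" if "g \<in> linear_maps K H H" "b \<in> carrier H" "k \<in> carrier H" "n \<in> carrier M" for g b k n
      using that unfolding f_def U_def Wc[unfolded U_def, symmetric] by (intro tens_lin1 tens_lin2 S.H_act_lin; simp)
    have [lin_intros]: "(\<lambda>v. f a (g v) k n) \<in> linear_maps K H W" if "g \<in> linear_maps K H H" "a \<in> carrier H" "k \<in> carrier H" "n \<in> carrier M" for g a k n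
      using that unfolding f_def U_def Wc[unfolded U_def, symmetric] by (intro tens_lin1 tens_lin2 S.H_act_lin; simp)
    have [lin_intros]: "(\<lambda>v. f a b (g v) n) \<in> linear_maps K H W" if "g \<in> linear_maps K H H" "a \<in> carrier H" "b \<in> carrier H" "n \<in> carrier M" for g a b n
      using that unfolding f_def U_def Wc[unfolded U_def, symmetric] by (intro tens_lin1 tens_lin2 S.H_act_lin; simp)
    have [simp]: "f a b k n \<in> carrier W" if "a \<in> carrier H" "b \<in> carrier H" "k \<in> carrier H" "n \<in> carrier M" for a b k n
      using that by (simp add: f_def)
    have fe: "tens K HH U (tens K H H a b) (tens K Y M (act Y k y) n) = f a b k n" for a b k n
      by (simp add: f_def)
    note pp = psum_phit[folded U_def]
    have bl: "bilin K H U W (\<lambda>h u'. dsum W h (\<lambda>a b. rsum W (\<lambda>s t. tens K HH U (tens K H H (a ** t) (b ** s)) u')))"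
      by (intro lin_intros; simp)
    have "?F (tens K Y M y m) = psum M \<phi> W m (\<lambda>h n. rsum W (\<lambda>s' t'. rsum W (\<lambda>s t.
        dsum W (t' ** (h ** s)) (\<lambda>a b. rsum W (\<lambda>p q. f (a ** q) (b ** p) (s' ** t) n)))))"
      using pp[OF _ _ _ bl] by (simp add: f_def)
    also have "\<dots> = psum M \<phi> W m (\<lambda>h n. rsum W (\<lambda>s' t'. rsum W (\<lambda>s t.
        dsum W t' (\<lambda>a1 a2. dsum W (h ** s) (\<lambda>b1 b2. rsum W (\<lambda>p q.
          f ((a1 ** b1) ** q) ((a2 ** b2) ** p) (s' ** t) n))))))"
      by (intro psum_cong sum_congs(1) HOL.refl, rule dsum_mult; (intro lin_intros)?; simp)
    also have "\<dots> = psum M \<phi> W m (\<lambda>h n. rsum W (\<lambda>s' t'. rsum W (\<lambda>s t.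
        dsum W t' (\<lambda>a1 a2. dsum W h (\<lambda>b1 b2. dsum W s (\<lambda>c1 c2. rsum W (\<lambda>p q.
          f ((a1 ** (b1 ** c1)) ** q) ((a2 ** (b2 ** c2)) ** p) (s' ** t) n)))))))"
      by (intro psum_cong sum_congs(1) HOL.refl, rule sum_congs(3)[OF HOL.refl _ HOL.refl], rule dsum_mult; (intro lin_intros)?; simp)
    also have "\<dots> = psum M \<phi> W m (\<lambda>h n. rsum W (\<lambda>s' t'. 
        dsum W t' (\<lambda>a1 a2. dsum W h (\<lambda>b1 b2. rsum W (\<lambda>s t. dsum W s (\<lambda>c1 c2. rsum W (\<lambda>p q.
          f (a1 ** (b1 ** (c1 ** q))) (a2 ** (b2 ** (c2 ** p))) (s' ** t) n)))))))"
      by (simp add: rsum_dsum_swap)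
    also have "\<dots> = psum M \<phi> W m (\<lambda>h n. rsum W (\<lambda>s' t'. 
        dsum W t' (\<lambda>a1 a2. dsum W h (\<lambda>b1 b2. rsum W (\<lambda>s t. rsum W (\<lambda>u v. rsum W (\<lambda>p q.
          f (a1 ** (b1 ** (s ** q))) (a2 ** (b2 ** (u ** p))) (s' ** (t ** v)) n)))))))"
      by (rule psum_cong[OF HOL.refl HOL.refl], rule sum_congs(1)[OF HOL.refl], rule sum_congs(3)[OF HOL.refl _ HOL.refl], rule sum_congs(3)[OF HOL.refl _ HOL.refl], rule rsum_dsum_left; (intro lin_intros)?; simp)
    also have "\<dots> = psum M \<phi> W m (\<lambda>h n. rsum W (\<lambda>s' t'. 
        dsum W t' (\<lambda>a1 a2. dsum W h (\<lambda>b1 b2. rsum W (\<lambda>p q. rsum W (\<lambda>u v. rsum W (\<lambda>s t. 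
          f (a1 ** (b1 ** (q ** s))) (a2 ** (b2 ** (p ** u))) (s' ** (v ** t)) n)))))))"
    \<comment> \<open>The three inner sums are reordered until Yang-Baxter applies, with its first
      two legs exchanged.\<close>
    proof (intro psum_cong sum_congs(1) HOL.refl, rule sum_congs(3)[OF HOL.refl _ HOL.refl], rule sum_congs(3)[OF HOL.refl _ HOL.refl])
      fix h n s' t' a1 a2 b1 b2 assume [simp]: "h \<in> carrier H" "n \<in> carrier M" "s' \<in> carrier H" "t' \<in> carrier H"
        "a1 \<in> carrier H" "a2 \<in> carrier H" "b1 \<in> carrier H" "b2 \<in> carrier H"
      let ?f = "\<lambda>x1 x2 x3. f (a1 ** (b1 ** x1)) (a2 ** (b2 ** x2)) (s' ** x3) n"
      have "rsum W (\<lambda>s t. rsum W (\<lambda>u v. rsum W (\<lambda>p q. ?f (s ** q) (u ** p) (t ** v))))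
        = rsum W (\<lambda>s t. rsum W (\<lambda>p q. rsum W (\<lambda>u v. ?f (s ** q) (u ** p) (t ** v))))"
        by (rule sum_congs(1)[OF HOL.refl], rule rsum_swap(1)) simp_all
      also have "\<dots> = rsum W (\<lambda>p q. rsum W (\<lambda>s t. rsum W (\<lambda>u v. ?f (s ** q) (u ** p) (t ** v))))"
        by (rule rsum_swap(1)) simp_all
      also have "\<dots> = rsum W (\<lambda>p q. rsum W (\<lambda>u v. rsum W (\<lambda>s t. ?f (s ** q) (u ** p) (t ** v))))"
        by (rule sum_congs(1)[OF HOL.refl], rule rsum_swap(1)) simp_all
      also have "\<dots> = rsum W (\<lambda>p q. rsum W (\<lambda>u v. rsum W (\<lambda>s t. ?f (q ** s) (p ** u) (v ** t))))"
        by (rule YB_rsum[symmetric, where f="\<lambda>x2 x1 x3. ?f x1 x2 x3"]; (intro lin_intros)?; simp)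
      finally show "rsum W (\<lambda>s t. rsum W (\<lambda>u v. rsum W (\<lambda>p q. ?f (s ** q) (u ** p) (t ** v))))
        = rsum W (\<lambda>p q. rsum W (\<lambda>u v. rsum W (\<lambda>s t. ?f (q ** s) (p ** u) (v ** t))))" .
    qed
    also have "\<dots> = psum M \<phi> W m (\<lambda>h n. rsum W (\<lambda>s' t'. rsum W (\<lambda>u' v'.
        dsum W h (\<lambda>b1 b2. rsum W (\<lambda>p q. rsum W (\<lambda>u v. rsum W (\<lambda>s t. 
          f (v' ** (b1 ** (q ** s))) (t' ** (b2 ** (p ** u))) ((s' ** u') ** (v ** t)) n)))))))"
      by (rule psum_cong[OF HOL.refl HOL.refl], rule rsum_dsum_right; (intro lin_intros)?; simp)
    also have "\<dots> = psum M \<phi> W m (\<lambda>h n. dsum W h (\<lambda>b1 b2. rsum W (\<lambda>p q. rsum W (\<lambda>s' t'. rsum W (\<lambda>u' v'. rsum W (\<lambda>u v. rsum W (\<lambda>s t. 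
          f (v' ** ((b1 ** q) ** s)) (t' ** ((b2 ** p) ** u)) (s' ** (u' ** (v ** t))) n)))))))"
    proof (rule psum_cong[OF HOL.refl HOL.refl])
      fix h n assume [simp]: "h \<in> carrier H" "n \<in> carrier M"
      let ?f = "\<lambda>b1 b2 p q s' t' u' v' u v s t. f (v' ** (b1 ** (q ** s))) (t' ** (b2 ** (p ** u))) (s' ** (u' ** (v ** t))) n"
      have "rsum W (\<lambda>s' t'. rsum W (\<lambda>u' v'. dsum W h (\<lambda>b1 b2. rsum W (\<lambda>p q. rsum W (\<lambda>u v. rsum W (\<lambda>s t. 
          f (v' ** (b1 ** (q ** s))) (t' ** (b2 ** (p ** u))) ((s' ** u') ** (v ** t)) n))))))
        = dsum W h (\<lambda>b1 b2. rsum W (\<lambda>s' t'. rsum W (\<lambda>u' v'. rsum W (\<lambda>p q. rsum W (\<lambda>u v. rsum W (\<lambda>s t. ?f b1 b2 p q s' t' u' v' u v s t))))))"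
        by (simp add: rsum_dsum_swap)
      also have "\<dots> = dsum W h (\<lambda>b1 b2. rsum W (\<lambda>s' t'. rsum W (\<lambda>p q. rsum W (\<lambda>u' v'. rsum W (\<lambda>u v. rsum W (\<lambda>s t. ?f b1 b2 p q s' t' u' v' u v s t))))))"
        by (rule sum_congs(3)[OF HOL.refl _ HOL.refl], rule sum_congs(1)[OF HOL.refl], rule rsum_swap(1)) simp_all
      also have "\<dots> = dsum W h (\<lambda>b1 b2. rsum W (\<lambda>p q. rsum W (\<lambda>s' t'. rsum W (\<lambda>u' v'. rsum W (\<lambda>u v. rsum W (\<lambda>s t. ?f b1 b2 p q s' t' u' v' u v s t))))))"
        by (rule sum_congs(3)[OF HOL.refl _ HOL.refl], rule rsum_swap(1)) simp_all
      finally show "rsum W (\<lambda>s' t'. rsum W (\<lambda>u' v'. dsum W h (\<lambda>b1 b2. rsum W (\<lambda>p q. rsum W (\<lambda>u v. rsum W (\<lambda>s t. 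
          f (v' ** (b1 ** (q ** s))) (t' ** (b2 ** (p ** u))) ((s' ** u') ** (v ** t)) n))))))
        = dsum W h (\<lambda>b1 b2. rsum W (\<lambda>p q. rsum W (\<lambda>s' t'. rsum W (\<lambda>u' v'. rsum W (\<lambda>u v. rsum W (\<lambda>s t. 
          f (v' ** ((b1 ** q) ** s)) (t' ** ((b2 ** p) ** u)) (s' ** (u' ** (v ** t))) n))))))"
        by simp
    qed
    also have "\<dots> = psum M \<phi> W m (\<lambda>h n. psum M \<phi> W n (\<lambda>g n'. rsum W (\<lambda>p q. rsum W (\<lambda>s' t'. rsum W (\<lambda>u' v'. rsum W (\<lambda>u v. rsum W (\<lambda>s t. 
          f (v' ** ((q ** h) ** s)) (t' ** ((g ** p) ** u)) (s' ** (u' ** (v ** t))) n')))))))"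
      by (rule refl_braid[OF r]; (intro lin_intros)?; simp)
    also have "\<dots> = psum M \<phi> W m (\<lambda>h n. psum M \<phi> W n (\<lambda>g n'. rsum W (\<lambda>u' v'. rsum W (\<lambda>s t. rsum W (\<lambda>s' t'. rsum W (\<lambda>u v. rsum W (\<lambda>p q.
      f (q ** (v' ** (h ** s))) (t' ** (g ** (u ** p))) (s' ** (v ** (u' ** t))) n')))))))"
    proof (rule psum_cong[OF HOL.refl HOL.refl], rule psum_cong[OF HOL.refl HOL.refl])
      fix h n g n' assume [simp]: "h \<in> carrier H" "n \<in> carrier M" "g \<in> carrier H" "n' \<in> carrier M"
      have "trilin K H H H W (\<lambda>a b k. f a b k n')" by (intro lin_intros; simp)
      from YB_phit[OF _ this, of g h]
      show "rsum W (\<lambda>p q. rsum W (\<lambda>s' t'. rsum W (\<lambda>u' v'. rsum W (\<lambda>u v. rsum W (\<lambda>s t. 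
          f (v' ** ((q ** h) ** s)) (t' ** ((g ** p) ** u)) (s' ** (u' ** (v ** t))) n')))))
        = rsum W (\<lambda>u' v'. rsum W (\<lambda>s t. rsum W (\<lambda>s' t'. rsum W (\<lambda>u v. rsum W (\<lambda>p q.
      f (q ** (v' ** (h ** s))) (t' ** (g ** (u ** p))) (s' ** (v ** (u' ** t))) n')))))"
        by simp
    qed
    also have "\<dots> = psum M \<phi> W m (\<lambda>h n. rsum W (\<lambda>u' v'. rsum W (\<lambda>s t. psum M \<phi> W n (\<lambda>g n'. rsum W (\<lambda>s' t'. rsum W (\<lambda>u v. rsum W (\<lambda>p q.
      f (q ** (v' ** (h ** s))) ((t' ** (g ** u)) ** p) (s' ** (v ** (u' ** t))) n')))))))"
      by (simp add: psum_rsum_swap)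
    also have "\<dots> = psum M \<phi> W m (\<lambda>h n. rsum W (\<lambda>u' v'. rsum W (\<lambda>s t. 
        psum U (phit Y M \<phi>) W (tens K Y M (act Y (u' ** t) y) n) (\<lambda>g u''. rsum W (\<lambda>p q.
          tens K HH U (tens K H H (q ** (v' ** (h ** s))) (g ** p)) u'')))))"
    proof (intro psum_cong sum_congs(1) HOL.refl)
      fix h n u' v' s t assume [simp]: "h \<in> carrier H" "n \<in> carrier M" "u' \<in> carrier H" "v' \<in> carrier H" "s \<in> carrier H" "t \<in> carrier H"
      have "bilin K H U W (\<lambda>g u''. rsum W (\<lambda>p q.
          tens K HH U (tens K H H (q ** (v' ** (h ** s))) (g ** p)) u''))"
        by (intro lin_intros; simp)
      from pp[OF _ _ _ this, of "act Y (u' ** t) y" n]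
      show "psum M \<phi> W n (\<lambda>g n'. rsum W (\<lambda>s' t'. rsum W (\<lambda>u v. rsum W (\<lambda>p q.
          f (q ** (v' ** (h ** s))) ((t' ** (g ** u)) ** p) (s' ** (v ** (u' ** t))) n'))))
        = psum U (phit Y M \<phi>) W (tens K Y M (act Y (u' ** t) y) n) (\<lambda>g u''. rsum W (\<lambda>p q.
          tens K HH U (tens K H H (q ** (v' ** (h ** s))) (g ** p)) u''))"
        by (simp add: f_def S.H_act(4)[symmetric])
    qed
    also have "\<dots> = ?G (tens K Y M y m)"
    proof -
      have "bilin K H U W (\<lambda>h u'. psum U (phit Y M \<phi>) W u' (\<lambda>g u''. rsum W (\<lambda>s t.
        tens K HH U (tens K H H (t ** h) (g ** s)) u'')))"
        by (intro lin_intros; simp)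
      from pp[OF _ _ _ this, of y m] show ?thesis by simp
    qed
    finally show "?F (tens K Y M y m) = ?G (tens K Y M y m)" .
  qed simp_all
qed

text \<open>In view of \<open>DH_obj_iff\<close>, this says that \<open>DH_act\<close> takes
  Doi-Hopf modules to Doi-Hopf modules.\<close>

lemma phit_refl_coaction [simp]: "refl_coaction (V Y M) (phit Y M \<phi>)"
  unfolding refl_coaction_def Let_def
  using phit_ext phit_counit phit_braid phit_act by simp

end

end

section \<open>The braid axioms, and naturality as colinearity\<close>

context quasitriangular_comodule
begin

lemmas [simp] = H_mod_inv_simps(2)[OF _ _ S.I_left_module]

context
  fixes M :: "('k, ('k, 'a) univ) lmod" and \<phi> :: "('k, 'a) univ \<Rightarrow> ('k, 'a) univ"
  assumes lin [simp]: "left_module K A M" "\<phi> \<in> linear_maps K M (tensor K H M)"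
begin

lemmas [simp] = psum_fold[OF lin(2)]
declare S.H_act(4) [simp del] M.H_act(4) [simp del] S.A_act(4) [simp del]

context
  fixes X Y :: "('k, ('k, 'a) univ) lmod"
  assumes XY [simp]: "left_module K H X" "left_module K H Y"
    and e [simp]: "earr X M \<phi> \<in> Arr M.LA" "earr Y M \<phi> \<in> Arr M.LA"
begin

text \<open>The right-hand side of BM1 with the inverses of the associators and of the braiding
  spelled out, so that it can be evaluated on pure tensors.\<close>

definition BM1_arr where "BM1_arr = M.lassoc_inv X Y M \<cdot>\<^bsub>M.LA\<^esub> tensor_arrow (coact A) (Idn S.LH X) (earr Y M \<phi>) \<cdot>\<^bsub>M.LA\<^esub> M.lassoc X Y M
       \<cdot>\<^bsub>M.LA\<^esub> tensor_arrow (coact A) (braid Y X) (Idn M.LA M)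
       \<cdot>\<^bsub>M.LA\<^esub> M.lassoc_inv Y X M \<cdot>\<^bsub>M.LA\<^esub> tensor_arrow (coact A) (Idn S.LH Y) (earr X M \<phi>) \<cdot>\<^bsub>M.LA\<^esub> M.lassoc Y X M
       \<cdot>\<^bsub>M.LA\<^esub> tensor_arrow (coact A) (braid_inv Y X) (Idn M.LA M)"

lemma BM1_arr_Arr: "BM1_arr \<in> Arr M.LA" "src BM1_arr = V (S.T X Y) M" "tgt BM1_arr = V (S.T X Y) M"
  by (simp_all add: BM1_arr_def)

lemma BM1_arr_tens:
  assumes [simp]: "x \<in> carrier X" "y \<in> carrier Y" "m \<in> carrier M"
  defines "W \<equiv> tensor K (tensor K X Y) M"
  shows "fn BM1_arr (tens K (tensor K X Y) M (tens K X Y x y) m) =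
    psum M \<phi> W m (\<lambda>h n. psum M \<phi> W n (\<lambda>g n'. rsum W (\<lambda>s t. risum W (\<lambda>p q.
      tens K (tensor K X Y) M (tens K X Y (act X (t ** (h ** q)) x) (act Y (g ** (s ** p)) y)) n'))))"
  by (simp add: BM1_arr_def W_def S.H_act(4)[symmetric]
    sum_out[OF tensor_assoc_lin] sum_out[OF tensor_assoc_inv_lin] psum_out[OF tensor_assoc_lin _ _ _ lin(2)] psum_out[OF tensor_assoc_inv_lin _ _ _ lin(2)]
    psum_rsum_swap[symmetric] psum_risum_swap[symmetric] rsum_swap(2))

lemma BM2_arr_tens:
  assumes [simp]: "x \<in> carrier X" "y \<in> carrier Y" "m \<in> carrier M"
  defines "W \<equiv> tensor K X (tensor K Y M)"
  shows "fn (BM2_rhs (H_mod K H) (A_mod K H A) Y M (\<lambda>Z. earr Z M \<phi>) X) (tens K X (tensor K Y M) x (tens K Y M y m)) =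
    psum M \<phi> W m (\<lambda>h n. rsum W (\<lambda>s' t'. rsum W (\<lambda>s t.
      tens K X (tensor K Y M) (act X (t' ** (h ** s)) x) (tens K Y M (act Y (s' ** t) y) n))))"
  by (simp add: BM2_rhs_def W_def S.H_act(4)[symmetric]
    sum_out[OF tensor_assoc_lin] sum_out[OF tensor_assoc_inv_lin] psum_out[OF tensor_assoc_lin _ _ _ lin(2)] psum_out[OF tensor_assoc_inv_lin _ _ _ lin(2)]
    psum_rsum_swap[symmetric]) (rule psum_cong[OF HOL.refl HOL.refl], rule rsum_swap(1), simp_all)

end

lemma earr_tensor_tens:
  assumes [simp]: "left_module K H X" "left_module K H Y" "x \<in> carrier X" "y \<in> carrier Y" "m \<in> carrier M"
  defines "W \<equiv> tensor K (tensor K X Y) M"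
  shows "fn (earr (S.T X Y) M \<phi>) (tens K (tensor K X Y) M (tens K X Y x y) m) =
    psum M \<phi> W m (\<lambda>h n. dsum W h (\<lambda>a b. tens K (tensor K X Y) M (tens K X Y (act X a x) (act Y b y)) n))"
  by (simp add: W_def)

end


definition colin where
  "colin M \<phi> N \<psi> f \<longleftrightarrow> (\<forall>m\<in>carrier M. \<psi> (f m) = psum M \<phi> (tensor K H N) m (\<lambda>h n. tens K H N h (f n)))"

context
  fixes M :: "('k, ('k, 'a) univ) lmod" and \<phi> :: "('k, 'a) univ \<Rightarrow> ('k, 'a) univ"
  assumes r: "refl_coaction M \<phi>"
begin

lemmas [simp] = refl_coactionD[OF r] psum_fold[OF refl_coactionD(3,4)[OF r]] earr_Arr[OF r]
declare S.H_act(4) [simp del] M.H_act(4) [simp del] S.A_act(4) [simp del]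

text \<open>The reflection equation with the copy of \<open>R\<close> on the side of the coproduct
  carried over by the inverse of \<open>R\<close>.\<close>

lemma refl_BM1:
  assumes [simp]: "m \<in> carrier M" "module K W" and f: "trilin K H H M W f"
  shows "psum M \<phi> W m (\<lambda>h n. dsum W h (\<lambda>a b. f a b n)) =
    psum M \<phi> W m (\<lambda>h n. psum M \<phi> W n (\<lambda>g n'. rsum W (\<lambda>s t. risum W (\<lambda>p q.
      f (t ** (h ** q)) (g ** (s ** p)) n'))))"
proof -
  note [lin_intros] = trilin_lin1[OF f] trilin_lin2[OF f] trilin_lin3[OF f]
  note [simp] = trilin_closed[OF f]
  have "psum M \<phi> W m (\<lambda>h n. dsum W h (\<lambda>a b. rsum W (\<lambda>s t. risum W (\<lambda>p q. f (a ** (t ** q)) (b ** (s ** p)) n)))) =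
    psum M \<phi> W m (\<lambda>h n. dsum W h (\<lambda>a b. f (a ** \<one>\<^bsub>H\<^esub>) (b ** \<one>\<^bsub>H\<^esub>) n))"
    by (rule psum_cong[OF HOL.refl HOL.refl], rule sum_congs(3)[OF HOL.refl _ HOL.refl], rule rsum_risum(1); (intro lin_intros)?; simp)
  moreover have "psum M \<phi> W m (\<lambda>h n. dsum W h (\<lambda>a b. rsum W (\<lambda>s t. risum W (\<lambda>p q. f ((a ** t) ** q) ((b ** s) ** p) n)))) =
    psum M \<phi> W m (\<lambda>h n. psum M \<phi> W n (\<lambda>g n'. rsum W (\<lambda>s t. risum W (\<lambda>p q.
      f ((t ** h) ** q) ((g ** s) ** p) n'))))"
    by (rule refl_braid[OF r]; (intro lin_intros)?; simp)
  ultimately show ?thesis by simp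
qed

lemma earr_BM1: "BM1 (H_mod K H) (A_mod K H A) M (\<lambda>X. earr X M \<phi>)"
  unfolding BM1_def
proof (intro ballI)
  fix X Y assume "X \<in> Obj (H_mod K H)" "Y \<in> Obj (H_mod K H)"
  hence [simp]: "left_module K H X" "left_module K H Y" by simp_all
  have "earr (S.T X Y) M \<phi> = BM1_arr M \<phi> X Y"
  proof (rule lmod_Arr_eq_tensor_left[where X=X and Y=Y and Z=M and A=A])
    fix x y m assume [simp]: "x \<in> carrier X" "y \<in> carrier Y" "m \<in> carrier M"
    show "fn (earr (S.T X Y) M \<phi>) (tens K (tensor K X Y) M (tens K X Y x y) m) =
      fn (BM1_arr M \<phi> X Y) (tens K (tensor K X Y) M (tens K X Y x y) m)"
      by (simp add: earr_tensor_tens BM1_arr_tens del: earr_tens, rule refl_BM1; (intro lin_intros)?; simp)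
  qed (simp_all add: BM1_arr_Arr)
  thus "earr (X \<boxtimes>\<^bsub>H_mod K H\<^esub> Y) M \<phi> =
    inv_arr (A_mod K H A) (act_assoc (A_mod K H A) X Y M) \<cdot>\<^bsub>A_mod K H A\<^esub> (Idn (H_mod K H) X \<triangleright>\<^sub>a\<^bsub>A_mod K H A\<^esub> earr Y M \<phi>) \<cdot>\<^bsub>A_mod K H A\<^esub> act_assoc (A_mod K H A) X Y M
       \<cdot>\<^bsub>A_mod K H A\<^esub> (braiding (H_mod K H) Y X \<triangleright>\<^sub>a\<^bsub>A_mod K H A\<^esub> Idn (A_mod K H A) M)
       \<cdot>\<^bsub>A_mod K H A\<^esub> inv_arr (A_mod K H A) (act_assoc (A_mod K H A) Y X M) \<cdot>\<^bsub>A_mod K H A\<^esub> (Idn (H_mod K H) Y \<triangleright>\<^sub>a\<^bsub>A_mod K H A\<^esub> earr X M \<phi>) \<cdot>\<^bsub>A_mod K H A\<^esub> act_assoc (A_mod K H A) Y X M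
       \<cdot>\<^bsub>A_mod K H A\<^esub> (inv_arr (H_mod K H) (braiding (H_mod K H) Y X) \<triangleright>\<^sub>a\<^bsub>A_mod K H A\<^esub> Idn (A_mod K H A) M)"
    by (simp add: BM1_arr_def)
qed

text \<open>The two braidings in BM2 contribute exactly the two copies of \<open>R\<close> in
  \<open>phit\<close>: the coaction on Y \<otimes> M is the one that BM2 forces.\<close>

lemma earr_BM2:
  assumes [simp]: "left_module K H X" "left_module K H Y"
  shows "earr X (V Y M) (phit Y M \<phi>) = BM2_rhs (H_mod K H) (A_mod K H A) Y M (\<lambda>Z. earr Z M \<phi>) X"
proof (rule lmod_Arr_eq_tensor_right[where X=X and Y=Y and Z=M and A=A])
  note [simp] = phit_refl_coaction[OF r] earr_Arr[OF phit_refl_coaction[OF r]] psum_fold_phit[OF r] phit_lin[OF r]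
  show "earr X (V Y M) (phit Y M \<phi>) \<in> Arr M.LA" by simp
  fix x y m assume [simp]: "x \<in> carrier X" "y \<in> carrier Y" "m \<in> carrier M"
  let ?W = "tensor K X (tensor K Y M)"
  have "fn (earr X (V Y M) (phit Y M \<phi>)) (tens K X (tensor K Y M) x (tens K Y M y m)) =
    psum (V Y M) (phit Y M \<phi>) ?W (tens K Y M y m) (\<lambda>h u. tens K X (tensor K Y M) (act X h x) u)"
    by simp
  also have "\<dots> = psum (tensor K Y M) (phit Y M \<phi>) ?W (tens K Y M y m) (\<lambda>h u. tens K X (tensor K Y M) (act X h x) u)"
    by (simp add: psum_def)
  also have "\<dots> = fn (BM2_rhs (H_mod K H) (A_mod K H A) Y M (\<lambda>Z. earr Z M \<phi>) X) (tens K X (tensor K Y M) x (tens K Y M y m))"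
    by (simp only: BM2_arr_tens[OF refl_coactionD(1,3)[OF r]] earr_Arr[OF r] assms \<open>x \<in> carrier X\<close> \<open>y \<in> carrier Y\<close> \<open>m \<in> carrier M\<close>,
      rule psum_phit[OF r]; (intro lin_intros)?; simp)
  finally show "fn (earr X (V Y M) (phit Y M \<phi>)) (tens K X (tensor K Y M) x (tens K Y M y m)) = \<dots>" .
qed (simp_all add: BM2_rhs_def)

end


text \<open>The left regular module, the test object for natural families: evaluation at its element
  1 recovers the coaction.\<close>

definition Hreg :: "('k, ('k, 'a) univ) lmod" where
  "Hreg = module.extend (module.truncate H) \<lparr>act = monoid.mult H\<rparr>"

lemma Hreg_same_ops: "same_ops Hreg H"
  by (simp add: same_ops_def Hreg_def module.defs)

lemmas Hreg_simps [simp] = same_ops_simps[OF Hreg_same_ops] same_ops_sums[OF Hreg_same_ops] same_ops_psum[OF Hreg_same_ops] same_ops_csum[OF Hreg_same_ops]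

lemma Hreg_simps' [simp]: "carrier Hreg = carrier H" "act Hreg = monoid.mult H" "module K Hreg" "left_module K H Hreg"
proof -
  show 1 [simp]: "carrier Hreg = carrier H" "act Hreg = monoid.mult H" by (simp_all add: Hreg_def module.defs)
  show 2: "module K Hreg" using same_ops_module[OF Hreg_same_ops algebra_module[OF S.H_algebra]] by simp
  show "left_module K H Hreg"
    using 2 unfolding left_module_def by (auto intro!: lin_intros lin_id)
qed

context
  fixes M :: "('k, ('k, 'a) univ) lmod" and \<phi> :: "('k, 'a) univ \<Rightarrow> ('k, 'a) univ"
    and N :: "('k, ('k, 'a) univ) lmod" and \<psi> :: "('k, 'a) univ \<Rightarrow> ('k, 'a) univ"
  assumes r: "refl_coaction M \<phi>" and r': "refl_coaction N \<psi>"
begin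

lemmas [simp] = refl_coactionD[OF r] psum_fold[OF refl_coactionD(3,4)[OF r]] earr_Arr[OF r]
  refl_coactionD[OF r'] psum_fold[OF refl_coactionD(3,4)[OF r']] earr_Arr[OF r']
declare S.H_act(4) [simp del] M.H_act(4) [simp del] S.A_act(4) [simp del]

lemma psum_colin:
  assumes f: "f \<in> linear_maps K M N" and c: "colin M \<phi> N \<psi> f"
    and [simp]: "m \<in> carrier M" "module K W" and G: "bilin K H N W G"
  shows "psum N \<psi> W (f m) G = psum M \<phi> W m (\<lambda>h n. G h (f n))"
proof -
  note [simp] = lin_closed[OF f] bilin_closed[OF G]
  have "psum N \<psi> W (f m) G = sweedler W (\<psi> (f m)) G" by simp
  also have "\<dots> = sweedler W (psum M \<phi> (tensor K H N) m (\<lambda>h n. tens K H N h (f n))) G"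
    using c by (simp add: colin_def)
  also have "\<dots> = psum M \<phi> W m (\<lambda>h n. G h (f n))"
    by (simp add: psum_out[OF sweedler_linear[OF _ _ _ G]] sweedler_tens[OF _ _ _ G])
  finally show ?thesis .
qed

lemma colin_earr_nat:
  assumes [simp]: "g \<in> Arr S.LH" "f \<in> Arr M.LA" "src f = M" "tgt f = N" and c: "colin M \<phi> N \<psi> (fn f)"
  shows "earr (tgt g) N \<psi> \<cdot>\<^bsub>M.LA\<^esub> tensor_arrow (coact A) g f = tensor_arrow (coact A) g f \<cdot>\<^bsub>M.LA\<^esub> earr (src g) M \<phi>"
proof -
  note [simp] = lmod_Arr[OF assms(1)] lmod_Arr(4,5)[OF assms(2), simplified] lmod_Arr_lin[OF assms(2), simplified] lmod_Arr_lin[OF assms(1)]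
  have f: "fn f \<in> linear_maps K M N" using lmod_Arr[OF assms(2)] by simp
  show ?thesis
  proof (rule lmod_Arr_eq_tensor[where A=A and X="src g" and Y=M])
    fix x m assume [simp]: "x \<in> carrier (src g)" "m \<in> carrier M"
    have "psum N \<psi> (tensor K (tgt g) N) (fn f m) (\<lambda>h n. tens K (tgt g) N (act (tgt g) h (fn g x)) n)
      = psum M \<phi> (tensor K (tgt g) N) m (\<lambda>h n. tens K (tgt g) N (act (tgt g) h (fn g x)) (fn f n))"
      by (rule psum_colin[OF f c]; (intro lin_intros)?; simp)
    thus "fn (earr (tgt g) N \<psi> \<cdot>\<^bsub>M.LA\<^esub> tensor_arrow (coact A) g f) (tens K (src g) M x m) =
      fn (tensor_arrow (coact A) g f \<cdot>\<^bsub>M.LA\<^esub> earr (src g) M \<phi>) (tens K (src g) M x m)"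
      by simp
  qed simp_all
qed

text \<open>Colinearity is the naturality square at the regular module, evaluated at 1 \<otimes>
  m.\<close>

lemma earr_nat_colin:
  assumes [simp]: "f \<in> Arr M.LA" "src f = M" "tgt f = N"
    and c: "tensor_arrow (coact A) (Idn S.LH Hreg) f \<cdot>\<^bsub>M.LA\<^esub> earr Hreg M \<phi> = earr Hreg N \<psi> \<cdot>\<^bsub>M.LA\<^esub> tensor_arrow (coact A) (Idn S.LH Hreg) f"
  shows "colin M \<phi> N \<psi> (fn f)"
  unfolding colin_def
proof
  fix m assume [simp]: "m \<in> carrier M"
  have [simp]: "m \<in> carrier M \<Longrightarrow> fn f m \<in> carrier N" for m using lmod_Arr[OF assms(1)] lin_closed by auto
  have "\<psi> (fn f m) = sweedler (tensor K H N) (\<psi> (fn f m)) (tens K H N)"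
    by (rule sweedler_eta[symmetric]) (auto intro: lin_closed[OF refl_coactionD(3)[OF r']])
  also have "\<dots> = fn (earr Hreg N \<psi> \<cdot>\<^bsub>M.LA\<^esub> tensor_arrow (coact A) (Idn S.LH Hreg) f) (tens K H M \<one>\<^bsub>H\<^esub> m)"
    by simp
  also have "\<dots> = psum M \<phi> (tensor K H N) m (\<lambda>h n. tens K H N h (fn f n))"
    unfolding c[symmetric] by simp
  finally show "\<psi> (fn f m) = psum M \<phi> (tensor K H N) m (\<lambda>h n. tens K H N h (fn f n))" .
qed

end

end

section \<open>Colinearity of the structure maps\<close>

context quasitriangular_comodule
begin

lemma DH_arr_iff:
  "Arrow P f Q \<in> DH_arr K H A \<longleftrightarrow> P \<in> DH_obj K H A \<and> Q \<in> DH_obj K H A \<and>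
    Arrow (fst P) f (fst Q) \<in> Arr M.LA \<and> colin (fst P) (snd P) (fst Q) (snd Q) f"
proof -
  obtain M \<phi> N \<psi> where [simp]: "P = (M, \<phi>)" "Q = (N, \<psi>)" by fastforce
  show ?thesis
  proof (cases "P \<in> DH_obj K H A \<and> Q \<in> DH_obj K H A")
    case True
    hence r: "refl_coaction M \<phi>" "refl_coaction N \<psi>" by (simp_all add: DH_obj_iff)
    note [simp] = refl_coactionD[OF r(1)] refl_coactionD[OF r(2)] psum_fold[OF refl_coactionD(3,4)[OF r(1)]]
    show ?thesis using True by (auto simp: DH_arr_def lmod_Arr_iff colin_def)
  next
    case False
    thus ?thesis by (auto simp: DH_arr_def)
  qed
qed

context
  fixes M :: "('k, ('k, 'a) univ) lmod" and \<phi> :: "('k, 'a) univ \<Rightarrow> ('k, 'a) univ"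
  assumes r: "refl_coaction M \<phi>"
begin

lemmas [simp] = refl_coactionD[OF r] psum_fold[OF refl_coactionD(3,4)[OF r]] earr_Arr[OF r]
declare S.H_act(4) [simp del] M.H_act(4) [simp del] S.A_act(4) [simp del]

lemma psum_eta:
  assumes "m \<in> carrier M"
  shows "psum M \<phi> (tensor K H M) m (tens K H M) = \<phi> m"
  using sweedler_eta[of "\<phi> m" H M] lin_closed[OF refl_coactionD(3)[OF r] assms] assms by simp

lemma colin_id: "colin M \<phi> M \<phi> (\<lambda>m\<in>carrier M. m)"
  by (simp add: colin_def psum_eta)

lemma colin_comp:
  assumes r': "refl_coaction N \<psi>" and l: "f \<in> linear_maps K M N" "g \<in> linear_maps K N L" "module K L"
    and c: "colin M \<phi> N \<psi> f" "colin N \<psi> L \<theta> g"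
  shows "colin M \<phi> L \<theta> (compose (carrier M) g f)"
  unfolding colin_def
proof
  note [simp] = refl_coactionD[OF r'] psum_fold[OF refl_coactionD(3,4)[OF r']] lin_closed[OF l(1)] lin_closed[OF l(2)] l(3)
  note [lin_intros] = lin_comp[OF l(2)]
  fix m assume [simp]: "m \<in> carrier M"
  have "\<theta> (g (f m)) = psum N \<psi> (tensor K H L) (f m) (\<lambda>h n. tens K H L h (g n))"
    using c(2) by (simp add: colin_def)
  also have "\<dots> = psum M \<phi> (tensor K H L) m (\<lambda>h n. tens K H L h (g (f n)))"
    by (rule psum_colin[OF r r' l(1) c(1)]; (intro lin_intros)?; simp add: lin_id)
  finally show "\<theta> (compose (carrier M) g f m) = psum M \<phi> (tensor K H L) m (\<lambda>h n. tens K H L h (compose (carrier M) g f n))"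
    by (simp add: compose_eq)
qed

text \<open>Needed for the forgetful functor to reflect isomorphisms. Colinearity of
  \<open>f\<close> is applied at \<open>g n\<close>.\<close>

lemma colin_inverse:
  assumes r': "refl_coaction N \<psi>" and l: "f \<in> linear_maps K M N" "g \<in> linear_maps K N M"
    and c: "colin M \<phi> N \<psi> f" and inv: "\<And>m. m \<in> carrier M \<Longrightarrow> g (f m) = m" "\<And>n. n \<in> carrier N \<Longrightarrow> f (g n) = n"
  shows "colin N \<psi> M \<phi> g"
  unfolding colin_def
proof
  note [simp] = refl_coactionD[OF r'] psum_fold[OF refl_coactionD(3,4)[OF r']] lin_closed[OF l(1)] lin_closed[OF l(2)] inv
  note [lin_intros] = lin_comp[OF l(2)]
  fix n assume [simp]: "n \<in> carrier N"
  have "psum N \<psi> (tensor K H M) (f (g n)) (\<lambda>h n. tens K H M h (g n)) = psum M \<phi> (tensor K H M) (g n) (\<lambda>h n. tens K H M h (g (f n)))"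
    by (rule psum_colin[OF r r' l(1) c]; (intro lin_intros)?; simp add: lin_id del: inv)
  also have "\<dots> = \<phi> (g n)" by (simp add: psum_eta)
  finally show "\<phi> (g n) = psum N \<psi> (tensor K H M) n (\<lambda>h n. tens K H M h (g n))" by simp
qed

end

context
  fixes Y M :: "('k, ('k, 'a) univ) lmod" and \<phi> :: "('k, 'a) univ \<Rightarrow> ('k, 'a) univ"
    and N :: "('k, ('k, 'a) univ) lmod" and \<psi> :: "('k, 'a) univ \<Rightarrow> ('k, 'a) univ"
  assumes r: "refl_coaction M \<phi>" and r': "refl_coaction N \<psi>" and Y [simp]: "left_module K H Y"
begin

lemmas [simp] = refl_coactionD[OF r] psum_fold[OF refl_coactionD(3,4)[OF r]] earr_Arr[OF r]
  refl_coactionD[OF r'] psum_fold[OF refl_coactionD(3,4)[OF r']] earr_Arr[OF r']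
declare S.H_act(4) [simp del] M.H_act(4) [simp del] S.A_act(4) [simp del]

text \<open>A criterion on pure tensors in which \<open>phit\<close> is already unfolded into \<phi>
  and two copies of \<open>R\<close>; the source side of the constraint and braiding computations
  below is brought to this form.\<close>

lemma colin_phitI:
  assumes f: "f \<in> linear_maps K (tensor K Y M) N"
    and t: "\<And>y m. y \<in> carrier Y \<Longrightarrow> m \<in> carrier M \<Longrightarrow> \<psi> (f (tens K Y M y m)) =
      psum M \<phi> (tensor K H N) m (\<lambda>h n. rsum (tensor K H N) (\<lambda>s' t'. rsum (tensor K H N) (\<lambda>s t.
        tens K H N (t' ** (h ** s)) (f (tens K Y M (act Y (s' ** t) y) n)))))"
  shows "colin (V Y M) (phit Y M \<phi>) N \<psi> f"
  unfolding colin_def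
proof
  note [simp] = phit_lin[OF r Y] lin_closed[OF f] psum_fold_phit[OF r Y]
  note [lin_intros] = lin_comp[OF f]
  let ?W = "tensor K H N"
  fix u assume "u \<in> carrier (V Y M)"
  hence u: "u \<in> carrier (tensor K Y M)" by simp
  have "\<psi> (f u) = psum (tensor K Y M) (phit Y M \<phi>) ?W u (\<lambda>h n. tens K H N h (f n))"
  proof (rule lin_eq_tensor[where G="\<lambda>u. psum (tensor K Y M) (phit Y M \<phi>) ?W u (\<lambda>h n. tens K H N h (f n))" and F="\<lambda>u. \<psi> (f u)", OF _ _ _ _ _ _ u])
    show "(\<lambda>u. \<psi> (f u)) \<in> linear_maps K (tensor K Y M) ?W" using lin_comp[OF refl_coactionD(3)[OF r'] f] .
    show "(\<lambda>u. psum (tensor K Y M) (phit Y M \<phi>) ?W u (\<lambda>h n. tens K H N h (f n))) \<in> linear_maps K (tensor K Y M) ?W"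
      by (intro lin_intros; simp add: lin_id)
    fix y m assume [simp]: "y \<in> carrier Y" "m \<in> carrier M"
    show "\<psi> (f (tens K Y M y m)) = psum (tensor K Y M) (phit Y M \<phi>) ?W (tens K Y M y m) (\<lambda>h n. tens K H N h (f n))"
      unfolding t[OF \<open>y \<in> carrier Y\<close> \<open>m \<in> carrier M\<close>] by (rule psum_phit[OF r Y, symmetric]; (intro lin_intros)?; simp add: lin_id)
  qed simp_all
  thus "\<psi> (f u) = psum (V Y M) (phit Y M \<phi>) ?W u (\<lambda>h n. tens K H N h (f n))" by simp
qed

end


context
  fixes M :: "('k, ('k, 'a) univ) lmod" and \<phi> :: "('k, 'a) univ \<Rightarrow> ('k, 'a) univ"
  assumes r: "refl_coaction M \<phi>"
begin

lemmas [simp] = refl_coactionD[OF r] psum_fold[OF refl_coactionD(3,4)[OF r]] earr_Arr[OF r] phit_refl_coaction[OF r]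
  refl_coactionD[OF phit_refl_coaction[OF r]]
declare S.H_act(4) [simp del] M.H_act(4) [simp del] S.A_act(4) [simp del]

lemma phit_eta:
  assumes [simp]: "left_module K H Y" and ym: "y \<in> carrier Y" "m \<in> carrier M"
  shows "phit Y M \<phi> (tens K Y M y m) = psum M \<phi> (tensor K H (tensor K Y M)) m (\<lambda>h n. rsum (tensor K H (tensor K Y M)) (\<lambda>s' t'. rsum (tensor K H (tensor K Y M)) (\<lambda>s t.
        tens K H (tensor K Y M) (t' ** (h ** s)) (tens K Y M (act Y (s' ** t) y) n))))"
proof -
  let ?W = "tensor K H (tensor K Y M)"
  have "psum (V Y M) (phit Y M \<phi>) ?W (tens K Y M y m) (tens K H (tensor K Y M)) = phit Y M \<phi> (tens K Y M y m)"
    using psum_eta[OF phit_refl_coaction[OF r \<open>left_module K H Y\<close>], of "tens K Y M y m"] ym by simp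
  moreover have "psum (tensor K Y M) (phit Y M \<phi>) ?W (tens K Y M y m) (\<lambda>h u. tens K H (tensor K Y M) h u) = psum M \<phi> ?W m (\<lambda>h n. rsum ?W (\<lambda>s' t'. rsum ?W (\<lambda>s t.
        tens K H (tensor K Y M) (t' ** (h ** s)) (tens K Y M (act Y (s' ** t) y) n))))"
    by (rule psum_phit[OF r \<open>left_module K H Y\<close> ym]; (intro lin_intros)?; simp add: lin_id)
  ultimately show ?thesis by simp
qed

end

context
  fixes M :: "('k, ('k, 'a) univ) lmod" and \<phi> :: "('k, 'a) univ \<Rightarrow> ('k, 'a) univ"
  assumes r: "refl_coaction M \<phi>"
begin

lemmas [simp] = refl_coactionD[OF r] psum_fold[OF refl_coactionD(3,4)[OF r]] earr_Arr[OF r] phit_refl_coaction[OF r]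
  refl_coactionD[OF phit_refl_coaction[OF r]]
declare S.H_act(4) [simp del] M.H_act(4) [simp del] S.A_act(4) [simp del]

lemma colin_tensor_arrow:
  assumes r': "refl_coaction N \<psi>"
    and [simp]: "g \<in> Arr S.LH" "f \<in> Arr M.LA" "src f = M" "tgt f = N" and c: "colin M \<phi> N \<psi> (fn f)"
  shows "colin (V (src g) M) (phit (src g) M \<phi>) (V (tgt g) N) (phit (tgt g) N \<psi>) (fn (tensor_arrow (coact A) g f))"
proof (rule colin_phitI[OF r])
  note [simp] = lmod_Arr[OF assms(2)] lmod_Arr(4,5)[OF assms(3), simplified] lmod_Arr_lin[OF assms(3), simplified] lmod_Arr_lin[OF assms(2)]
    refl_coactionD[OF r'] psum_fold[OF refl_coactionD(3,4)[OF r']]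
  have f: "fn f \<in> linear_maps K M N" using lmod_Arr[OF assms(3)] by simp
  show "refl_coaction (V (tgt g) N) (phit (tgt g) N \<psi>)" by (rule phit_refl_coaction[OF r']) simp
  show "left_module K H (src g)" by simp
  show "fn (tensor_arrow (coact A) g f) \<in> linear_maps K (tensor K (src g) M) (V (tgt g) N)"
    using lmod_Arr(3)[OF M.tensor_arrow_Arr[OF assms(2,3)]] by simp
  fix x m assume [simp]: "x \<in> carrier (src g)" "m \<in> carrier M"
  let ?Y = "tgt g"
  let ?W = "tensor K H (tensor K ?Y N)"
  have "phit ?Y N \<psi> (tens K ?Y N (fn g x) (fn f m)) = psum N \<psi> ?W (fn f m) (\<lambda>h n. rsum ?W (\<lambda>s' t'. rsum ?W (\<lambda>s t.
        tens K H (tensor K ?Y N) (t' ** (h ** s)) (tens K ?Y N (act ?Y (s' ** t) (fn g x)) n))))"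
    by (rule phit_eta[OF r']) simp_all
  also have "\<dots> = psum M \<phi> ?W m (\<lambda>h n. rsum ?W (\<lambda>s' t'. rsum ?W (\<lambda>s t.
        tens K H (tensor K ?Y N) (t' ** (h ** s)) (tens K ?Y N (act ?Y (s' ** t) (fn g x)) (fn f n)))))"
    by (rule psum_colin[OF r r' f c]; (intro lin_intros)?; simp)
  finally show "phit ?Y N \<psi> (fn (tensor_arrow (coact A) g f) (tens K (src g) M x m)) =
    psum M \<phi> (tensor K H (V ?Y N)) m (\<lambda>h n. rsum (tensor K H (V ?Y N)) (\<lambda>s' t'. rsum (tensor K H (V ?Y N)) (\<lambda>s t.
        tens K H (V ?Y N) (t' ** (h ** s)) (fn (tensor_arrow (coact A) g f) (tens K (src g) M (act (src g) (s' ** t) x) n)))))"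
    by simp
qed

text \<open>\<open>H\<close> acts on the unit object through the counit, so both copies of
  \<open>R\<close> in the coaction contract to the unit.\<close>

lemma colin_lunit: "colin (V S.I M) (phit S.I M \<phi>) M \<phi> (fn (M.lunit M))"
proof (rule colin_phitI[OF r r])
  let ?W = "tensor K H M"
  interpret W: module K ?W by simp
  fix c m assume cm: "c \<in> carrier S.I" "m \<in> carrier M"
  define k where "k = unScal c"
  have sm: "c \<odot>\<^bsub>?W\<^esub> rsum ?W f = rsum ?W (\<lambda>s t. c \<odot>\<^bsub>?W\<^esub> f s t)"
    if "c \<in> carrier K" "\<And>a b. a \<in> carrier H \<Longrightarrow> b \<in> carrier H \<Longrightarrow> f a b \<in> carrier ?W" for c f
    using that by (intro sum_out(1) lin_smult_const lin_id) simp_all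
  have [simp]: "k \<in> carrier K" "m \<in> carrier M" "c = Scal k" using cm by (auto simp: k_def)
  have "psum M \<phi> ?W m (\<lambda>h n. rsum ?W (\<lambda>s' t'. rsum ?W (\<lambda>s t.
        tens K H M (t' ** (h ** s)) (fn (M.lunit M) (tens K S.I M (act S.I (s' ** t) c) n)))))
    = psum M \<phi> ?W m (\<lambda>h n. sweedler ?W R (\<lambda>s' t'. counit H s' \<odot>\<^bsub>?W\<^esub> sweedler ?W R (\<lambda>s t. counit H t \<odot>\<^bsub>?W\<^esub>
        (k \<odot>\<^bsub>?W\<^esub> tens K H M (t' ** (h ** s)) n))))"
    by (simp add: tens_rules W.smult_assoc1 sm[symmetric])
  also have "\<dots> = psum M \<phi> ?W m (\<lambda>h n. sweedler ?W R (\<lambda>s t. counit H t \<odot>\<^bsub>?W\<^esub>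
        (k \<odot>\<^bsub>?W\<^esub> tens K H M (\<one>\<^bsub>H\<^esub> ** (h ** s)) n)))"
    by (rule psum_cong[OF HOL.refl HOL.refl], rule R_counit_left; (intro lin_smult_const sum_lin lin_intros)?; simp)
  also have "\<dots> = psum M \<phi> ?W m (\<lambda>h n. k \<odot>\<^bsub>?W\<^esub> tens K H M (\<one>\<^bsub>H\<^esub> ** (h ** \<one>\<^bsub>H\<^esub>)) n)"
    by (rule psum_cong[OF HOL.refl HOL.refl], rule R_counit_right; (intro lin_smult_const lin_intros)?; simp)
  also have "\<dots> = k \<odot>\<^bsub>?W\<^esub> psum M \<phi> ?W m (\<lambda>h n. tens K H M h n)"
    by (simp, rule psum_out[where F="\<lambda>v. k \<odot>\<^bsub>?W\<^esub> v", symmetric]; (intro lin_smult_const lin_id)?; simp)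
  also have "\<dots> = \<phi> (fn (M.lunit M) (tens K S.I M c m))"
    by (simp add: psum_eta[OF r] lin_smult[OF refl_coactionD(3)[OF r]])
  finally show "\<phi> (fn (M.lunit M) (tens K S.I M c m)) = psum M \<phi> ?W m (\<lambda>h n. rsum ?W (\<lambda>s' t'. rsum ?W (\<lambda>s t.
        tens K H M (t' ** (h ** s)) (fn (M.lunit M) (tens K S.I M (act S.I (s' ** t) c) n)))))" ..
qed (simp_all add: M.lunit_lin)

text \<open>Acting twice involves four copies of \<open>R\<close>. The axioms on (\<Delta> \<otimes>
  Id)R and (Id \<otimes> \<Delta>)R merge them into two, whose legs act on X \<otimes> Y through the
  coproduct, as in the action of the tensor product.\<close>

lemma colin_lassoc:
  assumes [simp]: "left_module K H X" "left_module K H Y"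
  shows "colin (V (S.T X Y) M) (phit (S.T X Y) M \<phi>) (V X (V Y M)) (phit X (V Y M) (phit Y M \<phi>)) (fn (M.lassoc X Y M))"
proof (rule colin_phitI[OF r])
  note [simp] = phit_refl_coaction[OF phit_refl_coaction[OF r]] tensor_assoc_lin
  show "left_module K H (S.T X Y)" "refl_coaction (V X (V Y M)) (phit X (V Y M) (phit Y M \<phi>))"
    "fn (M.lassoc X Y M) \<in> linear_maps K (tensor K (S.T X Y) M) (V X (V Y M))" by simp_all
  fix u m assume u: "u \<in> carrier (S.T X Y)" and [simp]: "m \<in> carrier M"
  let ?W = "tensor K H (tensor K X (tensor K Y M))"
  let ?psi = "phit X (V Y M) (phit Y M \<phi>)"
  note c = sum_congs(1)[OF HOL.refl] and p = psum_cong[OF HOL.refl HOL.refl]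
  have u: "u \<in> carrier (tensor K X Y)" using u by simp
  have "?psi (fn (M.lassoc X Y M) (tens K (tensor K X Y) M u m)) =
      psum M \<phi> ?W m (\<lambda>h n. rsum ?W (\<lambda>s' t'. rsum ?W (\<lambda>s t.
        tens K H (tensor K X (tensor K Y M)) (t' ** (h ** s)) (fn (M.lassoc X Y M) (tens K (tensor K X Y) M (act (S.T X Y) (s' ** t) u) n)))))"
  proof (rule lin_eq_tensor[where F="\<lambda>u. ?psi (fn (M.lassoc X Y M) (tens K (tensor K X Y) M u m))" and
      G="\<lambda>u. psum M \<phi> ?W m (\<lambda>h n. rsum ?W (\<lambda>s' t'. rsum ?W (\<lambda>s t.
        tens K H (tensor K X (tensor K Y M)) (t' ** (h ** s)) (fn (M.lassoc X Y M) (tens K (tensor K X Y) M (act (S.T X Y) (s' ** t) u) n)))))", OF _ _ _ _ _ _ u])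
    have la: "fn (M.lassoc X Y M) \<in> linear_maps K (tensor K (tensor K X Y) M) (tensor K X (tensor K Y M))" by simp
    have ph: "?psi \<in> linear_maps K (tensor K X (tensor K Y M)) ?W"
      using phit_lin[OF phit_refl_coaction[OF r], of Y X] by simp
    have T: "(\<lambda>u. act (S.T X Y) k u) \<in> linear_maps K (tensor K X Y) (tensor K X Y)" if "k \<in> carrier H" for k
      using S.H_act_lin(2)[of "S.T X Y" k, OF _ _ lin_id] that by simp
    show "(\<lambda>u. ?psi (fn (M.lassoc X Y M) (tens K (tensor K X Y) M u m))) \<in> linear_maps K (tensor K X Y) ?W"
      by (intro lin_comp[OF ph] lin_comp[OF la] tens_lin1 lin_id; simp)
    show "(\<lambda>u. psum M \<phi> ?W m (\<lambda>h n. rsum ?W (\<lambda>s' t'. rsum ?W (\<lambda>s t.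
        tens K H (tensor K X (tensor K Y M)) (t' ** (h ** s)) (fn (M.lassoc X Y M) (tens K (tensor K X Y) M (act (S.T X Y) (s' ** t) u) n)))))) \<in> linear_maps K (tensor K X Y) ?W"
      by (intro psum_lin sum_lin tens_lin2 lin_comp[OF la] tens_lin1 T; simp)
    fix x y assume [simp]: "x \<in> carrier X" "y \<in> carrier Y"
    define F where "F a b c n = tens K H (tensor K X (tensor K Y M)) a (tens K X (tensor K Y M) (act X b x) (tens K Y M (act Y c y) n))" for a b c n
    have [simp]: "F a b k n \<in> carrier ?W" if "a \<in> carrier H" "b \<in> carrier H" "k \<in> carrier H" "n \<in> carrier M" for a b k n
      using that by (simp add: F_def)
    have [lin_intros]: "(\<lambda>v. F a b k v) \<in> linear_maps K M ?W" if "a \<in> carrier H" "b \<in> carrier H" "k \<in> carrier H" for a b k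
      using that unfolding F_def by (intro lin_intros; simp)
    have [lin_intros]: "(\<lambda>v. F (g v) b k n) \<in> linear_maps K H ?W" if "g \<in> linear_maps K H H" "b \<in> carrier H" "k \<in> carrier H" "n \<in> carrier M" for g b k n
      using that unfolding F_def by (intro lin_intros; simp)
    have [lin_intros]: "(\<lambda>v. F a (g v) k n) \<in> linear_maps K H ?W" if "g \<in> linear_maps K H H" "a \<in> carrier H" "k \<in> carrier H" "n \<in> carrier M" for g a k n
      using that unfolding F_def by (intro lin_intros; simp)
    have [lin_intros]: "(\<lambda>v. F a b (g v) n) \<in> linear_maps K H ?W" if "g \<in> linear_maps K H H" "a \<in> carrier H" "b \<in> carrier H" "n \<in> carrier M" for g a b n
      using that unfolding F_def by (intro lin_intros; simp)
    have "?psi (fn (M.lassoc X Y M) (tens K (tensor K X Y) M (tens K X Y x y) m)) = ?psi (tens K X (V Y M) x (tens K Y M y m))" by simp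
    also have "\<dots> = psum (V Y M) (phit Y M \<phi>) ?W (tens K Y M y m) (\<lambda>h n. rsum ?W (\<lambda>s' t'. rsum ?W (\<lambda>s t.
        tens K H (tensor K X (V Y M)) (t' ** (h ** s)) (tens K X (V Y M) (act X (s' ** t) x) n))))"
      by (subst phit_eta[OF phit_refl_coaction[OF r]]) simp_all
    also have "\<dots> = psum (tensor K Y M) (phit Y M \<phi>) ?W (tens K Y M y m) (\<lambda>h n. rsum ?W (\<lambda>s' t'. rsum ?W (\<lambda>s t.
        tens K H (tensor K X (tensor K Y M)) (t' ** (h ** s)) (tens K X (tensor K Y M) (act X (s' ** t) x) n))))"
      by simp
    also have "\<dots> = psum M \<phi> ?W m (\<lambda>h n. rsum ?W (\<lambda>p q. rsum ?W (\<lambda>p' q'. rsum ?W (\<lambda>s' t'. rsum ?W (\<lambda>s t.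
        tens K H (tensor K X (tensor K Y M)) (t' ** ((q ** (h ** p')) ** s)) (tens K X (tensor K Y M) (act X (s' ** t) x) (tens K Y M (act Y (p ** q') y) n)))))))"
      by (rule psum_phit[OF r]; (intro lin_intros)?; simp)
    also have "\<dots> = psum M \<phi> ?W m (\<lambda>h n. rsum ?W (\<lambda>p q. rsum ?W (\<lambda>p' q'. rsum ?W (\<lambda>s' t'. rsum ?W (\<lambda>s t.
        F (t' ** (q ** (h ** (p' ** s)))) (s' ** t) (p ** q') n)))))"
      by (simp add: F_def)
    also have "\<dots> = psum M \<phi> ?W m (\<lambda>h n. rsum ?W (\<lambda>p q. rsum ?W (\<lambda>s' t'. rsum ?W (\<lambda>p' q'. rsum ?W (\<lambda>s t.
        F (t' ** (q ** (h ** (p' ** s)))) (s' ** t) (p ** q') n)))))"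
      by (rule p, rule c, rule rsum_swap(1)) simp_all
    also have "\<dots> = psum M \<phi> ?W m (\<lambda>h n. rsum ?W (\<lambda>s' t'. rsum ?W (\<lambda>p q. rsum ?W (\<lambda>p' q'. rsum ?W (\<lambda>s t.
        F (t' ** (q ** (h ** (p' ** s)))) (s' ** t) (p ** q') n)))))"
      by (rule p, rule rsum_swap(1)) simp_all
    also have "\<dots> = psum M \<phi> ?W m (\<lambda>h n. rsum ?W (\<lambda>s' t'. rsum ?W (\<lambda>p q. rsum ?W (\<lambda>p' q'. rsum ?W (\<lambda>s t.
        F ((t' ** q) ** (h ** (p' ** s))) (s' ** t) (p ** q') n)))))"
      by simp
    also have "\<dots> = psum M \<phi> ?W m (\<lambda>h n. rsum ?W (\<lambda>s' t'. rsum ?W (\<lambda>p q. rsum ?W (\<lambda>s t. dsum ?W t (\<lambda>b1 b2.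
        F ((t' ** q) ** (h ** s)) (s' ** b1) (p ** b2) n)))))"
      by (rule p, rule c, rule c, rule rsum_dsum_right[symmetric]; (intro lin_intros)?; simp)
    also have "\<dots> = psum M \<phi> ?W m (\<lambda>h n. rsum ?W (\<lambda>s' t'. dsum ?W s' (\<lambda>a1 a2. rsum ?W (\<lambda>s t. dsum ?W t (\<lambda>b1 b2.
        F (t' ** (h ** s)) (a1 ** b1) (a2 ** b2) n)))))"
      by (rule p, rule rsum_dsum_left[symmetric]; (intro lin_intros)?; simp)
    also have "\<dots> = psum M \<phi> ?W m (\<lambda>h n. rsum ?W (\<lambda>s' t'. rsum ?W (\<lambda>s t. dsum ?W s' (\<lambda>a1 a2. dsum ?W t (\<lambda>b1 b2.
        F (t' ** (h ** s)) (a1 ** b1) (a2 ** b2) n)))))"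
      by (rule p, rule c, rule rsum_dsum_swap[symmetric]) simp_all
    also have "\<dots> = psum M \<phi> ?W m (\<lambda>h n. rsum ?W (\<lambda>s' t'. rsum ?W (\<lambda>s t. dsum ?W (s' ** t) (\<lambda>b1 b2.
        F (t' ** (h ** s)) b1 b2 n))))"
      by (rule p, rule c, rule c, rule dsum_mult[symmetric]; (intro lin_intros)?; simp)
    finally show "?psi (fn (M.lassoc X Y M) (tens K (tensor K X Y) M (tens K X Y x y) m)) =
      psum M \<phi> ?W m (\<lambda>h n. rsum ?W (\<lambda>s' t'. rsum ?W (\<lambda>s t.
        tens K H (tensor K X (tensor K Y M)) (t' ** (h ** s)) (fn (M.lassoc X Y M) (tens K (tensor K X Y) M (act (S.T X Y) (s' ** t) (tens K X Y x y)) n)))))"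
      by (simp add: F_def sum_out[OF tensor_assoc_lin])
  qed simp_all
  thus "?psi (fn (M.lassoc X Y M) (tens K (S.T X Y) M u m)) =
      psum M \<phi> (tensor K H (V X (V Y M))) m (\<lambda>h n. rsum (tensor K H (V X (V Y M))) (\<lambda>s' t'. rsum (tensor K H (V X (V Y M))) (\<lambda>s t.
        tens K H (V X (V Y M)) (t' ** (h ** s)) (fn (M.lassoc X Y M) (tens K (S.T X Y) M (act (S.T X Y) (s' ** t) u) n)))))"
    by simp
qed

text \<open>The reflection equation is used twice. Read backwards it turns the two coactions into a
  coproduct, a copy of \<open>R\<close> is moved past this coproduct, and read forwards it restores
  the coactions in the order wanted.\<close>

lemma colin_earr:
  assumes [simp]: "left_module K H X"
  shows "colin (V X M) (phit X M \<phi>) (V X M) (phit X M \<phi>) (fn (earr X M \<phi>))"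
proof (rule colin_phitI[OF r])
  show "fn (earr X M \<phi>) \<in> linear_maps K (tensor K X M) (V X M)" by simp
  fix x m assume [simp]: "x \<in> carrier X" "m \<in> carrier M"
  let ?W = "tensor K H (tensor K X M)"
  note c = sum_congs(1)[OF HOL.refl] and p = psum_cong[OF HOL.refl HOL.refl] and d = sum_congs(3)[OF HOL.refl _ HOL.refl]
  have ph: "phit X M \<phi> \<in> linear_maps K (tensor K X M) ?W" using phit_lin[OF r, of X] by simp
  have el: "fn (earr X M \<phi>) \<in> linear_maps K (tensor K X M) (tensor K X M)" by simp
  define F where "F a b n = tens K H (tensor K X M) a (tens K X M (act X b x) n)" for a b n
  have [simp]: "F a b n \<in> carrier ?W" if "a \<in> carrier H" "b \<in> carrier H" "n \<in> carrier M" for a b n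
    using that by (simp add: F_def)
  have [lin_intros]: "(\<lambda>v. F a b v) \<in> linear_maps K M ?W" if "a \<in> carrier H" "b \<in> carrier H" for a b
    using that unfolding F_def by (intro lin_intros; simp)
  have [lin_intros]: "(\<lambda>v. F (g v) b n) \<in> linear_maps K H ?W" if "g \<in> linear_maps K H H" "b \<in> carrier H" "n \<in> carrier M" for g b n
    using that unfolding F_def by (intro lin_intros; simp)
  have [lin_intros]: "(\<lambda>v. F a (g v) n) \<in> linear_maps K H ?W" if "g \<in> linear_maps K H H" "a \<in> carrier H" "n \<in> carrier M" for g a n
    using that unfolding F_def by (intro lin_intros; simp)
  have "phit X M \<phi> (fn (earr X M \<phi>) (tens K X M x m)) = psum M \<phi> ?W m (\<lambda>g n. phit X M \<phi> (tens K X M (act X g x) n))"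
    by (simp add: psum_out[OF ph])
  also have "\<dots> = psum M \<phi> ?W m (\<lambda>g n. psum M \<phi> ?W n (\<lambda>h n'. rsum ?W (\<lambda>s' t'. rsum ?W (\<lambda>s t.
      F (t' ** (h ** s)) (s' ** (t ** g)) n'))))"
    by (simp add: phit_eta[OF r] F_def S.H_act(4)[symmetric])
  also have "\<dots> = psum M \<phi> ?W m (\<lambda>g n. psum M \<phi> ?W n (\<lambda>h n'. rsum ?W (\<lambda>s t. rsum ?W (\<lambda>s' t'.
      F (t' ** (h ** s)) (s' ** (t ** g)) n'))))"
    by (rule p, rule p, rule rsum_swap(1)) simp_all
  also have "\<dots> = psum M \<phi> ?W m (\<lambda>h n. dsum ?W h (\<lambda>a b. rsum ?W (\<lambda>s t. rsum ?W (\<lambda>s' t'.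
      F (t' ** (b ** s)) (s' ** (a ** t)) n))))"
    by (rule refl_braid[OF r, symmetric]; (intro lin_intros)?; simp)
  also have "\<dots> = psum M \<phi> ?W m (\<lambda>h n. rsum ?W (\<lambda>s t. rsum ?W (\<lambda>s' t'. dsum ?W h (\<lambda>a b.
      F ((t' ** b) ** s) ((s' ** a) ** t) n))))"
    by (simp add: rsum_dsum_swap)
  also have "\<dots> = psum M \<phi> ?W m (\<lambda>h n. rsum ?W (\<lambda>s t. dsum ?W h (\<lambda>a b. rsum ?W (\<lambda>s' t'.
      F ((a ** t') ** s) ((b ** s') ** t) n))))"
    by (rule p, rule c, rule rsum_dsum; (intro lin_intros)?; simp)
  also have "\<dots> = psum M \<phi> ?W m (\<lambda>h n. dsum ?W h (\<lambda>a b. rsum ?W (\<lambda>s t. rsum ?W (\<lambda>s' t'.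
      F ((a ** t') ** s) ((b ** s') ** t) n))))"
    by (simp add: rsum_dsum_swap)
  also have "\<dots> = psum M \<phi> ?W m (\<lambda>h n. dsum ?W h (\<lambda>a b. rsum ?W (\<lambda>s' t'. rsum ?W (\<lambda>s t.
      F ((a ** t') ** s) ((b ** s') ** t) n))))"
    by (rule p, rule d, rule rsum_swap(1)) simp_all
  also have "\<dots> = psum M \<phi> ?W m (\<lambda>h n. psum M \<phi> ?W n (\<lambda>g n'. rsum ?W (\<lambda>s' t'. rsum ?W (\<lambda>s t.
      F ((t' ** h) ** s) ((g ** s') ** t) n'))))"
    by (rule refl_braid[OF r]; (intro lin_intros)?; simp)
  also have "\<dots> = psum M \<phi> ?W m (\<lambda>h n. rsum ?W (\<lambda>s' t'. rsum ?W (\<lambda>s t.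
        tens K H (tensor K X M) (t' ** (h ** s)) (fn (earr X M \<phi>) (tens K X M (act X (s' ** t) x) n)))))"
    by (simp add: F_def S.H_act(4)[symmetric] psum_rsum_swap)
  finally show "phit X M \<phi> (fn (earr X M \<phi>) (tens K X M x m)) =
    psum M \<phi> (tensor K H (V X M)) m (\<lambda>h n. rsum (tensor K H (V X M)) (\<lambda>s' t'. rsum (tensor K H (V X M)) (\<lambda>s t.
        tens K H (V X M) (t' ** (h ** s)) (fn (earr X M \<phi>) (tens K X M (act X (s' ** t) x) n)))))" by simp
qed simp_all

end

end

section \<open>Pulling back and transporting braided module structure\<close>

text \<open>A faithful, isomorphism-reflecting map of categories that strictly preserves all of the structure
  pulls the axioms of a braided module category back.\<close>

locale structure_reflecting = C: braided_category C + M: module_category C M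
  for C :: "('c, 'd, 'y) braided_cat_scheme" and M :: "('o, 'm, 'c, 'd, 'z) module_cat_scheme" +
  fixes N :: "('p, 'n, 'c, 'd, 'w) braided_module_cat_scheme" and UO :: "'p \<Rightarrow> 'o" and UA :: "'n \<Rightarrow> 'm"
  assumes UO: "P \<in> Obj N \<Longrightarrow> UO P \<in> Obj M"
    and Dom_Cod: "f \<in> Arr N \<Longrightarrow> Dom N f \<in> Obj N" "f \<in> Arr N \<Longrightarrow> Cod N f \<in> Obj N"
    and UA: "f \<in> Homs N P Q \<Longrightarrow> UA f \<in> Homs M (UO P) (UO Q)"
    and faithful: "f \<in> Homs N P Q \<Longrightarrow> g \<in> Homs N P Q \<Longrightarrow> UA f = UA g \<Longrightarrow> f = g"
    and Idn: "P \<in> Obj N \<Longrightarrow> Idn N P \<in> Homs N P P" "P \<in> Obj N \<Longrightarrow> UA (Idn N P) = Idn M (UO P)"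
    and Comp: "f \<in> Homs N P P' \<Longrightarrow> g \<in> Homs N P' P'' \<Longrightarrow> g \<cdot>\<^bsub>N\<^esub> f \<in> Homs N P P''"
      "f \<in> Homs N P P' \<Longrightarrow> g \<in> Homs N P' P'' \<Longrightarrow> UA (g \<cdot>\<^bsub>N\<^esub> f) = UA g \<cdot>\<^bsub>M\<^esub> UA f"
    and inverse: "f \<in> Homs N P Q \<Longrightarrow> inverse_arrows M (UA f) a \<Longrightarrow> \<exists>g'\<in>Homs N Q P. UA g' = a"
    and act_obj: "X \<in> Obj C \<Longrightarrow> P \<in> Obj N \<Longrightarrow> X \<triangleright>\<^bsub>N\<^esub> P \<in> Obj N"
      "X \<in> Obj C \<Longrightarrow> P \<in> Obj N \<Longrightarrow> UO (X \<triangleright>\<^bsub>N\<^esub> P) = X \<triangleright>\<^bsub>M\<^esub> UO P"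
    and act_arr: "k \<in> Homs C X X' \<Longrightarrow> f \<in> Homs N P P' \<Longrightarrow> k \<triangleright>\<^sub>a\<^bsub>N\<^esub> f \<in> Homs N (X \<triangleright>\<^bsub>N\<^esub> P) (X' \<triangleright>\<^bsub>N\<^esub> P')"
      "k \<in> Homs C X X' \<Longrightarrow> f \<in> Homs N P P' \<Longrightarrow> UA (k \<triangleright>\<^sub>a\<^bsub>N\<^esub> f) = k \<triangleright>\<^sub>a\<^bsub>M\<^esub> UA f"
    and assoc: "X \<in> Obj C \<Longrightarrow> Y \<in> Obj C \<Longrightarrow> P \<in> Obj N \<Longrightarrow>
        act_assoc N X Y P \<in> Homs N ((X \<boxtimes>\<^bsub>C\<^esub> Y) \<triangleright>\<^bsub>N\<^esub> P) (X \<triangleright>\<^bsub>N\<^esub> (Y \<triangleright>\<^bsub>N\<^esub> P))"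
      "X \<in> Obj C \<Longrightarrow> Y \<in> Obj C \<Longrightarrow> P \<in> Obj N \<Longrightarrow> UA (act_assoc N X Y P) = act_assoc M X Y (UO P)"
    and unit: "P \<in> Obj N \<Longrightarrow> act_unit N P \<in> Homs N (unit_obj C \<triangleright>\<^bsub>N\<^esub> P) P"
      "P \<in> Obj N \<Longrightarrow> UA (act_unit N P) = act_unit M (UO P)"
    and braid: "X \<in> Obj C \<Longrightarrow> P \<in> Obj N \<Longrightarrow> mod_braiding N X P \<in> Homs N (X \<triangleright>\<^bsub>N\<^esub> P) (X \<triangleright>\<^bsub>N\<^esub> P)"
      "X \<in> Obj C \<Longrightarrow> P \<in> Obj N \<Longrightarrow> UA (mod_braiding N X P) \<in> Isos M (X \<triangleright>\<^bsub>M\<^esub> UO P) (X \<triangleright>\<^bsub>M\<^esub> UO P)"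
    and braid_nat: "k \<in> Homs C X X' \<Longrightarrow> f \<in> Homs N P P' \<Longrightarrow>
        UA (mod_braiding N X' P') \<cdot>\<^bsub>M\<^esub> (k \<triangleright>\<^sub>a\<^bsub>M\<^esub> UA f) = (k \<triangleright>\<^sub>a\<^bsub>M\<^esub> UA f) \<cdot>\<^bsub>M\<^esub> UA (mod_braiding N X P)"
    and BM1: "P \<in> Obj N \<Longrightarrow> BM1 C M (UO P) (\<lambda>X. UA (mod_braiding N X P))"
    and BM2: "X \<in> Obj C \<Longrightarrow> Y \<in> Obj C \<Longrightarrow> P \<in> Obj N \<Longrightarrow>
        UA (mod_braiding N X (Y \<triangleright>\<^bsub>N\<^esub> P)) = BM2_rhs C M Y (UO P) (\<lambda>Z. UA (mod_braiding N Z P)) X"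
begin

lemma category: "category N"
proof (unfold_locales, goal_cases)
  case (5 f X Y)
  hence X: "X \<in> Obj N" using Dom_Cod by (auto simp: Homs_def)
  show ?case
    by (rule faithful[OF Comp(1)[OF Idn(1)[OF X] 5] 5])
      (simp add: Comp(2)[OF Idn(1)[OF X] 5] Idn(2) X M.Comp_Idn[OF UA[OF 5]])
next
  case (6 f X Y)
  hence Y: "Y \<in> Obj N" using Dom_Cod by (auto simp: Homs_def)
  show ?case
    by (rule faithful[OF Comp(1)[OF 6 Idn(1)[OF Y]] 6])
      (simp add: Comp(2)[OF 6 Idn(1)[OF Y]] Idn(2) Y M.Idn_Comp[OF UA[OF 6]])
next
  case (7 f W X g Y h Z)
  then have "(h \<cdot>\<^bsub>N\<^esub> g) \<cdot>\<^bsub>N\<^esub> f \<in> Homs N W Z" "h \<cdot>\<^bsub>N\<^esub> g \<cdot>\<^bsub>N\<^esub> f \<in> Homs N W Z" "h \<cdot>\<^bsub>N\<^esub> g \<in> Homs N X Z" "g \<cdot>\<^bsub>N\<^esub> f \<in> Homs N W Y"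
    by (blast intro: Comp(1))+
  with 7 M.Comp_assoc[of "UA f" "UO W" "UO X" "UA g" "UO Y" "UA h" "UO Z"] show ?case
    by (intro faithful[of _ W Z]) (simp_all add: Comp(2)[of f W X] Comp(2)[of g X Y h Z] Comp(2)[of f W Y] Comp(2)[of _ W] UA)
qed (auto intro: Idn Comp Dom_Cod)

sublocale N: category N by (rule category)

lemma inverse_arrows_reflect:
  assumes f: "f \<in> Homs N P Q" and g: "inverse_arrows M (UA f) g"
  shows "f \<in> Isos N P Q" "inv_arr N f \<in> Homs N Q P" "UA (inv_arr N f) = g"
proof -
  obtain g' where g': "g' \<in> Homs N Q P" "UA g' = g" using inverse[OF assms] by blast
  have PQ: "P \<in> Obj N" "Q \<in> Obj N" using f Dom_Cod[of f] by (auto simp: Homs_def)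
  have "Dom M (UA f) = UO P" "Cod M (UA f) = UO Q" using UA[OF f] by (auto simp: Homs_def)
  hence "g' \<cdot>\<^bsub>N\<^esub> f = Idn N P" "f \<cdot>\<^bsub>N\<^esub> g' = Idn N Q"
    using g g' f PQ Comp[OF f g'(1)] Comp[OF g'(1) f]
    by (intro faithful[of _ P P] faithful[of _ Q Q]; auto simp: Idn inverse_arrows_def)+
  from N.inverse_arrowsI[OF f g'(1) this]
  show "f \<in> Isos N P Q" "inv_arr N f \<in> Homs N Q P" "UA (inv_arr N f) = g" using g' by auto
qed

lemma Isos_reflect:
  assumes f: "f \<in> Homs N P Q" and u: "UA f \<in> Isos M (UO P) (UO Q)"
  shows "f \<in> Isos N P Q" "inv_arr N f \<in> Homs N Q P" "UA (inv_arr N f) = inv_arr M (UA f)"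
proof -
  have i: "inverse_arrows M (UA f) (inv_arr M (UA f))" using u M.inv_arr_eq by (auto simp: Isos_def)
  show "f \<in> Isos N P Q" "inv_arr N f \<in> Homs N Q P" "UA (inv_arr N f) = inv_arr M (UA f)"
    using inverse_arrows_reflect[OF f i] by auto
qed

lemma assoc_iso:
  assumes [simp]: "X \<in> Obj C" "Y \<in> Obj C" "P \<in> Obj N"
  shows "act_assoc N X Y P \<in> Isos N ((X \<boxtimes>\<^bsub>C\<^esub> Y) \<triangleright>\<^bsub>N\<^esub> P) (X \<triangleright>\<^bsub>N\<^esub> (Y \<triangleright>\<^bsub>N\<^esub> P))"
    "inv_arr N (act_assoc N X Y P) \<in> Homs N (X \<triangleright>\<^bsub>N\<^esub> (Y \<triangleright>\<^bsub>N\<^esub> P)) ((X \<boxtimes>\<^bsub>C\<^esub> Y) \<triangleright>\<^bsub>N\<^esub> P)"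
    "UA (inv_arr N (act_assoc N X Y P)) = inv_arr M (act_assoc M X Y (UO P))"
  using Isos_reflect[OF assoc(1)[OF assms]] M.act_assoc_iso[of X Y "UO P"]
  by (simp_all add: assoc act_obj C.tensor_obj UO)

lemma braid_Homs:
  assumes "X \<in> Obj C" "Y \<in> Obj C"
  shows "braiding C X Y \<in> Homs C (X \<boxtimes>\<^bsub>C\<^esub> Y) (Y \<boxtimes>\<^bsub>C\<^esub> X)" "inv_arr C (braiding C X Y) \<in> Homs C (Y \<boxtimes>\<^bsub>C\<^esub> X) (X \<boxtimes>\<^bsub>C\<^esub> Y)"
  using C.braiding_iso[OF assms] C.Isos_inv[OF C.braiding_iso[OF assms]] by (auto simp: Isos_def)

text \<open>Hom-set membership and the image under \<open>UA\<close> are derived together, so that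
  resolution computes the image in \<open>M\<close> of a composite of structure arrows of
  \<open>N\<close>.\<close>

lemma UA_Comp: "g \<cdot>\<^bsub>N\<^esub> f \<in> Homs N P P'' \<and> UA (g \<cdot>\<^bsub>N\<^esub> f) = b \<cdot>\<^bsub>M\<^esub> a"
  if "f \<in> Homs N P P' \<and> UA f = a" "g \<in> Homs N P' P'' \<and> UA g = b" for f g P P' P'' a b
  using that Comp by auto

lemma UA_act: "g \<triangleright>\<^sub>a\<^bsub>N\<^esub> f \<in> Homs N (X \<triangleright>\<^bsub>N\<^esub> P) (X' \<triangleright>\<^bsub>N\<^esub> P') \<and> UA (g \<triangleright>\<^sub>a\<^bsub>N\<^esub> f) = g \<triangleright>\<^sub>a\<^bsub>M\<^esub> a"
  if "f \<in> Homs N P P' \<and> UA f = a" "g \<in> Homs C X X'" for f g P P' X X' a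
  using that act_arr by auto

lemma UA_rules:
  "P \<in> Obj N \<Longrightarrow> Idn N P \<in> Homs N P P \<and> UA (Idn N P) = Idn M (UO P)"
  "X \<in> Obj C \<Longrightarrow> Y \<in> Obj C \<Longrightarrow> P \<in> Obj N \<Longrightarrow> act_assoc N X Y P \<in> Homs N ((X \<boxtimes>\<^bsub>C\<^esub> Y) \<triangleright>\<^bsub>N\<^esub> P) (X \<triangleright>\<^bsub>N\<^esub> (Y \<triangleright>\<^bsub>N\<^esub> P)) \<and>
    UA (act_assoc N X Y P) = act_assoc M X Y (UO P)"
  "X \<in> Obj C \<Longrightarrow> Y \<in> Obj C \<Longrightarrow> P \<in> Obj N \<Longrightarrow> inv_arr N (act_assoc N X Y P) \<in> Homs N (X \<triangleright>\<^bsub>N\<^esub> (Y \<triangleright>\<^bsub>N\<^esub> P)) ((X \<boxtimes>\<^bsub>C\<^esub> Y) \<triangleright>\<^bsub>N\<^esub> P) \<and>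
    UA (inv_arr N (act_assoc N X Y P)) = inv_arr M (act_assoc M X Y (UO P))"
  "P \<in> Obj N \<Longrightarrow> act_unit N P \<in> Homs N (unit_obj C \<triangleright>\<^bsub>N\<^esub> P) P \<and> UA (act_unit N P) = act_unit M (UO P)"
  "X \<in> Obj C \<Longrightarrow> P \<in> Obj N \<Longrightarrow> mod_braiding N X P \<in> Homs N (X \<triangleright>\<^bsub>N\<^esub> P) (X \<triangleright>\<^bsub>N\<^esub> P) \<and> UA (mod_braiding N X P) = UA (mod_braiding N X P)"
  "f \<in> Homs N P P' \<Longrightarrow> f \<in> Homs N P P' \<and> UA f = UA f"
  by (simp_all add: Idn assoc assoc_iso unit braid)

lemma reflect_eq:
  assumes "f \<in> Homs N P Q \<and> UA f = a" "g \<in> Homs N P Q \<and> UA g = b" "a = b"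
  shows "f = g"
  using assms faithful by blast

lemmas closure = C.tensor_obj act_obj(1) C.Idn_Homs braid_Homs C.unit_obj C.tensor_arr

lemma braided_module_category: "braided_module_category C N"
proof -
  have D: "P \<in> Obj N" "P' \<in> Obj N" if "f \<in> Homs N P P'" for f P P'
    using that Dom_Cod by (auto simp: Homs_def)
  have CD: "X \<in> Obj C" "X' \<in> Obj C" if "g \<in> Homs C X X'" for g X X'
    using that C.Dom_Obj C.Cod_Obj by (auto simp: Homs_def)
  \<comment> \<open>Repeated resolution with these rules finds, for each side of an axiom, its
    hom-set and its image in \<open>M\<close>. What is left is the same axiom in \<open>M\<close>,
    and faithfulness lifts it.\<close>
  note r = UA_Comp UA_act UA_rules(1-5) closure
  show ?thesis
  proof (unfold_locales, goal_cases)
    case (3 X P)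
    show ?case
      by (rule reflect_eq, ((rule r 3)+)[1], ((rule r 3)+)[1]) (simp add: act_obj 3 M.act_Idn UO)
  next
    case (4 g X X' g' X'' f P P' f' P'')
    note o = UA_rules(6)[OF 4(3)] UA_rules(6)[OF 4(4)] C.Comp_Homs 4
    show ?case
      by (rule reflect_eq, ((rule r o)+)[1], ((rule r o)+)[1], rule M.act_Comp; (rule UA 4)+)
  next
    case (5 X Y P)
    then show ?case by (rule assoc_iso)
  next
    case (6 g X X' h Y Y' f P P')
    note o = UA_rules(6)[OF 6(3)] 6 CD[OF 6(1)] CD[OF 6(2)] D[OF 6(3)]
    show ?case
      by (rule reflect_eq, ((rule r o)+)[1], ((rule r o)+)[1], rule M.act_assoc_nat; (rule UA 6)+)
  next
    case (7 P)
    then show ?case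
      using Isos_reflect[OF unit(1)] M.act_unit_iso[of "UO P"] by (simp add: unit act_obj UO C.unit_obj)
  next
    case (8 f P P')
    note o = UA_rules(6)[OF 8] 8 D[OF 8]
    show ?case
      by (rule reflect_eq, ((rule r o)+)[1], ((rule r o)+)[1], rule M.act_unit_nat; (rule UA 8)+)
  next
    case (9 X Y Z P)
    note o = 9 C.associator_iso[unfolded Isos_def, THEN CollectD, THEN conjunct1]
    have UZ: "UO (Z \<triangleright>\<^bsub>N\<^esub> P) = Z \<triangleright>\<^bsub>M\<^esub> UO P" using 9 by (simp add: act_obj)
    show ?case
      by (rule reflect_eq, ((rule r o)+)[1], ((rule r o)+)[1], unfold UZ, rule M.act_pentagon; (rule UO 9)+)
  next
    case (10 X P)
    note o = 10 C.right_unitor_iso[unfolded Isos_def, THEN CollectD, THEN conjunct1]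
    show ?case
      by (rule reflect_eq, ((rule r o)+)[1], ((rule r o)+)[1], rule M.act_triangle; (rule UO 10)+)
  next
    case (11 X P)
    then show ?case using Isos_reflect[OF braid(1)] braid(2) by (simp add: act_obj)
  next
    case (12 g X X' f P P')
    note o = UA_rules(6)[OF 12(2)] 12 CD[OF 12(1)] D[OF 12(2)]
    show ?case
      by (rule reflect_eq, ((rule r o)+)[1], ((rule r o)+)[1], rule braid_nat; (rule 12)+)
  next
    case (13 P)
    show ?case unfolding BM1_def
    proof (intro ballI, goal_cases)
      case (1 X Y)
      show ?case
        by (rule reflect_eq, ((rule r 1 13)+)[1], ((rule r 1 13)+)[1], rule BM1[OF 13, unfolded BM1_def, rule_format]; (rule 1)+)
    qed
  next
    case (14 X Y P)
    show ?case unfolding BM2_rhs_def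
      by (rule reflect_eq, ((rule r 14)+)[1], ((rule r 14)+)[1], rule BM2[unfolded BM2_rhs_def]; (rule 14)+)
  qed (auto intro: act_obj act_arr)
qed

end

text \<open>When the action is preserved on the nose, identities serve as the comparison
  isomorphisms and the coherence conditions become preservation of the constraints.\<close>

lemma strict_braided_module_functor:
  fixes C :: "('c, 'd, 'x) braided_cat_scheme" and M :: "('o, 'm, 'c, 'd, 'y) braided_module_cat_scheme"
    and N :: "('p, 'n, 'c, 'd, 'z) braided_module_cat_scheme"
  assumes "braided_module_category C M" "braided_module_category C N"
    and FO: "\<And>P. P \<in> Obj M \<Longrightarrow> FO P \<in> Obj N"
    and FA: "\<And>f P Q. f \<in> Homs M P Q \<Longrightarrow> FA f \<in> Homs N (FO P) (FO Q)"
    and Idn: "\<And>P. P \<in> Obj M \<Longrightarrow> FA (Idn M P) = Idn N (FO P)"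
    and Comp: "\<And>f f' P P' P''. f \<in> Homs M P P' \<Longrightarrow> f' \<in> Homs M P' P'' \<Longrightarrow> FA (f' \<cdot>\<^bsub>M\<^esub> f) = FA f' \<cdot>\<^bsub>N\<^esub> FA f"
    and act_obj: "\<And>X P. X \<in> Obj C \<Longrightarrow> P \<in> Obj M \<Longrightarrow> FO (X \<triangleright>\<^bsub>M\<^esub> P) = X \<triangleright>\<^bsub>N\<^esub> FO P"
    and act_arr: "\<And>g f X X' P P'. g \<in> Homs C X X' \<Longrightarrow> f \<in> Homs M P P' \<Longrightarrow> FA (g \<triangleright>\<^sub>a\<^bsub>M\<^esub> f) = g \<triangleright>\<^sub>a\<^bsub>N\<^esub> FA f"
    and assoc: "\<And>X Y P. X \<in> Obj C \<Longrightarrow> Y \<in> Obj C \<Longrightarrow> P \<in> Obj M \<Longrightarrow> FA (act_assoc M X Y P) = act_assoc N X Y (FO P)"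
    and unit: "\<And>P. P \<in> Obj M \<Longrightarrow> FA (act_unit M P) = act_unit N (FO P)"
    and braid: "\<And>X P. X \<in> Obj C \<Longrightarrow> P \<in> Obj M \<Longrightarrow> FA (mod_braiding M X P) = mod_braiding N X (FO P)"
  shows "braided_module_functor C M N FO FA (\<lambda>X P. Idn N (X \<triangleright>\<^bsub>N\<^esub> FO P))"
proof -
  interpret M: braided_module_category C M by fact
  interpret N: braided_module_category C N by fact
  have CD: "X \<in> Obj C" "X' \<in> Obj C" if "g \<in> Homs C X X'" for g X X'
    using that M.C.Dom_Obj M.C.Cod_Obj by (auto simp: Homs_def)
  have I: "f \<cdot>\<^bsub>N\<^esub> Idn N P = f" "Idn N Q \<cdot>\<^bsub>N\<^esub> f = f" if "f \<in> Homs N P Q" for f P Q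
    using that N.Comp_Idn N.Idn_Comp by auto
  show ?thesis
  proof (unfold_locales, goal_cases)
    case (5 X P)
    then have "X \<triangleright>\<^bsub>N\<^esub> FO P \<in> Obj N" by (simp add: FO N.act_obj)
    from N.inverse_arrowsI(1)[OF N.Idn_Homs N.Idn_Homs I(1) I(1), OF this this N.Idn_Homs N.Idn_Homs, OF this this]
    show ?case using 5 by (simp add: act_obj)
  next
    case (6 g X X' f P P')
    from N.act_arr[OF 6(1) FA[OF 6(2)]] show ?case by (simp add: act_arr[OF 6] I)
  next
    case (7 X Y P)
    have "act_assoc N X Y (FO P) \<in> Homs N ((X \<boxtimes>\<^bsub>C\<^esub> Y) \<triangleright>\<^bsub>N\<^esub> FO P) (X \<triangleright>\<^bsub>N\<^esub> (Y \<triangleright>\<^bsub>N\<^esub> FO P))"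
      using N.act_assoc_iso[of X Y "FO P"] 7 by (simp add: FO Isos_def)
    thus ?case using 7 by (simp add: act_obj assoc FO N.act_obj M.act_obj N.act_Idn I)
  next
    case (8 P)
    have "act_unit N (FO P) \<in> Homs N (unit_obj C \<triangleright>\<^bsub>N\<^esub> FO P) (FO P)"
      using N.act_unit_iso[of "FO P"] 8 by (simp add: FO Isos_def)
    thus ?case using 8 by (simp add: unit I)
  next
    case (9 X P)
    have "mod_braiding N X (FO P) \<in> Homs N (X \<triangleright>\<^bsub>N\<^esub> FO P) (X \<triangleright>\<^bsub>N\<^esub> FO P)"
      using N.mod_braiding_iso[of X "FO P"] 9 by (simp add: FO Isos_def)
    thus ?case using 9 by (simp add: braid I)
  qed (simp_all add: FO FA Idn Comp)
qed

text \<open>\<open>M\<close> is bare data here. That it is a braided module category is derived from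
  the bijections and from \<open>N\<close>; the reflective center obtains its axioms in this
  way.\<close>

locale structure_transport = N: braided_module_category C N
  for C :: "('c, 'd, 'y) braided_cat_scheme" and N :: "('p, 'n, 'c, 'd, 'z) braided_module_cat_scheme" +
  fixes M :: "('o, 'm, 'c, 'd, 'w) braided_module_cat_scheme" and GO :: "'p \<Rightarrow> 'o" and GA :: "'n \<Rightarrow> 'm"
  assumes GO: "bij_betw GO (Obj N) (Obj M)" and GA: "bij_betw GA (Arr N) (Arr M)"
    and Dom: "f \<in> Arr N \<Longrightarrow> Dom M (GA f) = GO (Dom N f)"
    and Cod: "f \<in> Arr N \<Longrightarrow> Cod M (GA f) = GO (Cod N f)"
    and Idn: "P \<in> Obj N \<Longrightarrow> GA (Idn N P) = Idn M (GO P)"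
    and Comp: "f \<in> Homs N P P' \<Longrightarrow> f' \<in> Homs N P' P'' \<Longrightarrow> GA (f' \<cdot>\<^bsub>N\<^esub> f) = GA f' \<cdot>\<^bsub>M\<^esub> GA f"
    and act_obj: "X \<in> Obj C \<Longrightarrow> P \<in> Obj N \<Longrightarrow> GO (X \<triangleright>\<^bsub>N\<^esub> P) = X \<triangleright>\<^bsub>M\<^esub> GO P"
    and act_arr: "k \<in> Homs C X X' \<Longrightarrow> f \<in> Homs N P P' \<Longrightarrow> GA (k \<triangleright>\<^sub>a\<^bsub>N\<^esub> f) = k \<triangleright>\<^sub>a\<^bsub>M\<^esub> GA f"
    and assoc: "X \<in> Obj C \<Longrightarrow> Y \<in> Obj C \<Longrightarrow> P \<in> Obj N \<Longrightarrow> GA (act_assoc N X Y P) = act_assoc M X Y (GO P)"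
    and unit: "P \<in> Obj N \<Longrightarrow> GA (act_unit N P) = act_unit M (GO P)"
    and braid: "X \<in> Obj C \<Longrightarrow> P \<in> Obj N \<Longrightarrow> GA (mod_braiding N X P) = mod_braiding M X (GO P)"
begin

definition "FO = inv_into (Obj N) GO"
definition "FA = inv_into (Arr N) GA"

lemma FO_GO [simp]: "P \<in> Obj N \<Longrightarrow> FO (GO P) = P"
  using GO by (auto simp: FO_def bij_betw_def)

lemma FA_GA [simp]: "f \<in> Arr N \<Longrightarrow> FA (GA f) = f"
  using GA by (auto simp: FA_def bij_betw_def)

lemma GO_FO [simp]: "P \<in> Obj M \<Longrightarrow> GO (FO P) = P"
  using GO by (simp add: FO_def bij_betw_inv_into_right)

lemma GA_FA [simp]: "f \<in> Arr M \<Longrightarrow> GA (FA f) = f"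
  using GA by (simp add: FA_def bij_betw_inv_into_right)

lemma FO_Obj [simp]: "P \<in> Obj M \<Longrightarrow> FO P \<in> Obj N"
  using GO by (auto simp: FO_def bij_betw_def intro: inv_into_into)

lemma FA_Arr [simp]: "f \<in> Arr M \<Longrightarrow> FA f \<in> Arr N"
  using GA by (auto simp: FA_def bij_betw_def intro: inv_into_into)

lemma GO_Obj [simp]: "P \<in> Obj N \<Longrightarrow> GO P \<in> Obj M"
  using GO by (auto simp: bij_betw_def)

lemma GA_Homs: "f \<in> Homs N P Q \<Longrightarrow> GA f \<in> Homs M (GO P) (GO Q)"
  using GA by (auto simp: bij_betw_def Homs_def Dom Cod)

text \<open>Each arrow of \<open>M\<close> is the image of an arrow of \<open>N\<close>, so even the
  fact that its ends are objects is inherited from \<open>N\<close>.\<close>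

lemma FA_Homs:
  assumes "f \<in> Homs M P Q"
  shows "P \<in> Obj M" "Q \<in> Obj M" "FA f \<in> Homs N (FO P) (FO Q)"
proof -
  obtain g where g: "g \<in> Arr N" "f = GA g" using assms GA by (auto simp: Homs_def bij_betw_def)
  hence "P = GO (Dom N g)" "Q = GO (Cod N g)" using assms by (auto simp: Homs_def Dom Cod)
  thus "P \<in> Obj M" "Q \<in> Obj M" "FA f \<in> Homs N (FO P) (FO Q)"
    using g N.Dom_Obj N.Cod_Obj by (auto simp: Homs_def)
qed

lemma FA_eqI: "g \<in> Homs N P Q \<Longrightarrow> GA g = f \<Longrightarrow> f \<in> Homs M (GO P) (GO Q) \<and> FA f = g"
  using GA_Homs by (auto simp: HomsD)

lemma Iso_Homs: "f \<in> Isos B P Q \<Longrightarrow> f \<in> Homs B P Q"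
  by (simp add: Isos_def)

lemma FA_facts:
  "P \<in> Obj M \<Longrightarrow> Idn M P \<in> Homs M P P \<and> FA (Idn M P) = Idn N (FO P)"
  "f \<in> Homs M P P' \<Longrightarrow> f' \<in> Homs M P' P'' \<Longrightarrow> f' \<cdot>\<^bsub>M\<^esub> f \<in> Homs M P P'' \<and> FA (f' \<cdot>\<^bsub>M\<^esub> f) = FA f' \<cdot>\<^bsub>N\<^esub> FA f"
  "k \<in> Homs C X X' \<Longrightarrow> f \<in> Homs M P P' \<Longrightarrow> k \<triangleright>\<^sub>a\<^bsub>M\<^esub> f \<in> Homs M (X \<triangleright>\<^bsub>M\<^esub> P) (X' \<triangleright>\<^bsub>M\<^esub> P') \<and> FA (k \<triangleright>\<^sub>a\<^bsub>M\<^esub> f) = k \<triangleright>\<^sub>a\<^bsub>N\<^esub> FA f"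
  "X \<in> Obj C \<Longrightarrow> Y \<in> Obj C \<Longrightarrow> P \<in> Obj M \<Longrightarrow> act_assoc M X Y P \<in> Homs M ((X \<boxtimes>\<^bsub>C\<^esub> Y) \<triangleright>\<^bsub>M\<^esub> P) (X \<triangleright>\<^bsub>M\<^esub> (Y \<triangleright>\<^bsub>M\<^esub> P)) \<and>
    FA (act_assoc M X Y P) = act_assoc N X Y (FO P)"
  "P \<in> Obj M \<Longrightarrow> act_unit M P \<in> Homs M (unit_obj C \<triangleright>\<^bsub>M\<^esub> P) P \<and> FA (act_unit M P) = act_unit N (FO P)"
  "X \<in> Obj C \<Longrightarrow> P \<in> Obj M \<Longrightarrow> mod_braiding M X P \<in> Homs M (X \<triangleright>\<^bsub>M\<^esub> P) (X \<triangleright>\<^bsub>M\<^esub> P) \<and> FA (mod_braiding M X P) = mod_braiding N X (FO P)"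
  "X \<in> Obj C \<Longrightarrow> P \<in> Obj M \<Longrightarrow> X \<triangleright>\<^bsub>M\<^esub> P \<in> Obj M \<and> FO (X \<triangleright>\<^bsub>M\<^esub> P) = X \<triangleright>\<^bsub>N\<^esub> FO P"
proof -
  show act: "X \<triangleright>\<^bsub>M\<^esub> P \<in> Obj M \<and> FO (X \<triangleright>\<^bsub>M\<^esub> P) = X \<triangleright>\<^bsub>N\<^esub> FO P" if "X \<in> Obj C" "P \<in> Obj M" for X P
    using act_obj[OF that(1), of "FO P"] GO_Obj[of "X \<triangleright>\<^bsub>N\<^esub> FO P"] FO_GO[of "X \<triangleright>\<^bsub>N\<^esub> FO P"] that by (simp add: N.act_obj)
  have GOact: "GO (X \<triangleright>\<^bsub>N\<^esub> FO P) = X \<triangleright>\<^bsub>M\<^esub> P" if "X \<in> Obj C" "P \<in> Obj M" for X P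
    using act_obj that by simp
  show "P \<in> Obj M \<Longrightarrow> Idn M P \<in> Homs M P P \<and> FA (Idn M P) = Idn N (FO P)"
    using FA_eqI[OF N.Idn_Homs[of "FO P"] Idn[of "FO P"]] by simp
  show "f' \<cdot>\<^bsub>M\<^esub> f \<in> Homs M P P'' \<and> FA (f' \<cdot>\<^bsub>M\<^esub> f) = FA f' \<cdot>\<^bsub>N\<^esub> FA f" if "f \<in> Homs M P P'" "f' \<in> Homs M P' P''"
    using FA_eqI[OF N.Comp_Homs[OF FA_Homs(3)[OF that(1)] FA_Homs(3)[OF that(2)]] Comp[OF FA_Homs(3)[OF that(1)] FA_Homs(3)[OF that(2)]]]
      FA_Homs(1,2)[OF that(1)] FA_Homs(1,2)[OF that(2)] that by (simp add: HomsD)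
  show "k \<triangleright>\<^sub>a\<^bsub>M\<^esub> f \<in> Homs M (X \<triangleright>\<^bsub>M\<^esub> P) (X' \<triangleright>\<^bsub>M\<^esub> P') \<and> FA (k \<triangleright>\<^sub>a\<^bsub>M\<^esub> f) = k \<triangleright>\<^sub>a\<^bsub>N\<^esub> FA f"
    if "k \<in> Homs C X X'" "f \<in> Homs M P P'"
  proof -
    have "X \<in> Obj C" "X' \<in> Obj C" using that N.C.Dom_Obj N.C.Cod_Obj by (auto simp: Homs_def)
    thus ?thesis
      using FA_eqI[OF N.act_arr[OF that(1) FA_Homs(3)[OF that(2)]] act_arr[OF that(1) FA_Homs(3)[OF that(2)]]] FA_Homs(1,2)[OF that(2)] that
      by (simp add: HomsD GOact)
  qed
  show "act_assoc M X Y P \<in> Homs M ((X \<boxtimes>\<^bsub>C\<^esub> Y) \<triangleright>\<^bsub>M\<^esub> P) (X \<triangleright>\<^bsub>M\<^esub> (Y \<triangleright>\<^bsub>M\<^esub> P)) \<and> FA (act_assoc M X Y P) = act_assoc N X Y (FO P)"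
    if "X \<in> Obj C" "Y \<in> Obj C" "P \<in> Obj M"
    using FA_eqI[OF Iso_Homs[OF N.act_assoc_iso[of X Y "FO P"]] assoc[of X Y "FO P"]] that GOact[of X "Y \<triangleright>\<^bsub>M\<^esub> P"] act[of Y P]
    by (simp add: GOact N.C.tensor_obj)
  show "act_unit M P \<in> Homs M (unit_obj C \<triangleright>\<^bsub>M\<^esub> P) P \<and> FA (act_unit M P) = act_unit N (FO P)" if "P \<in> Obj M"
    using FA_eqI[OF Iso_Homs[OF N.act_unit_iso[of "FO P"]] unit[of "FO P"]] that by (simp add: GOact N.C.unit_obj)
  show "mod_braiding M X P \<in> Homs M (X \<triangleright>\<^bsub>M\<^esub> P) (X \<triangleright>\<^bsub>M\<^esub> P) \<and> FA (mod_braiding M X P) = mod_braiding N X (FO P)" if "X \<in> Obj C" "P \<in> Obj M"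
    using FA_eqI[OF Iso_Homs[OF N.mod_braiding_iso[of X "FO P"]] braid[of X "FO P"]] that by (simp add: GOact)
qed

text \<open>The inverse bijections form a faithful structure-preserving map from \<open>M\<close> to
  \<open>N\<close>, so the axioms can be pulled back along them.\<close>

lemma reflecting: "structure_reflecting C N M FO FA"
proof (unfold_locales, goal_cases)
  case (2 f) then show ?case using FA_Homs(1)[of f "Dom M f" "Cod M f"] by (simp add: Homs_def)
next
  case (3 f) then show ?case using FA_Homs(2)[of f "Dom M f" "Cod M f"] by (simp add: Homs_def)
next
  case (5 f P Q g) then show ?case by (metis GA_FA HomsD(1))
next
  case (10 f P Q a)
  have "FA f \<in> Homs N (FO P) (FO Q)" by (rule FA_Homs) fact
  hence "a \<in> Homs N (FO Q) (FO P)" using 10 by (simp add: inverse_arrows_def Homs_def)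
  thus ?case using GA_Homs[of a "FO Q" "FO P"] FA_Homs(1,2)[OF 10(1)] by (intro bexI[of _ "GA a"]) (simp_all add: HomsD)
next
  case (21 k X X' f P P')
  have "X \<in> Obj C" "X' \<in> Obj C" using 21 N.C.Dom_Obj N.C.Cod_Obj by (auto simp: Homs_def)
  thus ?case using N.mod_braiding_nat[OF 21(1) FA_Homs(3)[OF 21(2)]] FA_Homs(1,2)[OF 21(2)] by (simp add: FA_facts)
next
  case (22 P)
  show ?case using N.mod_braiding_BM1[OF FO_Obj[OF 22]] 22 by (simp add: BM1_def FA_facts N.C.tensor_obj)
next
  case (23 X Y P)
  then show ?case using N.mod_braiding_BM2[of X Y "FO P"] by (simp add: BM2_rhs_def FA_facts)
qed (auto simp: FA_facts FA_Homs N.mod_braiding_iso)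

theorem isomorphic: "braided_module_isomorphic C M N"
proof -
  note M = structure_reflecting.braided_module_category[OF reflecting]
  have "braided_module_functor C M N FO FA (\<lambda>X P. Idn N (X \<triangleright>\<^bsub>N\<^esub> FO P))"
    by (rule strict_braided_module_functor[OF M N.braided_module_category_axioms]) (auto simp: FA_facts FA_Homs)
  moreover have "braided_module_functor C N M GO GA (\<lambda>X P. Idn M (X \<triangleright>\<^bsub>M\<^esub> GO P))"
    by (rule strict_braided_module_functor[OF N.braided_module_category_axioms M])
      (simp_all add: GA_Homs Idn Comp act_obj act_arr assoc unit braid)
  ultimately show ?thesis
    unfolding braided_module_isomorphic_def by (intro exI conjI) auto
qed

end

section \<open>Doi-Hopf modules form a braided module category\<close>

context quasitriangular_comodule
begin

definition under where "under f = Arrow (fst (src f)) (fn f) (fst (tgt f))"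

lemma under_simps [simp]: "src (under f) = fst (src f)" "tgt (under f) = fst (tgt f)" "fn (under f) = fn f"
  by (simp_all add: under_def)

lemma under_arrow [simp]: "src F = fst P \<Longrightarrow> tgt F = fst Q \<Longrightarrow> under (Arrow P (fn F) Q) = F"
  by (cases F) (simp add: under_def)

lemma DH_act_eq': "DH_act K H A Y P = (V Y (fst P), phit Y (fst P) (snd P))"
  by (cases P) simp

text \<open>The structure of \<open>DH_cat\<close> is expressed through arrows of the
  \<open>A\<close>-modules with relabelled ends, so that forgetting the coaction visibly preserves
  it.\<close>

lemma DH_cat_simps:
  "Obj (DH_cat K H A) = {P. refl_coaction (fst P) (snd P)}"
  "Arr (DH_cat K H A) = DH_arr K H A" "Dom (DH_cat K H A) = src" "Cod (DH_cat K H A) = tgt"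
  "Idn (DH_cat K H A) P = Arrow P (fn (Idn M.LA (fst P))) P"
  "g \<cdot>\<^bsub>DH_cat K H A\<^esub> f = Arrow (src f) (fn (under g \<cdot>\<^bsub>M.LA\<^esub> under f)) (tgt g)"
  "act_obj (DH_cat K H A) = DH_act K H A"
  "k \<triangleright>\<^sub>a\<^bsub>DH_cat K H A\<^esub> f = Arrow (DH_act K H A (src k) (src f)) (fn (tensor_arrow (coact A) k (under f))) (DH_act K H A (tgt k) (tgt f))"
  "act_assoc (DH_cat K H A) X Y P = Arrow (DH_act K H A (S.T X Y) P) (fn (M.lassoc X Y (fst P))) (DH_act K H A X (DH_act K H A Y P))"
  "act_unit (DH_cat K H A) P = Arrow (DH_act K H A S.I P) (fn (M.lunit (fst P))) P"
  "mod_braiding (DH_cat K H A) X P = Arrow (DH_act K H A X P) (fn (earr X (fst P) (snd P))) (DH_act K H A X P)"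
  using DH_obj_iff
  by (auto simp: under_def DH_cat_def Let_def lmod_cat_def tensor_arrow_def M.lassoc_def M.lunit_def earr_def DH_act_eq')

lemma DH_arr_iff':
  "f \<in> DH_arr K H A \<longleftrightarrow> refl_coaction (fst (src f)) (snd (src f)) \<and> refl_coaction (fst (tgt f)) (snd (tgt f)) \<and>
    under f \<in> Arr M.LA \<and> colin (fst (src f)) (snd (src f)) (fst (tgt f)) (snd (tgt f)) (fn f)"
  by (cases f) (simp add: DH_arr_iff DH_obj_iff under_def)

lemma DH_arr_src: "f \<in> DH_arr K H A \<Longrightarrow> refl_coaction (fst (src f)) (snd (src f))"
  and DH_arr_tgt: "f \<in> DH_arr K H A \<Longrightarrow> refl_coaction (fst (tgt f)) (snd (tgt f))"
  and DH_arr_under: "f \<in> DH_arr K H A \<Longrightarrow> under f \<in> Arr M.LA"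
  and DH_arr_colin: "f \<in> DH_arr K H A \<Longrightarrow> colin (fst (src f)) (snd (src f)) (fst (tgt f)) (snd (tgt f)) (fn f)"
  by (simp_all add: DH_arr_iff')

lemma refl_left: "refl_coaction (fst P) (snd P) \<Longrightarrow> left_module K A (fst P)"
  by (rule refl_coactionD)

lemma DH_arrI:
  assumes "src F = fst P" "tgt F = fst Q" "refl_coaction (fst P) (snd P)" "refl_coaction (fst Q) (snd Q)" "F \<in> Arr M.LA"
    "colin (fst P) (snd P) (fst Q) (snd Q) (fn F)"
  shows "Arrow P (fn F) Q \<in> DH_arr K H A"
  using assms by (simp add: DH_arr_iff')

lemma refl_V [simp]: "refl_coaction M \<phi> \<Longrightarrow> left_module K H Y \<Longrightarrow> refl_coaction (tensor_lmod K (coact A) Y M) (phit Y M \<phi>)"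
  by (rule phit_refl_coaction)

lemma fn_Idn: "fn (Idn M.LA P) = (\<lambda>m\<in>carrier P. m)"
  and fn_Comp: "fn (g \<cdot>\<^bsub>M.LA\<^esub> f) = compose (carrier (src f)) (fn g) (fn f)"
  by (simp_all add: lmod_cat_def)

text \<open>The substance is that identities, composites, inverses, the action, the constraints and
  the braiding are colinear. The equations then come from the \<open>A\<close>-modules, together
  with naturality, invertibility and the two braid axioms of \<open>earr\<close>.\<close>

lemma DH_reflecting: "structure_reflecting (H_mod K H) (A_mod K H A) (DH_cat K H A) fst under"
proof -
  interpret C: braided_category "H_mod K H" by (rule H_mod_braided_category)
  interpret M': module_category "H_mod K H" "A_mod K H A" by (rule A_mod_module_category)
  note [simp] = DH_cat_simps DH_act_eq' Homs_def DH_arr_src DH_arr_tgt DH_arr_under refl_left earr_Arr DH_arrI lmod_Arr(4,5)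
  show ?thesis
  proof (unfold_locales, goal_cases)
    case (5 f P Q g)
    then show ?case by (cases f; cases g) (auto simp: under_def)
  next
    case (6 P)
    then show ?case using colin_id[of "fst P" "snd P"] by (simp add: fn_Idn[symmetric])
  next
    case (8 f P P' g P'')
    then have fg: "f \<in> DH_arr K H A" "g \<in> DH_arr K H A" and [simp]: "src g = tgt f" by auto
    have "colin (fst (src f)) (snd (src f)) (fst (tgt g)) (snd (tgt g)) (compose (carrier (fst (src f))) (fn g) (fn f))"
      using DH_arr_colin[OF fg(1)] DH_arr_colin[OF fg(2)] lmod_Arr(5)[OF DH_arr_under[OF fg(1)]] lmod_Arr(5)[OF DH_arr_under[OF fg(2)]] fg
      by (intro colin_comp[OF DH_arr_src DH_arr_tgt]) simp_all
    hence "colin (fst (src f)) (snd (src f)) (fst (tgt g)) (snd (tgt g)) (fn (under g \<cdot>\<^bsub>M.LA\<^esub> under f))" by (simp add: fn_Comp)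
    then show ?case using 8 by auto
  next
    case (10 f P Q a)
    hence f: "f \<in> DH_arr K H A" "src f = P" "tgt f = Q" by auto
    have a: "a \<in> Arr M.LA" "src a = fst Q" "tgt a = fst P" "a \<cdot>\<^bsub>M.LA\<^esub> under f = Idn M.LA (fst P)" "under f \<cdot>\<^bsub>M.LA\<^esub> a = Idn M.LA (fst Q)"
      using 10(2) f by (simp_all add: inverse_arrows_def)
    have 1: "fn a (fn f m) = m" if "m \<in> carrier (fst P)" for m
      using arg_cong[OF a(4), of "\<lambda>h. fn h m"] f that by simp
    have 2: "fn f (fn a m) = m" if "m \<in> carrier (fst Q)" for m
      using arg_cong[OF a(5), of "\<lambda>h. fn h m"] a(2) f that by simp
    have "colin (fst Q) (snd Q) (fst P) (snd P) (fn a)"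
      using DH_arr_src[OF f(1)] DH_arr_tgt[OF f(1)] DH_arr_colin[OF f(1)] lmod_Arr(5)[OF DH_arr_under[OF f(1)]] lmod_Arr(5)[OF a(1)] f(2,3) a(2,3) 1 2
      by (intro colin_inverse[of "fst P" "snd P" "fst Q" "snd Q" "fn f"]) simp_all
    hence "Arrow Q (fn a) P \<in> DH_arr K H A"
      using DH_arr_src[OF f(1)] DH_arr_tgt[OF f(1)] f(2,3) a by simp
    thus ?case using a by (intro bexI[of _ "Arrow Q (fn a) P"]) simp_all
  next
    case (13 k X X' f P P')
    hence f: "f \<in> DH_arr K H A" "src f = P" "tgt f = P'" "k \<in> Arr S.LH" "src k = X" "tgt k = X'" by auto
    have "colin (V X (fst P)) (phit X (fst P) (snd P)) (V X' (fst P')) (phit X' (fst P') (snd P')) (fn (tensor_arrow (coact A) k (under f)))"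
      using colin_tensor_arrow[OF DH_arr_src[OF f(1)] DH_arr_tgt[OF f(1)] f(4) DH_arr_under[OF f(1)] _ _ ] DH_arr_colin[OF f(1)] f by simp
    then show ?case using f DH_arr_src[OF f(1)] DH_arr_tgt[OF f(1)] lmod_Arr(1,2)[OF f(4)] by simp
  next
    case (15 X Y P)
    then show ?case using colin_lassoc[of "fst P" "snd P" X Y]
        DH_arrI[of "M.lassoc X Y (fst P)" "(V (S.T X Y) (fst P), phit (S.T X Y) (fst P) (snd P))" "(V X (V Y (fst P)), phit X (V Y (fst P)) (phit Y (fst P) (snd P)))"]
      by simp
  next
    case (16 X Y P)
    then show ?case by (simp add: under_def M.lassoc_def)
  next
    case (17 P)
    then show ?case using colin_lunit[of "fst P" "snd P"] by simp
  next
    case (19 X P)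
    then show ?case using colin_earr[of "fst P" "snd P" X] by simp
  next
    case (20 X P)
    then show ?case
      using A_mod_inverse[of "earr X (fst P) (snd P)" "earr_inv X (fst P) (snd P)"] earr_inverse[of "fst P" "snd P" X] by simp
  next
    case (21 k X X' f P P')
    hence f: "f \<in> DH_arr K H A" "src f = P" "tgt f = P'" "k \<in> Arr S.LH" "src k = X" "tgt k = X'" by auto
    show ?case
      using colin_earr_nat[OF DH_arr_src[OF f(1)] DH_arr_tgt[OF f(1)] f(4) DH_arr_under[OF f(1)] _ _] DH_arr_colin[OF f(1)] f by simp
  next
    case (22 P)
    then show ?case using earr_BM1[of "fst P" "snd P"] by simp
  next
    case (23 X Y P)
    then show ?case by (simp add: earr_BM2[symmetric])
  qed simp_all
qed

lemmas DH_braided_module_category = structure_reflecting.braided_module_category[OF DH_reflecting]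

end

section \<open>From objects of the reflective center to coactions\<close>

context quasitriangular_comodule
begin

context
  fixes M :: "('k, ('k, 'a) univ) lmod"
    and e :: "('k, ('k, 'a) univ) lmod \<Rightarrow> (('k, ('k, 'a) univ) lmod, ('k, 'a) univ \<Rightarrow> ('k, 'a) univ) arrow"
  assumes Me: "(M, e) \<in> center_obj (H_mod K H) (A_mod K H A)"
begin

lemma center_M [simp]: "left_module K A M" "module K M"
  using Me lmod_module by (auto simp: center_obj_def)

lemma center_e [simp]:
  assumes "left_module K H X"
  shows "e X \<in> Arr M.LA" "src (e X) = V X M" "tgt (e X) = V X M"
  using Me assms by (auto simp: center_obj_def Isos_def Homs_def)

lemma center_inj:
  assumes [simp]: "left_module K H X" "u \<in> carrier (V X M)" "v \<in> carrier (V X M)" and eq: "fn (e X) u = fn (e X) v"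
  shows "u = v"
proof -
  have "e X \<in> Isos (A_mod K H A) (V X M) (V X M)" using Me by (simp add: center_obj_def)
  then obtain g where "inverse_arrows (A_mod K H A) (e X) g" by (auto simp: Isos_def)
  hence g: "g \<cdot>\<^bsub>M.LA\<^esub> e X = Idn M.LA (V X M)" by (simp add: inverse_arrows_def)
  have "fn g (fn (e X) w) = w" if "w \<in> carrier (V X M)" for w
    using arg_cong[OF g, of "\<lambda>h. fn h w"] that by simp
  thus ?thesis using assms by metis
qed

lemma center_nat:
  assumes "g \<in> Arr S.LH"
  shows "e (tgt g) \<cdot>\<^bsub>M.LA\<^esub> tensor_arrow (coact A) g (Idn M.LA M) = tensor_arrow (coact A) g (Idn M.LA M) \<cdot>\<^bsub>M.LA\<^esub> e (src g)"
  using Me assms lmod_Arr(1,2)[OF assms] by (auto simp: center_obj_def Homs_def)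

text \<open>The Yoneda element of the family \<open>e\<close>: its value at 1 in the regular
  module.\<close>

definition cphi where "cphi = (\<lambda>m\<in>carrier M. fn (e Hreg) (tens K H M \<one>\<^bsub>H\<^esub> m))"

lemma center_e_lin [simp]:
  assumes "left_module K H X"
  shows "fn (e X) \<in> linear_maps K (tensor K X M) (tensor K X M)"
  using lmod_Arr_lin[OF center_e(1)[OF assms], of "tensor K X M" "tensor K X M"] assms by simp

lemma cphi_lin [simp]: "cphi \<in> linear_maps K M (tensor K H M)"
proof -
  have "fn (e Hreg) \<in> linear_maps K (tensor K H M) (tensor K H M)" using center_e_lin[of Hreg] by simp
  hence "(\<lambda>m. fn (e Hreg) (tens K H M \<one>\<^bsub>H\<^esub> m)) \<in> linear_maps K M (tensor K H M)"
    by (rule lin_comp) (rule tens_lin2; simp add: lin_id)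
  thus ?thesis unfolding cphi_def by (subst lin_cong) auto
qed

lemmas [simp] = psum_fold[OF cphi_lin]
declare S.H_act(4) [simp del] M.H_act(4) [simp del] S.A_act(4) [simp del]

lemma cphi_eta:
  assumes "m \<in> carrier M"
  shows "fn (e Hreg) (tens K H M \<one>\<^bsub>H\<^esub> m) = psum M cphi (tensor K H M) m (\<lambda>h n. tens K H M h n)"
proof -
  have "fn (e Hreg) (tens K H M \<one>\<^bsub>H\<^esub> m) = cphi m" using assms by (simp add: cphi_def)
  also have "\<dots> = psum M cphi (tensor K H M) m (\<lambda>h n. tens K H M h n)"
    using sweedler_eta[of "cphi m" H M] lin_closed[OF cphi_lin assms] assms by simp
  finally show ?thesis .
qed

text \<open>Naturality along the module map h \<mapsto> h x from the regular module to
  \<open>X\<close>, which sends 1 to x.\<close>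

lemma center_e_tens:
  assumes [simp]: "left_module K H X" "x \<in> carrier X" "m \<in> carrier M"
  shows "fn (e X) (tens K X M x m) = psum M cphi (tensor K X M) m (\<lambda>h n. tens K X M (act X h x) n)"
proof -
  define g where "g = Arrow Hreg (\<lambda>h\<in>carrier H. act X h x) X"
  have l: "(\<lambda>h. act X h x) \<in> linear_maps K H X" by (intro lin_intros; simp add: lin_id)
  have [simp]: "src g = Hreg" "tgt g = X" "h \<in> carrier H \<Longrightarrow> fn g h = act X h x" for h by (simp_all add: g_def)
  have [simp]: "g \<in> Arr S.LH"
  proof -
    have "fn g \<in> linear_maps K H X" by (rule iffD2[OF lin_cong l]) simp_all
    moreover have "fn g \<in> extensional (carrier H)" by (simp add: g_def)
    ultimately show ?thesis unfolding lmod_Arr_iff left_module_maps_def by (simp add: S.H_act(4))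
  qed
  have "fn (e (tgt g) \<cdot>\<^bsub>M.LA\<^esub> tensor_arrow (coact A) g (Idn M.LA M)) (tens K H M \<one>\<^bsub>H\<^esub> m) = fn (e X) (tens K X M x m)"
    by simp
  moreover have "fn (tensor_arrow (coact A) g (Idn M.LA M) \<cdot>\<^bsub>M.LA\<^esub> e (src g)) (tens K H M \<one>\<^bsub>H\<^esub> m) =
    psum M cphi (tensor K X M) m (\<lambda>h n. tens K X M (act X h x) n)"
    by (simp add: cphi_eta)
  ultimately show ?thesis unfolding center_nat[OF \<open>g \<in> Arr S.LH\<close>] by (simp only:)
qed

lemma center_e_eq:
  assumes [simp]: "left_module K H X"
  shows "e X = earr X M cphi"
proof -
  have "fn (e X) u = fn (earr X M cphi) u" if "u \<in> carrier (tensor K X M)" for u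
    by (rule lin_eq_tensor[OF center_e_lin earr_lin(1) _ _ _ _ that]) (simp_all add: center_e_tens)
  moreover have "fn (earr X M cphi) \<in> extensional (carrier (V X M))" by (simp add: earr_def)
  moreover have "fn (e X) \<in> extensional (carrier (V X M))"
    using center_e(1,2)[OF assms] by (simp add: lmod_Arr_iff)
  ultimately have "fn (e X) = fn (earr X M cphi)" by (intro extensionalityI) auto
  thus ?thesis by (intro arrow.expand) simp
qed

text \<open>BM1 for two copies of the regular module, evaluated at 1 \<otimes> 1 \<otimes>
  m.\<close>

lemma center_BM1:
  assumes [simp]: "m \<in> carrier M" "module K W" and f: "trilin K H H M W f"
  shows "psum M cphi W m (\<lambda>h n. dsum W h (\<lambda>a b. f a b n)) =
    psum M cphi W m (\<lambda>h n. psum M cphi W n (\<lambda>g n'. rsum W (\<lambda>s t. risum W (\<lambda>p q.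
      f (t ** (h ** q)) (g ** (s ** p)) n'))))"
proof -
  obtain F where F: "F \<in> linear_maps K (tensor K HH M) W"
    and Ft [simp]: "\<And>x y z. x \<in> carrier H \<Longrightarrow> y \<in> carrier H \<Longrightarrow> z \<in> carrier M \<Longrightarrow>
      F (tens K HH M (tens K H H x y) z) = f x y z"
    using trilin_lift[OF _ _ _ _ f] by auto
  have [simp]: "earr Hreg M cphi \<in> Arr M.LA" using center_e(1)[of Hreg] center_e_eq[of Hreg] by simp
  have "e (S.T Hreg Hreg) = BM1_arr M cphi Hreg Hreg"
    using Me by (simp add: center_obj_def BM1_def BM1_arr_def center_e_eq)
  hence "earr (S.T Hreg Hreg) M cphi = BM1_arr M cphi Hreg Hreg" by (simp add: center_e_eq)
  hence "fn (earr (S.T Hreg Hreg) M cphi) (tens K (tensor K Hreg Hreg) M (tens K Hreg Hreg \<one>\<^bsub>H\<^esub> \<one>\<^bsub>H\<^esub>) m) =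
    fn (BM1_arr M cphi Hreg Hreg) (tens K (tensor K Hreg Hreg) M (tens K Hreg Hreg \<one>\<^bsub>H\<^esub> \<one>\<^bsub>H\<^esub>) m)" by simp
  hence "F (psum M cphi (tensor K HH M) m (\<lambda>h n. dsum (tensor K HH M) h (\<lambda>a b. tens K HH M (tens K H H a b) n))) =
    F (psum M cphi (tensor K HH M) m (\<lambda>h n. psum M cphi (tensor K HH M) n (\<lambda>g n'. rsum (tensor K HH M) (\<lambda>s t. risum (tensor K HH M) (\<lambda>p q.
      tens K HH M (tens K H H (t ** (h ** q)) (g ** (s ** p))) n')))))"
    using earr_tensor_tens[of M cphi Hreg Hreg "\<one>\<^bsub>H\<^esub>" "\<one>\<^bsub>H\<^esub>" m] BM1_arr_tens[of M cphi Hreg Hreg "\<one>\<^bsub>H\<^esub>" "\<one>\<^bsub>H\<^esub>" m] by simp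
  thus ?thesis by (simp add: psum_out[OF F] sum_out[OF F])
qed

text \<open>No axiom of the center mentions the counit; its law comes from invertibility.
  Contracting the coaction by the counit gives a map E, which is the operator of the family at the
  unit object. BM1 makes E idempotent, and an injective idempotent is the identity.\<close>

lemma center_counit:
  assumes [simp]: "m \<in> carrier M"
  shows "psum M cphi M m (\<lambda>h n. counit H h \<odot>\<^bsub>M\<^esub> n) = m"
proof -
  interpret M: module K M by simp
  define E where "E m = psum M cphi M m (\<lambda>h n. counit H h \<odot>\<^bsub>M\<^esub> n)" for m
  have El: "E \<in> linear_maps K M M" unfolding E_def by (intro lin_intros lin_smult_const; simp add: lin_id)
  note [simp] = lin_closed[OF El]
  have "E (E m) = psum M cphi M m (\<lambda>h n. E (counit H h \<odot>\<^bsub>M\<^esub> n))"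
    unfolding E_def[of m] by (rule psum_out[OF El]) simp_all
  also have "\<dots> = psum M cphi M m (\<lambda>h n. counit H h \<odot>\<^bsub>M\<^esub> E n)"
    by (simp add: lin_smult[OF El])
  also have "\<dots> = psum M cphi M m (\<lambda>h n. psum M cphi M n (\<lambda>g n'. counit H h \<odot>\<^bsub>M\<^esub> (counit H g \<odot>\<^bsub>M\<^esub> n')))"
    unfolding E_def
    by (rule psum_cong[OF HOL.refl HOL.refl], rule psum_out[where F="\<lambda>v. _ \<odot>\<^bsub>M\<^esub> v"]; (intro lin_smult_const lin_id)?; simp)
  \<comment> \<open>The unit is inserted as \<open>R\<close> times its inverse under the counit, to
    match the right-hand side of \<open>center_BM1\<close>.\<close>
  also have "\<dots> = psum M cphi M m (\<lambda>h n. psum M cphi M n (\<lambda>g n'. rsum M (\<lambda>s t. risum M (\<lambda>p q.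
      counit H (s ** p) \<odot>\<^bsub>M\<^esub> (counit H (t ** q) \<odot>\<^bsub>M\<^esub> (counit H h \<odot>\<^bsub>M\<^esub> (counit H g \<odot>\<^bsub>M\<^esub> n')))))))"
    by (rule psum_cong[OF HOL.refl HOL.refl], rule psum_cong[OF HOL.refl HOL.refl], subst rsum_risum(1); (intro lin_smult_const lin_intros)?; simp)
  also have "\<dots> = psum M cphi M m (\<lambda>h n. psum M cphi M n (\<lambda>g n'. rsum M (\<lambda>s t. risum M (\<lambda>p q.
      counit H (t ** (h ** q)) \<odot>\<^bsub>M\<^esub> (counit H (g ** (s ** p)) \<odot>\<^bsub>M\<^esub> n')))))"
    by (simp add: M.smult_assoc1[symmetric] m_ac)
  also have "\<dots> = psum M cphi M m (\<lambda>h n. dsum M h (\<lambda>a b. counit H a \<odot>\<^bsub>M\<^esub> (counit H b \<odot>\<^bsub>M\<^esub> n)))"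
    by (rule center_BM1[symmetric]; (intro lin_smult_const lin_intros)?; simp add: lin_id)
  also have "\<dots> = E m"
    unfolding E_def
  proof (rule psum_cong[OF HOL.refl HOL.refl])
    fix h n assume [simp]: "h \<in> carrier H" "n \<in> carrier M"
    have "(\<lambda>b. counit H b \<odot>\<^bsub>M\<^esub> n) \<in> linear_maps K H M" by (intro lin_intros; simp)
    from S.comult_counit[OF _ this] show "dsum M h (\<lambda>a b. counit H a \<odot>\<^bsub>M\<^esub> (counit H b \<odot>\<^bsub>M\<^esub> n)) = counit H h \<odot>\<^bsub>M\<^esub> n"
      by simp
  qed
  finally have EE: "E (E m) = E m" .
  have eI: "fn (e S.I) (tens K S.I M (Scal \<one>\<^bsub>K\<^esub>) n) = tens K S.I M (Scal \<one>\<^bsub>K\<^esub>) (E n)" if [simp]: "n \<in> carrier M" for n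
  proof -
    have "fn (e S.I) (tens K S.I M (Scal \<one>\<^bsub>K\<^esub>) n) = psum M cphi (tensor K S.I M) n (\<lambda>h n. tens K S.I M (Scal \<one>\<^bsub>K\<^esub>) (counit H h \<odot>\<^bsub>M\<^esub> n))"
      by (simp add: center_e_tens tens_rules(4) tens_rules(3)[symmetric])
    thus ?thesis by (simp add: E_def)
  qed
  \<comment> \<open>By idempotence both sides have the same image under the operator at the unit
    object, which is injective.\<close>
  have "tens K S.I M (Scal \<one>\<^bsub>K\<^esub>) (E m) = tens K S.I M (Scal \<one>\<^bsub>K\<^esub>) m"
    by (rule center_inj[of S.I]) (simp_all add: eI EE)
  from arg_cong[OF this, of "fn (M.lunit M)"] show ?thesis by (simp add: E_def)
qed

text \<open>Linearity over \<open>A\<close> of the operator at the regular module, evaluated at 1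
  \<otimes> m.\<close>

lemma center_act':
  assumes [simp]: "a \<in> carrier A" "m \<in> carrier M"
  shows "csum (tensor K H M) a (\<lambda>l b. psum M cphi (tensor K H M) (act M b m) (\<lambda>h n. tens K H M (h ** l) n))
       = csum (tensor K H M) a (\<lambda>l b. psum M cphi (tensor K H M) m (\<lambda>h n. tens K H M (l ** h) (act M b n)))"
proof -
  have [simp]: "fn (e Hreg) \<in> linear_maps K (tensor K H M) (tensor K H M)" using center_e_lin[of Hreg] by simp
  have "fn (e Hreg) (act (V Hreg M) a (tens K H M \<one>\<^bsub>H\<^esub> m)) = act (V Hreg M) a (fn (e Hreg) (tens K H M \<one>\<^bsub>H\<^esub> m))"
    using lmod_Arr(6)[OF center_e(1)[of Hreg] assms(1), of "tens K H M \<one>\<^bsub>H\<^esub> m"] by simp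
  thus ?thesis
    using center_e_tens[of Hreg]
    by (simp add: cphi_eta csum_out[OF \<open>fn (e Hreg) \<in> linear_maps K (tensor K H M) (tensor K H M)\<close>] csum_psum_swap)
qed

text \<open>The one equation that needs work is the reflection equation: \<open>center_BM1\<close>
  is multiplied on the right by \<open>R\<close> with exchanged legs, which cancels the inverse of
  \<open>R\<close>.\<close>

lemma center_refl_coaction: "refl_coaction M cphi"
proof -
  let ?W = "tensor K HH M" and ?tt = "\<lambda>a b. tens K HH M (tens K H H a b)"
  have "psum M cphi ?W m (\<lambda>h n. dsum ?W h (\<lambda>a b. rsum ?W (\<lambda>s t. ?tt (a ** t) (b ** s) n)))
       = psum M cphi ?W m (\<lambda>h n. psum M cphi ?W n (\<lambda>g n'. rsum ?W (\<lambda>s t. ?tt (t ** h) (g ** s) n')))"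
    if [simp]: "m \<in> carrier M" for m
  proof -
    have "psum M cphi ?W m (\<lambda>h n. dsum ?W h (\<lambda>a b. rsum ?W (\<lambda>u v. ?tt (a ** v) (b ** u) n)))
      = psum M cphi ?W m (\<lambda>h n. psum M cphi ?W n (\<lambda>g n'. rsum ?W (\<lambda>s t. risum ?W (\<lambda>p q. rsum ?W (\<lambda>u v.
      ?tt ((t ** (h ** q)) ** v) ((g ** (s ** p)) ** u) n')))))"
      by (rule center_BM1; (intro lin_intros)?; simp)
    also have "\<dots> = psum M cphi ?W m (\<lambda>h n. psum M cphi ?W n (\<lambda>g n'. rsum ?W (\<lambda>s t. risum ?W (\<lambda>p q. rsum ?W (\<lambda>u v.
      ?tt ((t ** h) ** (q ** v)) ((g ** s) ** (p ** u)) n')))))"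
      by simp
    also have "\<dots> = psum M cphi ?W m (\<lambda>h n. psum M cphi ?W n (\<lambda>g n'. rsum ?W (\<lambda>s t.
      ?tt ((t ** h) ** \<one>\<^bsub>H\<^esub>) ((g ** s) ** \<one>\<^bsub>H\<^esub>) n')))"
      by (rule psum_cong[OF HOL.refl HOL.refl], rule psum_cong[OF HOL.refl HOL.refl], rule sum_congs(1)[OF HOL.refl],
        rule rsum_risum(2); (intro lin_intros)?; simp)
    finally show ?thesis by simp
  qed
  moreover have "cphi \<in> extensional (carrier M)" by (simp add: cphi_def)
  ultimately show ?thesis
    unfolding refl_coaction_def Let_def using center_counit center_act' center_M cphi_lin by blast
qed

end

end

section \<open>The isomorphism between the two categories\<close>

context quasitriangular_comodule
begin

abbreviation "CH \<equiv> H_mod K H"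
abbreviation "MA \<equiv> A_mod K H A"

text \<open>Objects of the center carry families that are extensional on the objects of the
  \<open>H\<close>-modules, hence the restriction.\<close>

definition center_of where
  "center_of P = (fst P, restrict (\<lambda>X. earr X (fst P) (snd P)) (Obj CH))"

definition center_arr_of where
  "center_arr_of f = Arrow (center_of (src f)) (under f) (center_of (tgt f))"

lemma earr_Hreg_one:
  assumes r: "refl_coaction M \<phi>" and [simp]: "m \<in> carrier M"
  shows "fn (earr Hreg M \<phi>) (tens K H M \<one>\<^bsub>H\<^esub> m) = \<phi> m"
proof -
  note [simp] = refl_coactionD[OF r]
  show ?thesis by (simp add: psum_eta[OF r])
qed

lemma center_of_center_obj:
  assumes r: "refl_coaction (fst P) (snd P)"
  shows "center_of P \<in> center_obj CH MA"
proof -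
  note [simp] = refl_left[OF r] earr_Arr[OF r]
  have i: "earr Y (fst P) (snd P) \<in> Isos MA (V Y (fst P)) (V Y (fst P))" if "left_module K H Y" for Y
    using A_mod_inverse[of "earr Y (fst P) (snd P)" "earr_inv Y (fst P) (snd P)"] earr_inverse[OF r that] earr_Arr[OF r that] by simp
  have n: "earr Z (fst P) (snd P) \<cdot>\<^bsub>M.LA\<^esub> tensor_arrow (coact A) g (Idn M.LA (fst P)) =
      tensor_arrow (coact A) g (Idn M.LA (fst P)) \<cdot>\<^bsub>M.LA\<^esub> earr Y (fst P) (snd P)"
    if "g \<in> Homs CH Y Z" for g Y Z
    using colin_earr_nat[OF r r, of g "Idn M.LA (fst P)"] colin_id[OF r] that by (auto simp: Homs_def fn_Idn)
  have b: "BM1 CH MA (fst P) (restrict (\<lambda>X. earr X (fst P) (snd P)) (Obj CH))"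
    using earr_BM1[OF r] by (simp add: BM1_def)
  show ?thesis
    unfolding center_of_def center_obj_def mem_Collect_eq case_prod_conv
  proof (intro conjI ballI, goal_cases)
    case (3 Y) then show ?case using i by simp
  next
    case (4 Y Z g) then show ?case using n[OF 4(3)] by simp
  qed (simp_all add: b del: A_mod_simps(1) H_mod_simps(1), simp_all)
qed

text \<open>The coaction is read off from the operator at the regular module by
  \<open>earr_Hreg_one\<close>; extensionality of both coactions turns pointwise agreement into
  equality.\<close>

lemma center_of_inj:
  assumes r: "refl_coaction (fst P) (snd P)" "refl_coaction (fst Q) (snd Q)" and eq: "center_of P = center_of Q"
  shows "P = Q"
proof -
  have f: "fst P = fst Q" using eq by (simp add: center_of_def)
  have "earr Hreg (fst P) (snd P) = earr Hreg (fst Q) (snd Q)"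
  proof -
    have "snd (center_of P) Hreg = snd (center_of Q) Hreg" by (simp only: eq)
    thus ?thesis by (simp add: center_of_def)
  qed
  hence "snd P m = snd Q m" if "m \<in> carrier (fst P)" for m
    using earr_Hreg_one[OF r(1) that] earr_Hreg_one[OF r(2), of m] that f by simp
  hence "snd P = snd Q"
    using refl_coactionD(2)[OF r(1)] refl_coactionD(2)[OF r(2)] f by (intro extensionalityI) auto
  with f show ?thesis by (simp add: prod_eq_iff)
qed

lemma center_of_surj:
  assumes "Q \<in> center_obj CH MA"
  obtains P where "refl_coaction (fst P) (snd P)" "center_of P = Q"
proof -
  obtain M e where Q: "Q = (M, e)" by (cases Q)
  note c = assms[unfolded Q]
  have "refl_coaction (fst (M, cphi M e)) (snd (M, cphi M e))" using center_refl_coaction[OF c] by simp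
  moreover have "restrict (\<lambda>X. earr X M (cphi M e)) (Obj CH) = e"
  proof (rule extensionalityI[of _ "Obj CH"])
    show "e \<in> extensional (Obj CH)" using c unfolding center_obj_def by blast
    fix X assume "X \<in> Obj CH"
    thus "restrict (\<lambda>X. earr X M (cphi M e)) (Obj CH) X = e X" using center_e_eq[OF c, of X, symmetric] by simp
  qed simp
  hence "center_of (M, cphi M e) = Q" by (simp add: center_of_def Q)
  ultimately show thesis by (rule that)
qed

text \<open>The center defines its action by the composite in BM2, and \<open>earr_BM2\<close>
  identifies this with the family of \<open>phit\<close>.\<close>

lemma center_of_DH_act:
  assumes "refl_coaction (fst P) (snd P)" "left_module K H Y"
  shows "center_of (DH_act K H A Y P) = center_act CH MA Y (center_of P)"
proof -
  have "BM2_rhs CH MA Y (fst P) (\<lambda>Z. if left_module K H Z then earr Z (fst P) (snd P) else undefined) X =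
    BM2_rhs CH MA Y (fst P) (\<lambda>Z. earr Z (fst P) (snd P)) X" if "left_module K H X" for X
    using that by (simp add: BM2_rhs_def)
  thus ?thesis
    by (auto simp: center_of_def center_act_def DH_act_eq' earr_BM2[OF assms(1) _ assms(2)] restrict_def fun_eq_iff)
qed

lemma center_arr_of_center_arr:
  assumes f: "f \<in> DH_arr K H A"
  shows "center_arr_of f \<in> center_arr CH MA"
proof -
  note r = DH_arr_src[OF f] DH_arr_tgt[OF f]
  have "tensor_arrow (coact A) (Idn S.LH Y) (under f) \<cdot>\<^bsub>M.LA\<^esub> earr Y (fst (src f)) (snd (src f)) =
      earr Y (fst (tgt f)) (snd (tgt f)) \<cdot>\<^bsub>M.LA\<^esub> tensor_arrow (coact A) (Idn S.LH Y) (under f)" if "left_module K H Y" for Y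
    using colin_earr_nat[OF r, of "Idn S.LH Y" "under f"] DH_arr_colin[OF f] DH_arr_under[OF f] that by simp
  thus ?thesis
    using center_of_center_obj[OF r(1)] center_of_center_obj[OF r(2)] DH_arr_under[OF f]
    by (simp add: center_arr_of_def center_arr_def center_of_def Homs_def)
qed

text \<open>An arrow of the center commutes with the operators at the regular module, and
  \<open>earr_nat_colin\<close> makes it colinear for the coactions of its two ends.\<close>

lemma center_arr_of_surj:
  assumes "g \<in> center_arr CH MA"
  obtains f where "f \<in> DH_arr K H A" "center_arr_of f = g"
proof -
  from assms obtain P e k Q e' where g: "g = Arrow (P, e) k (Q, e')" and c: "(P, e) \<in> center_obj CH MA" "(Q, e') \<in> center_obj CH MA"
    and k: "k \<in> Arr M.LA" "src k = P" "tgt k = Q"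
    and com: "\<And>Y. left_module K H Y \<Longrightarrow> tensor_arrow (coact A) (Idn S.LH Y) k \<cdot>\<^bsub>M.LA\<^esub> e Y = e' Y \<cdot>\<^bsub>M.LA\<^esub> tensor_arrow (coact A) (Idn S.LH Y) k"
    by (auto simp: center_arr_def Homs_def)
  obtain P' where P': "refl_coaction (fst P') (snd P')" "center_of P' = (P, e)" using center_of_surj[OF c(1)] .
  obtain Q' where Q': "refl_coaction (fst Q') (snd Q')" "center_of Q' = (Q, e')" using center_of_surj[OF c(2)] .
  have e: "fst P' = P" "fst Q' = Q" "e Hreg = earr Hreg P (snd P')" "e' Hreg = earr Hreg Q (snd Q')"
    using P'(2) Q'(2) by (auto simp: center_of_def)
  have "colin P (snd P') Q (snd Q') (fn k)"
    using earr_nat_colin[OF P'(1) Q'(1), of k] com[of Hreg] k e by simp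
  hence "Arrow P' (fn k) Q' \<in> DH_arr K H A"
    using P'(1) Q'(1) k e by (intro DH_arrI) simp_all
  moreover have "center_arr_of (Arrow P' (fn k) Q') = g"
    using P'(2) Q'(2) k e by (simp add: center_arr_of_def g)
  ultimately show thesis by (rule that)
qed

lemma center_cat_simps:
  "Obj (reflective_center CH MA) = center_obj CH MA" "Arr (reflective_center CH MA) = center_arr CH MA"
  "Dom (reflective_center CH MA) = src" "Cod (reflective_center CH MA) = tgt"
  "Idn (reflective_center CH MA) P = Arrow P (Idn M.LA (fst P)) P"
  "g \<cdot>\<^bsub>reflective_center CH MA\<^esub> f = Arrow (src f) (fn g \<cdot>\<^bsub>M.LA\<^esub> fn f) (tgt g)"
  "act_obj (reflective_center CH MA) = center_act CH MA"
  "k \<triangleright>\<^sub>a\<^bsub>reflective_center CH MA\<^esub> f = Arrow (center_act CH MA (src k) (src f)) (tensor_arrow (coact A) k (fn f)) (center_act CH MA (tgt k) (tgt f))"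
  "act_assoc (reflective_center CH MA) X Y P = Arrow (center_act CH MA (S.T X Y) P) (M.lassoc X Y (fst P)) (center_act CH MA X (center_act CH MA Y P))"
  "act_unit (reflective_center CH MA) P = Arrow (center_act CH MA S.I P) (M.lunit (fst P)) P"
  "mod_braiding (reflective_center CH MA) X P = Arrow (center_act CH MA X P) (snd P X) (center_act CH MA X P)"
  by (simp_all add: reflective_center_def)

text \<open>The constraints and braidings on the two sides have the same underlying functions, so
  the content is the bijectivity on objects and arrows and the agreement of the two actions.\<close>

lemma DH_center_transport: "structure_transport CH (DH_cat K H A) (reflective_center CH MA) center_of center_arr_of"
proof -
  interpret N: braided_module_category CH "DH_cat K H A" by (rule DH_braided_module_category)
  note [simp] = DH_cat_simps center_cat_simps center_of_DH_act Homs_def DH_arr_src DH_arr_tgt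
  have [simp]: "fst (center_of P) = fst P" "left_module K H X \<Longrightarrow> snd (center_of P) X = earr X (fst P) (snd P)" for P X
    by (simp_all add: center_of_def)
  have [simp]: "fst (DH_act K H A X P) = V X (fst P)" "snd (DH_act K H A X P) = phit X (fst P) (snd P)" for P X by (simp_all add: DH_act_eq')
  show ?thesis
  proof (unfold_locales, goal_cases)
    case 1
    show ?case
      using center_of_inj center_of_center_obj center_of_surj
      by (auto simp: bij_betw_def inj_on_def image_iff) metis
  next
    case 2
    show ?case
      unfolding bij_betw_def inj_on_def
    proof (intro conjI ballI impI equalityI subsetI)
      fix f g assume "f \<in> Arr (DH_cat K H A)" "g \<in> Arr (DH_cat K H A)" and eq: "center_arr_of f = center_arr_of g"
      hence fg: "f \<in> DH_arr K H A" "g \<in> DH_arr K H A" by simp_all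
      have "src f = src g" "tgt f = tgt g" "fn f = fn g"
        using eq center_of_inj[OF DH_arr_src[OF fg(1)] DH_arr_src[OF fg(2)]] center_of_inj[OF DH_arr_tgt[OF fg(1)] DH_arr_tgt[OF fg(2)]]
        by (auto simp: center_arr_of_def under_def)
      thus "f = g" by (cases f; cases g) simp
    qed (auto simp: center_arr_of_center_arr elim: center_arr_of_surj)
  next
    case (9 X Y P)
    then show ?case by (simp add: center_arr_of_def under_def M.lassoc_def)
  qed (auto simp: center_arr_of_def lmod_Arr)
qed

end

theorem proposition6p4:
  fixes K :: "'k ring" and H :: "('k, 'a) qt_hopf" and A :: "('k, 'a) comod_alg"
  assumes "algebraically_closed K"
    and "quasitriangular_hopf_algebra K H"
    and "left_comodule_algebra K H A"
  shows "braided_module_isomorphic (H_mod K H)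
           (reflective_center (H_mod K H) (A_mod K H A))
           (DH_cat K H A)"
proof -
  interpret algebraically_closed K by fact
  interpret quasitriangular_comodule K H A
    by unfold_locales (use assms in \<open>auto\<close>)
  show ?thesis by (rule structure_transport.isomorphic[OF DH_center_transport])
qed

end
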